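(* The full set of indecomposable $K_2$-modules (up to isomorphism) is $$\{V(r),\ P(r),\ \Omega^{s}V(r),\ \Omega^{-s}V(r),\ M_n(r,\eta)\},$$ where $r\in\mathbb{Z}/2$, $s,n\in\mathbb{Z}_+$, $\eta\in\mathbb{C}P^1$. Their duals and tensor products are as follows, for all $r,r'\in\mathbb{Z}/2$, $s,n\in\mathbb{Z}_+$, $\eta,\eta'\in\mathbb{C}P^1$ (all equalities are isomorphisms of $K_2$-modules; $cX$ denotes the direct sum of $c$ copies of $X$). Simples and projectives: 1. $V(r)^*=V(r)$, $P(r)^*=P(r)$. 2. $V(r)\otimes V(r')=V(r+r')$, $V(r)\otimes P(r')=P(r+r')$, $P(r)\otimes P(r')=2P(0)\oplus 2P(1)$. The rest: 1. $(\Omega^sV(r))^*=\Omega^{-s}V(r)$, $(M_n(r,\eta))^*=M_n(r+1,\eta)$. 2. $V(r)\otimes\Omega^{s}V(r')=\Omega^{s}V(r+r')$, $V(r)\otimes\Omega^{-s}V(r')=\Omega^{-s}V(r+r')$, $V(r)\otimes M_n(r',\eta)=M_n(r+r',\eta)$. 3. $P(r)\otimes\Omega^{s}V(r')=P(r)\otimes\Omega^{-s}V(r')=sP(r+r'+p(s+1))\oplus(s+1)P(r+r'+p(s))$, and $P(r)\otimes M_n(r',\eta)=nP(0)\oplus nP(1)$. 4. $\Omega^sV(r)\otimes M_n(r',\eta)=M_n(r+r'+p(s),\eta)\oplus snP(r+r'+p(s+1))$, and $\Omega^{-s}V(r)\otimes M_n(r',\eta)=M_n(r+r'+p(s),\eta)\oplus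 snP(r+r'+p(s))$. 5. $\Omega^sV(r)\otimes\Omega^nV(r')=\Omega^{s+n}V(r+r')\oplus snP(r+r'+p(s+n))$; $\Omega^sV(r)\otimes\Omega^{-n}V(r')=\Omega^{s-n}V(r+r')\oplus(s+1)nP(r+r'+p(s+n+1))$ if $s\ge n$; and $\Omega^sV(r)\otimes\Omega^{-n}V(r')=\Omega^{s-n}V(r+r')\oplus(n+1)sP(r+r'+p(s+n+1))$ otherwise. 6. $M_s(r,\eta)\otimes M_n(r',\eta')=snP(r+r')$ if $\eta\ne\eta'$, and $M_s(r,\eta)\otimes M_n(r',\eta)=s(n-1)P(r+r')\oplus M_s(0,\eta)\oplus M_s(1,\eta)$ if $s\le n$.
   Context: $K_2$ is the $8$-dimensional Hopf algebra over $\mathbb{C}$ generated by $K,\xi_1,\xi_2$ with $K^2=1$, $\xi_i^2=0$, $K\xi_i=-\xi_iK$, $\xi_1\xi_2=-\xi_2\xi_1$, and $\Delta(K)=K\otimes K$, $\Delta(\xi_i)=K\otimes\xi_i+\xi_i\otimes1$, $\epsilon(K)=1$, $\epsilon(\xi_i)=0$, $S(K)=K$, $S(\xi_i)=-K\xi_i$. Modules are finite-dimensional left modules. $\mathbb{Z}_+$ is the set of positive integers; $r,r'\in\mathbb{Z}/2=\{0,1\}$ with addition mod $2$; $p(n)=n \bmod 2$; $\mathbb{C}P^1=\mathbb{C}\cup\{\infty\}$. $V(r)$ is the one-dimensional module with $K$ acting by $(-1)^r$ and $\xi_i$ by $0$; $P(r)$ is its ($4$-dimensional) projective cover. $\Omega^sV(r)$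 is the $s$-th syzygy of $V(r)$ (the $s$-th kernel in the minimal projective resolution of $V(r)$) and $\Omega^{-s}V(r)$ the $s$-th cosyzygy (the $s$-th cokernel in the minimal injective resolution); $\Omega^0V(r)=V(r)$; $\dim\Omega^{\pm s}V(r)=2s+1$. $M_n(r,\eta)$ is the $2n$-dimensional module with basis $e_1,\dots,e_n,f_1,\dots,f_n$, with $Ke_i=(-1)^{r+1}e_i$, $Kf_i=(-1)^rf_i$, $\xi_1f_i=\xi_2f_i=0$, and (with $f_0=0$) $\xi_1e_i=f_i$, $\xi_2e_i=\eta f_i+f_{i-1}$ if $\eta\in\mathbb{C}$, while $\xi_1e_i=f_{i-1}$, $\xi_2e_i=f_i$ if $\eta=\infty$. *)

theory Defs
  imports "Jordan_Normal_Form.Matrix_Kernel" "HOL-Library.Z2"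
begin

datatype gen = GK | GXi1 | GXi2

text \<open>
  \<open>K\<^sub>2\<close> is given by generators and relations. An element of the free algebra on
  \<open>gen\<close> is written as a list of terms \<open>(c, w)\<close>, standing for the sum of the \<open>c w\<close>,
  where a word \<open>w\<close> is a list of generators and \<open>[]\<close> is the unit. An element of the tensor
  square of the free algebra is a list of terms \<open>(c, u, w)\<close>, standing for the sum of the
  \<open>c (u \<otimes> w)\<close>.
\<close>

type_synonym free_elt = "(complex \<times> gen list) list"
type_synonym free_elt2 = "(complex \<times> gen list \<times> gen list) list"

definition relators :: "free_elt set" where
  "relators =
    {[(1, [GK, GK]), (-1, [])],
     [(1, [GXi1, GXi1])],
     [(1, [GXi2, GXi2])],
     [(1, [GK, GXi1]), (1, [GXi1, GK])],
     [(1, [GK, GXi2]), (1, [GXi2, GK])],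
     [(1, [GXi1, GXi2]), (1, [GXi2, GXi1])]}"

fun comult :: "gen \<Rightarrow> free_elt2" where
  "comult GK = [(1, [GK], [GK])]"
| "comult GXi1 = [(1, [GK], [GXi1]), (1, [GXi1], [])]"
| "comult GXi2 = [(1, [GK], [GXi2]), (1, [GXi2], [])]"

fun antipode :: "gen \<Rightarrow> free_elt" where
  "antipode GK = [(1, [GK])]"
| "antipode GXi1 = [(-1, [GK, GXi1])]"
| "antipode GXi2 = [(-1, [GK, GXi2])]"

text \<open>
  A finite-dimensional module is a coordinate space \<open>\<complex>\<^sup>n\<close> together with the matrices by which
  the generators act on column vectors; these have to satisfy the defining relations.
\<close>

record rep =
  rdim :: nat
  act :: "gen \<Rightarrow> complex mat"

fun act_word :: "rep \<Rightarrow> gen list \<Rightarrow> complex mat" where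
  "act_word M [] = 1\<^sub>m (rdim M)"
| "act_word M (g # w) = act M g * act_word M w"

fun act_elt :: "rep \<Rightarrow> free_elt \<Rightarrow> complex mat" where
  "act_elt M [] = 0\<^sub>m (rdim M) (rdim M)"
| "act_elt M ((c, w) # ts) = c \<cdot>\<^sub>m act_word M w + act_elt M ts"

definition is_module :: "rep \<Rightarrow> bool" where
  "is_module M \<longleftrightarrow>
    (\<forall>g. act M g \<in> carrier_mat (rdim M) (rdim M)) \<and>
    (\<forall>x\<in>relators. act_elt M x = 0\<^sub>m (rdim M) (rdim M))"

definition module_homs :: "rep \<Rightarrow> rep \<Rightarrow> complex mat set" where
  "module_homs M N =
    {f \<in> carrier_mat (rdim N) (rdim M). \<forall>g. act N g * f = f * act M g}"

definition rep_iso :: "rep \<Rightarrow> rep \<Rightarrow> bool" (infix "\<cong>\<^sub>K" 50) where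
  "M \<cong>\<^sub>K N \<longleftrightarrow> is_module M \<and> is_module N \<and>
    (\<exists>f\<in>module_homs M N. \<exists>h\<in>module_homs N M. f * h = 1\<^sub>m (rdim N) \<and> h * f = 1\<^sub>m (rdim M))"

definition image_of :: "complex mat \<Rightarrow> complex vec set" where
  "image_of f = (\<lambda>v. f *\<^sub>v v) ` carrier_vec (dim_col f)"

definition mono_mat :: "complex mat \<Rightarrow> bool" where
  "mono_mat f \<longleftrightarrow> inj_on (\<lambda>v. f *\<^sub>v v) (carrier_vec (dim_col f))"

definition epi_mat :: "complex mat \<Rightarrow> bool" where
  "epi_mat f \<longleftrightarrow> image_of f = carrier_vec (dim_row f)"

definition zero_rep :: rep where
  "zero_rep = \<lparr>rdim = 0, act = (\<lambda>g. 0\<^sub>m 0 0)\<rparr>"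

definition direct_sum :: "rep \<Rightarrow> rep \<Rightarrow> rep" (infixr "\<oplus>\<^sub>K" 65) where
  "M \<oplus>\<^sub>K N = \<lparr>rdim = rdim M + rdim N,
     act = (\<lambda>g. four_block_mat (act M g) (0\<^sub>m (rdim M) (rdim N))
                               (0\<^sub>m (rdim N) (rdim M)) (act N g))\<rparr>"

definition copies :: "nat \<Rightarrow> rep \<Rightarrow> rep" (infixr "\<odot>\<^sub>K" 75) where
  "c \<odot>\<^sub>K M = ((\<lambda>N. M \<oplus>\<^sub>K N) ^^ c) zero_rep"

definition indecomposable :: "rep \<Rightarrow> bool" where
  "indecomposable M \<longleftrightarrow> is_module M \<and> rdim M \<noteq> 0 \<and>
    (\<forall>A B. is_module A \<and> is_module B \<and> M \<cong>\<^sub>K A \<oplus>\<^sub>K B \<longrightarrow> rdim A = 0 \<or> rdim B = 0)"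

text \<open>
  Kronecker product: the basis vector \<open>u\<^sub>i \<otimes> w\<^sub>j\<close> of \<open>\<complex>\<^sup>m \<otimes> \<complex>\<^sup>n\<close> has index \<open>i n + j\<close>.
\<close>

definition kron :: "complex mat \<Rightarrow> complex mat \<Rightarrow> complex mat" where
  "kron A B = mat (dim_row A * dim_row B) (dim_col A * dim_col B)
     (\<lambda>(i, j). A $$ (i div dim_row B, j div dim_col B) * B $$ (i mod dim_row B, j mod dim_col B))"

fun act_elt2 :: "rep \<Rightarrow> rep \<Rightarrow> free_elt2 \<Rightarrow> complex mat" where
  "act_elt2 M N [] = 0\<^sub>m (rdim M * rdim N) (rdim M * rdim N)"
| "act_elt2 M N ((c, u, w) # ts) =
     c \<cdot>\<^sub>m kron (act_word M u) (act_word N w) + act_elt2 M N ts"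

definition tensor :: "rep \<Rightarrow> rep \<Rightarrow> rep" (infixr "\<otimes>\<^sub>K" 70) where
  "M \<otimes>\<^sub>K N = \<lparr>rdim = rdim M * rdim N, act = (\<lambda>g. act_elt2 M N (comult g))\<rparr>"

text \<open>The left dual, \<open>(h \<phi>)(v) = \<phi>(S(h) v)\<close>, in the dual basis.\<close>

definition dual :: "rep \<Rightarrow> rep" where
  "dual M = \<lparr>rdim = rdim M, act = (\<lambda>g. transpose_mat (act_elt M (antipode g)))\<rparr>"

definition projective :: "rep \<Rightarrow> bool" where
  "projective P \<longleftrightarrow> is_module P \<and>
    (\<forall>M N. is_module M \<and> is_module N \<longrightarrow>
      (\<forall>q\<in>module_homs M N. epi_mat q \<longrightarrow>
        (\<forall>f\<in>module_homs P N. \<exists>h\<in>module_homs P M. q * h = f)))"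

definition injective :: "rep \<Rightarrow> bool" where
  "injective I \<longleftrightarrow> is_module I \<and>
    (\<forall>M N. is_module M \<and> is_module N \<longrightarrow>
      (\<forall>j\<in>module_homs M N. mono_mat j \<longrightarrow>
        (\<forall>f\<in>module_homs M I. \<exists>h\<in>module_homs N I. h * j = f)))"

text \<open>A projective cover is a projective module with an essential epimorphism onto \<open>M\<close>;
  dually, an injective hull is an injective module with an essential monomorphism from \<open>M\<close>.\<close>

definition projective_cover :: "rep \<Rightarrow> complex mat \<Rightarrow> rep \<Rightarrow> bool" where
  "projective_cover P q M \<longleftrightarrow> projective P \<and> is_module M \<and> q \<in> module_homs P M \<and> epi_mat q \<and>
    (\<forall>X. is_module X \<longrightarrow> (\<forall>f\<in>module_homs X P. epi_mat (q * f) \<longrightarrow> epi_mat f))"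

definition injective_hull :: "rep \<Rightarrow> complex mat \<Rightarrow> rep \<Rightarrow> bool" where
  "injective_hull I j M \<longleftrightarrow> injective I \<and> is_module M \<and> j \<in> module_homs M I \<and> mono_mat j \<and>
    (\<forall>X. is_module X \<longrightarrow> (\<forall>f\<in>module_homs I X. mono_mat (f * j) \<longrightarrow> mono_mat f))"

text \<open>
  Projective covers, syzygies and cosyzygies are unique up to isomorphism only; the following
  functions choose a representative.
\<close>

definition proj_cover :: "rep \<Rightarrow> rep" where
  "proj_cover M = (SOME P. \<exists>q. projective_cover P q M)"

definition syzygy :: "rep \<Rightarrow> rep" where
  "syzygy M = (SOME X. is_module X \<and>
     (\<exists>P q j. projective_cover P q M \<and>
        j \<in> module_homs X P \<and> mono_mat j \<and> image_of j = mat_kernel q))"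

definition cosyzygy :: "rep \<Rightarrow> rep" where
  "cosyzygy M = (SOME X. is_module X \<and>
     (\<exists>I j q. injective_hull I j M \<and>
        q \<in> module_homs I X \<and> epi_mat q \<and> mat_kernel q = image_of j))"

text \<open>The integer power \<open>\<Omega>\<^sup>k\<close>: the \<open>k\<close>-th syzygy for \<open>k \<ge> 0\<close>, the \<open>(-k)\<close>-th cosyzygy for
  \<open>k \<le> 0\<close>. Iterating projective covers yields the minimal projective resolution.\<close>

definition Omega :: "int \<Rightarrow> rep \<Rightarrow> rep" where
  "Omega k M = (if k \<ge> 0 then (syzygy ^^ nat k) M else (cosyzygy ^^ nat (- k)) M)"

text \<open>The index \<open>r \<in> \<int>/2\<close> is an element of the two-element field \<open>bit\<close>, whose
  addition is addition modulo 2; \<open>of_nat n :: bit\<close> is \<open>n\<close> modulo 2.\<close>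

definition sgn_bit :: "bit \<Rightarrow> complex" where
  "sgn_bit r = (if r = 0 then 1 else -1)"

definition parity :: "nat \<Rightarrow> bit" where
  "parity n = of_nat n"

definition V_mod :: "bit \<Rightarrow> rep" where
  "V_mod r = \<lparr>rdim = 1, act = (\<lambda>g. case g of GK \<Rightarrow> sgn_bit r \<cdot>\<^sub>m 1\<^sub>m 1 | GXi1 \<Rightarrow> 0\<^sub>m 1 1 | GXi2 \<Rightarrow> 0\<^sub>m 1 1)\<rparr>"

definition P_mod :: "bit \<Rightarrow> rep" where
  "P_mod r = proj_cover (V_mod r)"

datatype cp1 = Fin complex | Infty

text \<open>
  In the basis \<open>e\<^sub>1, \<dots>, e\<^sub>n, f\<^sub>1, \<dots>, f\<^sub>n\<close>, the vector \<open>e\<^sub>i\<close> has index \<open>i - 1\<close>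
  and \<open>f\<^sub>i\<close> has index \<open>n + i - 1\<close>. The matrix \<open>e_to_f n\<close> maps \<open>e\<^sub>i\<close> to \<open>f\<^sub>i\<close>, the matrix
  \<open>e_to_prev_f n\<close> maps \<open>e\<^sub>i\<close> to \<open>f\<^bsub>i-1\<^esub>\<close> (with \<open>f\<^sub>0 = 0\<close>), and both annihilate all \<open>f\<^sub>i\<close>.
\<close>

definition e_to_f :: "nat \<Rightarrow> complex mat" where
  "e_to_f n = mat (2 * n) (2 * n) (\<lambda>(i, j). if j < n \<and> i = n + j then 1 else 0)"

definition e_to_prev_f :: "nat \<Rightarrow> complex mat" where
  "e_to_prev_f n = mat (2 * n) (2 * n) (\<lambda>(i, j). if j < n \<and> 0 < j \<and> i = n + j - 1 then 1 else 0)"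

definition M_mod :: "nat \<Rightarrow> bit \<Rightarrow> cp1 \<Rightarrow> rep" where
  "M_mod n r \<eta> = \<lparr>rdim = 2 * n, act = (\<lambda>g. case g of
      GK \<Rightarrow> mat (2 * n) (2 * n) (\<lambda>(i, j). if i = j then (if i < n then sgn_bit (r + 1) else sgn_bit r) else 0)
    | GXi1 \<Rightarrow> (case \<eta> of Fin c \<Rightarrow> e_to_f n | Infty \<Rightarrow> e_to_prev_f n)
    | GXi2 \<Rightarrow> (case \<eta> of Fin c \<Rightarrow> c \<cdot>\<^sub>m e_to_f n + e_to_prev_f n | Infty \<Rightarrow> e_to_f n))\<rparr>"

datatype label = LV bit | LP bit | LSyz nat bit | LCosyz nat bit | LMod nat bit cp1

definition labels :: "label set" where
  "labels = range LV \<union> range LP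
    \<union> {LSyz s r | s r. s > 0} \<union> {LCosyz s r | s r. s > 0} \<union> {LMod n r \<eta> | n r \<eta>. n > 0}"

fun listed :: "label \<Rightarrow> rep" where
  "listed (LV r) = V_mod r"
| "listed (LP r) = P_mod r"
| "listed (LSyz s r) = Omega (int s) (V_mod r)"
| "listed (LCosyz s r) = Omega (- int s) (V_mod r)"
| "listed (LMod n r \<eta>) = M_mod n r \<eta>"

lemma is_module_iff:
  "is_module M \<longleftrightarrow>
    (let n = rdim M; A = act M GK; X = act M GXi1; Y = act M GXi2 in
      A \<in> carrier_mat n n \<and> X \<in> carrier_mat n n \<and> Y \<in> carrier_mat n n \<and>
      A * A = 1\<^sub>m n \<and> X * X = 0\<^sub>m n n \<and> Y * Y = 0\<^sub>m n n \<and>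
      A * X = - (X * A) \<and> A * Y = - (Y * A) \<and> X * Y = - (Y * X))"
proof -
  let ?n = "rdim M"
  have all_gen: "(\<forall>g. Q g) \<longleftrightarrow> Q GK \<and> Q GXi1 \<and> Q GXi2" for Q
    by (metis gen.exhaust)
  have minus: "(A + B = 0\<^sub>m ?n ?n) = (A = - B)"
    if "A \<in> carrier_mat ?n ?n" "B \<in> carrier_mat ?n ?n" for A B :: "complex mat"
    using that by (auto simp: mat_eq_iff eq_neg_iff_add_eq_0)
  have one: "(1 :: complex) \<cdot>\<^sub>m A = A" for A by (auto simp: mat_eq_iff)
  have unit: "- ((-1 :: complex) \<cdot>\<^sub>m 1\<^sub>m ?n) = 1\<^sub>m ?n"
    by (auto simp: mat_eq_iff)
  show ?thesis
  proof (cases "\<forall>g. act M g \<in> carrier_mat ?n ?n")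
    case True
    then have c: "act M g \<in> carrier_mat ?n ?n" for g by blast
    then have cc: "act M g * act M h \<in> carrier_mat ?n ?n" for g h
      by (meson mult_carrier_mat)
    show ?thesis
      using c by (simp add: is_module_def relators_def Let_def all_gen one unit minus cc
          right_mult_one_mat[OF c] right_add_zero_mat[OF c] right_add_zero_mat[OF cc])
  next
    case False
    then show ?thesis by (auto simp: is_module_def all_gen Let_def)
  qed
qed

lemma tensor_simps:
  assumes "is_module M" "is_module N"
  shows "rdim (M \<otimes>\<^sub>K N) = rdim M * rdim N"
    and "act (M \<otimes>\<^sub>K N) GK = kron (act M GK) (act N GK)"
    and "act (M \<otimes>\<^sub>K N) GXi1 = kron (act M GK) (act N GXi1) + kron (act M GXi1) (1\<^sub>m (rdim N))"
    and "act (M \<otimes>\<^sub>K N) GXi2 = kron (act M GK) (act N GXi2) + kron (act M GXi2) (1\<^sub>m (rdim N))"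
proof -
  have one: "(1 :: complex) \<cdot>\<^sub>m A = A" for A by (auto simp: mat_eq_iff)
  have c: "act M g \<in> carrier_mat (rdim M) (rdim M)" "act N g \<in> carrier_mat (rdim N) (rdim N)" for g
    using assms by (auto simp: is_module_def)
  have k: "kron A B \<in> carrier_mat (rdim M * rdim N) (rdim M * rdim N)"
    if "A \<in> carrier_mat (rdim M) (rdim M)" "B \<in> carrier_mat (rdim N) (rdim N)" for A B
    using that by (simp add: kron_def)
  show "rdim (M \<otimes>\<^sub>K N) = rdim M * rdim N"
    and "act (M \<otimes>\<^sub>K N) GK = kron (act M GK) (act N GK)"
    and "act (M \<otimes>\<^sub>K N) GXi1 = kron (act M GK) (act N GXi1) + kron (act M GXi1) (1\<^sub>m (rdim N))"
    and "act (M \<otimes>\<^sub>K N) GXi2 = kron (act M GK) (act N GXi2) + kron (act M GXi2) (1\<^sub>m (rdim N))"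
    using c k by (simp_all add: tensor_def one right_mult_one_mat[OF c(1)] right_mult_one_mat[OF c(2)]
        right_add_zero_mat[OF k])
qed

lemma dual_simps:
  assumes "is_module M"
  shows "rdim (dual M) = rdim M"
    and "act (dual M) GK = transpose_mat (act M GK)"
    and "act (dual M) GXi1 = transpose_mat (- (act M GK * act M GXi1))"
    and "act (dual M) GXi2 = transpose_mat (- (act M GK * act M GXi2))"
proof -
  have one: "(1 :: complex) \<cdot>\<^sub>m A = A" "(-1 :: complex) \<cdot>\<^sub>m A = - A" for A
    by (auto simp: mat_eq_iff)
  have c: "act M g \<in> carrier_mat (rdim M) (rdim M)" for g
    using assms by (auto simp: is_module_def)
  then have cc: "act M g * act M h \<in> carrier_mat (rdim M) (rdim M)" for g h
    by (meson mult_carrier_mat)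
  show "rdim (dual M) = rdim M"
    and "act (dual M) GK = transpose_mat (act M GK)"
    and "act (dual M) GXi1 = transpose_mat (- (act M GK * act M GXi1))"
    and "act (dual M) GXi2 = transpose_mat (- (act M GK * act M GXi2))"
    using c cc by (simp_all add: dual_def one right_mult_one_mat[OF c]
        right_add_zero_mat[OF c] right_add_zero_mat[OF cc])
qed

end

theory Submission
  imports Defs "Jordan_Normal_Form.Jordan_Normal_Form_Existence"
begin

text \<open>
  A module with \<open>\<xi>\<^sub>1\<xi>\<^sub>2 M \<noteq> 0\<close> splits off some \<open>P(r)\<close>. An indecomposable \<open>M\<close> with
  \<open>\<xi>\<^sub>1\<xi>\<^sub>2 M = 0\<close> is a pencil \<open>(X, Y)\<close> of matrices from its top to its socle, the two being
  distinguished by the sign of \<open>K\<close>. If some \<open>X + tY\<close> is invertible, the pencil is governed by a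
  single Jordan block and \<open>M\<close> is some \<open>M\<^sub>n(r, \<eta>)\<close>. Otherwise, after transposing if necessary, \<open>X + tY\<close>
  kills a polynomial vector; passing to the cosyzygy shortens this vector, so that \<open>M\<close> is an iterated
  syzygy of a simple module.

  Projectivity is detected by Higman's trace map, which makes it visible that tensoring with a module
  preserves projectives. Hence \<open>\<Omega>\<^sup>k V(r) \<otimes> X\<close> and \<open>\<Omega>\<^sup>k (V(r) \<otimes> X)\<close> are stably isomorphic, and a
  stable isomorphism onto a module killed by \<open>\<xi>\<^sub>1\<xi>\<^sub>2\<close> determines the product up to projective summands, whose
  number and parity are read off from the dimension and from \<open>K\<close> on \<open>\<xi>\<^sub>1\<xi>\<^sub>2\<close>. For equal \<open>\<eta>\<close> and
  \<open>s \<le> n\<close>, the sequence \<open>0 \<rightarrow> V \<rightarrow> M\<^sub>n \<rightarrow> \<Omega>\<^bsup>n-1\<^esup> V' \<rightarrow> 0\<close> splits after tensoring with \<open>M\<^sub>s\<close>.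
\<close>

subsection \<open>Finitely supported matrices\<close>

text \<open>Projective covers and syzygies are chosen by \<open>SOME\<close>, hence known only up to
  isomorphism. Explicit pencils take their place: Kronecker's singular blocks \<open>Wp\<close> and
  \<open>Wn\<close> model the syzygies and cosyzygies of V(r), and \<open>Pc\<close> models P(r).
  Uniqueness of covers ties the chosen representatives to these models.

  Krull-Schmidt is bypassed. On a module killed by \<xi>1\<xi>2 every value of the trace map squares
  to zero, so a map invertible up to traces is invertible, and stable isomorphism between two such
  modules is isomorphism. The projective summands of a product of two such modules all have the same
  parity, because \<xi>1\<xi>2 carries top tensor top into socle tensor socle, where K is a single
  sign.

  Exactness is recorded by linear splittings, that is, by equations between matrices. Such equations
  survive transposition and tensoring verbatim. Transposition also exchanges projectives with
  injectives, so each argument about syzygies gives the one about cosyzygies.\<close>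

text \<open>Regarding all matrices as blocks of one infinite matrix makes multiplication total and
  associative without side conditions; the format is recorded separately by \<open>rect\<close>.\<close>

typedef fmat = "{f :: nat \<Rightarrow> nat \<Rightarrow> complex. \<exists>n. \<forall>i j. n \<le> i \<or> n \<le> j \<longrightarrow> f i j = 0}"
  morphisms ent Fmat
  by (rule exI[of _ "\<lambda>i j. 0"]) simp

setup_lifting type_definition_fmat

lemma ent_bound: "\<exists>n. \<forall>i j. n \<le> i \<or> n \<le> j \<longrightarrow> ent f i j = 0"
  using ent[of f] by simp

lemma ent_bound2:
  "\<exists>n. \<forall>i j. n \<le> i \<or> n \<le> j \<longrightarrow> ent f i j = 0 \<and> ent g i j = 0"
proof -
  obtain a b where "\<forall>i j. a \<le> i \<or> a \<le> j \<longrightarrow> ent f i j = 0" "\<forall>i j. b \<le> i \<or> b \<le> j \<longrightarrow> ent g i j = 0"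
    using ent_bound by meson
  then show ?thesis by (intro exI[of _ "max a b"]) auto
qed

lemma fmat_eqI: "(\<And>i j. ent f i j = ent g i j) \<Longrightarrow> f = g"
  by (metis ent_inject ext)

instantiation fmat :: ring
begin

lift_definition zero_fmat :: fmat is "\<lambda>i j. 0" by simp
lift_definition plus_fmat :: "fmat \<Rightarrow> fmat \<Rightarrow> fmat" is "\<lambda>f g i j. f i j + g i j"
proof -
  fix f g :: "nat \<Rightarrow> nat \<Rightarrow> complex"
  assume "\<exists>n. \<forall>i j. n \<le> i \<or> n \<le> j \<longrightarrow> f i j = 0" "\<exists>n. \<forall>i j. n \<le> i \<or> n \<le> j \<longrightarrow> g i j = 0"
  then obtain a b where "\<forall>i j. a \<le> i \<or> a \<le> j \<longrightarrow> f i j = 0" "\<forall>i j. b \<le> i \<or> b \<le> j \<longrightarrow> g i j = 0"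
    by blast
  then show "\<exists>n. \<forall>i j. n \<le> i \<or> n \<le> j \<longrightarrow> f i j + g i j = 0" by (intro exI[of _ "max a b"]) auto
qed
lift_definition uminus_fmat :: "fmat \<Rightarrow> fmat" is "\<lambda>f i j. - f i j" by simp
definition minus_fmat :: "fmat \<Rightarrow> fmat \<Rightarrow> fmat" where "minus_fmat f g = f + - g"
text \<open>The support of a row is always finite, so the product is total without choosing a bound;
  \<open>ent_times_left\<close> and \<open>ent_times_right\<close> then allow any sufficiently large
  range.\<close>

lift_definition times_fmat :: "fmat \<Rightarrow> fmat \<Rightarrow> fmat" is "\<lambda>f g i j. \<Sum>k | f i k \<noteq> 0. f i k * g k j"
proof -
  fix f g :: "nat \<Rightarrow> nat \<Rightarrow> complex"
  assume "\<exists>n. \<forall>i j. n \<le> i \<or> n \<le> j \<longrightarrow> f i j = 0" "\<exists>n. \<forall>i j. n \<le> i \<or> n \<le> j \<longrightarrow> g i j = 0"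
  then obtain a b where "\<forall>i j. a \<le> i \<or> a \<le> j \<longrightarrow> f i j = 0" "\<forall>i j. b \<le> i \<or> b \<le> j \<longrightarrow> g i j = 0"
    by blast
  then show "\<exists>n. \<forall>i j. n \<le> i \<or> n \<le> j \<longrightarrow> (\<Sum>k | f i k \<noteq> 0. f i k * g k j) = 0"
    by (intro exI[of _ "max a b"]) auto
qed

lemma ent_zero [simp]: "ent 0 i j = 0" by transfer simp
lemma ent_plus [simp]: "ent (f + g) i j = ent f i j + ent g i j" by transfer simp
lemma ent_uminus [simp]: "ent (- f) i j = - ent f i j" by transfer simp
lemma ent_minus [simp]: "ent (f - g) i j = ent f i j - ent g i j" by (simp add: minus_fmat_def)

lemma ent_times_left:
  assumes "\<And>k. k \<ge> n \<Longrightarrow> ent f i k = 0"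
  shows "ent (f * g) i j = (\<Sum>k<n. ent f i k * ent g k j)"
proof -
  have "ent (f * g) i j = (\<Sum>k | ent f i k \<noteq> 0. ent f i k * ent g k j)" by transfer simp
  also have "\<dots> = (\<Sum>k<n. ent f i k * ent g k j)"
    using assms by (intro sum.mono_neutral_left) (auto simp: not_less[symmetric])
  finally show ?thesis .
qed

lemma ent_times_right:
  assumes "\<And>k. k \<ge> n \<Longrightarrow> ent g k j = 0"
  shows "ent (f * g) i j = (\<Sum>k<n. ent f i k * ent g k j)"
proof -
  obtain a where a: "\<forall>i j. a \<le> i \<or> a \<le> j \<longrightarrow> ent f i j = 0" using ent_bound by blast
  have "ent (f * g) i j = (\<Sum>k<max a n. ent f i k * ent g k j)"
    by (rule ent_times_left) (use a in auto)
  also have "\<dots> = (\<Sum>k<n. ent f i k * ent g k j)"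
    using assms by (intro sum.mono_neutral_right) auto
  finally show ?thesis .
qed

instance
proof
  fix a b c :: fmat
  show "a + b + c = a + (b + c)" "a + b = b + a" "0 + a = a" "- a + a = 0"
    by (auto intro!: fmat_eqI)
  show "a - b = a + - b" by (simp add: minus_fmat_def)
  obtain n where n: "\<forall>i j. n \<le> i \<or> n \<le> j \<longrightarrow> ent a i j = 0 \<and> ent b i j = 0"
    using ent_bound2 by blast
  obtain m where m: "\<forall>i j. m \<le> i \<or> m \<le> j \<longrightarrow> ent c i j = 0 \<and> ent c i j = 0"
    using ent_bound2 by blast
  show "a * b * c = a * (b * c)"
  proof (rule fmat_eqI)
    fix i j
    have ab: "ent (a * b) i k = (\<Sum>l<n. ent a i l * ent b l k)" for k
      by (rule ent_times_left) (use n in auto)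
    have bc: "ent (b * c) l j = (\<Sum>k<n. ent b l k * ent c k j)" for l
      by (rule ent_times_left) (use n in auto)
    have "ent (a * b * c) i j = (\<Sum>k<n. ent (a * b) i k * ent c k j)"
      by (rule ent_times_left) (use n in \<open>auto simp: ab\<close>)
    also have "\<dots> = (\<Sum>k<n. \<Sum>l<n. ent a i l * ent b l k * ent c k j)"
      by (simp add: ab sum_distrib_right)
    also have "\<dots> = (\<Sum>l<n. \<Sum>k<n. ent a i l * ent b l k * ent c k j)" by (rule sum.swap)
    also have "\<dots> = (\<Sum>l<n. ent a i l * ent (b * c) l j)"
      by (simp add: bc sum_distrib_left mult.assoc)
    also have "\<dots> = ent (a * (b * c)) i j"
      by (rule ent_times_left[symmetric]) (use n in auto)
    finally show "ent (a * b * c) i j = ent (a * (b * c)) i j" .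
  qed
  show "(a + b) * c = a * c + b * c"
  proof (rule fmat_eqI)
    fix i j
    have *: "ent (x * c) i j = (\<Sum>k<m. ent x i k * ent c k j)" for x
      by (rule ent_times_right) (use m in auto)
    show "ent ((a + b) * c) i j = ent (a * c + b * c) i j"
      by (simp add: * sum.distrib distrib_right)
  qed
  show "a * (b + c) = a * b + a * c"
  proof (rule fmat_eqI)
    fix i j
    have *: "ent (a * x) i j = (\<Sum>k<n. ent a i k * ent x k j)" for x
      by (rule ent_times_left) (use n in auto)
    show "ent (a * (b + c)) i j = ent (a * b + a * c) i j"
      by (simp add: * sum.distrib distrib_left)
  qed
qed

end

lemma ent_sum [simp]: "ent (sum f S) i j = (\<Sum>x\<in>S. ent (f x) i j)"
  by (induction S rule: infinite_finite_induct) auto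

lift_definition scaleC :: "complex \<Rightarrow> fmat \<Rightarrow> fmat" (infixr "*\<^sub>C" 75) is "\<lambda>c f i j. c * f i j"
  by auto

lift_definition tp :: "fmat \<Rightarrow> fmat" is "\<lambda>f i j. f j i" by metis

text \<open>The ring \<open>fmat\<close> has no unit; these corner idempotents serve as the
  identities of the various sizes.\<close>

lift_definition Idm :: "nat \<Rightarrow> fmat" is "\<lambda>n i j. if i = j \<and> i < n then 1 else 0"
  by (metis not_less)

lift_definition Eu :: "nat \<Rightarrow> nat \<Rightarrow> fmat" is "\<lambda>a b i j. if i = a \<and> j = b then 1 else 0"
proof -
  fix a b :: nat
  show "\<exists>n. \<forall>i j. n \<le> i \<or> n \<le> j \<longrightarrow> (if i = a \<and> j = b then 1 else 0 :: complex) = 0"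
    by (rule exI[of _ "Suc (max a b)"]) auto
qed

lemma ent_scaleC [simp]: "ent (c *\<^sub>C f) i j = c * ent f i j" by transfer simp
lemma ent_tp [simp]: "ent (tp f) i j = ent f j i" by transfer simp
lemma ent_Idm: "ent (Idm n) i j = (if i = j \<and> i < n then 1 else 0)" by transfer simp
lemma ent_Eu: "ent (Eu a b) i j = (if i = a \<and> j = b then 1 else 0)" by transfer simp

lemma ent_Idm_times [simp]: "ent (Idm n * f) i j = (if i < n then ent f i j else 0)"
proof -
  have "ent (Idm n * f) i j = (\<Sum>k<n. ent (Idm n) i k * ent f k j)"
    by (rule ent_times_left) (auto simp: ent_Idm)
  also have "\<dots> = (\<Sum>k<n. if k = i then ent f i j else 0)"
    by (intro sum.cong) (auto simp: ent_Idm)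
  finally show ?thesis by simp
qed

lemma ent_times_Idm [simp]: "ent (f * Idm n) i j = (if j < n then ent f i j else 0)"
proof -
  have "ent (f * Idm n) i j = (\<Sum>k<n. ent f i k * ent (Idm n) k j)"
    by (rule ent_times_right) (auto simp: ent_Idm)
  also have "\<dots> = (\<Sum>k<n. if k = j then ent f i j else 0)"
    by (intro sum.cong) (auto simp: ent_Idm)
  finally show ?thesis by simp
qed

lemma ent_Eu_times [simp]: "ent (Eu a b * f) i j = (if i = a then ent f b j else 0)"
proof -
  have "ent (Eu a b * f) i j = (\<Sum>k<Suc b. ent (Eu a b) i k * ent f k j)"
    by (rule ent_times_left) (auto simp: ent_Eu)
  also have "\<dots> = (\<Sum>k<Suc b. if k = b then (if i = a then ent f b j else 0) else 0)"
    by (intro sum.cong) (auto simp: ent_Eu)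
  finally show ?thesis by simp
qed

lemma ent_times_Eu [simp]: "ent (f * Eu a b) i j = (if j = b then ent f i a else 0)"
proof -
  have "ent (f * Eu a b) i j = (\<Sum>k<Suc a. ent f i k * ent (Eu a b) k j)"
    by (rule ent_times_right) (auto simp: ent_Eu)
  also have "\<dots> = (\<Sum>k<Suc a. if k = a then (if j = b then ent f i a else 0) else 0)"
    by (intro sum.cong) (auto simp: ent_Eu)
  finally show ?thesis by simp
qed

lemma tp_tp [simp]: "tp (tp f) = f" by (auto intro!: fmat_eqI)
lemma tp_zero [simp]: "tp 0 = 0" by (auto intro!: fmat_eqI)
lemma tp_plus [simp]: "tp (f + g) = tp f + tp g" by (auto intro!: fmat_eqI)
lemma tp_minus [simp]: "tp (f - g) = tp f - tp g" by (auto intro!: fmat_eqI)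
lemma tp_uminus [simp]: "tp (- f) = - tp f" by (auto intro!: fmat_eqI)
lemma tp_scaleC [simp]: "tp (c *\<^sub>C f) = c *\<^sub>C tp f" by (auto intro!: fmat_eqI)
lemma tp_Idm [simp]: "tp (Idm n) = Idm n" by (auto intro!: fmat_eqI simp: ent_Idm)
lemma tp_times [simp]: "tp (f * g) = tp g * tp f"
proof (rule fmat_eqI)
  fix i j
  obtain n where n: "\<forall>i j. n \<le> i \<or> n \<le> j \<longrightarrow> ent f i j = 0 \<and> ent g i j = 0"
    using ent_bound2 by blast
  have "ent (f * g) j i = (\<Sum>k<n. ent f j k * ent g k i)"
    by (rule ent_times_left) (use n in auto)
  moreover have "ent (tp g * tp f) i j = (\<Sum>k<n. ent (tp g) i k * ent (tp f) k j)"
    by (rule ent_times_left) (use n in auto)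
  ultimately show "ent (tp (f * g)) i j = ent (tp g * tp f) i j"
    by (simp add: mult.commute)
qed

lemma scaleC_mult_left [simp]: "(c *\<^sub>C f) * g = c *\<^sub>C (f * g)"
proof (rule fmat_eqI)
  fix i j
  obtain n where n: "\<forall>i j. n \<le> i \<or> n \<le> j \<longrightarrow> ent f i j = 0" using ent_bound by blast
  have "ent (x * g) i j = (\<Sum>k<n. ent x i k * ent g k j)" if "x = f \<or> x = c *\<^sub>C f" for x
    by (rule ent_times_left) (use n that in auto)
  then show "ent ((c *\<^sub>C f) * g) i j = ent (c *\<^sub>C (f * g)) i j"
    by (simp add: sum_distrib_left mult.assoc)
qed

lemma scaleC_mult_right [simp]: "f * (c *\<^sub>C g) = c *\<^sub>C (f * g)"
  by (metis tp_times tp_scaleC tp_tp scaleC_mult_left)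

lemma scaleC_scaleC [simp]: "c *\<^sub>C d *\<^sub>C f = (c * d) *\<^sub>C f" by (auto intro!: fmat_eqI)
lemma scaleC_one [simp]: "1 *\<^sub>C f = f" by (auto intro!: fmat_eqI)
lemma scaleC_zero [simp]: "c *\<^sub>C 0 = 0" "0 *\<^sub>C f = 0" by (auto intro!: fmat_eqI)
lemma scaleC_minus_left [simp]: "(- c) *\<^sub>C f = - (c *\<^sub>C f)" by (auto intro!: fmat_eqI)
lemma scaleC_minus_right [simp]: "c *\<^sub>C (- f) = - (c *\<^sub>C f)" by (auto intro!: fmat_eqI)
lemma scaleC_add: "c *\<^sub>C (f + g) = c *\<^sub>C f + c *\<^sub>C g" by (auto intro!: fmat_eqI simp: algebra_simps)
lemma scaleC_diff: "c *\<^sub>C (f - g) = c *\<^sub>C f - c *\<^sub>C g" by (auto intro!: fmat_eqI simp: algebra_simps)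
lemma scaleC_add_left: "(c + d) *\<^sub>C f = c *\<^sub>C f + d *\<^sub>C f" by (auto intro!: fmat_eqI simp: algebra_simps)
lemma scaleC_diff_left: "(c - d) *\<^sub>C f = c *\<^sub>C f - d *\<^sub>C f" by (auto intro!: fmat_eqI simp: algebra_simps)

lemma scaleC_cancel: "c *\<^sub>C f = 0 \<Longrightarrow> c \<noteq> 0 \<Longrightarrow> f = 0"
  by (metis scaleC_one scaleC_scaleC scaleC_zero(1) left_inverse)

lemma scaleC_half: "(1/2) *\<^sub>C (f + f) = f" by (auto intro!: fmat_eqI)

lemma Idm_zero [simp]: "Idm 0 = 0" by (auto intro!: fmat_eqI simp: ent_Idm)
lemma Idm_times_Idm [simp]: "Idm m * Idm n = Idm (min m n)" by (auto intro!: fmat_eqI simp: ent_Idm)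
lemma Eu_times_Eu: "Eu a b * Eu c d = (if b = c then Eu a d else 0)"
  by (auto intro!: fmat_eqI simp: ent_Eu)
lemma Idm_times_Eu [simp]: "Idm n * Eu a b = (if a < n then Eu a b else 0)"
  by (auto intro!: fmat_eqI simp: ent_Eu ent_Idm)
lemma Eu_times_Idm [simp]: "Eu a b * Idm n = (if b < n then Eu a b else 0)"
  by (auto intro!: fmat_eqI simp: ent_Eu ent_Idm)
lemma Idm_Suc: "Idm (Suc n) = Idm n + Eu n n" by (auto intro!: fmat_eqI simp: ent_Eu ent_Idm)

lemma Idm_inj: assumes "Idm m = Idm n" shows "m = n"
proof (rule ccontr)
  assume "m \<noteq> n"
  then have "ent (Idm m) (min m n) (min m n) \<noteq> ent (Idm n) (min m n) (min m n)"
    by (auto simp: ent_Idm min_def)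
  with assms show False by simp
qed

text \<open>Extends a product rule to right-nested products, so that the simplifier can apply it
  after reassociation by \<open>mult.assoc\<close>.\<close>

lemma assoc_rew: "a * b = c \<Longrightarrow> a * (b * z) = c * z" for a :: fmat
  by (metis mult.assoc)

subsection \<open>Formats, trace and rank factorization\<close>

text \<open>Phrased through the corner idempotents rather than entrywise: closure under products
  becomes pure associativity, and \<open>rectD\<close> can be used for rewriting.\<close>

definition rect :: "nat \<Rightarrow> nat \<Rightarrow> fmat \<Rightarrow> bool" where
  "rect m n f \<longleftrightarrow> Idm m * f = f \<and> f * Idm n = f"

lemma rect_entD: "rect m n f \<Longrightarrow> m \<le> i \<or> n \<le> j \<Longrightarrow> ent f i j = 0"
  unfolding rect_def by (metis ent_Idm_times ent_times_Idm not_less)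

lemma rect_entI: "(\<And>i j. m \<le> i \<or> n \<le> j \<Longrightarrow> ent f i j = 0) \<Longrightarrow> rect m n f"
  unfolding rect_def by (auto intro!: fmat_eqI)

lemma rectD:
  assumes "rect m n f"
  shows "Idm m * f = f" "f * Idm n = f" "Idm m * (f * z) = f * z" "f * (Idm n * z) = f * z"
  using assms by (auto simp: rect_def mult.assoc[symmetric])

lemma rect_zero [simp]: "rect m n 0" by (simp add: rect_def)
lemma rect_Idm: "n \<le> a \<Longrightarrow> n \<le> b \<Longrightarrow> rect a b (Idm n)" by (simp add: rect_def min_absorb1 min_absorb2)
lemma rect_Idm_same [simp]: "rect n n (Idm n)" by (simp add: rect_Idm)
lemma rect_Eu [simp]: "rect m n (Eu a b) \<longleftrightarrow> a < m \<and> b < n"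
  by (metis (no_types) rect_def Idm_times_Eu Eu_times_Idm ent_Eu ent_zero zero_neq_one)
lemma rect_plus: "rect m n f \<Longrightarrow> rect m n g \<Longrightarrow> rect m n (f + g)" by (simp add: rect_def algebra_simps)
lemma rect_minus: "rect m n f \<Longrightarrow> rect m n g \<Longrightarrow> rect m n (f - g)" by (simp add: rect_def algebra_simps)
lemma rect_uminus: "rect m n f \<Longrightarrow> rect m n (- f)" by (simp add: rect_def)
lemma rect_scaleC: "rect m n f \<Longrightarrow> rect m n (c *\<^sub>C f)" by (simp add: rect_def)
lemma rect_times: "rect m k f \<Longrightarrow> rect k n g \<Longrightarrow> rect m n (f * g)"
  unfolding rect_def by (metis mult.assoc)
lemma rect_tp: "rect m n f \<Longrightarrow> rect n m (tp f)"
  unfolding rect_def by (metis tp_times tp_Idm)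
lemma rect_sum: "(\<And>x. x \<in> S \<Longrightarrow> rect m n (f x)) \<Longrightarrow> rect m n (sum f S)"
  by (induction S rule: infinite_finite_induct) (auto intro: rect_plus)

lemma rect_mono: "rect m n f \<Longrightarrow> m \<le> m' \<Longrightarrow> n \<le> n' \<Longrightarrow> rect m' n' f"
  by (rule rect_entI) (meson le_trans rect_entD)

section \<open>Trace and rank factorization as substitutes for dimension theory\<close>

definition tr :: "fmat \<Rightarrow> complex" where
  "tr f = (\<Sum>i | ent f i i \<noteq> 0. ent f i i)"

lemma tr_eq: assumes "\<And>i. i \<ge> n \<Longrightarrow> ent f i i = 0" shows "tr f = (\<Sum>i<n. ent f i i)"
  unfolding tr_def using assms by (intro sum.mono_neutral_left) (auto simp: not_less[symmetric])

lemma tr_plus: "tr (f + g) = tr f + tr g"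
proof -
  obtain n where "\<forall>i j. n \<le> i \<or> n \<le> j \<longrightarrow> ent f i j = 0 \<and> ent g i j = 0"
    using ent_bound2 by blast
  then show ?thesis by (simp add: tr_eq[of n] sum.distrib)
qed

lemma tr_scaleC: "tr (c *\<^sub>C f) = c * tr f"
proof -
  obtain n where "\<forall>i j. n \<le> i \<or> n \<le> j \<longrightarrow> ent f i j = 0" using ent_bound by blast
  then show ?thesis by (simp add: tr_eq[of n] sum_distrib_left)
qed

lemma tr_uminus: "tr (- f) = - tr f" using tr_scaleC[of "-1" f] by simp
lemma tr_minus: "tr (f - g) = tr f - tr g" by (simp add: tr_plus tr_uminus diff_conv_add_uminus del: add_uminus_conv_diff)

lemma tr_zero [simp]: "tr 0 = 0" by (simp add: tr_def)
lemma tr_Idm: "tr (Idm n) = of_nat n" by (subst tr_eq[of n]) (auto simp: ent_Idm)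

lemma tr_commute: "tr (f * g) = tr (g * f)"
proof -
  obtain n where n: "\<forall>i j. n \<le> i \<or> n \<le> j \<longrightarrow> ent f i j = 0 \<and> ent g i j = 0"
    using ent_bound2 by blast
  have e: "ent (x * y) i j = (\<Sum>k<n. ent x i k * ent y k j)" if "x = f \<or> x = g" for x y i j
    by (rule ent_times_left) (use n that in auto)
  have "tr (f * g) = (\<Sum>i<n. \<Sum>k<n. ent f i k * ent g k i)"
    by (subst tr_eq[of n]) (use n in \<open>auto simp: e\<close>)
  also have "\<dots> = (\<Sum>k<n. \<Sum>i<n. ent g k i * ent f i k)"
    by (subst sum.swap) (simp add: mult.commute)
  also have "\<dots> = tr (g * f)"
    by (subst tr_eq[of n]) (use n in \<open>auto simp: e\<close>)
  finally show ?thesis .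
qed

text \<open>The only elimination argument: kernels, images, cokernels and idempotent splittings are
  all derived from this factorization through one-sided inverses. Each pivot clears a nonzero row,
  so the number of nonzero rows decreases.\<close>

lemma rank_factorization:
  assumes "rect m n f"
  obtains k i p l r where "rect m k i" "rect k n p" "rect k m l" "rect n k r"
    "f = i * p" "l * i = Idm k" "p * r = Idm k"
proof -
  have "\<exists>k i p l r. rect m k i \<and> rect k n p \<and> rect k m l \<and> rect n k r \<and>
    f = i * p \<and> l * i = Idm k \<and> p * r = Idm k"
    using assms
  proof (induction "card {a. a < m \<and> (\<exists>b. ent f a b \<noteq> 0)}" arbitrary: f rule: less_induct)
    case less
    show ?case
    proof (cases "f = 0")
      case True
      then show ?thesis by (intro exI[of _ 0]) (simp add: rect_def)
    next
      case False
      then obtain a b where ab: "ent f a b \<noteq> 0" by (metis ent_zero fmat_eqI)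
      then have a: "a < m" and b: "b < n"
        using rect_entD[OF less.prems] not_less by blast+
      define c where "c = ent f a b"
      have c: "c \<noteq> 0" using ab by (simp add: c_def)
      \<comment> \<open>Subtracting the rank one matrix through the pivot \<open>c\<close> clears row \<open>a\<close>.\<close>
      define f' where "f' = f - (1/c) *\<^sub>C (f * Eu b a * f)"
      have row: "ent (f * Eu b a * f) i j = ent f i b * ent f a j" for i j
      proof -
        have "ent (f * Eu b a * f) i j = (\<Sum>k<Suc a. ent (f * Eu b a) i k * ent f k j)"
          by (rule ent_times_left) auto
        also have "\<dots> = (\<Sum>k<Suc a. if k = a then ent f i b * ent f a j else 0)"
          by (intro sum.cong) auto
        finally show ?thesis by simp
      qed
      have f': "ent f' i j = ent f i j - ent f i b * ent f a j / c" for i j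
        by (simp add: f'_def row)
      have rf: "rect m n f'" unfolding f'_def
        using a b by (intro rect_minus rect_scaleC less.prems
            rect_times[OF rect_times[OF less.prems] less.prems]) simp
      have sub: "{i. i < m \<and> (\<exists>j. ent f' i j \<noteq> 0)} \<subseteq> {i. i < m \<and> (\<exists>j. ent f i j \<noteq> 0)} - {a}"
      proof clarsimp
        fix x j assume "x < m" "ent f' x j \<noteq> 0"
        moreover have "ent f' a j = 0" using c by (simp add: f' c_def)
        moreover have "ent f' x j = 0" if "\<forall>j. ent f x j = 0" using that by (simp add: f')
        ultimately show "(\<exists>j. ent f x j \<noteq> 0) \<and> x \<noteq> a" by metis
      qed
      have "card {i. i < m \<and> (\<exists>j. ent f' i j \<noteq> 0)} < card {i. i < m \<and> (\<exists>j. ent f i j \<noteq> 0)}"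
      proof (rule psubset_card_mono)
        have "a \<in> {i. i < m \<and> (\<exists>j. ent f i j \<noteq> 0)}" using a ab by blast
        then show "{i. i < m \<and> (\<exists>j. ent f' i j \<noteq> 0)} \<subset> {i. i < m \<and> (\<exists>j. ent f i j \<noteq> 0)}"
          using sub by blast
      qed simp
      from less.hyps[OF this rf] obtain k i p l r where
        ih: "rect m k i" "rect k n p" "rect k m l" "rect n k r"
          "f' = i * p" "l * i = Idm k" "p * r = Idm k" by (elim exE conjE) (rule that)
      have rowa: "Eu k a * f' = 0" using c by (auto intro!: fmat_eqI simp: f' c_def)
      have colb: "f' * Eu b k = 0" using c by (auto intro!: fmat_eqI simp: f' c_def)
      \<comment> \<open>Row \<open>a\<close> of \<open>f' = i * p\<close> vanishes and
        \<open>p\<close> has a right inverse, so row \<open>a\<close> of \<open>i\<close> vanishes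
        too; dually, column \<open>b\<close> of \<open>p\<close> vanishes.\<close>
      have ai: "Eu k a * i = 0"
      proof -
        have "Eu k a * i = Eu k a * (i * (p * r))" by (simp add: ih(7) rectD[OF ih(1)])
        also have "\<dots> = (Eu k a * f') * r" by (simp add: ih(5) mult.assoc)
        finally show ?thesis by (simp add: rowa)
      qed
      have pb: "p * Eu b k = 0"
      proof -
        have "p * Eu b k = (l * i) * (p * Eu b k)" by (simp add: ih(6) rectD[OF ih(2)] mult.assoc[symmetric])
        also have "\<dots> = l * (f' * Eu b k)" by (simp add: ih(5) mult.assoc)
        finally show ?thesis by (simp add: colb)
      qed
      \<comment> \<open>The pivot contributes one new column to \<open>i\<close> and one new row to
        \<open>p\<close>. The middle terms of \<open>l'\<close> and \<open>r'\<close> cancel what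
        \<open>l\<close> and \<open>r\<close> would produce on this column and this row.\<close>
      define i' where "i' = i + f * Eu b k"
      define p' where "p' = p + (1/c) *\<^sub>C (Eu k a * f)"
      define l' where "l' = l - (1/c) *\<^sub>C (l * f * Eu b a) + (1/c) *\<^sub>C Eu k a"
      define r' where "r' = r - (1/c) *\<^sub>C (Eu b a * f * r) + Eu b k"
      have iE: "i * Eu k x = 0" for x using rectD(2)[OF ih(1)] by (metis Eu_times_Eu Idm_times_Eu mult.assoc mult_zero_right less_irrefl)
      have Ep: "Eu x k * p = 0" for x using rectD(1)[OF ih(2)] by (metis Eu_times_Idm mult.assoc mult_zero_left less_irrefl)
      have El: "Eu x k * l = 0" for x using rectD(1)[OF ih(3)] by (metis Eu_times_Idm mult.assoc mult_zero_left less_irrefl)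
      have rE: "r * Eu k x = 0" for x using rectD(2)[OF ih(4)] by (metis Idm_times_Eu mult.assoc mult_zero_right less_irrefl)
      have piv: "Eu x a * (f * Eu b y) = c *\<^sub>C Eu x y" for x y
        by (auto intro!: fmat_eqI simp: ent_Eu c_def)
      have piv2: "Eu x a * (f * (Eu b y * z)) = c *\<^sub>C (Eu x y * z)" for x y z
        by (metis piv mult.assoc scaleC_mult_left)
      have EE: "Eu x y * Eu z w = (if y = z then Eu x w else 0)" for x y z w by (rule Eu_times_Eu)
      note rules = ih(5,6,7) rectD[OF ih(1)] rectD[OF ih(2)] rectD[OF ih(3)] rectD[OF ih(4)]
        assoc_rew[OF ih(6)] assoc_rew[OF ih(7)] iE Ep El rE piv EE ai pb
        assoc_rew[OF iE] assoc_rew[OF Ep] assoc_rew[OF El] assoc_rew[OF rE] assoc_rew[OF EE]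
        assoc_rew[OF ai] assoc_rew[OF pb]
      have F: "f = i' * p'"
      proof -
        have "i' * p' = f' + (1/c) *\<^sub>C (f * Eu b a * f)"
          using c by (simp add: i'_def p'_def rules distrib_left distrib_right mult.assoc)
        then show ?thesis by (simp add: f'_def)
      qed
      have ba: "Eu x a * i = 0" for x by (metis ai EE mult.assoc mult_zero_right)
      have pb2: "p * Eu b x = 0" for x by (metis pb EE mult.assoc mult_zero_left)
      have L: "l' * i' = Idm (Suc k)"
        using c by (simp add: l'_def i'_def rules ba scaleC_diff Idm_Suc distrib_left distrib_right
            left_diff_distrib right_diff_distrib mult.assoc)
      have R: "p' * r' = Idm (Suc k)"
        using c by (simp add: p'_def r'_def rules pb2 assoc_rew[OF pb2] piv2 scaleC_diff
            scaleC_add Idm_Suc distrib_left distrib_right left_diff_distrib right_diff_distrib mult.assoc)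
      have bk: "rect n (Suc k) (Eu b k)" and ka: "rect (Suc k) m (Eu k a)" and ba': "rect n m (Eu b a)"
        using a b by simp_all
      have "rect m (Suc k) i'" unfolding i'_def
        by (intro rect_plus rect_mono[OF ih(1)] rect_times[OF less.prems bk]) simp_all
      moreover have "rect (Suc k) n p'" unfolding p'_def
        by (intro rect_plus rect_mono[OF ih(2)] rect_scaleC rect_times[OF ka less.prems]) simp_all
      moreover have "rect (Suc k) m l'" unfolding l'_def
        by (intro rect_plus rect_minus rect_scaleC rect_mono[OF ih(3)] ka
            rect_times[OF rect_times[OF rect_mono[OF ih(3)] less.prems] ba']) simp_all
      moreover have "rect n (Suc k) r'" unfolding r'_def
        by (intro rect_plus rect_minus rect_scaleC rect_mono[OF ih(4)] bk
            rect_times[OF rect_times[OF ba' less.prems] rect_mono[OF ih(4)]]) simp_all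
      ultimately show ?thesis using F L R
        by (intro exI[of _ "Suc k"] exI[of _ i'] exI[of _ p'] exI[of _ l'] exI[of _ r'] conjI)
    qed
  qed
  then show ?thesis by (elim exE conjE) (rule that)
qed

text \<open>In \<open>i * p * (i * p) = i * p\<close> the outer factors can be cancelled by the
  one-sided inverses of the rank factorization, which leaves \<open>p * i = Idm k\<close>.\<close>

lemma idempotent_split:
  assumes "rect n n e" "e * e = e"
  obtains k i p where "rect n k i" "rect k n p" "e = i * p" "p * i = Idm k"
proof -
  obtain k i p l r where *: "rect n k i" "rect k n p" "rect k n l" "rect n k r"
    "e = i * p" "l * i = Idm k" "p * r = Idm k"
    using rank_factorization[OF assms(1)] .
  have "p * i = (l * i) * (p * i) * (p * r)"
    by (simp add: *(6,7) rectD[OF *(1)] rectD[OF *(2)] mult.assoc)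
  also have "\<dots> = l * (e * e) * r" by (simp only: *(5) mult.assoc)
  also have "\<dots> = (l * i) * (p * r)" by (simp only: assms(2)) (simp only: *(5) mult.assoc)
  also have "\<dots> = Idm k" by (simp add: *(6,7))
  finally show ?thesis using that * by blast
qed

lemma generalized_inverse:
  assumes "rect m n f"
  obtains s where "rect n m s" "f * s * f = f"
proof -
  obtain k i p l r where *: "rect m k i" "rect k n p" "rect k m l" "rect n k r"
    "f = i * p" "l * i = Idm k" "p * r = Idm k"
    using rank_factorization[OF assms] .
  have "f * (r * l) * f = i * ((p * r) * ((l * i) * p))" by (simp only: *(5) mult.assoc)
  also have "\<dots> = f" by (simp add: *(5,6,7) rectD[OF *(1)] rectD[OF *(2)])
  finally show ?thesis using that[of "r * l"] rect_times[OF *(4,3)] by blast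
qed

text \<open>The complementary idempotent \<open>Idm m - f * g\<close> has trace \<open>m - n\<close>
  and splits through some \<open>Idm k\<close>, whose trace is \<open>k\<close>. Hence
  \<open>m = k + n\<close>, and for \<open>m = n\<close> the complement is zero.\<close>

lemma left_inverse_dim:
  assumes "rect m n f" "rect n m g" "g * f = Idm n"
  shows "n \<le> m" "m = n \<Longrightarrow> f * g = Idm m"
proof -
  have rr: "rect m m (Idm m - f * g)"
    by (intro rect_minus rect_times[OF assms(1,2)]) simp
  have "(f * g) * (f * g) = f * g"
    by (simp add: mult.assoc assoc_rew[OF assms(3)] rectD[OF assms(2)])
  then have id: "(Idm m - f * g) * (Idm m - f * g) = Idm m - f * g"
    using assms by (simp add: algebra_simps rectD)
  obtain k i p where k: "rect m k i" "rect k m p" "Idm m - f * g = i * p" "p * i = Idm k"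
    using idempotent_split[OF rr id] .
  have "of_nat m - of_nat n = tr (Idm m - f * g)"
    by (simp add: tr_minus tr_commute[of f g] assms tr_Idm)
  also have "\<dots> = of_nat k" by (simp add: k(3) tr_commute[of i p] k(4) tr_Idm)
  finally have "(of_nat m :: complex) = of_nat (k + n)" by (simp add: algebra_simps)
  then have "m = k + n" using of_nat_eq_iff by blast
  then show "n \<le> m" by simp
  assume "m = n"
  with \<open>m = k + n\<close> have "k = 0" by simp
  then have "i = 0" using k(1) by (simp add: rect_def)
  then show "f * g = Idm m" using k(3) by simp
qed

subsection \<open>Embedding matrices\<close>

definition emb :: "complex mat \<Rightarrow> fmat" where
  "emb A = Fmat (\<lambda>i j. if i < dim_row A \<and> j < dim_col A then A $$ (i, j) else 0)"

lemma ent_emb: "ent (emb A) i j = (if i < dim_row A \<and> j < dim_col A then A $$ (i, j) else 0)"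
proof -
  have "(\<lambda>i j. if i < dim_row A \<and> j < dim_col A then A $$ (i, j) else 0)
      \<in> {f. \<exists>n. \<forall>i j. n \<le> i \<or> n \<le> j \<longrightarrow> f i j = 0}"
    by (auto intro!: exI[of _ "max (dim_row A) (dim_col A)"])
  then show ?thesis by (simp add: emb_def Fmat_inverse)
qed

definition prj :: "nat \<Rightarrow> nat \<Rightarrow> fmat \<Rightarrow> complex mat" where
  "prj m n f = mat m n (\<lambda>(i, j). ent f i j)"

lemma prj_carrier [simp]: "prj m n f \<in> carrier_mat m n" by (simp add: prj_def)
lemma prj_dims [simp]: "dim_row (prj m n f) = m" "dim_col (prj m n f) = n" by (simp_all add: prj_def)
lemma emb_prj: "rect m n f \<Longrightarrow> emb (prj m n f) = f"
  by (auto intro!: fmat_eqI simp: ent_emb prj_def rect_entD)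
lemma prj_emb: "A \<in> carrier_mat m n \<Longrightarrow> prj m n (emb A) = A"
  by (auto simp: prj_def ent_emb)
lemma rect_emb: "A \<in> carrier_mat m n \<Longrightarrow> rect m n (emb A)"
  by (rule rect_entI) (auto simp: ent_emb)
lemma emb_inj: "emb A = emb B \<Longrightarrow> A \<in> carrier_mat m n \<Longrightarrow> B \<in> carrier_mat m n \<Longrightarrow> A = B"
  by (metis prj_emb)

lemma emb_mult: "dim_col A = dim_row B \<Longrightarrow> emb (A * B) = emb A * emb B"
proof (rule fmat_eqI)
  fix i j assume d: "dim_col A = dim_row B"
  have "ent (emb A * emb B) i j = (\<Sum>k<dim_col A. ent (emb A) i k * ent (emb B) k j)"
    by (rule ent_times_left) (auto simp: ent_emb)
  then show "ent (emb (A * B)) i j = ent (emb A * emb B) i j"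
    using d by (auto simp: ent_emb scalar_prod_def lessThan_atLeast0)
qed

lemma emb_add: "dim_row A = dim_row B \<Longrightarrow> dim_col A = dim_col B \<Longrightarrow> emb (A + B) = emb A + emb B"
  by (auto intro!: fmat_eqI simp: ent_emb)
lemma emb_uminus: "emb (- A) = - emb A" by (auto intro!: fmat_eqI simp: ent_emb)
lemma emb_smult: "emb (c \<cdot>\<^sub>m A) = c *\<^sub>C emb A" by (auto intro!: fmat_eqI simp: ent_emb)
lemma emb_transpose: "emb (transpose_mat A) = tp (emb A)" by (auto intro!: fmat_eqI simp: ent_emb)
lemma emb_one: "emb (1\<^sub>m n) = Idm n" by (auto intro!: fmat_eqI simp: ent_emb ent_Idm)
lemma emb_zero: "emb (0\<^sub>m m n) = 0" by (auto intro!: fmat_eqI simp: ent_emb)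

subsection \<open>Modules and homomorphisms\<close>

definition ac :: "rep \<Rightarrow> gen \<Rightarrow> fmat" where "ac M g = emb (act M g)"

abbreviation kk :: "rep \<Rightarrow> fmat" where "kk M \<equiv> ac M GK"
abbreviation x1 :: "rep \<Rightarrow> fmat" where "x1 M \<equiv> ac M GXi1"
abbreviation x2 :: "rep \<Rightarrow> fmat" where "x2 M \<equiv> ac M GXi2"

definition mk :: "nat \<Rightarrow> fmat \<Rightarrow> fmat \<Rightarrow> fmat \<Rightarrow> rep" where
  "mk n K x y = \<lparr>rdim = n, act = (\<lambda>g. prj n n (case g of GK \<Rightarrow> K | GXi1 \<Rightarrow> x | GXi2 \<Rightarrow> y))\<rparr>"

lemma rdim_mk [simp]: "rdim (mk n K x y) = n" by (simp add: mk_def)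

lemma ac_mk:
  assumes "rect n n K" "rect n n x" "rect n n y"
  shows "kk (mk n K x y) = K" "x1 (mk n K x y) = x" "x2 (mk n K x y) = y"
  using assms by (simp_all add: ac_def mk_def emb_prj)

lemma is_module_carrier: "is_module M \<Longrightarrow> act M g \<in> carrier_mat (rdim M) (rdim M)"
  by (simp add: is_module_def)

lemma rect_ac: "is_module M \<Longrightarrow> rect (rdim M) (rdim M) (ac M g)"
  by (simp add: ac_def rect_emb is_module_carrier)

lemma all_gen: "(\<forall>g. Q g) \<longleftrightarrow> Q GK \<and> Q GXi1 \<and> Q GXi2"
  by (metis gen.exhaust)

lemma emb_eq_iff: "A \<in> carrier_mat m n \<Longrightarrow> B \<in> carrier_mat m n \<Longrightarrow> A = B \<longleftrightarrow> emb A = emb B"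
  by (metis emb_inj)

lemma module_iff:
  "is_module M \<longleftrightarrow> (\<forall>g. act M g \<in> carrier_mat (rdim M) (rdim M)) \<and>
    kk M * kk M = Idm (rdim M) \<and> x1 M * x1 M = 0 \<and> x2 M * x2 M = 0 \<and>
    kk M * x1 M = - (x1 M * kk M) \<and> kk M * x2 M = - (x2 M * kk M) \<and> x1 M * x2 M = - (x2 M * x1 M)"
  (is "_ \<longleftrightarrow> ?c \<and> ?r")
proof (cases ?c)
  case True
  then have c: "act M g \<in> carrier_mat (rdim M) (rdim M)" for g by blast
  have d: "dim_row (act M g) = rdim M" "dim_col (act M g) = rdim M" for g using c[of g] by auto
  have cc: "act M g * act M h \<in> carrier_mat (rdim M) (rdim M)"
    "- (act M g * act M h) \<in> carrier_mat (rdim M) (rdim M)" for g h using c[of g] c[of h] by auto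
  show ?thesis
    using c by (simp add: is_module_iff Let_def emb_eq_iff[OF cc(1) one_carrier_mat]
        emb_eq_iff[OF cc(1) zero_carrier_mat] emb_eq_iff[OF cc(1) cc(2)]
        emb_mult emb_uminus emb_one emb_zero d ac_def)
next
  case False
  then show ?thesis by (auto simp: is_module_def)
qed

lemma module_mk:
  assumes "rect n n K" "rect n n x" "rect n n y" "K * K = Idm n" "x * x = 0" "y * y = 0"
    "K * x = - (x * K)" "K * y = - (y * K)" "x * y = - (y * x)"
  shows "is_module (mk n K x y)"
  unfolding module_iff ac_mk[OF assms(1-3)] using assms by (simp add: mk_def)

text \<open>Oriented towards a normal form in which \<open>kk M\<close> stands on the right and
  \<open>x1 M\<close> precedes \<open>x2 M\<close>; the versions with \<open>z\<close> act inside
  right-nested products.\<close>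

lemma mod_rels:
  assumes "is_module M"
  shows "kk M * kk M = Idm (rdim M)" "x1 M * x1 M = 0" "x2 M * x2 M = 0"
    "kk M * x1 M = - (x1 M * kk M)" "kk M * x2 M = - (x2 M * kk M)" "x2 M * x1 M = - (x1 M * x2 M)"
    "kk M * (kk M * z) = Idm (rdim M) * z" "x1 M * (x1 M * z) = 0" "x2 M * (x2 M * z) = 0"
    "kk M * (x1 M * z) = - (x1 M * (kk M * z))" "kk M * (x2 M * z) = - (x2 M * (kk M * z))"
    "x2 M * (x1 M * z) = - (x1 M * (x2 M * z))"
proof -
  show *: "kk M * kk M = Idm (rdim M)" "x1 M * x1 M = 0" "x2 M * x2 M = 0"
    "kk M * x1 M = - (x1 M * kk M)" "kk M * x2 M = - (x2 M * kk M)" "x2 M * x1 M = - (x1 M * x2 M)"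
    using assms by (auto simp: module_iff)
  show "kk M * (kk M * z) = Idm (rdim M) * z" "x1 M * (x1 M * z) = 0" "x2 M * (x2 M * z) = 0"
    "kk M * (x1 M * z) = - (x1 M * (kk M * z))" "kk M * (x2 M * z) = - (x2 M * (kk M * z))"
    "x2 M * (x1 M * z) = - (x1 M * (x2 M * z))"
    using *[THEN assoc_rew] by (simp_all add: mult.assoc)
qed

lemmas mod_simps = rectD[OF rect_ac] mod_rels

definition hom :: "rep \<Rightarrow> rep \<Rightarrow> fmat \<Rightarrow> bool" where
  "hom M N f \<longleftrightarrow> rect (rdim N) (rdim M) f \<and> (\<forall>g. ac N g * f = f * ac M g)"

lemma hom_rect: "hom M N f \<Longrightarrow> rect (rdim N) (rdim M) f" by (simp add: hom_def)

lemma homD: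
  assumes "hom M N f"
  shows "Idm (rdim N) * f = f" "f * Idm (rdim M) = f" "Idm (rdim N) * (f * z) = f * z"
    "f * (Idm (rdim M) * z) = f * z" "ac N g * f = f * ac M g" "ac N g * (f * z) = f * (ac M g * z)"
proof -
  show "Idm (rdim N) * f = f" "f * Idm (rdim M) = f" "Idm (rdim N) * (f * z) = f * z"
    "f * (Idm (rdim M) * z) = f * z" using rectD[OF hom_rect[OF assms]] by simp_all
  show *: "ac N g * f = f * ac M g" using assms by (simp add: hom_def)
  show "ac N g * (f * z) = f * (ac M g * z)" using assoc_rew[OF *] by (simp add: mult.assoc)
qed

lemma homI:
  assumes "rect (rdim N) (rdim M) f" "kk N * f = f * kk M" "x1 N * f = f * x1 M" "x2 N * f = f * x2 M"
  shows "hom M N f"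
  using assms by (auto simp: hom_def all_gen)

lemma hom_comp: "hom N L g \<Longrightarrow> hom M N f \<Longrightarrow> hom M L (g * f)"
  unfolding hom_def by (metis mult.assoc rect_times)
lemma hom_plus: "hom M N f \<Longrightarrow> hom M N g \<Longrightarrow> hom M N (f + g)"
  by (simp add: hom_def rect_plus distrib_left distrib_right)
lemma hom_minus: "hom M N f \<Longrightarrow> hom M N g \<Longrightarrow> hom M N (f - g)"
  by (simp add: hom_def rect_minus left_diff_distrib right_diff_distrib)
lemma hom_scaleC: "hom M N f \<Longrightarrow> hom M N (c *\<^sub>C f)"
  by (simp add: hom_def rect_scaleC)
lemma hom_zero [simp]: "hom M N 0" by (simp add: hom_def)
lemma hom_Idm: "is_module M \<Longrightarrow> hom M M (Idm (rdim M))"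
  by (simp add: hom_def mod_simps)

lemma hom_emb:
  assumes "is_module M" "is_module N" "f \<in> module_homs M N"
  shows "hom M N (emb f)"
proof -
  have f: "f \<in> carrier_mat (rdim N) (rdim M)" "act N g * f = f * act M g" for g
    using assms(3) by (auto simp: module_homs_def)
  have "emb (act N g) * emb f = emb f * emb (act M g)" for g
    using f is_module_carrier[OF assms(1), of g] is_module_carrier[OF assms(2), of g]
    by (metis carrier_matD emb_mult)
  then show ?thesis using f by (simp add: hom_def ac_def rect_emb)
qed

lemma prj_hom:
  assumes "is_module M" "is_module N" "hom M N f"
  shows "prj (rdim N) (rdim M) f \<in> module_homs M N"
proof -
  have "act N g * prj (rdim N) (rdim M) f = prj (rdim N) (rdim M) f * act M g" for g
  proof (rule emb_inj[where m = "rdim N" and n = "rdim M"])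
    have c: "act N g \<in> carrier_mat (rdim N) (rdim N)" "act M g \<in> carrier_mat (rdim M) (rdim M)"
      using assms by (auto intro: is_module_carrier)
    then show "act N g * prj (rdim N) (rdim M) f \<in> carrier_mat (rdim N) (rdim M)"
      "prj (rdim N) (rdim M) f * act M g \<in> carrier_mat (rdim N) (rdim M)" by auto
    show "emb (act N g * prj (rdim N) (rdim M) f) = emb (prj (rdim N) (rdim M) f * act M g)"
      using c assms(3) by (simp add: emb_mult emb_prj hom_rect homD flip: ac_def)
  qed
  then show ?thesis by (simp add: module_homs_def)
qed

lemma isoI:
  assumes "is_module M" "is_module N" "hom M N f" "hom N M h"
    "f * h = Idm (rdim N)" "h * f = Idm (rdim M)"
  shows "M \<cong>\<^sub>K N"
proof -
  let ?f = "prj (rdim N) (rdim M) f" and ?h = "prj (rdim M) (rdim N) h"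
  have "?f * ?h = 1\<^sub>m (rdim N)"
    by (rule emb_inj[where m = "rdim N" and n = "rdim N"])
      (auto simp: emb_mult emb_prj hom_rect assms emb_one)
  moreover have "?h * ?f = 1\<^sub>m (rdim M)"
    by (rule emb_inj[where m = "rdim M" and n = "rdim M"])
      (auto simp: emb_mult emb_prj hom_rect assms emb_one)
  ultimately show ?thesis unfolding rep_iso_def using assms prj_hom by blast
qed

lemma isoE:
  assumes "M \<cong>\<^sub>K N"
  obtains f h where "is_module M" "is_module N" "hom M N f" "hom N M h"
    "f * h = Idm (rdim N)" "h * f = Idm (rdim M)"
proof -
  from assms obtain f h where *: "is_module M" "is_module N" "f \<in> module_homs M N" "h \<in> module_homs N M"
    "f * h = 1\<^sub>m (rdim N)" "h * f = 1\<^sub>m (rdim M)" unfolding rep_iso_def by blast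
  have d: "f \<in> carrier_mat (rdim N) (rdim M)" "h \<in> carrier_mat (rdim M) (rdim N)"
    using *(3,4) by (auto simp: module_homs_def)
  have "emb f * emb h = Idm (rdim N)" "emb h * emb f = Idm (rdim M)"
    using d *(5,6) by (metis carrier_matD emb_mult emb_one)+
  then show ?thesis using that * hom_emb by blast
qed

lemma iso_module: "M \<cong>\<^sub>K N \<Longrightarrow> is_module M" "M \<cong>\<^sub>K N \<Longrightarrow> is_module N"
  by (auto simp: rep_iso_def)

lemma iso_refl: "is_module M \<Longrightarrow> M \<cong>\<^sub>K M"
  by (rule isoI) (auto intro: hom_Idm)

lemma iso_sym: "M \<cong>\<^sub>K N \<Longrightarrow> N \<cong>\<^sub>K M"
  by (auto simp: rep_iso_def)

lemma iso_trans [trans]: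
  assumes "M \<cong>\<^sub>K N" "N \<cong>\<^sub>K L" shows "M \<cong>\<^sub>K L"
proof -
  obtain f h where f: "is_module M" "is_module N" "hom M N f" "hom N M h"
    "f * h = Idm (rdim N)" "h * f = Idm (rdim M)" using isoE[OF assms(1)] .
  obtain f' h' where f': "is_module N" "is_module L" "hom N L f'" "hom L N h'"
    "f' * h' = Idm (rdim L)" "h' * f' = Idm (rdim N)" using isoE[OF assms(2)] .
  show ?thesis
    by (rule isoI[of _ _ "f' * f" "h * h'"])
      (use f f' in \<open>auto intro: hom_comp simp: mult.assoc assoc_rew[OF f(5)] assoc_rew[OF f'(6)]
        homD[OF f'(4)] homD[OF f(3)]\<close>)
qed

lemma iso_rdim: "M \<cong>\<^sub>K N \<Longrightarrow> rdim M = rdim N"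
  by (elim isoE) (metis antisym left_inverse_dim(1) hom_rect)

text \<open>Equal dimensions make \<open>h\<close> a two-sided inverse, and the inverse of an
  equivariant bijection is equivariant.\<close>

lemma isoI_left_inverse:
  assumes "is_module M" "is_module N" "hom M N f" "rect (rdim M) (rdim N) h"
    "h * f = Idm (rdim M)" "rdim M = rdim N"
  shows "M \<cong>\<^sub>K N"
proof -
  have fh: "f * h = Idm (rdim N)"
    using left_inverse_dim(2)[OF hom_rect[OF assms(3)] assms(4,5)] assms(6) by simp
  have "ac M g * h = h * ac N g" for g
  proof -
    have "ac M g * h = (h * f) * (ac M g * h)" by (simp add: assms(5) mod_simps assms(1))
    also have "\<dots> = h * ac N g * (f * h)" by (simp add: mult.assoc homD[OF assms(3)])
    also have "\<dots> = h * ac N g" by (simp add: fh mod_simps assms(2) mult.assoc)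
    finally show ?thesis .
  qed
  then have "hom N M h" using assms(4) by (simp add: hom_def)
  then show ?thesis using isoI assms fh by blast
qed

lemma tr_ac_iso: assumes "M \<cong>\<^sub>K N" shows "tr (ac M g) = tr (ac N g)"
proof -
  obtain f h where f: "is_module M" "is_module N" "hom M N f" "hom N M h"
    "f * h = Idm (rdim N)" "h * f = Idm (rdim M)" using isoE[OF assms] .
  have "tr (ac M g) = tr (h * (f * ac M g))" by (simp add: assoc_rew[OF f(6)] mod_simps f)
  also have "\<dots> = tr ((f * ac M g) * h)" by (rule tr_commute)
  also have "(f * ac M g) * h = (f * h) * ac N g" by (simp add: mult.assoc homD[OF f(4)])
  finally show ?thesis by (simp add: f mod_simps)
qed

subsection \<open>Submodules, quotients and idempotents\<close>

text \<open>The product \<open>i * p\<close> projects onto the image of \<open>i\<close>, so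
  \<open>inv\<close> says that this image is stable under the action. The lemma
  \<open>quotient_module\<close> is the mirror image, where \<open>inv\<close> says that the kernel
  of \<open>p\<close> is stable.\<close>

lemma sub_module:
  assumes "is_module M" "rect (rdim M) k i" "rect k (rdim M) p" "p * i = Idm k"
    and inv: "\<And>g. i * (p * (ac M g * i)) = ac M g * i"
  defines "N \<equiv> mk k (p * kk M * i) (p * x1 M * i) (p * x2 M * i)"
  shows "is_module N" "hom N M i" "rdim N = k" "ac N g = p * ac M g * i"
proof -
  note s = mod_simps[OF assms(1)] rectD[OF assms(2)] rectD[OF assms(3)] assms(4) assoc_rew[OF assms(4)] mult.assoc
    inv
  have inv2: "i * (p * (ac M g * (i * z))) = ac M g * (i * z)" for g z
    by (metis inv mult.assoc)
  have r: "rect k k (p * ac M g * i)" for g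
    by (intro rect_times[OF rect_times[OF assms(3) rect_ac[OF assms(1)]] assms(2)])
  show "is_module N" unfolding N_def by (rule module_mk) (use r in \<open>auto simp: s inv2\<close>)
  show "rdim N = k" by (simp add: N_def)
  show ac: "ac N g = p * ac M g * i" for g by (cases g) (simp_all add: N_def ac_mk r)
  show "hom N M i" by (auto simp: hom_def ac assms(2) \<open>rdim N = k\<close> s inv2)
qed

lemma quotient_module:
  assumes "is_module M" "rect (rdim M) k i" "rect k (rdim M) p" "p * i = Idm k"
    and inv: "\<And>g. p * (ac M g * (i * p)) = p * ac M g"
  defines "N \<equiv> mk k (p * kk M * i) (p * x1 M * i) (p * x2 M * i)"
  shows "is_module N" "hom M N p" "rdim N = k" "ac N g = p * ac M g * i"
proof -
  have inv2: "p * (ac M g * (i * (p * z))) = p * (ac M g * z)" for g z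
    by (metis inv mult.assoc)
  note s = mod_simps[OF assms(1)] rectD[OF assms(2)] rectD[OF assms(3)] assms(4) assoc_rew[OF assms(4)] mult.assoc
    inv inv2
  have r: "rect k k (p * ac M g * i)" for g
    by (intro rect_times[OF rect_times[OF assms(3) rect_ac[OF assms(1)]] assms(2)])
  show "is_module N" unfolding N_def by (rule module_mk) (use r in \<open>auto simp: s\<close>)
  show "rdim N = k" by (simp add: N_def)
  show ac: "ac N g = p * ac M g * i" for g by (cases g) (simp_all add: N_def ac_mk r)
  show "hom M N p" by (auto simp: hom_def ac assms(3) \<open>rdim N = k\<close> s)
qed

lemma hom_idempotent_split:
  assumes "is_module M" "hom M M e" "e * e = e"
  obtains N i p where "is_module N" "hom N M i" "hom M N p" "e = i * p" "p * i = Idm (rdim N)"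
proof -
  obtain k i p where *: "rect (rdim M) k i" "rect k (rdim M) p" "e = i * p" "p * i = Idm k"
    using idempotent_split[OF hom_rect[OF assms(2)] assms(3)] .
  have ei: "e * i = i" and pe: "p * e = p"
    by (simp_all add: *(3) mult.assoc[symmetric] *(4) rectD[OF *(2)]) (simp add: mult.assoc *(4) rectD[OF *(1)])
  have i1: "i * (p * (ac M g * i)) = ac M g * i" for g
  proof -
    have "i * (p * (ac M g * i)) = e * ac M g * i" by (simp add: *(3) mult.assoc)
    also have "\<dots> = ac M g * (e * i)" by (simp add: homD(5)[OF assms(2), symmetric] mult.assoc)
    finally show ?thesis by (simp add: ei)
  qed
  have i2: "p * (ac M g * (i * p)) = p * ac M g" for g
  proof -
    have "p * (ac M g * (i * p)) = (p * e) * ac M g"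
      by (simp add: homD(5)[OF assms(2)] *(3)[symmetric] mult.assoc)
    then show ?thesis by (simp add: pe)
  qed
  show ?thesis
    using that sub_module[OF assms(1) *(1,2,4) i1] quotient_module[OF assms(1) *(1,2,4) i2] * by metis
qed

text \<open>For a generalized inverse \<open>t\<close>, the idempotent \<open>Idm - f * t\<close> is
  a projection along the image of \<open>f\<close>; splitting it yields the cokernel together with a
  section \<open>s\<close> that is only linear.\<close>

lemma hom_cokernel:
  assumes "is_module M" "is_module N" "hom M N f"
  obtains C c s where "is_module C" "hom N C c" "rect (rdim N) (rdim C) s" "c * s = Idm (rdim C)"
    "c * f = 0" "\<exists>t. rect (rdim M) (rdim N) t \<and> s * c = Idm (rdim N) - f * t"
proof -
  obtain t where t: "rect (rdim M) (rdim N) t" "f * t * f = f"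
    using generalized_inverse[OF hom_rect[OF assms(3)]] .
  define e where "e = Idm (rdim N) - f * t"
  have re: "rect (rdim N) (rdim N) e" unfolding e_def
    by (intro rect_minus rect_times[OF hom_rect[OF assms(3)] t(1)]) simp
  have ft: "f * (t * (f * z)) = f * z" for z using t(2) by (metis mult.assoc)
  have ee: "e * e = e"
    by (simp add: e_def algebra_simps ft rectD[OF t(1)] homD[OF assms(3)])
  have ef: "e * f = 0" using t(2) by (simp add: e_def algebra_simps homD[OF assms(3)])
  obtain k i p where *: "rect (rdim N) k i" "rect k (rdim N) p" "e = i * p" "p * i = Idm k"
    using idempotent_split[OF re ee] .
  have pf: "p * f = 0"
  proof -
    have "p * f = p * (e * f)" by (simp add: *(3) assoc_rew[OF *(4)] rectD[OF *(2)] mult.assoc)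
    then show ?thesis by (simp add: ef)
  qed
  have inv: "p * (ac N g * (i * p)) = p * ac N g" for g
    by (simp add: *(3)[symmetric] e_def right_diff_distrib mod_simps assms homD[OF assms(3)]
        assoc_rew[OF pf])
  note q = quotient_module[OF assms(2) *(1,2,4) inv]
  show ?thesis
    by (rule that[OF q(1,2)]) (use q(3) * pf t e_def in auto)
qed

subsection \<open>Direct sums\<close>

definition biprod :: "rep \<Rightarrow> rep \<Rightarrow> rep \<Rightarrow> bool" where
  "biprod M A B \<longleftrightarrow> (\<exists>i p j q. hom A M i \<and> hom M A p \<and> hom B M j \<and> hom M B q \<and>
     p * i = Idm (rdim A) \<and> q * j = Idm (rdim B) \<and> i * p + j * q = Idm (rdim M))"

text \<open>The cross terms vanish automatically: inserting \<open>i * p + j * q = Idm\<close>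
  between \<open>p\<close> and \<open>j\<close> gives twice \<open>p * j\<close>. The dimension
  formula is the trace of the same identity.\<close>

lemma biprodE:
  assumes "biprod M A B"
  obtains i p j q where "hom A M i" "hom M A p" "hom B M j" "hom M B q"
    "p * i = Idm (rdim A)" "q * j = Idm (rdim B)" "i * p + j * q = Idm (rdim M)"
    "p * j = 0" "q * i = 0" "rdim M = rdim A + rdim B"
proof -
  from assms obtain i p j q where *: "hom A M i" "hom M A p" "hom B M j" "hom M B q"
    "p * i = Idm (rdim A)" "q * j = Idm (rdim B)" "i * p + j * q = Idm (rdim M)"
    unfolding biprod_def by blast
  have "p * j = p * ((i * p + j * q) * j)" by (simp add: *(7) homD[OF *(3)])
  also have "\<dots> = p * j + p * j"
    by (simp only: distrib_left distrib_right mult.assoc *(6) assoc_rew[OF *(5)] homD[OF *(2)] homD[OF *(3)])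
  finally have pj: "p * j = 0" by simp
  have "q * i = q * ((i * p + j * q) * i)" by (simp add: *(7) homD[OF *(1)])
  also have "\<dots> = q * i + q * i"
    by (simp only: distrib_left distrib_right mult.assoc *(5) assoc_rew[OF *(6)] homD[OF *(4)] homD[OF *(1)])
  finally have qi: "q * i = 0" by simp
  have "of_nat (rdim M) = tr (i * p) + tr (j * q)" by (simp flip: tr_Idm tr_plus add: *(7))
  also have "\<dots> = of_nat (rdim A + rdim B)"
    by (simp add: tr_commute[of i p] tr_commute[of j q] * tr_Idm)
  finally have "rdim M = rdim A + rdim B" using of_nat_eq_iff by blast
  then show ?thesis using that * pj qi by blast
qed

lemma biprodI:
  assumes "hom A M i" "hom M A p" "hom B M j" "hom M B q"
    "p * i = Idm (rdim A)" "q * j = Idm (rdim B)" "i * p + j * q = Idm (rdim M)"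
  shows "biprod M A B"
  using assms unfolding biprod_def by blast

lemma biprod_cong:
  assumes "is_module M" "is_module N" "biprod M A B" "biprod N A' B'" "A \<cong>\<^sub>K A'" "B \<cong>\<^sub>K B'"
  shows "M \<cong>\<^sub>K N"
proof -
  obtain i p j q where m: "hom A M i" "hom M A p" "hom B M j" "hom M B q"
    "p * i = Idm (rdim A)" "q * j = Idm (rdim B)" "i * p + j * q = Idm (rdim M)"
    "p * j = 0" "q * i = 0" "rdim M = rdim A + rdim B" using biprodE[OF assms(3)] .
  obtain i' p' j' q' where n: "hom A' N i'" "hom N A' p'" "hom B' N j'" "hom N B' q'"
    "p' * i' = Idm (rdim A')" "q' * j' = Idm (rdim B')" "i' * p' + j' * q' = Idm (rdim N)"
    "p' * j' = 0" "q' * i' = 0" "rdim N = rdim A' + rdim B'" using biprodE[OF assms(4)] .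
  obtain f h where f: "hom A A' f" "hom A' A h" "f * h = Idm (rdim A')" "h * f = Idm (rdim A)"
    using isoE[OF assms(5)] by metis
  obtain f' h' where f': "hom B B' f'" "hom B' B h'" "f' * h' = Idm (rdim B')" "h' * f' = Idm (rdim B)"
    using isoE[OF assms(6)] by metis
  note r = homD[OF m(1)] homD[OF m(2)] homD[OF m(3)] homD[OF m(4)] homD[OF n(1)] homD[OF n(2)]
    homD[OF n(3)] homD[OF n(4)] homD[OF f(1)] homD[OF f(2)] homD[OF f'(1)] homD[OF f'(2)]
    m(5,6,8,9)[THEN assoc_rew] n(5,6,8,9)[THEN assoc_rew] f(3,4)[THEN assoc_rew] f'(3,4)[THEN assoc_rew] m(8,9) n(8,9)
  show ?thesis
    by (rule isoI[of _ _ "i' * f * p + j' * f' * q" "i * h * p' + j * h' * q'"])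
      (use assms m n f f' in \<open>auto intro!: hom_plus intro: hom_comp simp: distrib_left distrib_right mult.assoc r\<close>)
qed

text \<open>Inclusion of a block of \<open>n\<close> coordinates starting at position
  \<open>a\<close>; with \<open>Idm a\<close> it describes block matrices of size
  \<open>a + n\<close>, and its transpose reads the block off.\<close>

definition Sh :: "nat \<Rightarrow> nat \<Rightarrow> fmat" where
  "Sh a n = (\<Sum>k<n. Eu (a + k) k)"

lemma ent_Sh: "ent (Sh a n) i j = (if j < n \<and> i = a + j then 1 else 0)"
proof -
  have "ent (Sh a n) i j = (\<Sum>k<n. if k = j then (if i = a + j then 1 else 0) else 0)"
    unfolding Sh_def ent_sum by (intro sum.cong) (auto simp: ent_Eu)
  then show ?thesis by simp
qed

lemma ent_Sh_times [simp]:
  "ent (Sh a n * f) i j = (if a \<le> i \<and> i < a + n then ent f (i - a) j else 0)"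
proof -
  have "ent (Sh a n * f) i j = (\<Sum>k<n. ent (Sh a n) i k * ent f k j)"
    by (rule ent_times_left) (auto simp: ent_Sh)
  also have "\<dots> = (\<Sum>k<n. if k = i - a then (if a \<le> i then ent f (i - a) j else 0) else 0)"
    by (intro sum.cong) (auto simp: ent_Sh)
  finally show ?thesis by (simp, linarith)
qed

lemma ent_times_Sh [simp]: "ent (f * Sh a n) i j = (if j < n then ent f i (a + j) else 0)"
proof -
  have "ent (f * Sh a n) i j = (\<Sum>k<a+n. ent f i k * ent (Sh a n) k j)"
    by (rule ent_times_right) (auto simp: ent_Sh)
  also have "\<dots> = (\<Sum>k<a+n. if k = a + j then (if j < n then ent f i (a + j) else 0) else 0)"
    by (intro sum.cong) (auto simp: ent_Sh)
  finally show ?thesis by simp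
qed

lemma ent_times_tpSh [simp]:
  "ent (f * tp (Sh a n)) i j = (if a \<le> j \<and> j < a + n then ent f i (j - a) else 0)"
  using ent_Sh_times[of a n "tp f" j i] by (metis ent_tp tp_times tp_tp)

lemma rect_Sh: "a + n \<le> m \<Longrightarrow> rect m n (Sh a n)" by (rule rect_entI) (auto simp: ent_Sh)

lemma tpSh_Sh: "tp (Sh a n) * Sh a n = Idm n" by (auto intro!: fmat_eqI simp: ent_Sh ent_Idm)
lemma Sh_tpSh: "Idm a + Sh a n * tp (Sh a n) = Idm (a + n)"
  by (auto intro!: fmat_eqI simp: ent_Sh ent_Idm)
lemma Idm_Sh [simp]: "k \<le> a \<Longrightarrow> Idm k * Sh a n = 0" by (auto intro!: fmat_eqI simp: ent_Sh ent_Idm)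
lemma tpSh_Idm [simp]: "k \<le> a \<Longrightarrow> tp (Sh a n) * Idm k = 0" by (auto intro!: fmat_eqI simp: ent_Sh ent_Idm)

lemma rdim_dsum [simp]: "rdim (A \<oplus>\<^sub>K B) = rdim A + rdim B" by (simp add: direct_sum_def)

lemma ac_dsum:
  assumes "is_module A" "is_module B"
  shows "ac (A \<oplus>\<^sub>K B) g = ac A g + Sh (rdim A) (rdim B) * ac B g * tp (Sh (rdim A) (rdim B))"
proof (rule fmat_eqI)
  fix i j
  have c: "act A g \<in> carrier_mat (rdim A) (rdim A)" "act B g \<in> carrier_mat (rdim B) (rdim B)"
    using assms by (auto intro: is_module_carrier)
  then show "ent (ac (A \<oplus>\<^sub>K B) g) i j =
    ent (ac A g + Sh (rdim A) (rdim B) * ac B g * tp (Sh (rdim A) (rdim B))) i j"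
    by (auto simp: ac_def direct_sum_def ent_emb mult.assoc)
qed

lemma module_dsum:
  assumes "is_module A" "is_module B"
  shows "is_module (A \<oplus>\<^sub>K B)" "biprod (A \<oplus>\<^sub>K B) A B"
proof -
  let ?a = "rdim A" and ?b = "rdim B"
  let ?S = "Sh ?a ?b"
  have IS: "Idm ?a * (?S * z) = 0" "tp ?S * (Idm ?a * z) = 0" for z
    by (simp_all flip: mult.assoc)
  have z1: "ac A g * ?S = 0" "ac A g * (?S * z) = 0" "tp ?S * ac A g = 0" "tp ?S * (ac A g * z) = 0" for g z
    by (metis rectD(2) rect_ac[OF assms(1)] Idm_Sh order_refl mult.assoc mult_zero_left mult_zero_right
        rectD(1) tpSh_Idm)+
  note s = mod_simps[OF assms(1)] mod_simps[OF assms(2)] tpSh_Sh assoc_rew[OF tpSh_Sh] z1 mult.assoc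
    rectD[OF rect_Sh[OF order_refl[of "?a + ?b"]]] rectD[OF rect_tp[OF rect_Sh[OF order_refl[of "?a + ?b"]]]]
    distrib_left distrib_right
  have r: "rect (?a + ?b) (?a + ?b) (ac (A \<oplus>\<^sub>K B) g)" for g
    unfolding ac_dsum[OF assms]
    by (intro rect_plus rect_times[OF rect_times[OF rect_Sh rect_ac[OF assms(2)]] rect_tp[OF rect_Sh]]
        rect_mono[OF rect_ac[OF assms(1)]]) auto
  show m: "is_module (A \<oplus>\<^sub>K B)"
    unfolding module_iff
  proof (intro conjI allI)
    show "act (A \<oplus>\<^sub>K B) g \<in> carrier_mat (rdim (A \<oplus>\<^sub>K B)) (rdim (A \<oplus>\<^sub>K B))" for g
      using assms is_module_carrier[of A g] is_module_carrier[of B g] by (auto simp: direct_sum_def)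
    show "kk (A \<oplus>\<^sub>K B) * kk (A \<oplus>\<^sub>K B) = Idm (rdim (A \<oplus>\<^sub>K B))"
      using Sh_tpSh by (simp add: ac_dsum assms s)
  qed (simp_all add: ac_dsum assms s)
  have "ac A g * Idm ?a = ac A g" "Idm ?a * ac A g = ac A g" for g by (simp_all add: s)
  then show "biprod (A \<oplus>\<^sub>K B) A B"
    by (intro biprodI[of _ _ "Idm ?a" "Idm ?a" _ ?S "tp ?S"])
      (auto simp: hom_def ac_dsum assms s rect_Idm rect_Sh rect_tp Sh_tpSh IS)
qed

lemma iso_dsum_iff:
  assumes "is_module M" "is_module A" "is_module B"
  shows "M \<cong>\<^sub>K A \<oplus>\<^sub>K B \<longleftrightarrow> biprod M A B"
proof
  assume "biprod M A B"
  then show "M \<cong>\<^sub>K A \<oplus>\<^sub>K B"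
    using biprod_cong[OF assms(1) module_dsum(1)[OF assms(2,3)] _ module_dsum(2)[OF assms(2,3)]]
      iso_refl assms by blast
next
  assume "M \<cong>\<^sub>K A \<oplus>\<^sub>K B"
  then obtain f h where f: "hom M (A \<oplus>\<^sub>K B) f" "hom (A \<oplus>\<^sub>K B) M h"
    "f * h = Idm (rdim (A \<oplus>\<^sub>K B))" "h * f = Idm (rdim M)" by (metis isoE)
  obtain i p j q where m: "hom A (A \<oplus>\<^sub>K B) i" "hom (A \<oplus>\<^sub>K B) A p" "hom B (A \<oplus>\<^sub>K B) j" "hom (A \<oplus>\<^sub>K B) B q"
    "p * i = Idm (rdim A)" "q * j = Idm (rdim B)" "i * p + j * q = Idm (rdim (A \<oplus>\<^sub>K B))"
    using biprodE[OF module_dsum(2)[OF assms(2,3)]] by metis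
  have "h * i * (p * f) + h * j * (q * f) = h * ((i * p + j * q) * f)"
    by (simp only: distrib_left distrib_right mult.assoc)
  also have "\<dots> = Idm (rdim M)" by (simp only: m(7) homD[OF f(1)] f(4))
  finally show "biprod M A B"
    by (intro biprodI[of _ _ "h * i" "p * f" _ "h * j" "q * f"])
      (auto intro: hom_comp f m simp: m f homD[OF m(1)] homD[OF m(3)] mult.assoc assoc_rew[OF f(3)]
        simp del: rdim_dsum)
qed

lemma dsum_cong: "A \<cong>\<^sub>K A' \<Longrightarrow> B \<cong>\<^sub>K B' \<Longrightarrow> A \<oplus>\<^sub>K B \<cong>\<^sub>K A' \<oplus>\<^sub>K B'"
  by (rule biprod_cong[OF _ _ module_dsum(2) module_dsum(2)]) (auto intro: module_dsum iso_module)

lemma dsum_comm: "is_module A \<Longrightarrow> is_module B \<Longrightarrow> A \<oplus>\<^sub>K B \<cong>\<^sub>K B \<oplus>\<^sub>K A"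
  by (subst iso_dsum_iff; (intro module_dsum)?; assumption?)
    (metis module_dsum(2) biprod_def add.commute)

lemma biprod_assoc:
  assumes "biprod M A D" "biprod D B C" "biprod E A B" shows "biprod M E C"
proof -
  obtain i p j q where m: "hom A M i" "hom M A p" "hom D M j" "hom M D q"
    "p * i = Idm (rdim A)" "q * j = Idm (rdim D)" "i * p + j * q = Idm (rdim M)"
    "p * j = 0" "q * i = 0" "rdim M = rdim A + rdim D" using biprodE[OF assms(1)] .
  obtain i' p' j' q' where n: "hom B D i'" "hom D B p'" "hom C D j'" "hom D C q'"
    "p' * i' = Idm (rdim B)" "q' * j' = Idm (rdim C)" "i' * p' + j' * q' = Idm (rdim D)"
    "p' * j' = 0" "q' * i' = 0" "rdim D = rdim B + rdim C" using biprodE[OF assms(2)] .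
  obtain i2 p2 j2 q2 where e: "hom A E i2" "hom E A p2" "hom B E j2" "hom E B q2"
    "p2 * i2 = Idm (rdim A)" "q2 * j2 = Idm (rdim B)" "i2 * p2 + j2 * q2 = Idm (rdim E)"
    "p2 * j2 = 0" "q2 * i2 = 0" "rdim E = rdim A + rdim B" using biprodE[OF assms(3)] .
  note r = homD[OF m(1)] homD[OF m(2)] homD[OF m(3)] homD[OF m(4)] homD[OF n(1)] homD[OF n(2)]
    homD[OF n(3)] homD[OF n(4)] homD[OF e(1)] homD[OF e(2)] homD[OF e(3)] homD[OF e(4)]
    m(5,6,8,9) n(5,6,8,9) e(5,6,8,9)
    m(5,6,8,9)[THEN assoc_rew] n(5,6,8,9)[THEN assoc_rew] e(5,6,8,9)[THEN assoc_rew]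
    distrib_left distrib_right mult.assoc
  have "j * ((i' * p' + j' * q') * q) = j * q" by (simp only: n(7) homD[OF m(4)])
  then have jq: "j * (i' * (p' * q)) + j * (j' * (q' * q)) = j * q"
    by (simp only: distrib_left distrib_right mult.assoc)
  show ?thesis
  proof (rule biprodI[of _ _ "i * p2 + j * i' * q2" "i2 * p + j2 * p' * q" _ "j * j'" "q' * q"])
    show "(i * p2 + j * i' * q2) * (i2 * p + j2 * p' * q) + j * j' * (q' * q) = Idm (rdim M)"
      using m(7) by (simp add: r add.assoc jq)
    show "(i2 * p + j2 * p' * q) * (i * p2 + j * i' * q2) = Idm (rdim E)"
      using e(7) by (simp add: r)
  qed (auto intro!: hom_plus intro: hom_comp m n e simp: r)
qed

lemma dsum_assoc:
  assumes "is_module A" "is_module B" "is_module C"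
  shows "A \<oplus>\<^sub>K (B \<oplus>\<^sub>K C) \<cong>\<^sub>K (A \<oplus>\<^sub>K B) \<oplus>\<^sub>K C"
  using biprod_assoc[OF module_dsum(2) module_dsum(2) module_dsum(2)] assms
  by (subst iso_dsum_iff) (auto intro: module_dsum)

lemma module_zero: "is_module M" if "rdim M = 0" "\<And>g. act M g \<in> carrier_mat 0 0" for M
proof -
  have "ac M g = 0" for g using that(2)[of g] by (auto intro!: fmat_eqI simp: ac_def ent_emb)
  then show ?thesis using that by (simp add: module_iff)
qed

lemma dsum_zero:
  assumes "is_module A" "is_module Z" "rdim Z = 0"
  shows "A \<oplus>\<^sub>K Z \<cong>\<^sub>K A" "Z \<oplus>\<^sub>K A \<cong>\<^sub>K A"
proof -
  have "biprod A A Z" by (rule biprodI[of _ _ "Idm (rdim A)" "Idm (rdim A)" _ 0 0])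
      (use assms in \<open>auto intro: hom_Idm\<close>)
  then show "A \<oplus>\<^sub>K Z \<cong>\<^sub>K A" using iso_dsum_iff iso_sym assms by blast
  then show "Z \<oplus>\<^sub>K A \<cong>\<^sub>K A" using dsum_comm iso_trans assms by blast
qed

lemma hom_retract_split:
  assumes "is_module M" "is_module A" "hom A M i" "hom M A p" "p * i = Idm (rdim A)"
  obtains B where "is_module B" "biprod M A B"
proof -
  define e where "e = Idm (rdim M) - i * p"
  have h: "hom M M e" unfolding e_def by (intro hom_minus hom_Idm hom_comp[OF assms(3,4)] assms)
  have "e * e = e" by (simp add: e_def algebra_simps homD[OF assms(3)] homD[OF assms(4)] assoc_rew[OF assms(5)])
  then obtain N j q where *: "is_module N" "hom N M j" "hom M N q" "e = j * q" "q * j = Idm (rdim N)"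
    using hom_idempotent_split[OF assms(1) h] by metis
  moreover have "i * p + j * q = Idm (rdim M)" by (simp add: *(4)[symmetric] e_def)
  ultimately show ?thesis using that biprodI[OF assms(3,4) *(2,3) assms(5) *(5)] by blast
qed

text \<open>Decompositions correspond to idempotent endomorphisms. In this form indecomposability
  reduces later to pairs of idempotents compatible with a pencil.\<close>

lemma indecomposable_idem_iff:
  "indecomposable M \<longleftrightarrow> is_module M \<and> rdim M \<noteq> 0 \<and>
    (\<forall>e. hom M M e \<longrightarrow> e * e = e \<longrightarrow> e = 0 \<or> e = Idm (rdim M))"
proof (intro iffI conjI allI impI)
  assume ind: "indecomposable M"
  then show M: "is_module M" "rdim M \<noteq> 0" by (auto simp: indecomposable_def)
  fix e assume e: "hom M M e" "e * e = e"
  obtain A i p where A: "is_module A" "hom A M i" "hom M A p" "e = i * p" "p * i = Idm (rdim A)"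
    using hom_idempotent_split[OF M(1) e] .
  obtain B where B: "is_module B" "biprod M A B" using hom_retract_split[OF M(1) A(1-3,5)] .
  have "M \<cong>\<^sub>K A \<oplus>\<^sub>K B" using iso_dsum_iff[OF M(1) A(1) B(1)] B(2) by simp
  then have "rdim A = 0 \<or> rdim B = 0" using ind A(1) B(1) unfolding indecomposable_def by metis
  then show "e = 0 \<or> e = Idm (rdim M)"
  proof
    assume "rdim A = 0"
    then have "i = 0" using homD(2)[OF A(2)] by simp
    then show ?thesis by (simp add: A)
  next
    assume "rdim B = 0"
    then have "rdim M = rdim A" using B(2) by (metis biprodE add_0_right)
    then have "e = Idm (rdim M)"
      using left_inverse_dim(2)[OF hom_rect[OF A(2)] hom_rect[OF A(3)] A(5)] A(4) by simp
    then show ?thesis ..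
  qed
next
  assume M: "is_module M \<and> rdim M \<noteq> 0 \<and>
    (\<forall>e. hom M M e \<longrightarrow> e * e = e \<longrightarrow> e = 0 \<or> e = Idm (rdim M))"
  show "indecomposable M"
    unfolding indecomposable_def
  proof (intro conjI allI impI)
    fix A B assume AB: "is_module A \<and> is_module B \<and> M \<cong>\<^sub>K A \<oplus>\<^sub>K B"
    then have bp: "biprod M A B" using iso_dsum_iff M by blast
    obtain i p j q where m: "hom A M i" "hom M A p" "hom B M j" "hom M B q"
      "p * i = Idm (rdim A)" "q * j = Idm (rdim B)" "i * p + j * q = Idm (rdim M)" "p * j = 0" "q * i = 0"
      "rdim M = rdim A + rdim B"
      using biprodE[OF bp] .
    have "hom M M (i * p)" "i * p * (i * p) = i * p"
      using m by (auto intro: hom_comp simp: mult.assoc assoc_rew[OF m(5)] homD[OF m(2)])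
    then have "i * p = 0 \<or> i * p = Idm (rdim M)" using M by blast
    then show "rdim A = 0 \<or> rdim B = 0"
    proof
      assume "i * p = 0"
      then have "p * (i * p) * i = 0" by simp
      then have "Idm (rdim A) = 0" by (simp add: mult.assoc m(5) assoc_rew[OF m(5)])
      then show ?thesis using Idm_inj[of "rdim A" 0] by simp
    next
      assume "i * p = Idm (rdim M)"
      then have "q * (j * q) * j = 0" using m(7) by simp
      then have "Idm (rdim B) = 0" by (simp add: mult.assoc m(6) assoc_rew[OF m(6)])
      then show ?thesis using Idm_inj[of "rdim B" 0] by simp
    qed
  qed (use M in auto)
qed

subsection \<open>Transposition\<close>

text \<open>Transposition without the antipode. The defining relations are symmetric under reversal
  of products, so this is again a module; unlike \<open>dual\<close> it is an involution on the
  nose, which makes it the convenient way to reverse arrows.\<close>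

definition trp :: "rep \<Rightarrow> rep" where
  "trp M = \<lparr>rdim = rdim M, act = (\<lambda>g. transpose_mat (act M g))\<rparr>"

lemma rdim_trp [simp]: "rdim (trp M) = rdim M" by (simp add: trp_def)
lemma ac_trp [simp]: "ac (trp M) g = tp (ac M g)" by (simp add: trp_def ac_def emb_transpose)
lemma trp_trp [simp]: "trp (trp M) = M" by (cases M) (simp add: trp_def)

lemma module_trp: assumes "is_module M" shows "is_module (trp M)"
proof -
  have "tp (ac M g * ac M h) = tp (ac M h) * tp (ac M g)" for g h by simp
  then show ?thesis
    unfolding module_iff using mod_rels[OF assms] is_module_carrier[OF assms]
    by (simp add: trp_def[of M] flip: tp_times del: tp_times add: ac_trp[of M, unfolded trp_def])
qed

lemma module_trp_iff [simp]: "is_module (trp M) \<longleftrightarrow> is_module M"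
  by (metis module_trp trp_trp)

lemma hom_trp: "hom M N f \<Longrightarrow> hom (trp N) (trp M) (tp f)"
  by (simp add: hom_def rect_tp flip: tp_times)

lemma iso_trp: assumes "M \<cong>\<^sub>K N" shows "trp M \<cong>\<^sub>K trp N"
proof -
  obtain f h where *: "is_module M" "is_module N" "hom M N f" "hom N M h"
    "f * h = Idm (rdim N)" "h * f = Idm (rdim M)" using isoE[OF assms] .
  then show ?thesis
    by (intro isoI[of _ _ "tp h" "tp f"]) (auto intro: hom_trp simp flip: tp_times)
qed

subsection \<open>The trace map of Higman\<close>

abbreviation th :: "rep \<Rightarrow> fmat" where "th M \<equiv> x1 M * x2 M"

definition even_map :: "rep \<Rightarrow> rep \<Rightarrow> fmat \<Rightarrow> bool" where
  "even_map M N w \<longleftrightarrow> rect (rdim N) (rdim M) w \<and> kk N * w = w * kk M"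

text \<open>The iterated supercommutator \<open>[\<xi>\<^sub>1, [\<xi>\<^sub>2, w]]\<close>. A module is projective iff its identity is in
  the image of this map, and the image is an ideal; both make projectivity compatible with tensor
  products.\<close>

definition higman_trace :: "rep \<Rightarrow> rep \<Rightarrow> fmat \<Rightarrow> fmat" where
  "higman_trace M N w = x1 N * x2 N * w - x1 N * w * x2 M + x2 N * w * x1 M + w * x1 M * x2 M"

lemma even_mapD:
  assumes "even_map M N w"
  shows "rect (rdim N) (rdim M) w" "kk N * w = w * kk M" "kk N * (w * z) = w * (kk M * z)"
proof -
  show "rect (rdim N) (rdim M) w" and *: "kk N * w = w * kk M"
    using assms by (auto simp: even_map_def)
  show "kk N * (w * z) = w * (kk M * z)" using assoc_rew[OF *] by (simp add: mult.assoc)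
qed

lemma hom_even: "hom M N f \<Longrightarrow> even_map M N f"
  by (simp add: hom_def even_map_def)
lemma even_comp: "even_map N L g \<Longrightarrow> even_map M N f \<Longrightarrow> even_map M L (g * f)"
  unfolding even_map_def by (metis mult.assoc rect_times)
lemma even_plus: "even_map M N f \<Longrightarrow> even_map M N g \<Longrightarrow> even_map M N (f + g)"
  by (simp add: even_map_def rect_plus distrib_left distrib_right)
lemma even_zero [simp]: "even_map M N 0" by (simp add: even_map_def)

text \<open>The supercommutators with \<xi>1 and \<xi>2 square to zero and anticommute, so applying
  either one to the double supercommutator gives zero. As the result is even, it commutes with
  both.\<close>

lemma hom_higman_trace:
  assumes "is_module M" "is_module N" "even_map M N w"
  shows "hom M N (higman_trace M N w)"
proof (rule homI)
  note r = rect_ac[OF assms(1)] rect_ac[OF assms(2)] even_mapD(1)[OF assms(3)]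
  show "rect (rdim N) (rdim M) (higman_trace M N w)"
    unfolding higman_trace_def
    by (intro rect_plus rect_minus) (meson r rect_times)+
qed (simp_all add: higman_trace_def algebra_simps mod_simps assms even_mapD[OF assms(3)])

lemma higman_trace_plus: "higman_trace M N (v + w) = higman_trace M N v + higman_trace M N w"
  by (simp add: higman_trace_def algebra_simps)
lemma higman_trace_zero [simp]: "higman_trace M N 0 = 0" by (simp add: higman_trace_def)

lemma higman_trace_left: "hom N L f \<Longrightarrow> f * higman_trace M N w = higman_trace M L (f * w)"
  by (simp add: higman_trace_def algebra_simps homD)
lemma higman_trace_right: "hom L M f \<Longrightarrow> higman_trace M N w * f = higman_trace L N (w * f)"
  by (simp add: higman_trace_def algebra_simps homD)

text \<open>The sign arises because transposition reverses \<xi>1\<xi>2 to \<xi>2\<xi>1, which is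
  its negative.\<close>

lemma tp_higman_trace:
  assumes "is_module M" "is_module N"
  shows "tp (higman_trace M N w) = higman_trace (trp N) (trp M) (- tp w)"
proof -
  have "tp (x2 X) * tp (x1 X) = - (tp (x1 X) * tp (x2 X))"
    "tp (x2 X) * (tp (x1 X) * z) = - (tp (x1 X) * (tp (x2 X) * z))" if "is_module X" for X z
    using mod_rels(6)[OF module_trp[OF that]] mod_rels(12)[OF module_trp[OF that], of z] by auto
  then show ?thesis using assms by (simp add: higman_trace_def algebra_simps)
qed

lemma even_map_trp: "even_map M N w \<Longrightarrow> even_map (trp N) (trp M) (- tp w)"
  by (simp add: even_map_def rect_tp rect_uminus flip: tp_times)

text \<open>Averages \<open>s\<close> over the two-element group generated by K. Since
  \<open>q\<close> commutes with K, each of the two summands is a section.\<close>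

lemma even_section:
  assumes "is_module B" "is_module C" "hom B C q" "rect (rdim B) (rdim C) s" "q * s = Idm (rdim C)"
  obtains s' where "even_map C B s'" "q * s' = Idm (rdim C)"
proof
  define s' where "s' = (1/2) *\<^sub>C (s + kk B * s * kk C)"
  have r: "rect (rdim B) (rdim C) s'" unfolding s'_def
    by (intro rect_scaleC rect_plus assms(4) rect_times[OF rect_times[OF rect_ac[OF assms(1)] assms(4)] rect_ac[OF assms(2)]])
  have "kk B * s' = (1/2) *\<^sub>C (kk B * s + s * kk C)"
    by (simp add: s'_def mod_simps assms rectD[OF assms(4)] distrib_left mult.assoc add.commute)
  moreover have "s' * kk C = (1/2) *\<^sub>C (kk B * s + s * kk C)"
    by (simp add: s'_def mod_simps assms rectD[OF assms(4)] distrib_right mult.assoc add.commute)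
  ultimately show "even_map C B s'" using r by (simp add: even_map_def)
  have "q * (kk B * (s * kk C)) = Idm (rdim C)"
  proof -
    have "q * (kk B * (s * kk C)) = kk C * ((q * s) * kk C)"
      by (simp add: mult.assoc homD[OF assms(3)])
    then show ?thesis by (simp add: assms(5) mod_simps assms)
  qed
  then show "q * s' = Idm (rdim C)"
    by (simp add: s'_def distrib_left mult.assoc assms(5) scaleC_half)
qed

definition higman_projective :: "rep \<Rightarrow> bool" where
  "higman_projective M \<longleftrightarrow> is_module M \<and> (\<exists>w. even_map M M w \<and> higman_trace M M w = Idm (rdim M))"

lemma higman_projective_module: "higman_projective M \<Longrightarrow> is_module M" by (simp add: higman_projective_def)

lemma higman_projective_trp: assumes "higman_projective M" shows "higman_projective (trp M)"
proof -
  obtain w where w: "is_module M" "even_map M M w" "higman_trace M M w = Idm (rdim M)"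
    using assms by (auto simp: higman_projective_def)
  have "higman_trace (trp M) (trp M) (- tp w) = Idm (rdim (trp M))"
    using tp_higman_trace[OF w(1) w(1), of w] w(3) by simp
  then show ?thesis using w even_map_trp by (auto simp: higman_projective_def)
qed

text \<open>The linear lift \<open>s' * f * w\<close> need not be equivariant, but its trace is.
  Pulling \<open>q\<close> and then \<open>f\<close> out of the trace leaves \<open>f\<close> times
  the trace of \<open>w\<close>, which is \<open>f\<close>.\<close>

lemma higman_projective_lift:
  assumes "higman_projective P" "is_module B" "is_module C" "hom B C q" "rect (rdim B) (rdim C) s"
    "q * s = Idm (rdim C)" "hom P C f"
  obtains h where "hom P B h" "q * h = f"
proof -
  obtain w where w: "is_module P" "even_map P P w" "higman_trace P P w = Idm (rdim P)"
    using assms(1) by (auto simp: higman_projective_def)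
  obtain s' where s: "even_map C B s'" "q * s' = Idm (rdim C)"
    using even_section[OF assms(2-6)] .
  have e: "even_map P B (s' * f * w)"
    by (rule even_comp[OF even_comp[OF s(1) hom_even[OF assms(7)]] w(2)])
  have "q * higman_trace P B (s' * f * w) = higman_trace P C ((q * s') * f * w)"
    by (simp add: higman_trace_left[OF assms(4)] mult.assoc)
  also have "\<dots> = f * higman_trace P P w" by (simp add: s homD[OF assms(7)] higman_trace_left[OF assms(7)])
  also have "\<dots> = f" by (simp add: w homD[OF assms(7)])
  finally show ?thesis using that hom_higman_trace[OF w(1) assms(2) e] by blast
qed

lemma higman_projective_extend:
  assumes "higman_projective Q" "is_module A" "is_module B" "hom A B j" "rect (rdim A) (rdim B) l"
    "l * j = Idm (rdim A)" "hom A Q f"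
  obtains h where "hom B Q h" "h * j = f"
proof -
  have "tp j * tp l = Idm (rdim (trp A))" using assms(6) by (simp flip: tp_times)
  then obtain h where "hom (trp Q) (trp B) h" "tp j * h = tp f"
    using higman_projective_lift[OF higman_projective_trp[OF assms(1)] module_trp[OF assms(3)] module_trp[OF assms(2)]
        hom_trp[OF assms(4)] _ _ hom_trp[OF assms(7)], of "tp l"] rect_tp[OF assms(5)] by auto
  then show ?thesis using that[of "tp h"] hom_trp[of "trp Q" "trp B" h]
    by (metis tp_times tp_tp trp_trp)
qed

lemma higman_projective_retract:
  assumes "higman_projective M" "is_module A" "hom A M i" "hom M A p" "p * i = Idm (rdim A)"
  shows "higman_projective A"
proof -
  obtain w where w: "is_module M" "even_map M M w" "higman_trace M M w = Idm (rdim M)"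
    using assms(1) by (auto simp: higman_projective_def)
  have "higman_trace A A (p * (w * i)) = p * higman_trace M M w * i"
    by (simp add: higman_trace_left[OF assms(4)] higman_trace_right[OF assms(3)] mult.assoc)
  also have "\<dots> = Idm (rdim A)" by (simp add: w assms(5) homD[OF assms(4)])
  finally show ?thesis unfolding higman_projective_def
    using assms(2) even_comp[OF hom_even[OF assms(4)] even_comp[OF w(2) hom_even[OF assms(3)]]] by blast
qed

lemma higman_projective_iso: "M \<cong>\<^sub>K N \<Longrightarrow> higman_projective M \<Longrightarrow> higman_projective N"
  by (elim isoE) (rule higman_projective_retract)

lemma higman_projective_biprod:
  assumes "is_module M" "biprod M A B" "higman_projective A" "higman_projective B" shows "higman_projective M"
proof -
  obtain i p j q where m: "hom A M i" "hom M A p" "hom B M j" "hom M B q"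
    "p * i = Idm (rdim A)" "q * j = Idm (rdim B)" "i * p + j * q = Idm (rdim M)"
    "p * j = 0" "q * i = 0" "rdim M = rdim A + rdim B" using biprodE[OF assms(2)] .
  obtain v where v: "even_map A A v" "higman_trace A A v = Idm (rdim A)" using assms by (auto simp: higman_projective_def)
  obtain w where w: "even_map B B w" "higman_trace B B w = Idm (rdim B)" using assms by (auto simp: higman_projective_def)
  have "higman_trace M M (i * v * p + j * w * q) = i * higman_trace A A v * p + j * higman_trace B B w * q"
    by (simp add: higman_trace_plus higman_trace_left[OF m(1)] higman_trace_left[OF m(3)] higman_trace_right[OF m(2)] higman_trace_right[OF m(4)])
  also have "\<dots> = Idm (rdim M)" by (simp add: v w homD[OF m(1)] homD[OF m(3)] m(7))
  moreover have "even_map M M (i * v * p + j * w * q)"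
    by (intro even_plus even_comp[OF even_comp[OF hom_even[OF m(1)] v(1)] hom_even[OF m(2)]]
        even_comp[OF even_comp[OF hom_even[OF m(3)] w(1)] hom_even[OF m(4)]])
  ultimately show ?thesis unfolding higman_projective_def using assms(1) by metis
qed

text \<open>When \<xi>1\<xi>2 vanishes, only \<open>- x1 M * w * x2 M + x2 M * w * x1 M\<close>
  survives, and every term of its square contains two adjacent odd generators, whose product is
  zero.\<close>

lemma higman_trace_sq_zero:
  assumes "is_module M" "th M = 0" "rect (rdim M) (rdim M) w"
  shows "higman_trace M M w * higman_trace M M w = 0"
proof -
  have "x1 M * (x2 M * z) = 0" for z using assms(2) by (metis mult.assoc mult_zero_left)
  then show ?thesis using assms(2)
    by (simp add: higman_trace_def algebra_simps mod_simps assms)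
qed

subsection \<open>Stable isomorphism\<close>

text \<open>Isomorphism in the stable category: traces are exactly the maps that factor through
  projectives, so \<open>f\<close> and \<open>g\<close> are inverse modulo such maps.\<close>

definition stably_iso :: "rep \<Rightarrow> rep \<Rightarrow> bool" where
  "stably_iso M N \<longleftrightarrow> is_module M \<and> is_module N \<and> (\<exists>f g v w. hom M N f \<and> hom N M g \<and>
     even_map M M v \<and> even_map N N w \<and>
     Idm (rdim M) - g * f = higman_trace M M v \<and> Idm (rdim N) - f * g = higman_trace N N w)"

lemma stE:
  assumes "stably_iso M N"
  obtains f g v w where "is_module M" "is_module N" "hom M N f" "hom N M g"
     "even_map M M v" "even_map N N w"
     "Idm (rdim M) - g * f = higman_trace M M v" "Idm (rdim N) - f * g = higman_trace N N w"
  using assms unfolding stably_iso_def by (elim exE conjE) (rule that)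

lemma stI:
  assumes "is_module M" "is_module N" "hom M N f" "hom N M g"
     "even_map M M v" "even_map N N w"
     "Idm (rdim M) - g * f = higman_trace M M v" "Idm (rdim N) - f * g = higman_trace N N w"
  shows "stably_iso M N"
  using assms unfolding stably_iso_def by (intro conjI exI)

lemma stably_iso_iso: assumes "M \<cong>\<^sub>K N" shows "stably_iso M N"
proof -
  obtain f h where *: "is_module M" "is_module N" "hom M N f" "hom N M h"
    "f * h = Idm (rdim N)" "h * f = Idm (rdim M)" using isoE[OF assms] .
  show ?thesis by (rule stI[OF *(1-4) even_zero even_zero]) (simp_all add: *)
qed

lemma stably_iso_sym: assumes "stably_iso M N" shows "stably_iso N M"
proof -
  obtain f g v w where *: "is_module M" "is_module N" "hom M N f" "hom N M g"
     "even_map M M v" "even_map N N w"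
     "Idm (rdim M) - g * f = higman_trace M M v" "Idm (rdim N) - f * g = higman_trace N N w"
    using stE[OF assms] .
  show ?thesis by (rule stI[OF *(2,1,4,3,6,5,8,7)])
qed

lemma stably_iso_trans [trans]: assumes "stably_iso M N" "stably_iso N L" shows "stably_iso M L"
proof -
  obtain f g v w where 1: "is_module M" "is_module N" "hom M N f" "hom N M g"
     "even_map M M v" "even_map N N w"
     "Idm (rdim M) - g * f = higman_trace M M v" "Idm (rdim N) - f * g = higman_trace N N w"
    using stE[OF assms(1)] .
  obtain f' g' v' w' where 2: "is_module N" "is_module L" "hom N L f'" "hom L N g'"
     "even_map N N v'" "even_map L L w'"
     "Idm (rdim N) - g' * f' = higman_trace N N v'" "Idm (rdim L) - f' * g' = higman_trace L L w'"
    using stE[OF assms(2)] .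
  have a: "Idm (rdim M) - (g * g') * (f' * f) = higman_trace M M (v + g * v' * f)"
  proof -
    have "Idm (rdim M) - (g * g') * (f' * f) =
        (Idm (rdim M) - g * f) + g * (Idm (rdim N) - g' * f') * f"
      by (simp add: algebra_simps homD[OF 1(3)])
    also have "\<dots> = higman_trace M M (v + g * v' * f)"
      by (simp add: 1(7) 2(7) higman_trace_plus higman_trace_left[OF 1(4)] higman_trace_right[OF 1(3)])
    finally show ?thesis .
  qed
  have b: "Idm (rdim L) - (f' * f) * (g * g') = higman_trace L L (w' + f' * w * g')"
  proof -
    have "Idm (rdim L) - (f' * f) * (g * g') =
        (Idm (rdim L) - f' * g') + f' * (Idm (rdim N) - f * g) * g'"
      by (simp add: algebra_simps homD[OF 2(4)])
    also have "\<dots> = higman_trace L L (w' + f' * w * g')"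
      by (simp add: 1(8) 2(8) higman_trace_plus higman_trace_left[OF 2(3)] higman_trace_right[OF 2(4)])
    finally show ?thesis .
  qed
  show ?thesis
    by (rule stI[OF 1(1) 2(2) hom_comp[OF 2(3) 1(3)] hom_comp[OF 1(4) 2(4)] _ _ a b])
      (intro even_plus 1(5) 2(6) even_comp[OF even_comp[OF hom_even[OF 1(4)] 2(5)] hom_even[OF 1(3)]]
        even_comp[OF even_comp[OF hom_even[OF 2(3)] 1(6)] hom_even[OF 2(4)]])+
qed

lemma stably_iso_trp: assumes "stably_iso M N" shows "stably_iso (trp M) (trp N)"
proof -
  obtain f g v w where *: "is_module M" "is_module N" "hom M N f" "hom N M g"
     "even_map M M v" "even_map N N w"
     "Idm (rdim M) - g * f = higman_trace M M v" "Idm (rdim N) - f * g = higman_trace N N w"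
    using stE[OF assms] .
  have "Idm (rdim (trp M)) - tp f * tp g = higman_trace (trp M) (trp M) (- tp v)"
    "Idm (rdim (trp N)) - tp g * tp f = higman_trace (trp N) (trp N) (- tp w)"
    using arg_cong[OF *(7), of tp] arg_cong[OF *(8), of tp] by (simp_all add: tp_higman_trace *(1,2))
  then show ?thesis
    by (intro stI[OF _ _ hom_trp[OF *(4)] hom_trp[OF *(3)] even_map_trp[OF *(5)] even_map_trp[OF *(6)]]
        module_trp *(1,2))
qed

text \<open>Here \<open>g * f\<close> is the identity minus a trace of square zero, so multiplying
  \<open>g\<close> by one plus this trace gives a left inverse of \<open>f\<close>. The same on the
  other side makes the dimensions equal.\<close>

lemma stably_iso_imp_iso:
  assumes "stably_iso M N" "th M = 0" "th N = 0" shows "M \<cong>\<^sub>K N"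
proof -
  obtain f g v w where *: "is_module M" "is_module N" "hom M N f" "hom N M g"
     "even_map M M v" "even_map N N w"
     "Idm (rdim M) - g * f = higman_trace M M v" "Idm (rdim N) - f * g = higman_trace N N w"
    using stE[OF assms(1)] .
  have inv: "(Idm (rdim X) + higman_trace X X u) * b * a = Idm (rdim X)"
    if "is_module X" "th X = 0" "even_map X X u" "Idm (rdim X) - b * a = higman_trace X X u" for X u a b
  proof -
    have ba: "b * a = Idm (rdim X) - higman_trace X X u" using that(4) by (simp add: algebra_simps)
    have "hom X X (higman_trace X X u)" by (rule hom_higman_trace[OF that(1,1,3)])
    then show ?thesis
      using higman_trace_sq_zero[OF that(1,2) even_mapD(1)[OF that(3)]]
      by (simp add: mult.assoc ba algebra_simps homD)
  qed
  have r: "rect (rdim X) (rdim X) (Idm (rdim X) + higman_trace X X u)" if "is_module X" "even_map X X u" for X u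
    by (rule rect_plus[OF rect_Idm_same hom_rect[OF hom_higman_trace[OF that(1,1,2)]]])
  have 1: "(Idm (rdim M) + higman_trace M M v) * g * f = Idm (rdim M)" by (rule inv[OF *(1) assms(2) *(5,7)])
  have 2: "(Idm (rdim N) + higman_trace N N w) * f * g = Idm (rdim N)" by (rule inv[OF *(2) assms(3) *(6,8)])
  note r1 = rect_times[OF r[OF *(1,5)] hom_rect[OF *(4)]]
  note r2 = rect_times[OF r[OF *(2,6)] hom_rect[OF *(3)]]
  have "rdim M = rdim N"
    using left_inverse_dim(1)[OF hom_rect[OF *(3)] r1 1] left_inverse_dim(1)[OF hom_rect[OF *(4)] r2 2]
    by simp
  then show ?thesis using isoI_left_inverse[OF *(1,2,3) r1 1] by blast
qed

subsection \<open>Short exact sequences\<close>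

text \<open>The maps \<open>l\<close> and \<open>s\<close> are only linear. Every exact sequence of
  vector spaces splits, and a splitting turns exactness into equations that pass through
  \<open>tp\<close> and \<open>kp\<close>.\<close>

definition short_exact :: "rep \<Rightarrow> rep \<Rightarrow> rep \<Rightarrow> bool" where
  "short_exact A B C \<longleftrightarrow> is_module A \<and> is_module B \<and> is_module C \<and> (\<exists>j q l s. hom A B j \<and> hom B C q \<and>
     rect (rdim A) (rdim B) l \<and> rect (rdim B) (rdim C) s \<and>
     l * j = Idm (rdim A) \<and> q * s = Idm (rdim C) \<and> j * l + s * q = Idm (rdim B))"

lemma sesI:
  assumes "is_module A" "is_module B" "is_module C" "hom A B j" "hom B C q"
     "rect (rdim A) (rdim B) l" "rect (rdim B) (rdim C) s"
     "l * j = Idm (rdim A)" "q * s = Idm (rdim C)" "j * l + s * q = Idm (rdim B)"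
  shows "short_exact A B C"
  using assms unfolding short_exact_def by (intro conjI exI)

lemma sesE:
  assumes "short_exact A B C"
  obtains j q l s where "is_module A" "is_module B" "is_module C" "hom A B j" "hom B C q"
     "rect (rdim A) (rdim B) l" "rect (rdim B) (rdim C) s"
     "l * j = Idm (rdim A)" "q * s = Idm (rdim C)" "j * l + s * q = Idm (rdim B)"
     "q * j = 0" "l * s = 0"
proof -
  from assms obtain j q l s where *: "is_module A" "is_module B" "is_module C" "hom A B j" "hom B C q"
     "rect (rdim A) (rdim B) l" "rect (rdim B) (rdim C) s"
     "l * j = Idm (rdim A)" "q * s = Idm (rdim C)" "j * l + s * q = Idm (rdim B)"
    unfolding short_exact_def by (elim exE conjE) (rule that)
  have "q * j = q * ((j * l + s * q) * j)" by (simp add: *(10) homD[OF *(4)])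
  also have "\<dots> = q * j + q * j"
    by (simp only: distrib_left distrib_right mult.assoc *(8) assoc_rew[OF *(9)] homD[OF *(5)] homD[OF *(4)])
  finally have qj: "q * j = 0" by simp
  have "l * s = l * ((j * l + s * q) * s)" by (simp add: *(10) rectD[OF *(7)])
  also have "\<dots> = l * s + l * s"
    by (simp only: distrib_left distrib_right mult.assoc *(9) assoc_rew[OF *(8)] rectD[OF *(6)] rectD[OF *(7)])
  finally have "l * s = 0" by simp
  then show ?thesis using that * qj by metis
qed

lemma short_exact_rdim: assumes "short_exact A B C" shows "rdim B = rdim A + rdim C"
proof -
  obtain j q l s where *: "is_module A" "is_module B" "is_module C" "hom A B j" "hom B C q"
     "rect (rdim A) (rdim B) l" "rect (rdim B) (rdim C) s"
     "l * j = Idm (rdim A)" "q * s = Idm (rdim C)" "j * l + s * q = Idm (rdim B)"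
     "q * j = 0" "l * s = 0" using sesE[OF assms] .
  have "of_nat (rdim B) = tr (j * l) + tr (s * q)" by (simp flip: tr_Idm tr_plus add: *(10))
  also have "\<dots> = of_nat (rdim A + rdim C)"
    by (simp add: tr_commute[of j l] tr_commute[of s q] *(8,9) tr_Idm)
  finally show ?thesis using of_nat_eq_iff by blast
qed

lemma short_exact_trp: assumes "short_exact A B C" shows "short_exact (trp C) (trp B) (trp A)"
proof -
  obtain j q l s where *: "is_module A" "is_module B" "is_module C" "hom A B j" "hom B C q"
     "rect (rdim A) (rdim B) l" "rect (rdim B) (rdim C) s"
     "l * j = Idm (rdim A)" "q * s = Idm (rdim C)" "j * l + s * q = Idm (rdim B)"
     "q * j = 0" "l * s = 0" using sesE[OF assms] .
  have "tp s * tp q = Idm (rdim C)" "tp j * tp l = Idm (rdim A)"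
    "tp q * tp s + tp l * tp j = Idm (rdim B)"
    using arg_cong[OF *(9), of tp] arg_cong[OF *(8), of tp] arg_cong[OF *(10), of tp]
    by (simp_all add: add.commute)
  then show ?thesis
    by (intro sesI[OF _ _ _ hom_trp[OF *(5)] hom_trp[OF *(4)], of "tp s" "tp l"])
      (simp_all add: * rect_tp)
qed

text \<open>Universal property of the kernel. Although \<open>l\<close> is merely linear,
  \<open>l * h\<close> is equivariant, because \<open>j\<close> is equivariant and injective and
  \<open>j * (l * h) = h\<close>.\<close>

lemma short_exact_factor:
  assumes "is_module A" "is_module B" "hom A B j" "l * j = Idm (rdim A)" "rect (rdim A) (rdim B) l"
    "j * l + s * q = Idm (rdim B)" "hom X B h" "q * h = 0"
  shows "j * (l * h) = h" "hom X A (l * h)"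
proof -
  have "j * (l * h) + s * (q * h) = h"
    by (simp add: mult.assoc[symmetric] distrib_right[symmetric] assms(6) homD[OF assms(7)])
  then show jl: "j * (l * h) = h" by (simp add: assms(8))
  have "ac A g * (l * h) = l * h * ac X g" for g
  proof -
    have "ac A g * (l * h) = (l * j) * (ac A g * (l * h))" by (simp add: assms(4) mod_simps assms(1))
    also have "\<dots> = l * (ac B g * (j * (l * h)))" by (simp add: mult.assoc homD[OF assms(3)])
    also have "\<dots> = l * h * ac X g" by (simp only: jl homD[OF assms(7)] mult.assoc)
    finally show ?thesis .
  qed
  then show "hom X A (l * h)" by (simp add: hom_def rect_times[OF assms(5) hom_rect[OF assms(7)]])
qed

text \<open>One half of the statement that syzygies are functorial on the stable category: if
  \<open>g * f\<close> is the identity up to a trace, so is the induced composite on kernels.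
  Applying it twice, with the roles exchanged, gives \<open>stably_iso_syzygy\<close>.\<close>

lemma syzygy_half:
  assumes A: "is_module A" "is_module P" "is_module C" "hom A P j" "hom P C q"
     "rect (rdim A) (rdim P) l" "rect (rdim P) (rdim C) s"
     "l * j = Idm (rdim A)" "q * s = Idm (rdim C)" "j * l + s * q = Idm (rdim P)" "q * j = 0" "higman_projective P"
   and A': "is_module A'" "is_module P'" "is_module C'" "hom A' P' j'" "hom P' C' q'"
     "rect (rdim A') (rdim P') l'" "rect (rdim P') (rdim C') s'"
     "l' * j' = Idm (rdim A')" "q' * s' = Idm (rdim C')" "j' * l' + s' * q' = Idm (rdim P')" "q' * j' = 0"
   and F: "hom P P' F" "q' * F = f * q" and G: "hom P' P G" "q * G = g * q'"
   and w: "even_map C C w" "Idm (rdim C) - g * f = higman_trace C C w"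
  shows "\<exists>u. even_map A A u \<and> Idm (rdim A) - (l * (G * j')) * (l' * (F * j)) = higman_trace A A u"
proof -
  obtain p where p: "even_map P P p" "higman_trace P P p = Idm (rdim P)" using A(12) by (auto simp: higman_projective_def)
  obtain s0 where s0: "even_map C P s0" "q * s0 = Idm (rdim C)"
    using even_section[OF A(2,3,5,7,9)] .
  \<comment> \<open>The map \<open>t\<close> lifts the trace on \<open>C\<close> through
    \<open>q\<close>, so the error \<open>T\<close> below lands in the kernel of \<open>q\<close>.
    The correction \<open>t * q\<close> dies on \<open>A\<close>, since
    \<open>q * j = 0\<close>.\<close>
  define t where "t = higman_trace C P (s0 * w)"
  have t: "hom C P t" unfolding t_def by (rule hom_higman_trace[OF A(3,2) even_comp[OF s0(1) w(1)]])
  have qt: "q * t = higman_trace C C w" unfolding t_def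
    using rectD(1)[OF even_mapD(1)[OF w(1)]]
    by (simp add: higman_trace_left[OF A(5)] mult.assoc[symmetric] s0(2))
  define T where "T = Idm (rdim P) - G * F - t * q"
  have T: "hom P P T" unfolding T_def
    by (intro hom_minus hom_Idm hom_comp[OF G(1) F(1)] hom_comp[OF t A(5)] A)
  have "q * T = q - (g * f) * q - higman_trace C C w * q"
    by (simp add: T_def right_diff_distrib homD[OF A(5)] mult.assoc[symmetric] qt G(2))
      (simp add: mult.assoc F(2))
  also have "\<dots> = (Idm (rdim C) - g * f - higman_trace C C w) * q"
    by (simp add: left_diff_distrib homD[OF A(5)])
  finally have qT: "q * T = 0" by (simp add: w(2))
  note m = short_exact_factor[OF A(1,2,4,8,6,10) T qT]
  have hF: "hom A P' (F * j)" by (rule hom_comp[OF F(1) A(4)])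
  have qF: "q' * (F * j) = 0" by (simp add: mult.assoc[symmetric] F(2)) (simp add: mult.assoc A(11))
  have hG: "hom A' P (G * j')" by (rule hom_comp[OF G(1) A'(4)])
  have qG: "q * (G * j') = 0" by (simp add: mult.assoc[symmetric] G(2)) (simp add: mult.assoc A'(11))
  note f1 = short_exact_factor[OF A'(1,2,4,8,6,10) hF qF] and g1 = short_exact_factor[OF A(1,2,4,8,6,10) hG qG]
  have "j * (Idm (rdim A) - (l * (G * j')) * (l' * (F * j))) = j - (j * (l * (G * j'))) * (l' * (F * j))"
    by (simp add: right_diff_distrib homD[OF A(4)] mult.assoc)
  also have "\<dots> = j - G * (j' * (l' * (F * j)))" by (simp only: g1(1) mult.assoc)
  also have "\<dots> = j - G * (F * j)" by (simp only: f1(1))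
  also have "\<dots> = T * j" by (simp add: T_def left_diff_distrib homD[OF A(4)] mult.assoc A(11))
  also have "\<dots> = j * ((l * T) * j)" by (simp only: mult.assoc[symmetric] m(1)[unfolded mult.assoc[symmetric]])
  finally have "l * (j * (Idm (rdim A) - (l * (G * j')) * (l' * (F * j)))) = l * (j * ((l * T) * j))"
    by simp
  then have e: "Idm (rdim A) - (l * (G * j')) * (l' * (F * j)) = (l * T) * j"
    by (simp add: assoc_rew[OF A(8)] rectD[OF A(6)] right_diff_distrib mult.assoc)
  \<comment> \<open>This endomorphism of \<open>A\<close> factors through \<open>P\<close>, whose
    identity is a trace; by the ideal property it is a trace itself.\<close>
  have "(l * T) * j = (l * T) * higman_trace P P p * j" by (simp add: p(2) homD[OF A(4)] mult.assoc)
  also have "\<dots> = higman_trace A A ((l * T) * p * j)"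
    by (simp only: higman_trace_left[OF m(2)] higman_trace_right[OF A(4)])
  finally show ?thesis
    using e even_comp[OF even_comp[OF hom_even[OF m(2)] p(1)] hom_even[OF A(4)]] by metis
qed

lemma stably_iso_syzygy:
  assumes "short_exact A P C" "short_exact A' P' C'" "higman_projective P" "higman_projective P'" "stably_iso C C'"
  shows "stably_iso A A'"
proof -
  obtain j q l s where 1: "is_module A" "is_module P" "is_module C" "hom A P j" "hom P C q"
     "rect (rdim A) (rdim P) l" "rect (rdim P) (rdim C) s"
     "l * j = Idm (rdim A)" "q * s = Idm (rdim C)" "j * l + s * q = Idm (rdim P)"
     "q * j = 0" "l * s = 0" using sesE[OF assms(1)] .
  obtain j' q' l' s' where 2: "is_module A'" "is_module P'" "is_module C'" "hom A' P' j'" "hom P' C' q'"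
     "rect (rdim A') (rdim P') l'" "rect (rdim P') (rdim C') s'"
     "l' * j' = Idm (rdim A')" "q' * s' = Idm (rdim C')" "j' * l' + s' * q' = Idm (rdim P')"
     "q' * j' = 0" "l' * s' = 0" using sesE[OF assms(2)] .
  obtain f g v w where *: "is_module C" "is_module C'" "hom C C' f" "hom C' C g"
     "even_map C C v" "even_map C' C' w"
     "Idm (rdim C) - g * f = higman_trace C C v" "Idm (rdim C') - f * g = higman_trace C' C' w"
    using stE[OF assms(5)] .
  obtain F where F: "hom P P' F" "q' * F = f * q"
    using higman_projective_lift[OF assms(3) 2(2,3,5,7,9) hom_comp[OF *(3) 1(5)]] .
  obtain G where G: "hom P' P G" "q * G = g * q'"
    using higman_projective_lift[OF assms(4) 1(2,3,5,7,9) hom_comp[OF *(4) 2(5)]] .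
  have hF: "hom A P' (F * j)" by (rule hom_comp[OF F(1) 1(4)])
  have qF: "q' * (F * j) = 0" by (simp add: mult.assoc[symmetric] F(2)) (simp add: mult.assoc 1(11))
  have hG: "hom A' P (G * j')" by (rule hom_comp[OF G(1) 2(4)])
  have qG: "q * (G * j') = 0" by (simp add: mult.assoc[symmetric] G(2)) (simp add: mult.assoc 2(11))
  note f1 = short_exact_factor[OF 2(1,2,4,8,6,10) hF qF] and g1 = short_exact_factor[OF 1(1,2,4,8,6,10) hG qG]
  obtain u where u: "even_map A A u" "Idm (rdim A) - (l * (G * j')) * (l' * (F * j)) = higman_trace A A u"
    using syzygy_half[OF 1(1-11) assms(3) 2(1-11) F G *(5,7)] by blast
  obtain u' where u': "even_map A' A' u'" "Idm (rdim A') - (l' * (F * j)) * (l * (G * j')) = higman_trace A' A' u'"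
    using syzygy_half[OF 2(1-11) assms(4) 1(1-11) G F *(6,8)] by blast
  show ?thesis by (rule stI[OF 1(1) 2(1) f1(2) g1(2) u(1) u'(1) u(2) u'(2)])
qed

lemma stably_iso_cosyzygy:
  assumes "short_exact A P C" "short_exact A' P' C'" "higman_projective P" "higman_projective P'" "stably_iso A A'"
  shows "stably_iso C C'"
  using stably_iso_syzygy[OF short_exact_trp[OF assms(1)] short_exact_trp[OF assms(2)] higman_projective_trp[OF assms(3)] higman_projective_trp[OF assms(4)]
      stably_iso_trp[OF assms(5)]] stably_iso_trp by fastforce

lemma short_exact_split_retraction:
  assumes "is_module A" "is_module B" "is_module C" "hom A B j" "hom B C q"
     "rect (rdim B) (rdim C) s" "q * s = Idm (rdim C)" "j * l + s * q = Idm (rdim B)" "q * j = 0"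
     "hom B A r" "r * j = Idm (rdim A)"
  shows "biprod B A C"
proof -
  \<comment> \<open>The map \<open>c\<close> kills the image of \<open>j\<close>, hence factors
    through \<open>q\<close> as \<open>c * s\<close>. This makes \<open>c * s\<close> an equivariant
    section, although \<open>s\<close> need not be one.\<close>
  define c where "c = Idm (rdim B) - j * r"
  have c: "hom B B c" unfolding c_def by (intro hom_minus hom_Idm hom_comp[OF assms(4,10)] assms)
  have cj: "c * j = 0" by (simp add: c_def left_diff_distrib mult.assoc assms(11) homD[OF assms(4)])
  have "c * (j * l + s * q) = c" by (simp only: assms(8) homD[OF c])
  then have csq: "c * (s * q) = c" by (simp add: distrib_left mult.assoc[symmetric] cj)
  then have csq2: "c * (s * (q * z)) = c * z" for z by (metis mult.assoc)
  have "ac B g * (c * s) = c * s * ac C g" for g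
  proof -
    have "c * s * ac C g = c * s * (ac C g * (q * s))" by (simp add: assms(7) mod_simps assms(3))
    also have "\<dots> = c * (ac B g * s)" by (simp add: homD[OF assms(5)] mult.assoc csq2)
    finally show ?thesis by (simp add: homD[OF c] mult.assoc)
  qed
  then have h: "hom C B (c * s)" by (simp add: hom_def rect_times[OF hom_rect[OF c] assms(6)])
  have "q * c = q" by (simp add: c_def right_diff_distrib homD[OF assms(5)] mult.assoc[symmetric] assms(9))
  then have qcs: "q * (c * s) = Idm (rdim C)" by (simp add: mult.assoc[symmetric] assms(7))
  show ?thesis
    by (rule biprodI[OF assms(4,10) h assms(5,11) qcs]) (simp add: mult.assoc csq, simp add: c_def)
qed

text \<open>The submodule splits off because the trace criterion is stable under transposition, so
  such modules are injective as well: by \<open>higman_projective_extend\<close> the identity of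
  \<open>A\<close> extends to \<open>B\<close>.\<close>

lemma short_exact_split_left:
  assumes "short_exact A B C" "higman_projective A" shows "biprod B A C"
proof -
  obtain j q l s where *: "is_module A" "is_module B" "is_module C" "hom A B j" "hom B C q"
     "rect (rdim A) (rdim B) l" "rect (rdim B) (rdim C) s"
     "l * j = Idm (rdim A)" "q * s = Idm (rdim C)" "j * l + s * q = Idm (rdim B)"
     "q * j = 0" "l * s = 0" using sesE[OF assms(1)] .
  obtain r where "hom B A r" "r * j = Idm (rdim A)"
    using higman_projective_extend[OF assms(2) *(1,2,4,6,8) hom_Idm[OF *(1)]] .
  then show ?thesis using short_exact_split_retraction[OF *(1-5,7,9-11)] by blast
qed

lemma short_exact_higman_projective:
  assumes "short_exact A B C" "higman_projective A" "higman_projective C" shows "higman_projective B"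
  using higman_projective_biprod[OF _ short_exact_split_left[OF assms(1,2)] assms(2,3)] assms(1)
  by (auto simp: short_exact_def)

subsection \<open>Free modules over the exterior algebra\<close>

declare One_nat_def [simp del]

lemma sgn_bit_simps [simp]: "sgn_bit r * sgn_bit r = 1" "sgn_bit 0 = 1" "sgn_bit 1 = -1"
  "sgn_bit r * (sgn_bit r * c) = c" "sgn_bit r \<noteq> 0"
  by (auto simp: sgn_bit_def)

lemma sgn_bit_add: "sgn_bit (r + r') = sgn_bit r * sgn_bit r'"
  by (cases r; cases r') (auto simp: sgn_bit_def)

lemma sgn_bit_add_one [simp]: "sgn_bit (r + 1) = - sgn_bit r" by (simp add: sgn_bit_add)

lemma sgn_bit_inj [simp]: "sgn_bit r = sgn_bit r' \<longleftrightarrow> r = r'"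
  by (cases r; cases r') (auto simp: sgn_bit_def)

lemma bit_add_self [simp]: "(r :: bit) + r = 0" "r + (r + r') = r'"
  by (cases r; cases r'; simp)+

text \<open>\<open>M\<close> is \<open>P(t) \<otimes> \<complex>\<^sup>a\<close>: the maps \<open>i0, i1, i2, i3\<close> are the inclusions of
  \<open>g, \<xi>\<^sub>1 g, \<xi>\<^sub>2 g, \<xi>\<^sub>1\<xi>\<^sub>2 g\<close>, and \<open>p0, \<dots>, p3\<close> are the coordinates.\<close>

definition free_rep_data :: "rep \<Rightarrow> bit \<Rightarrow> nat \<Rightarrow> fmat \<Rightarrow> fmat \<Rightarrow> fmat \<Rightarrow> fmat \<Rightarrow> fmat \<Rightarrow> fmat \<Rightarrow> fmat \<Rightarrow> fmat \<Rightarrow> bool" where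
  "free_rep_data M t a i0 i1 i2 i3 p0 p1 p2 p3 \<longleftrightarrow> is_module M \<and>
     rect (rdim M) a i0 \<and> rect (rdim M) a i1 \<and> rect (rdim M) a i2 \<and> rect (rdim M) a i3 \<and>
     rect a (rdim M) p0 \<and> rect a (rdim M) p1 \<and> rect a (rdim M) p2 \<and> rect a (rdim M) p3 \<and>
     p0 * i0 = Idm a \<and> p0 * i1 = 0 \<and> p0 * i2 = 0 \<and> p0 * i3 = 0 \<and>
     p1 * i0 = 0 \<and> p1 * i1 = Idm a \<and> p1 * i2 = 0 \<and> p1 * i3 = 0 \<and>
     p2 * i0 = 0 \<and> p2 * i1 = 0 \<and> p2 * i2 = Idm a \<and> p2 * i3 = 0 \<and>
     p3 * i0 = 0 \<and> p3 * i1 = 0 \<and> p3 * i2 = 0 \<and> p3 * i3 = Idm a \<and>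
     i0 * p0 + i1 * p1 + i2 * p2 + i3 * p3 = Idm (rdim M) \<and>
     kk M = sgn_bit t *\<^sub>C (i0 * p0 - i1 * p1 - i2 * p2 + i3 * p3) \<and>
     x1 M = i1 * p0 + i3 * p2 \<and> x2 M = i2 * p0 - i3 * p1"

lemma free_rep_dataD:
  assumes "free_rep_data M t a i0 i1 i2 i3 p0 p1 p2 p3"
  shows "is_module M" "rect (rdim M) a i0" "rect (rdim M) a i1" "rect (rdim M) a i2" "rect (rdim M) a i3"
    "rect a (rdim M) p0" "rect a (rdim M) p1" "rect a (rdim M) p2" "rect a (rdim M) p3"
    "p0 * i0 = Idm a" "p0 * i1 = 0" "p0 * i2 = 0" "p0 * i3 = 0"
     "p1 * i0 = 0" "p1 * i1 = Idm a" "p1 * i2 = 0" "p1 * i3 = 0"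
     "p2 * i0 = 0" "p2 * i1 = 0" "p2 * i2 = Idm a" "p2 * i3 = 0"
     "p3 * i0 = 0" "p3 * i1 = 0" "p3 * i2 = 0" "p3 * i3 = Idm a"
     "i0 * p0 + i1 * p1 + i2 * p2 + i3 * p3 = Idm (rdim M)"
     "kk M = sgn_bit t *\<^sub>C (i0 * p0 - i1 * p1 - i2 * p2 + i3 * p3)"
     "x1 M = i1 * p0 + i3 * p2" "x2 M = i2 * p0 - i3 * p1"
  using assms unfolding free_rep_data_def by blast+

lemma free_rep_simps:
  assumes "free_rep_data M t a i0 i1 i2 i3 p0 p1 p2 p3"
  shows "kk M * i0 = sgn_bit t *\<^sub>C i0" "kk M * i1 = - sgn_bit t *\<^sub>C i1"
    "kk M * i2 = - sgn_bit t *\<^sub>C i2" "kk M * i3 = sgn_bit t *\<^sub>C i3"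
    "x1 M * i0 = i1" "x1 M * i1 = 0" "x1 M * i2 = i3" "x1 M * i3 = 0"
    "x2 M * i0 = i2" "x2 M * i1 = - i3" "x2 M * i2 = 0" "x2 M * i3 = 0"
    "p0 * kk M = sgn_bit t *\<^sub>C p0" "p1 * kk M = - sgn_bit t *\<^sub>C p1"
    "p2 * kk M = - sgn_bit t *\<^sub>C p2" "p3 * kk M = sgn_bit t *\<^sub>C p3"
    "p0 * x1 M = 0" "p1 * x1 M = p0" "p2 * x1 M = 0" "p3 * x1 M = p2"
    "p0 * x2 M = 0" "p1 * x2 M = 0" "p2 * x2 M = p0" "p3 * x2 M = - p1"
  using free_rep_dataD(10-25)[OF assms] free_rep_dataD(2-9)[OF assms, THEN rectD(1)] free_rep_dataD(2-9)[OF assms, THEN rectD(2)]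
  by (simp_all add: free_rep_dataD(27-29)[OF assms] left_diff_distrib right_diff_distrib distrib_left distrib_right
      mult.assoc free_rep_dataD(10-25)[OF assms, THEN assoc_rew] free_rep_dataD(2-9)[OF assms, THEN rectD(3)]
      free_rep_dataD(2-9)[OF assms, THEN rectD(4)])

lemmas free_rep_rules = free_rep_simps free_rep_simps[THEN assoc_rew] free_rep_dataD(10-25) free_rep_dataD(10-25)[THEN assoc_rew]
  free_rep_dataD(2-9)[THEN rectD(1)] free_rep_dataD(2-9)[THEN rectD(2)]
  free_rep_dataD(2-9)[THEN rectD(3)] free_rep_dataD(2-9)[THEN rectD(4)]

text \<open>The four blocks are the multiples of 1, \<xi>1, \<xi>2 and \<xi>1\<xi>2; the minus sign
  in the last matrix records \<xi>2\<xi>1 = - \<xi>1\<xi>2.\<close>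

definition free_rep :: "bit \<Rightarrow> nat \<Rightarrow> rep" where
  "free_rep t a = (let i0 = Idm a; i1 = Sh a a; i2 = Sh (2 * a) a; i3 = Sh (3 * a) a in
     mk (4 * a) (sgn_bit t *\<^sub>C (i0 * tp i0 - i1 * tp i1 - i2 * tp i2 + i3 * tp i3))
       (i1 * tp i0 + i3 * tp i2) (i2 * tp i0 - i3 * tp i1))"

lemma rdim_free_rep [simp]: "rdim (free_rep t a) = 4 * a" by (simp add: free_rep_def Let_def)

lemma tpSh_Sh_disjoint: "a + m \<le> b \<or> b + n \<le> a \<Longrightarrow> tp (Sh a m) * Sh b n = 0"
  by (auto intro!: fmat_eqI simp: ent_Sh)

lemma free_rep_data_mk:
  fixes t :: bit
  assumes r: "rect n a i0" "rect n a i1" "rect n a i2" "rect n a i3"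
     "rect a n p0" "rect a n p1" "rect a n p2" "rect a n p3"
   and p: "p0 * i0 = Idm a" "p0 * i1 = 0" "p0 * i2 = 0" "p0 * i3 = 0"
     "p1 * i0 = 0" "p1 * i1 = Idm a" "p1 * i2 = 0" "p1 * i3 = 0"
     "p2 * i0 = 0" "p2 * i1 = 0" "p2 * i2 = Idm a" "p2 * i3 = 0"
     "p3 * i0 = 0" "p3 * i1 = 0" "p3 * i2 = 0" "p3 * i3 = Idm a"
   and sum: "i0 * p0 + i1 * p1 + i2 * p2 + i3 * p3 = Idm n"
  defines "K \<equiv> sgn_bit t *\<^sub>C (i0 * p0 - i1 * p1 - i2 * p2 + i3 * p3)"
    and "X \<equiv> i1 * p0 + i3 * p2" and "Y \<equiv> i2 * p0 - i3 * p1"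
  shows "free_rep_data (mk n K X Y) t a i0 i1 i2 i3 p0 p1 p2 p3"
proof -
  note rr = r[THEN rectD(1)] r[THEN rectD(2)] r[THEN rectD(3)] r[THEN rectD(4)] p p[THEN assoc_rew]
    left_diff_distrib right_diff_distrib distrib_left distrib_right mult.assoc
  have rK: "rect n n K" "rect n n X" "rect n n Y"
    unfolding K_def X_def Y_def
    by (intro rect_scaleC rect_plus rect_minus rect_times[OF r(1)] rect_times[OF r(2)]
        rect_times[OF r(3)] rect_times[OF r(4)] r)+
  have mod: "is_module (mk n K X Y)"
  proof (rule module_mk[OF rK])
    show "K * K = Idm n"
      unfolding sum[symmetric] by (simp add: K_def rr scaleC_diff scaleC_add)
  qed (simp_all add: K_def X_def Y_def rr scaleC_diff scaleC_add)
  show ?thesis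
    unfolding free_rep_data_def rdim_mk ac_mk[OF rK] using mod r p sum by (simp add: K_def X_def Y_def)
qed

lemma free_rep_data_free_rep:
  "free_rep_data (free_rep t a) t a (Idm a) (Sh a a) (Sh (2 * a) a) (Sh (3 * a) a)
     (Idm a) (tp (Sh a a)) (tp (Sh (2 * a) a)) (tp (Sh (3 * a) a))"
proof -
  let ?i1 = "Sh a a" and ?i2 = "Sh (2 * a) a" and ?i3 = "Sh (3 * a) a"
  have r: "rect (4 * a) a (Idm a)" "rect (4 * a) a ?i1" "rect (4 * a) a ?i2" "rect (4 * a) a ?i3"
    "rect a (4 * a) (Idm a)" "rect a (4 * a) (tp ?i1)" "rect a (4 * a) (tp ?i2)" "rect a (4 * a) (tp ?i3)"
    by (auto intro!: rect_Sh rect_tp rect_Idm)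
  have e: "a + a = 2 * a" "2 * a + a = 3 * a" "3 * a + a = 4 * a" by linarith+
  have sum: "Idm a * Idm a + ?i1 * tp ?i1 + ?i2 * tp ?i2 + ?i3 * tp ?i3 = Idm (4 * a)"
    using Sh_tpSh[of a a, unfolded e] Sh_tpSh[of "2 * a" a, unfolded e] Sh_tpSh[of "3 * a" a, unfolded e]
    by simp
  have "free_rep_data (mk (4 * a) (sgn_bit t *\<^sub>C (Idm a * Idm a - ?i1 * tp ?i1 - ?i2 * tp ?i2 + ?i3 * tp ?i3))
      (?i1 * Idm a + ?i3 * tp ?i2) (?i2 * Idm a - ?i3 * tp ?i1)) t a (Idm a) ?i1 ?i2 ?i3
      (Idm a) (tp ?i1) (tp ?i2) (tp ?i3)"
    by (rule free_rep_data_mk[OF r]) (use sum in \<open>auto simp: tpSh_Sh tpSh_Sh_disjoint\<close>)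
  then show ?thesis by (simp only: free_rep_def Let_def tp_Idm)
qed

lemma module_free_rep [simp]: "is_module (free_rep t a)" using free_rep_dataD(1)[OF free_rep_data_free_rep] .

text \<open>The witness \<open>i0 * p3\<close> sends \<xi>1\<xi>2 g back to the generator g. The
  four terms of its trace are precisely the projections onto the four blocks.\<close>

lemma higman_projective_free_rep_data:
  assumes "free_rep_data M t a i0 i1 i2 i3 p0 p1 p2 p3" shows "higman_projective M"
proof -
  have "even_map M M (i0 * p3)"
    by (simp add: even_map_def free_rep_rules[OF assms] mult.assoc rect_times[OF free_rep_dataD(2,9)[OF assms]])
  moreover have "higman_trace M M (i0 * p3) = Idm (rdim M)"
    using free_rep_dataD(26)[OF assms] by (simp add: higman_trace_def free_rep_rules[OF assms] mult.assoc algebra_simps)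
  ultimately show ?thesis using free_rep_dataD(1)[OF assms] by (auto simp: higman_projective_def)
qed

lemma higman_projective_free_rep: "higman_projective (free_rep t a)" by (rule higman_projective_free_rep_data[OF free_rep_data_free_rep])

definition Pc :: "bit \<Rightarrow> rep" where "Pc r = free_rep r 1"

lemma rdim_Pc [simp]: "rdim (Pc r) = 4" and module_Pc [simp]: "is_module (Pc r)"
  and higman_projective_Pc: "higman_projective (Pc r)"
  by (simp_all add: Pc_def higman_projective_free_rep)

lemma Pc_dataE:
  obtains i0 i1 i2 i3 p0 p1 p2 p3 where "free_rep_data (Pc r) r 1 i0 i1 i2 i3 p0 p1 p2 p3"
  using free_rep_data_free_rep[of r 1] unfolding Pc_def by blast

lemma th_Pc: "th (Pc r) \<noteq> 0"
proof
  assume z: "th (Pc r) = 0"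
  obtain i0 i1 i2 i3 p0 p1 p2 p3 where d: "free_rep_data (Pc r) r 1 i0 i1 i2 i3 p0 p1 p2 p3"
    using Pc_dataE .
  have "p3 * (th (Pc r) * i0) = Idm 1" by (simp add: free_rep_rules[OF d] mult.assoc)
  then have "Idm 1 = Idm 0" by (simp add: z)
  then show False using Idm_inj[of 1 0] by simp
qed

lemma kk_th_Pc: "kk (Pc r) * th (Pc r) = sgn_bit r *\<^sub>C th (Pc r)"
proof -
  obtain i0 i1 i2 i3 p0 p1 p2 p3 where d: "free_rep_data (Pc r) r 1 i0 i1 i2 i3 p0 p1 p2 p3"
    using Pc_dataE .
  have "th (Pc r) = x1 (Pc r) * (i2 * p0 - i3 * p1)" by (simp only: free_rep_dataD(29)[OF d])
  also have "\<dots> = i3 * p0" by (simp add: right_diff_distrib free_rep_rules[OF d])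
  finally show ?thesis by (simp add: free_rep_rules[OF d])
qed

lemma rect_one: assumes "rect 1 1 f" shows "f = ent f 0 0 *\<^sub>C Idm 1"
proof (rule fmat_eqI)
  fix i j show "ent f i j = ent (ent f 0 0 *\<^sub>C Idm 1) i j"
    using rect_entD[OF assms, of i j] by (cases i; cases j) (auto simp: ent_Idm)
qed

lemma scaleC_neg_self: assumes "s *\<^sub>C f = - (s *\<^sub>C f)" "s \<noteq> 0" shows "f = 0"
proof (rule fmat_eqI)
  fix i j
  have "s * ent f i j = - (s * ent f i j)" using arg_cong[OF assms(1), of "\<lambda>f. ent f i j"] by simp
  then show "ent f i j = ent 0 i j" using assms(2) by (simp add: eq_neg_iff_add_eq_0)
qed

lemma kk_th: "is_module M \<Longrightarrow> kk M * th M = th M * kk M"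
  by (simp add: mod_simps mult.assoc)

text \<open>Self-injectivity of \<open>Pc r\<close> made explicit: the submodule generated by
  \<open>v\<close> is free, and the trace of a linear functional gives a map back. The composite
  \<open>d'\<close> is a nonzero scalar plus a square-zero endomorphism, hence invertible.\<close>

lemma split_off_Pc:
  assumes M: "is_module M" and v: "rect (rdim M) 1 v" "kk M * v = sgn_bit r *\<^sub>C v" "th M * v \<noteq> 0"
  obtains N where "is_module N" "biprod M (Pc r) N"
proof -
  define s where "s = sgn_bit r"
  obtain i0 i1 i2 i3 p0 p1 p2 p3 where d: "free_rep_data (Pc r) r 1 i0 i1 i2 i3 p0 p1 p2 p3"
    using Pc_dataE .
  have rp: "rect 1 4 p0" "rect 1 4 p1" "rect 1 4 p2" "rect 1 4 p3"
    and ri: "rect 4 1 i0" "rect 4 1 i1" "rect 4 1 i2" "rect 4 1 i3"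
    using free_rep_dataD(2-9)[OF d] by simp_all
  note R = free_rep_rules[OF d]
  define i where "i = v * p0 + x1 M * v * p1 + x2 M * v * p2 + th M * v * p3"
  note rx = rect_ac[OF M]
  have ri': "rect (rdim M) 4 i" unfolding i_def
    by (intro rect_plus rect_times[OF v(1) rp(1)] rect_times[OF rect_times[OF rx v(1)] rp(2)]
        rect_times[OF rect_times[OF rx v(1)] rp(3)] rect_times[OF rect_times[OF rect_times[OF rx rx] v(1)] rp(4)])
  have kv: "kk M * (v * z) = s *\<^sub>C (v * z)" for z
    using assoc_rew[OF v(2)] by (simp add: s_def)
  have ihom: "hom (Pc r) M i"
  proof (rule homI)
    show "rect (rdim M) (rdim (Pc r)) i" using ri' by simp
  qed (simp_all add: i_def distrib_left distrib_right mult.assoc mod_simps M R kv s_def[symmetric])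
  obtain a where a: "ent (th M * v) a 0 \<noteq> 0"
  proof (rule ccontr)
    assume "\<not> thesis"
    then have "ent (th M * v) a 0 = 0" for a using that by blast
    moreover have "ent (th M * v) a (Suc j) = 0" for a j
      using rect_entD[OF rect_times[OF rect_times[OF rx rx] v(1)], of a "Suc j"] by simp
    ultimately have "th M * v = 0" by (metis ent_zero fmat_eqI not0_implies_Suc)
    with v(3) show False by simp
  qed
  have an: "a < rdim M"
    using a rect_entD[OF rect_times[OF rect_times[OF rx rx] v(1)], of a 0] by (metis not_less)
  define c where "c = ent (th M * v) a 0"
  \<comment> \<open>A functional that detects \<open>\<xi>\<^sub>1\<xi>\<^sub>2 v\<close>; the trace map turns it into a retraction.\<close>
  define \<phi> where "\<phi> = (1/2) *\<^sub>C (Eu 0 a + s *\<^sub>C (Eu 0 a * kk M))"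
  have rE: "rect 1 (rdim M) (Eu 0 a)" using an by simp
  have r\<phi>: "rect 1 (rdim M) \<phi>" unfolding \<phi>_def
    by (intro rect_scaleC rect_plus rE rect_times[OF rE rx])
  have k\<phi>: "\<phi> * kk M = s *\<^sub>C \<phi>"
    using an by (simp add: \<phi>_def distrib_right mult.assoc mod_simps M scaleC_add s_def add.commute)
  have c: "\<phi> * (th M * v) = c *\<^sub>C Idm 1"
  proof -
    have "kk M * (x1 M * (x2 M * v)) = s *\<^sub>C (x1 M * (x2 M * v))"
      by (simp add: mod_simps M v(2) s_def)
    then have "\<phi> * (th M * v) = Eu 0 a * (th M * v)"
      by (simp add: \<phi>_def distrib_right mult.assoc s_def) (simp flip: scaleC_add add: scaleC_half[simplified])
    moreover have "rect 1 1 (Eu 0 a * (th M * v))"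
      by (intro rect_times[OF rE rect_times[OF rect_times[OF rx rx] v(1)]])
    moreover have "ent (Eu 0 a * (th M * v)) 0 0 = c" by (simp add: c_def)
    ultimately show ?thesis using rect_one by metis
  qed
  have e\<phi>: "even_map M (Pc r) (i0 * \<phi>)"
    using rect_times[OF ri(1) r\<phi>]
    by (simp add: even_map_def k\<phi> mult.assoc assoc_rew[OF free_rep_simps(1)[OF d]] s_def)
  define p where "p = higman_trace M (Pc r) (i0 * \<phi>)"
  have phom: "hom M (Pc r) p" unfolding p_def by (rule hom_higman_trace[OF M module_Pc e\<phi>])
  define d' where "d' = p * i"
  have dhom: "hom (Pc r) (Pc r) d'" unfolding d'_def by (rule hom_comp[OF phom ihom])
  have iv: "i * i0 = v" using rectD[OF v(1)]
    by (simp add: i_def distrib_right mult.assoc R)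
  have "p0 * p = \<phi> * th M"
    unfolding p_def higman_trace_def using rectD[OF r\<phi>]
    by (simp add: distrib_left right_diff_distrib R mult.assoc mult.assoc[symmetric, of p0])
  then have al: "p0 * (d' * i0) = c *\<^sub>C Idm 1"
    by (simp add: d'_def mult.assoc iv) (simp add: mult.assoc[symmetric] c[unfolded mult.assoc[symmetric]])
  have rd: "rect 4 4 d'" using hom_rect[OF dhom] by simp
  \<comment> \<open>An endomorphism of \<open>P(r)\<close> is determined by the image of the generator, hence
    equals \<open>c + \<beta> \<xi>\<^sub>1\<xi>\<^sub>2\<close>.\<close>
  define b where "b = p3 * (d' * i0)"
  have p1z: "p1 * (d' * i0) = 0"
  proof -
    have "s *\<^sub>C (p1 * (d' * i0)) = p1 * (d' * (kk (Pc r) * i0))"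
      by (simp add: free_rep_simps(1)[OF d] s_def)
    also have "\<dots> = p1 * kk (Pc r) * (d' * i0)" by (simp add: homD(6)[OF dhom, symmetric] mult.assoc)
    also have "\<dots> = - (s *\<^sub>C (p1 * (d' * i0)))" by (simp add: R(14) s_def)
    finally show ?thesis by (rule scaleC_neg_self) (simp add: s_def)
  qed
  have p2z: "p2 * (d' * i0) = 0"
  proof -
    have "s *\<^sub>C (p2 * (d' * i0)) = p2 * (d' * (kk (Pc r) * i0))"
      by (simp add: free_rep_simps(1)[OF d] s_def)
    also have "\<dots> = p2 * kk (Pc r) * (d' * i0)" by (simp add: homD(6)[OF dhom, symmetric] mult.assoc)
    also have "\<dots> = - (s *\<^sub>C (p2 * (d' * i0)))" by (simp add: R(15) s_def)
    finally show ?thesis by (rule scaleC_neg_self) (simp add: s_def)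
  qed
  have d0: "d' * i0 = c *\<^sub>C i0 + i3 * b"
  proof -
    have "d' * i0 = (i0 * p0 + i1 * p1 + i2 * p2 + i3 * p3) * (d' * i0)"
      unfolding free_rep_dataD(26)[OF d] using rectD(3)[OF rd] by simp
    also have "\<dots> = i0 * (p0 * (d' * i0)) + i3 * b"
      using p1z p2z
      by (simp only: distrib_right mult.assoc b_def) simp
    finally show ?thesis by (simp only: al) (simp add: R)
  qed
  have d1: "d' * i1 = c *\<^sub>C i1"
  proof -
    have "d' * i1 = x1 (Pc r) * (d' * i0)" by (simp add: homD(6)[OF dhom] free_rep_simps(5)[OF d])
    then show ?thesis unfolding d0 by (simp add: distrib_left R)
  qed
  have d2: "d' * i2 = c *\<^sub>C i2"
  proof -
    have "d' * i2 = x2 (Pc r) * (d' * i0)" by (simp add: homD(6)[OF dhom] free_rep_simps(9)[OF d])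
    then show ?thesis unfolding d0 by (simp add: distrib_left R)
  qed
  have d3: "d' * i3 = c *\<^sub>C i3"
  proof -
    have "d' * i3 = x1 (Pc r) * (d' * i2)" by (simp add: homD(6)[OF dhom] free_rep_simps(7)[OF d])
    then show ?thesis unfolding d2 by (simp add: free_rep_simps(7)[OF d])
  qed
  have dd: "d' = c *\<^sub>C Idm 4 + i3 * b * p0"
  proof -
    have "d' = d' * (i0 * p0 + i1 * p1 + i2 * p2 + i3 * p3)"
      unfolding free_rep_dataD(26)[OF d] using rectD(2)[OF rd] by simp
    also have "\<dots> = (d' * i0) * p0 + (d' * i1) * p1 + (d' * i2) * p2 + (d' * i3) * p3"
      by (simp only: distrib_left mult.assoc)
    also have "\<dots> = c *\<^sub>C (i0 * p0 + i1 * p1 + i2 * p2 + i3 * p3) + i3 * b * p0"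
      unfolding d0 d1 d2 d3 by (simp add: distrib_right scaleC_add algebra_simps)
    finally show ?thesis unfolding free_rep_dataD(26)[OF d] by simp
  qed
  have c0: "c \<noteq> 0" using a by (simp add: c_def)
  define n where "n = i3 * b * p0"
  have rb: "rect 1 1 b" unfolding b_def by (intro rect_times[OF rp(4) rect_times[OF rd ri(1)]])
  have nn: "n * n = 0" by (simp add: n_def mult.assoc) (simp add: mult.assoc[symmetric] R)
  have rn: "rect 4 4 n" unfolding n_def by (intro rect_times[OF rect_times[OF ri(4) rb] rp(1)])
  have nhom: "hom (Pc r) (Pc r) n"
  proof -
    have "n = d' - c *\<^sub>C Idm (rdim (Pc r))" by (simp add: dd n_def)
    then show ?thesis using hom_minus[OF dhom hom_scaleC[OF hom_Idm[OF module_Pc]]] by metis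
  qed
  \<comment> \<open>Since \<open>n * n = 0\<close>, the geometric series for the inverse of
    \<open>c + n\<close> stops after two terms.\<close>
  define e where "e = (1/c) *\<^sub>C Idm 4 - (1/c^2) *\<^sub>C n"
  have ehom: "hom (Pc r) (Pc r) e" unfolding e_def
    using hom_Idm[OF module_Pc[of r]] by (intro hom_minus hom_scaleC nhom) simp
  have "e * d' = Idm 4"
    using c0 unfolding dd[folded n_def] by (simp add: e_def algebra_simps nn rectD[OF rn] power2_eq_square scaleC_diff)
  then have "(e * p) * i = Idm (rdim (Pc r))" by (simp add: d'_def mult.assoc)
  then show ?thesis
    using that hom_retract_split[OF M module_Pc ihom hom_comp[OF ehom phom]] by metis
qed

text \<open>A basis vector not killed by \<xi>1\<xi>2 is the sum of its two K-eigenparts, and one of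
  these is not killed either. The last conclusion identifies \<open>r\<close> when \<xi>1\<xi>2
  takes values in a single K-eigenspace.\<close>

lemma th_nonzero_split:
  assumes M: "is_module M" "th M \<noteq> 0"
  obtains r N where "is_module N" "biprod M (Pc r) N" "kk M * th M \<noteq> - sgn_bit r *\<^sub>C th M"
proof -
  obtain a b where ab: "ent (th M) a b \<noteq> 0" using M(2) by (metis ent_zero fmat_eqI)
  define u where "u = Eu b 0"
  have b: "b < rdim M"
    using ab rect_entD[OF rect_times[OF rect_ac[OF M(1)] rect_ac[OF M(1)]], of a b] not_less by blast
  have ru: "rect (rdim M) 1 u" using b by (simp add: u_def)
  have tu: "th M * u \<noteq> 0" using ab by (metis ent_times_Eu ent_zero u_def)
  define v where "v r = (1/2) *\<^sub>C (u + sgn_bit r *\<^sub>C (kk M * u))" for r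
  have rv: "rect (rdim M) 1 (v r)" for r unfolding v_def
    by (intro rect_scaleC rect_plus ru rect_times[OF rect_ac ru] M)
  have kv: "kk M * v r = sgn_bit r *\<^sub>C v r" for r
    by (simp add: v_def distrib_left mod_simps M rectD[OF ru] scaleC_add add.commute)
  have "u = v 0 + v 1"
    by (auto intro!: fmat_eqI simp: v_def field_simps)
  then have "th M * v 0 \<noteq> 0 \<or> th M * v 1 \<noteq> 0" using tu by (auto simp: distrib_left)
  then obtain r where r: "th M * v r \<noteq> 0" by blast
  have "kk M * th M \<noteq> - sgn_bit r *\<^sub>C th M"
  proof
    assume "kk M * th M = - sgn_bit r *\<^sub>C th M"
    then have "kk M * (th M * v r) = - sgn_bit r *\<^sub>C (th M * v r)" using assoc_rew by fastforce
    moreover have "kk M * (th M * v r) = th M * (kk M * v r)" by (simp add: mod_simps M mult.assoc)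
    ultimately have "sgn_bit r *\<^sub>C (th M * v r) = - (sgn_bit r *\<^sub>C (th M * v r))"
      using kv[of r] by (metis scaleC_minus_left scaleC_mult_right)
    then have "th M * v r = 0" by (rule scaleC_neg_self) simp
    with r show False by simp
  qed
  then show ?thesis using split_off_Pc[OF M(1) rv kv r] that by metis
qed

section \<open>Sums of indecomposable projectives and their multiplicities\<close>

definition free_sum :: "bit list \<Rightarrow> rep" where "free_sum rs = foldr (\<lambda>r N. Pc r \<oplus>\<^sub>K N) rs zero_rep"

lemma free_sum_simps [simp]: "free_sum [] = zero_rep" "free_sum (r # rs) = Pc r \<oplus>\<^sub>K free_sum rs" by (simp_all add: free_sum_def)

lemma rdim_zero_rep [simp]: "rdim zero_rep = 0" by (simp add: zero_rep_def)
lemma module_zero_rep [simp]: "is_module zero_rep" by (rule module_zero) (simp_all add: zero_rep_def)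

lemma module_free_sum [simp]: "is_module (free_sum rs)" by (induction rs) (auto intro: module_dsum)
lemma rdim_free_sum [simp]: "rdim (free_sum rs) = 4 * length rs" by (induction rs) auto

lemma higman_projective_free_sum: "higman_projective (free_sum rs)"
proof (induction rs)
  case Nil
  show ?case unfolding higman_projective_def by (intro conjI exI[of _ 0]) simp_all
next
  case (Cons r rs)
  then show ?case
    using higman_projective_biprod[OF _ module_dsum(2)] higman_projective_Pc module_dsum(1) by (metis free_sum_simps(2) module_Pc module_free_sum)
qed

lemma copies_Suc: "Suc c \<odot>\<^sub>K M = M \<oplus>\<^sub>K (c \<odot>\<^sub>K M)" by (simp add: copies_def)
lemma copies_add_one: "(c + 1) \<odot>\<^sub>K M = M \<oplus>\<^sub>K (c \<odot>\<^sub>K M)"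
  by (simp only: Suc_eq_plus1[symmetric] copies_Suc)
lemma copies_zero: "0 \<odot>\<^sub>K M = zero_rep" by (simp add: copies_def)

lemma module_copies: "is_module M \<Longrightarrow> is_module (c \<odot>\<^sub>K M)"
  by (induction c) (auto simp: copies_Suc copies_zero intro: module_dsum)

lemma copies_cong: "M \<cong>\<^sub>K N \<Longrightarrow> c \<odot>\<^sub>K M \<cong>\<^sub>K c \<odot>\<^sub>K N"
  by (induction c) (auto simp: copies_Suc copies_zero intro: dsum_cong iso_refl)

lemma free_sum_replicate: "free_sum (replicate c r) = c \<odot>\<^sub>K Pc r"
  by (induction c) (auto simp: copies_Suc copies_zero)

lemma dsum_left_comm:
  assumes "is_module A" "is_module B" "is_module C"
  shows "A \<oplus>\<^sub>K (B \<oplus>\<^sub>K C) \<cong>\<^sub>K B \<oplus>\<^sub>K (A \<oplus>\<^sub>K C)"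
proof -
  have "A \<oplus>\<^sub>K (B \<oplus>\<^sub>K C) \<cong>\<^sub>K (A \<oplus>\<^sub>K B) \<oplus>\<^sub>K C" by (rule dsum_assoc[OF assms])
  also have "\<dots> \<cong>\<^sub>K (B \<oplus>\<^sub>K A) \<oplus>\<^sub>K C" by (intro dsum_cong dsum_comm iso_refl assms)
  also have "\<dots> \<cong>\<^sub>K B \<oplus>\<^sub>K (A \<oplus>\<^sub>K C)" by (intro iso_sym[OF dsum_assoc] assms)
  finally show ?thesis .
qed

lemma free_sum_norm: "free_sum rs \<cong>\<^sub>K (count_list rs 0 \<odot>\<^sub>K Pc 0) \<oplus>\<^sub>K (count_list rs 1 \<odot>\<^sub>K Pc 1)"
proof (induction rs)
  case Nil
  show ?case using iso_sym[OF dsum_zero(1)[of zero_rep zero_rep]] by (simp add: copies_zero)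
next
  case (Cons r rs)
  let ?a = "count_list rs 0 \<odot>\<^sub>K Pc 0" and ?b = "count_list rs 1 \<odot>\<^sub>K Pc 1"
  have m: "is_module ?a" "is_module ?b" by (simp_all add: module_copies)
  have 1: "free_sum (r # rs) \<cong>\<^sub>K Pc r \<oplus>\<^sub>K (?a \<oplus>\<^sub>K ?b)"
    using dsum_cong[OF iso_refl Cons, of "Pc r"] by simp
  show ?case
  proof (cases r)
    case zero
    then show ?thesis using iso_trans[OF 1] dsum_assoc[OF module_Pc m] by (simp add: copies_add_one)
  next
    case one
    then show ?thesis using iso_trans[OF 1] dsum_left_comm[OF module_Pc m] by (simp add: copies_add_one)
  qed
qed

lemma free_decomposition:
  assumes "is_module M"
  obtains N rs where "is_module N" "th N = 0" "M \<cong>\<^sub>K N \<oplus>\<^sub>K free_sum rs"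
proof -
  have "\<exists>N rs. is_module N \<and> th N = 0 \<and> M \<cong>\<^sub>K N \<oplus>\<^sub>K free_sum rs" using assms
  proof (induction "rdim M" arbitrary: M rule: less_induct)
    case less
    show ?case
    proof (cases "th M = 0")
      case True
      have "M \<cong>\<^sub>K M \<oplus>\<^sub>K free_sum []" using iso_sym[OF dsum_zero(1)[OF less.prems]] by simp
      then show ?thesis using True less.prems by blast
    next
      case False
      obtain r N where N: "is_module N" "biprod M (Pc r) N" using th_nonzero_split[OF less.prems False] by metis
      have iso: "M \<cong>\<^sub>K Pc r \<oplus>\<^sub>K N" using iso_dsum_iff[OF less.prems module_Pc N(1)] N(2) by blast
      then have "rdim N < rdim M" using iso_rdim[OF iso] by simp
      then obtain L rs where L: "is_module L" "th L = 0" "N \<cong>\<^sub>K L \<oplus>\<^sub>K free_sum rs"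
        using less.hyps N(1) by metis
      note iso
      also have "Pc r \<oplus>\<^sub>K N \<cong>\<^sub>K Pc r \<oplus>\<^sub>K (L \<oplus>\<^sub>K free_sum rs)" by (intro dsum_cong iso_refl module_Pc L)
      also have "\<dots> \<cong>\<^sub>K L \<oplus>\<^sub>K free_sum (r # rs)" unfolding free_sum_simps by (intro dsum_left_comm module_Pc module_free_sum L)
      finally show ?thesis using L by blast
    qed
  qed
  then show ?thesis using that by blast
qed

lemma free_sum_summand:
  assumes "r \<in> set rs"
  obtains i p where "hom (Pc r) (free_sum rs) i" "hom (free_sum rs) (Pc r) p" "p * i = Idm (rdim (Pc r))"
proof -
  have "\<exists>i p. hom (Pc r) (free_sum rs) i \<and> hom (free_sum rs) (Pc r) p \<and> p * i = Idm (rdim (Pc r))" using assms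
  proof (induction rs)
    case (Cons a rs)
    have "biprod (free_sum (a # rs)) (Pc a) (free_sum rs)" by (simp add: module_dsum)
    then obtain i p j q where m: "hom (Pc a) (free_sum (a # rs)) i" "hom (free_sum (a # rs)) (Pc a) p"
      "hom (free_sum rs) (free_sum (a # rs)) j" "hom (free_sum (a # rs)) (free_sum rs) q"
      "p * i = Idm (rdim (Pc a))" "q * j = Idm (rdim (free_sum rs))" unfolding biprod_def by blast
    show ?case
    proof (cases "r = a")
      case True
      then show ?thesis using m by metis
    next
      case False
      then obtain i' p' where *: "hom (Pc r) (free_sum rs) i'" "hom (free_sum rs) (Pc r) p'" "p' * i' = Idm (rdim (Pc r))"
        using Cons by auto
      have "(p' * q) * (j * i') = Idm (rdim (Pc r))"
        using * by (simp only: mult.assoc assoc_rew[OF m(6)] homD[OF *(1)])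
      then show ?thesis using hom_comp[OF m(3) *(1)] hom_comp[OF *(2) m(4)] by metis
    qed
  qed simp
  then show ?thesis using that by blast
qed

lemma biprod_stably_iso:
  assumes "is_module M" "is_module A" "biprod M A B" "higman_projective B" shows "stably_iso M A"
proof -
  obtain i p j q where m: "hom A M i" "hom M A p" "hom B M j" "hom M B q"
    "p * i = Idm (rdim A)" "q * j = Idm (rdim B)" "i * p + j * q = Idm (rdim M)"
    "p * j = 0" "q * i = 0" "rdim M = rdim A + rdim B" using biprodE[OF assms(3)] .
  obtain w where w: "even_map B B w" "higman_trace B B w = Idm (rdim B)" using assms(4) by (auto simp: higman_projective_def)
  have "Idm (rdim M) - i * p = j * higman_trace B B w * q"
    by (simp add: m(7)[symmetric] w(2) homD[OF m(3)])
  also have "\<dots> = higman_trace M M (j * w * q)" by (simp only: higman_trace_left[OF m(3)] higman_trace_right[OF m(4)])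
  finally show ?thesis
    by (intro stI[OF assms(1,2) m(2,1) even_comp[OF even_comp[OF hom_even[OF m(3)] w(1)] hom_even[OF m(4)]]
          even_zero]) (simp_all add: m(5))
qed

text \<open>On a summand \<open>Pc r\<close>, K acts on the image of \<xi>1\<xi>2 by
  \<open>sgn_bit r\<close>; this must be the sign prescribed on all of \<open>M\<close>, because
  \<xi>1\<xi>2 is not zero on the summand.\<close>

lemma Pc_parity:
  assumes "is_module M" "kk M * th M = sgn_bit \<rho> *\<^sub>C th M"
    "hom (Pc r) M i" "hom M (Pc r) p" "p * i = Idm (rdim (Pc r))"
  shows "r = \<rho>"
proof (rule ccontr)
  assume "r \<noteq> \<rho>"
  have "th (Pc r) = p * (i * th (Pc r))" by (simp add: assoc_rew[OF assms(5)] mod_simps del: rdim_Pc)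
  also have "i * th (Pc r) = th M * i" by (simp add: homD[OF assms(3)] mult.assoc)
  finally have t: "th (Pc r) = p * (th M * i)" .
  have "sgn_bit r *\<^sub>C th (Pc r) = kk (Pc r) * (p * (th M * i))" by (simp only: kk_th_Pc t[symmetric])
  also have "\<dots> = p * ((kk M * th M) * i)" by (simp only: homD[OF assms(4)] mult.assoc)
  also have "\<dots> = sgn_bit \<rho> *\<^sub>C th (Pc r)" by (simp add: assms(2) t)
  finally have "(sgn_bit r - sgn_bit \<rho>) *\<^sub>C th (Pc r) = 0" by (simp add: scaleC_diff_left)
  then have "th (Pc r) = 0" by (rule scaleC_cancel) (use \<open>r \<noteq> \<rho>\<close> in simp)
  then show False using th_Pc by blast
qed

lemma free_part_parity:
  assumes "is_module M" "kk M * th M = sgn_bit \<rho> *\<^sub>C th M" "is_module N" "M \<cong>\<^sub>K N \<oplus>\<^sub>K free_sum rs"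
  shows "rs = replicate (length rs) \<rho>"
proof -
  have "r = \<rho>" if r: "r \<in> set rs" for r
  proof -
    obtain i p where *: "hom (Pc r) (free_sum rs) i" "hom (free_sum rs) (Pc r) p" "p * i = Idm (rdim (Pc r))"
      using free_sum_summand[OF r] .
    have bp: "biprod M N (free_sum rs)" using iso_dsum_iff[OF assms(1,3) module_free_sum] assms(4) by blast
    obtain i' p' j q where m: "hom N M i'" "hom M N p'" "hom (free_sum rs) M j" "hom M (free_sum rs) q"
      "p' * i' = Idm (rdim N)" "q * j = Idm (rdim (free_sum rs))" "i' * p' + j * q = Idm (rdim M)"
      "p' * j = 0" "q * i' = 0" "rdim M = rdim N + rdim (free_sum rs)" using biprodE[OF bp] .
    have "(p * q) * (j * i) = Idm (rdim (Pc r))"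
      by (simp only: mult.assoc assoc_rew[OF m(6)] homD[OF *(1)] *(3))
    then show ?thesis by (rule Pc_parity[OF assms(1,2) hom_comp[OF m(3) *(1)] hom_comp[OF *(2) m(4)]])
  qed
  then show ?thesis by (intro replicate_eqI[symmetric, THEN sym]) auto
qed

text \<open>The tool for all tensor products without projective factor: only the stable class, the
  parity of \<open>\<xi>\<^sub>1\<xi>\<^sub>2 M\<close> and the dimension have to be computed.\<close>

lemma stable_decomposition:
  assumes "stably_iso M N" "th N = 0" "kk M * th M = sgn_bit \<rho> *\<^sub>C th M" "rdim M = rdim N + 4 * m"
  shows "M \<cong>\<^sub>K N \<oplus>\<^sub>K m \<odot>\<^sub>K Pc \<rho>"
proof -
  have mod: "is_module M" "is_module N" using assms(1) by (auto simp: stably_iso_def)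
  obtain L rs where L: "is_module L" "th L = 0" "M \<cong>\<^sub>K L \<oplus>\<^sub>K free_sum rs" using free_decomposition[OF mod(1)] .
  have "stably_iso M L"
    using biprod_stably_iso[OF mod(1) L(1) _ higman_projective_free_sum] iso_dsum_iff[OF mod(1) L(1) module_free_sum] L(3) by blast
  then have LN: "L \<cong>\<^sub>K N" using stably_iso_imp_iso[OF stably_iso_trans[OF stably_iso_sym assms(1)] L(2) assms(2)] by blast
  have rs: "rs = replicate (length rs) \<rho>" by (rule free_part_parity[OF mod(1) assms(3) L(1,3)])
  have "length rs = m" using iso_rdim[OF L(3)] iso_rdim[OF LN] assms(4) by simp
  then have "free_sum rs = m \<odot>\<^sub>K Pc \<rho>" using rs free_sum_replicate by metis
  then show ?thesis using iso_trans[OF L(3) dsum_cong[OF LN iso_refl[OF module_free_sum, of rs]]] by simp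
qed

text \<open>The identity of \<open>M\<close> is a trace, so \<open>M\<close> is stably isomorphic to
  the zero module and no nonprojective part is left.\<close>

lemma higman_projective_decomposition:
  assumes "higman_projective M" "kk M * th M = sgn_bit \<rho> *\<^sub>C th M" "rdim M = 4 * m"
  shows "M \<cong>\<^sub>K m \<odot>\<^sub>K Pc \<rho>"
proof -
  have mod: "is_module M" by (rule higman_projective_module[OF assms(1)])
  obtain w where w: "even_map M M w" "higman_trace M M w = Idm (rdim M)" using assms(1) by (auto simp: higman_projective_def)
  have "stably_iso M zero_rep"
    by (rule stI[OF mod module_zero_rep hom_zero hom_zero w(1) even_zero]) (simp_all add: w)
  moreover have "th zero_rep = 0" using rectD(1)[OF rect_ac[OF module_zero_rep]] by simp
  ultimately have "M \<cong>\<^sub>K zero_rep \<oplus>\<^sub>K m \<odot>\<^sub>K Pc \<rho>" using stable_decomposition[OF _ _ assms(2)] assms(3) by simp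
  then show ?thesis using iso_trans dsum_zero(2) module_copies module_Pc module_zero_rep rdim_zero_rep by blast
qed

lemma Pc_char:
  assumes "is_module M" "rdim M = 4" "th M \<noteq> 0" "kk M * th M = sgn_bit \<rho> *\<^sub>C th M"
  shows "M \<cong>\<^sub>K Pc \<rho>"
proof -
  obtain r N where N: "is_module N" "biprod M (Pc r) N" "kk M * th M \<noteq> - sgn_bit r *\<^sub>C th M"
    using th_nonzero_split[OF assms(1,3)] .
  have r: "r = \<rho>" using N(3) assms(4) by (cases r; cases \<rho>) (auto simp: sgn_bit_def)
  have iso: "M \<cong>\<^sub>K Pc r \<oplus>\<^sub>K N" using iso_dsum_iff[OF assms(1) module_Pc N(1)] N(2) by blast
  have "rdim N = 0" using iso_rdim[OF iso] assms(2) by simp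
  then show ?thesis using iso_trans[OF iso dsum_zero(1)[OF module_Pc N(1)]] r by simp
qed

subsection \<open>Column vectors, monomorphisms and epimorphisms\<close>

definition vemb :: "complex vec \<Rightarrow> fmat" where
  "vemb v = emb (mat (dim_vec v) 1 (\<lambda>(i, j). v $ i))"

lemma ent_vemb: "ent (vemb v) i j = (if i < dim_vec v \<and> j = 0 then v $ i else 0)"
  by (auto simp: vemb_def ent_emb)

lemma rect_vemb: "v \<in> carrier_vec n \<Longrightarrow> rect n 1 (vemb v)"
  by (rule rect_entI) (auto simp: ent_vemb)

lemma vemb_inj: assumes "vemb v = vemb w" "v \<in> carrier_vec n" "w \<in> carrier_vec n" shows "v = w"
proof (rule eq_vecI)
  fix i assume "i < dim_vec w"
  then show "v $ i = w $ i" using arg_cong[OF assms(1), of "\<lambda>f. ent f i 0"] assms(2,3) by (simp add: ent_vemb)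
qed (use assms in auto)

lemma vemb_surj: assumes "rect n 1 u" obtains v where "v \<in> carrier_vec n" "vemb v = u"
proof
  show "vemb (vec n (\<lambda>i. ent u i 0)) = u"
    using rect_entD[OF assms] by (intro fmat_eqI) (auto simp: ent_vemb Suc_le_eq)
qed simp

lemma vemb_mult:
  assumes "A \<in> carrier_mat m n" "v \<in> carrier_vec n" shows "vemb (A *\<^sub>v v) = emb A * vemb v"
proof (rule fmat_eqI)
  fix i j
  have "ent (emb A * vemb v) i j = (\<Sum>k<n. ent (emb A) i k * ent (vemb v) k j)"
    using assms by (intro ent_times_left) (auto simp: ent_emb)
  then show "ent (vemb (A *\<^sub>v v)) i j = ent (emb A * vemb v) i j"
    using assms by (auto simp: ent_emb ent_vemb scalar_prod_def lessThan_atLeast0)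
qed

lemma fmat_col_ext:
  assumes "rect m n f" "rect m n g" "\<And>u. rect n 1 u \<Longrightarrow> f * u = g * u" shows "f = g"
proof (rule fmat_eqI)
  fix i j
  show "ent f i j = ent g i j"
  proof (cases "j < n")
    case True
    then have "f * Eu j 0 = g * Eu j 0" by (intro assms(3)) simp
    from arg_cong[OF this, of "\<lambda>f. ent f i 0"] show ?thesis by simp
  next
    case False
    then show ?thesis using rect_entD[OF assms(1)] rect_entD[OF assms(2)] by simp
  qed
qed

text \<open>For injective \<open>f\<close>, the equation f s f = f of a generalized inverse can be
  cancelled on the left.\<close>

lemma mono_mat_iff:
  assumes "f \<in> carrier_mat m n"
  shows "mono_mat f \<longleftrightarrow> (\<exists>l. rect n m l \<and> l * emb f = Idm n)"
proof
  assume mono: "mono_mat f"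
  obtain s where s: "rect n m s" "emb f * s * emb f = emb f"
    using generalized_inverse[OF rect_emb[OF assms]] .
  have "s * emb f = Idm n"
  proof (rule fmat_col_ext[OF rect_times[OF s(1) rect_emb[OF assms]] rect_Idm_same])
    fix u assume u: "rect n 1 u"
    have su: "rect n 1 (s * emb f * u)" by (rule rect_times[OF rect_times[OF s(1) rect_emb[OF assms]] u])
    obtain v where v: "v \<in> carrier_vec n" "vemb v = u" using vemb_surj[OF u] .
    obtain w where w: "w \<in> carrier_vec n" "vemb w = s * emb f * u" using vemb_surj[OF su] .
    have "vemb (f *\<^sub>v w) = vemb (f *\<^sub>v v)"
      by (simp add: vemb_mult[OF assms] v w mult.assoc[symmetric] s(2))
    then have "f *\<^sub>v w = f *\<^sub>v v" by (rule vemb_inj[where n = m]) (use assms v w in auto)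
    then have "w = v" using mono v w assms by (auto simp: mono_mat_def inj_on_def)
    then show "s * emb f * u = Idm n * u" using v w by (simp add: rectD[OF u])
  qed
  then show "\<exists>l. rect n m l \<and> l * emb f = Idm n" using s by blast
next
  assume "\<exists>l. rect n m l \<and> l * emb f = Idm n"
  then obtain l where l: "l * emb f = Idm n" by blast
  show "mono_mat f"
    unfolding mono_mat_def inj_on_def
  proof (intro ballI impI)
    fix v w assume v: "v \<in> carrier_vec (dim_col f)" "w \<in> carrier_vec (dim_col f)" "f *\<^sub>v v = f *\<^sub>v w"
    have c: "v \<in> carrier_vec n" "w \<in> carrier_vec n" using v assms by auto
    have "emb f * vemb v = emb f * vemb w" using v(3) by (metis vemb_mult[OF assms] c)
    then have "l * (emb f * vemb v) = l * (emb f * vemb w)" by simp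
    then have "vemb v = vemb w" by (simp add: assoc_rew[OF l] rectD[OF rect_vemb[OF c(1)]] rectD[OF rect_vemb[OF c(2)]])
    then show "v = w" using vemb_inj c by blast
  qed
qed

lemma epi_mat_iff:
  assumes "f \<in> carrier_mat m n"
  shows "epi_mat f \<longleftrightarrow> (\<exists>r. rect n m r \<and> emb f * r = Idm m)"
proof
  assume epi: "epi_mat f"
  obtain s where s: "rect n m s" "emb f * s * emb f = emb f"
    using generalized_inverse[OF rect_emb[OF assms]] .
  have "emb f * s = Idm m"
  proof (rule fmat_col_ext[OF rect_times[OF rect_emb[OF assms] s(1)] rect_Idm_same])
    fix u assume u: "rect m 1 u"
    obtain v where v: "v \<in> carrier_vec m" "vemb v = u" using vemb_surj[OF u] .
    then have "v \<in> image_of f" using epi assms by (simp add: epi_mat_def)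
    then obtain w where w: "w \<in> carrier_vec n" "f *\<^sub>v w = v"
      using assms by (auto simp: image_of_def)
    have "u = emb f * vemb w" using vemb_mult[OF assms w(1)] v w by simp
    then show "emb f * s * u = Idm m * u" by (simp add: mult.assoc[symmetric] s(2) rectD[OF rect_emb[OF assms]])
  qed
  then show "\<exists>r. rect n m r \<and> emb f * r = Idm m" using s by blast
next
  assume "\<exists>r. rect n m r \<and> emb f * r = Idm m"
  then obtain r where r: "rect n m r" "emb f * r = Idm m" by blast
  have "v \<in> image_of f" if v: "v \<in> carrier_vec m" for v
  proof -
    obtain w where w: "w \<in> carrier_vec n" "vemb w = r * vemb v"
      using vemb_surj[OF rect_times[OF r(1) rect_vemb[OF v]]] .
    have "vemb (f *\<^sub>v w) = vemb v"
      by (simp add: vemb_mult[OF assms w(1)] w(2) assoc_rew[OF r(2)] rectD[OF rect_vemb[OF v]])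
    then have "f *\<^sub>v w = v" by (rule vemb_inj[where n = m]) (use assms v w in auto)
    then show ?thesis using w assms by (auto simp: image_of_def)
  qed
  then show "epi_mat f" using assms by (auto simp: epi_mat_def image_of_def)
qed

text \<open>The bridge from the set-theoretic exactness in the definitions of syzygy and cosyzygy to
  the equations used in the rest of the proof.\<close>

lemma exact_mat_iff:
  assumes "j \<in> carrier_mat n k" "q \<in> carrier_mat m n"
  shows "mono_mat j \<and> epi_mat q \<and> image_of j = mat_kernel q \<longleftrightarrow>
    (\<exists>l s. rect k n l \<and> rect n m s \<and> l * emb j = Idm k \<and> emb q * s = Idm m \<and>
      emb j * l + s * emb q = Idm n)"
proof
  assume "mono_mat j \<and> epi_mat q \<and> image_of j = mat_kernel q"
  then obtain l s where l: "rect k n l" "l * emb j = Idm k" and s: "rect n m s" "emb q * s = Idm m"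
    and ker: "image_of j = mat_kernel q"
    using mono_mat_iff[OF assms(1)] epi_mat_iff[OF assms(2)] by blast
  note rj = rect_emb[OF assms(1)] and rq = rect_emb[OF assms(2)]
  \<comment> \<open>A given left inverse \<open>l\<close> of \<open>j\<close> need not kill the
    section \<open>s\<close>. Composing it with the projection \<open>e\<close> along
    \<open>s\<close> repairs this, which is what the splitting identity requires.\<close>
  define e where "e = Idm n - s * emb q"
  have re: "rect n n e" unfolding e_def by (intro rect_minus rect_times[OF s(1) rq]) simp
  have qe: "emb q * e = 0" by (simp add: e_def right_diff_distrib rectD[OF rq] assoc_rew[OF s(2)])
  have qj: "emb q * emb j = 0"
  proof (rule fmat_col_ext[OF rect_times[OF rq rj] rect_zero])
    fix u assume u: "rect k 1 u"
    obtain v where v: "v \<in> carrier_vec k" "vemb v = u" using vemb_surj[OF u] .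
    have jv: "j *\<^sub>v v \<in> carrier_vec n" using v assms by auto
    have "j *\<^sub>v v \<in> mat_kernel q" using v assms ker by (auto simp: image_of_def)
    then have "q *\<^sub>v (j *\<^sub>v v) = 0\<^sub>v m" using assms by (simp add: mat_kernel_def)
    then have "emb q * (emb j * u) = vemb (0\<^sub>v m)"
      using vemb_mult[OF assms(1) v(1)] vemb_mult[OF assms(2) jv] v(2) by simp
    moreover have "vemb (0\<^sub>v m) = 0" by (auto intro!: fmat_eqI simp: ent_vemb)
    ultimately show "emb q * emb j * u = 0 * u" by (simp add: mult.assoc)
  qed
  have jle: "emb j * (l * e) = e"
  proof (rule fmat_col_ext[OF rect_times[OF rj rect_times[OF l(1) re]] re])
    fix u assume u: "rect n 1 u"
    obtain v where v: "v \<in> carrier_vec n" "vemb v = e * u" using vemb_surj[OF rect_times[OF re u]] .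
    have "vemb (q *\<^sub>v v) = vemb (0\<^sub>v m)"
      by (auto intro!: fmat_eqI simp: vemb_mult[OF assms(2) v(1)] v(2) mult.assoc[symmetric] qe ent_vemb)
    then have "q *\<^sub>v v = 0\<^sub>v m" by (rule vemb_inj[where n = m]) (use v assms in auto)
    then have "v \<in> image_of j" using ker v assms by (simp add: mat_kernel_def)
    then obtain w where w: "w \<in> carrier_vec k" "v = j *\<^sub>v w" using assms by (auto simp: image_of_def)
    then have "e * u = emb j * vemb w" using vemb_mult[OF assms(1) w(1)] v by simp
    then show "emb j * (l * e) * u = e * u"
      by (simp add: mult.assoc assoc_rew[OF l(2)] rectD[OF rect_vemb[OF w(1)]])
  qed
  have "l * e * emb j = Idm k"
  proof -
    have "e * emb j = emb j" by (simp add: e_def left_diff_distrib rectD[OF rj] mult.assoc qj)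
    then show ?thesis by (simp add: mult.assoc l(2))
  qed
  moreover have "emb j * (l * e) + s * emb q = Idm n" unfolding jle by (simp add: e_def)
  ultimately show "\<exists>l s. rect k n l \<and> rect n m s \<and> l * emb j = Idm k \<and> emb q * s = Idm m \<and>
      emb j * l + s * emb q = Idm n"
    using rect_times[OF l(1) re] s by blast
next
  assume "\<exists>l s. rect k n l \<and> rect n m s \<and> l * emb j = Idm k \<and> emb q * s = Idm m \<and>
      emb j * l + s * emb q = Idm n"
  then obtain l s where *: "rect k n l" "rect n m s" "l * emb j = Idm k" "emb q * s = Idm m"
      "emb j * l + s * emb q = Idm n" by (elim exE conjE) (rule that)
  note rj = rect_emb[OF assms(1)] and rq = rect_emb[OF assms(2)]
  have "emb q * emb j = emb q * ((emb j * l + s * emb q) * emb j)" by (simp add: *(5) rectD[OF rj])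
  also have "\<dots> = emb q * emb j + emb q * emb j"
    by (simp only: distrib_left distrib_right mult.assoc *(3) assoc_rew[OF *(4)] rectD[OF rj] rectD[OF rq])
  finally have qj: "emb q * emb j = 0" by simp
  have "image_of j = mat_kernel q"
  proof (intro equalityI subsetI)
    fix v assume "v \<in> image_of j"
    then obtain w where w: "w \<in> carrier_vec k" "v = j *\<^sub>v w" using assms by (auto simp: image_of_def)
    have v: "v \<in> carrier_vec n" using w assms by auto
    have "vemb (q *\<^sub>v v) = emb q * emb j * vemb w"
      using vemb_mult[OF assms(2) v] vemb_mult[OF assms(1) w(1)] w(2) by (simp add: mult.assoc)
    then have "vemb (q *\<^sub>v v) = vemb (0\<^sub>v m)" by (auto intro!: fmat_eqI simp: qj ent_vemb)
    then have "q *\<^sub>v v = 0\<^sub>v m" by (rule vemb_inj[where n = m]) (use v assms in auto)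
    then show "v \<in> mat_kernel q" using v assms by (simp add: mat_kernel_def)
  next
    fix v assume "v \<in> mat_kernel q"
    then have v: "v \<in> carrier_vec n" "q *\<^sub>v v = 0\<^sub>v m" using assms by (auto simp: mat_kernel_def)
    obtain w where w: "w \<in> carrier_vec k" "vemb w = l * vemb v"
      using vemb_surj[OF rect_times[OF *(1) rect_vemb[OF v(1)]]] .
    have "vemb (0\<^sub>v m) = 0" by (auto intro!: fmat_eqI simp: ent_vemb)
    then have qv: "emb q * vemb v = 0" using vemb_mult[OF assms(2) v(1)] v(2) by simp
    have "emb j * (l * vemb v) + s * (emb q * vemb v) = vemb v"
      by (simp add: mult.assoc[symmetric] distrib_right[symmetric] *(5) rectD[OF rect_vemb[OF v(1)]])
    then have "vemb (j *\<^sub>v w) = vemb v" by (simp add: vemb_mult[OF assms(1) w(1)] w(2) qv)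
    then have "j *\<^sub>v w = v" by (rule vemb_inj[where n = n]) (use assms v w in auto)
    then show "v \<in> image_of j" using w assms by (auto simp: image_of_def)
  qed
  then show "mono_mat j \<and> epi_mat q \<and> image_of j = mat_kernel q"
    using mono_mat_iff[OF assms(1)] epi_mat_iff[OF assms(2)] * by blast
qed

subsection \<open>Projective covers and syzygies\<close>

lemma module_homs_carrier: "f \<in> module_homs M N \<Longrightarrow> f \<in> carrier_mat (rdim N) (rdim M)"
  by (simp add: module_homs_def)

lemma epi_prj:
  "rect m n f \<Longrightarrow> epi_mat (prj m n f) \<longleftrightarrow> (\<exists>r. rect n m r \<and> f * r = Idm m)"
  by (subst epi_mat_iff[of _ m n]) (auto simp: emb_prj)

lemma higman_projective_projective: assumes "higman_projective P" shows "projective P"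
  unfolding projective_def
proof (intro conjI allI impI ballI)
  show "is_module P" by (rule higman_projective_module[OF assms])
  fix M N q f
  assume M: "is_module M \<and> is_module N" and q: "q \<in> module_homs M N" "epi_mat q" and f: "f \<in> module_homs P N"
  have c: "q \<in> carrier_mat (rdim N) (rdim M)" "f \<in> carrier_mat (rdim N) (rdim P)"
    using q f by (auto dest: module_homs_carrier)
  obtain s where s: "rect (rdim M) (rdim N) s" "emb q * s = Idm (rdim N)"
    using epi_mat_iff[OF c(1)] q(2) by blast
  obtain h where h: "hom P M h" "emb q * h = emb f"
    using higman_projective_lift[OF assms _ _ hom_emb[OF _ _ q(1)] s hom_emb[OF _ _ f]] M higman_projective_module[OF assms] by blast
  have "q * prj (rdim M) (rdim P) h = f"
    by (rule emb_inj[where m = "rdim N" and n = "rdim P"])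
      (use c h hom_rect[OF h(1)] in \<open>auto simp: emb_mult emb_prj\<close>)
  then show "\<exists>h\<in>module_homs P M. q * h = f" using prj_hom[OF _ _ h(1)] M higman_projective_module[OF assms] by blast
qed

lemma projective_lift:
  assumes "projective P" "is_module M" "is_module N" "hom M N q" "rect (rdim M) (rdim N) s"
    "q * s = Idm (rdim N)" "hom P N f"
  obtains h where "hom P M h" "q * h = f"
proof -
  have P: "is_module P" using assms(1) by (simp add: projective_def)
  let ?q = "prj (rdim N) (rdim M) q" and ?f = "prj (rdim N) (rdim P) f"
  have "epi_mat ?q" using epi_prj[OF hom_rect[OF assms(4)]] assms by blast
  then obtain h where h: "h \<in> module_homs P M" "?q * h = ?f"
    using assms(1) prj_hom[OF assms(2,3,4)] prj_hom[OF P assms(3,7)] assms(2,3)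
    unfolding projective_def by metis
  have "emb ?q * emb h = emb ?f" using h module_homs_carrier[OF h(1)] by (simp flip: h(2) add: emb_mult)
  then have "q * emb h = f" by (simp add: emb_prj hom_rect assms)
  then show ?thesis using that hom_emb[OF P assms(2) h(1)] by blast
qed

lemma projective_coverD:
  assumes "projective_cover P q M"
  shows "projective P" "is_module P" "is_module M" "hom P M (emb q)"
    "\<exists>r. rect (rdim P) (rdim M) r \<and> emb q * r = Idm (rdim M)"
    "is_module X \<Longrightarrow> hom X P f \<Longrightarrow> rect (rdim X) (rdim M) r \<Longrightarrow> emb q * f * r = Idm (rdim M) \<Longrightarrow>
      \<exists>r. rect (rdim X) (rdim P) r \<and> f * r = Idm (rdim P)"
proof -
  show P: "projective P" "is_module P" "is_module M" using assms by (auto simp: projective_cover_def projective_def)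
  have q: "q \<in> module_homs P M" "epi_mat q" using assms by (auto simp: projective_cover_def)
  have c: "q \<in> carrier_mat (rdim M) (rdim P)" using q by (auto dest: module_homs_carrier)
  show "hom P M (emb q)" by (rule hom_emb[OF P(2,3) q(1)])
  show "\<exists>r. rect (rdim P) (rdim M) r \<and> emb q * r = Idm (rdim M)" using epi_mat_iff[OF c] q(2) by blast
  assume X: "is_module X" "hom X P f" "rect (rdim X) (rdim M) r" "emb q * f * r = Idm (rdim M)"
  let ?f = "prj (rdim P) (rdim X) f"
  have qf: "q * ?f \<in> carrier_mat (rdim M) (rdim X)" using c by auto
  have "emb (q * ?f) = emb q * f" using c X by (simp add: emb_mult emb_prj hom_rect)
  then have "epi_mat (q * ?f)" using epi_mat_iff[OF qf] X by auto
  then have "epi_mat ?f" using assms X(1) prj_hom[OF X(1) P(2) X(2)] unfolding projective_cover_def by blast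
  then show "\<exists>r. rect (rdim X) (rdim P) r \<and> f * r = Idm (rdim P)"
    using epi_prj[OF hom_rect[OF X(2)]] by blast
qed

text \<open>The lift \<open>h\<close> of \<open>f\<close> is epi by minimality of the second cover,
  hence has an equivariant section \<open>g\<close> by projectivity. Minimality of the first cover
  makes \<open>g\<close> epi as well, so \<open>g\<close> is inverse to \<open>h\<close>.\<close>

lemma projective_cover_unique:
  assumes c: "projective_cover P q M" and c': "projective_cover P' q' M'" and iso: "M \<cong>\<^sub>K M'"
  obtains h g f e where "hom P P' h" "hom P' P g" "h * g = Idm (rdim P')" "g * h = Idm (rdim P)"
    "hom M M' f" "hom M' M e" "emb q' * h = f * emb q" "emb q * g = e * emb q'"
proof -
  obtain f e where f: "is_module M" "is_module M'" "hom M M' f" "hom M' M e"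
    "f * e = Idm (rdim M')" "e * f = Idm (rdim M)" using isoE[OF iso] .
  note P = projective_coverD(1-4)[OF c] and P' = projective_coverD(1-4)[OF c']
  obtain r where r: "rect (rdim P) (rdim M) r" "emb q * r = Idm (rdim M)" using projective_coverD(5)[OF c] by blast
  obtain r' where r': "rect (rdim P') (rdim M') r'" "emb q' * r' = Idm (rdim M')"
    using projective_coverD(5)[OF c'] by blast
  obtain h where h: "hom P P' h" "emb q' * h = f * emb q"
    using projective_lift[OF P(1) P'(2,3,4) r' hom_comp[OF f(3) P(4)]] .
  have "emb q' * h * (r * e) = Idm (rdim M')"
    by (simp add: h(2) mult.assoc assoc_rew[OF r(2)] homD[OF f(4)] f(5))
  then obtain r0 where r0: "rect (rdim P) (rdim P') r0" "h * r0 = Idm (rdim P')"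
    using projective_coverD(6)[OF c' P(2) h(1) rect_times[OF r(1) hom_rect[OF f(4)]]] by blast
  obtain g where g: "hom P' P g" "h * g = Idm (rdim P')"
    using projective_lift[OF P'(1) P(2) P'(2) h(1) r0 hom_Idm[OF P'(2)]] .
  have "f * (emb q * g) = emb q'"
    by (simp add: mult.assoc[symmetric] h(2)[symmetric]) (simp add: mult.assoc g(2) homD[OF P'(4)])
  then have "e * (f * (emb q * g)) = e * emb q'" by simp
  then have qg: "emb q * g = e * emb q'"
    by (simp add: assoc_rew[OF f(6)] homD[OF P(4)] )
  have "emb q * g * (r' * f) = Idm (rdim M)"
    by (simp add: qg mult.assoc assoc_rew[OF r'(2)] homD[OF f(3)] f(6))
  then obtain r1 where r1: "rect (rdim P') (rdim P) r1" "g * r1 = Idm (rdim P)"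
    using projective_coverD(6)[OF c P'(2) g(1) rect_times[OF r'(1) hom_rect[OF f(3)]]] by blast
  have "r1 = h"
  proof -
    have "r1 = (h * g) * r1" by (simp add: g(2) rectD[OF r1(1)])
    also have "\<dots> = h" by (simp add: mult.assoc r1(2) homD[OF h(1)])
    finally show ?thesis .
  qed
  then show ?thesis using that[OF h(1) g(1) g(2) _ f(3,4) h(2) qg] r1(2) by simp
qed

section \<open>Syzygies, cosyzygies and minimal presentations\<close>

definition is_syzygy :: "rep \<Rightarrow> rep \<Rightarrow> bool" where
  "is_syzygy X M \<longleftrightarrow> is_module X \<and>
     (\<exists>P q j. projective_cover P q M \<and>
        j \<in> module_homs X P \<and> mono_mat j \<and> image_of j = mat_kernel q)"

definition is_cosyzygy :: "rep \<Rightarrow> rep \<Rightarrow> bool" where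
  "is_cosyzygy X M \<longleftrightarrow> is_module X \<and>
     (\<exists>I j q. injective_hull I j M \<and>
        q \<in> module_homs I X \<and> epi_mat q \<and> mat_kernel q = image_of j)"

lemma is_syzygyD:
  assumes "is_syzygy X M"
  obtains P q j l s where "projective_cover P q M" "hom X P j"
    "rect (rdim X) (rdim P) l" "rect (rdim P) (rdim M) s" "l * j = Idm (rdim X)"
    "emb q * s = Idm (rdim M)" "j * l + s * emb q = Idm (rdim P)" "emb q * j = 0"
proof -
  from assms obtain P q j where *: "is_module X" "projective_cover P q M"
        "j \<in> module_homs X P" "mono_mat j" "image_of j = mat_kernel q" unfolding is_syzygy_def by blast
  note P = projective_coverD(1-4)[OF *(2)]
  have c: "j \<in> carrier_mat (rdim P) (rdim X)" "q \<in> carrier_mat (rdim M) (rdim P)" "epi_mat q"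
    using * by (auto dest: module_homs_carrier simp: projective_cover_def)
  obtain l s where ls: "rect (rdim X) (rdim P) l" "rect (rdim P) (rdim M) s" "l * emb j = Idm (rdim X)"
    "emb q * s = Idm (rdim M)" "emb j * l + s * emb q = Idm (rdim P)"
    using exact_mat_iff[OF c(1,2)] * c(3) by metis
  have j: "hom X P (emb j)" by (rule hom_emb[OF *(1) P(2) *(3)])
  have "emb q * emb j = emb q * ((emb j * l + s * emb q) * emb j)" by (simp add: ls(5) homD[OF j])
  also have "\<dots> = emb q * emb j + emb q * emb j"
    by (simp only: distrib_left distrib_right mult.assoc ls(3) assoc_rew[OF ls(4)] homD[OF j] homD[OF P(4)])
  finally have "emb q * emb j = 0" by simp
  then show ?thesis using that[OF *(2) j ls] by blast
qed

lemma is_syzygy_unique: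
  assumes "is_syzygy X M" "is_syzygy X' M'" "M \<cong>\<^sub>K M'" shows "X \<cong>\<^sub>K X'"
proof -
  have X: "is_module X" "is_module X'" using assms by (auto simp: is_syzygy_def)
  obtain P q j l s where 1: "projective_cover P q M" "hom X P j"
    "rect (rdim X) (rdim P) l" "rect (rdim P) (rdim M) s" "l * j = Idm (rdim X)"
    "emb q * s = Idm (rdim M)" "j * l + s * emb q = Idm (rdim P)" "emb q * j = 0"
    using is_syzygyD[OF assms(1)] .
  obtain P' q' j' l' s' where 2: "projective_cover P' q' M'" "hom X' P' j'"
    "rect (rdim X') (rdim P') l'" "rect (rdim P') (rdim M') s'" "l' * j' = Idm (rdim X')"
    "emb q' * s' = Idm (rdim M')" "j' * l' + s' * emb q' = Idm (rdim P')" "emb q' * j' = 0"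
    using is_syzygyD[OF assms(2)] .
  obtain h g f e where h: "hom P P' h" "hom P' P g" "h * g = Idm (rdim P')" "g * h = Idm (rdim P)"
    "hom M M' f" "hom M' M e" "emb q' * h = f * emb q" "emb q * g = e * emb q'"
    using projective_cover_unique[OF 1(1) 2(1) assms(3)] .
  have "emb q' * (h * j) = 0" by (simp add: mult.assoc[symmetric] h(7)) (simp add: mult.assoc 1(8))
  note a = short_exact_factor[OF X(2) projective_coverD(2)[OF 2(1)] 2(2,5,3,7) hom_comp[OF h(1) 1(2)] this]
  have "emb q * (g * j') = 0" by (simp add: mult.assoc[symmetric] h(8)) (simp add: mult.assoc 2(8))
  note b = short_exact_factor[OF X(1) projective_coverD(2)[OF 1(1)] 1(2,5,3,7) hom_comp[OF h(2) 2(2)] this]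
  show ?thesis
  proof (rule isoI[OF X a(2) b(2)])
    have "l * (g * j') * (l' * (h * j)) = l * (g * (j' * (l' * (h * j))))" by (simp add: mult.assoc)
    also have "\<dots> = Idm (rdim X)" by (simp only: a(1) assoc_rew[OF h(4)] homD[OF 1(2)] 1(5))
    finally show "l * (g * j') * (l' * (h * j)) = Idm (rdim X)" .
    have "l' * (h * j) * (l * (g * j')) = l' * (h * (j * (l * (g * j'))))" by (simp add: mult.assoc)
    also have "\<dots> = Idm (rdim X')" by (simp only: b(1) assoc_rew[OF h(3)] homD[OF 2(2)] 2(5))
    finally show "l' * (h * j) * (l * (g * j')) = Idm (rdim X')" .
  qed
qed

text \<open>The last condition, that the kernel lies in the radical of \<open>P\<close>, makes \<open>P\<close> a projective cover
  of \<open>C\<close>.\<close>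

definition minimal_exact :: "rep \<Rightarrow> rep \<Rightarrow> rep \<Rightarrow> bool" where
  "minimal_exact A P C \<longleftrightarrow> higman_projective P \<and> is_module A \<and> is_module C \<and> (\<exists>j q l s u v. hom A P j \<and> hom P C q \<and>
     rect (rdim A) (rdim P) l \<and> rect (rdim P) (rdim C) s \<and>
     l * j = Idm (rdim A) \<and> q * s = Idm (rdim C) \<and> j * l + s * q = Idm (rdim P) \<and>
     j = x1 P * u + x2 P * v)"

lemma msesE:
  assumes "minimal_exact A P C"
  obtains j q l s u v where "higman_projective P" "is_module A" "is_module C" "hom A P j" "hom P C q"
     "rect (rdim A) (rdim P) l" "rect (rdim P) (rdim C) s"
     "l * j = Idm (rdim A)" "q * s = Idm (rdim C)" "j * l + s * q = Idm (rdim P)"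
     "j = x1 P * u + x2 P * v"
  using assms unfolding minimal_exact_def by (elim exE conjE) (rule that)

lemma minimal_exact_short_exact: "minimal_exact A P C \<Longrightarrow> short_exact A P C"
  by (elim msesE) (rule sesI[OF _ higman_projective_module])

lemma minimal_exact_iso:
  assumes "minimal_exact A P C" "C \<cong>\<^sub>K C'" shows "minimal_exact A P C'"
proof -
  obtain j q l s u v where *: "higman_projective P" "is_module A" "is_module C" "hom A P j" "hom P C q"
     "rect (rdim A) (rdim P) l" "rect (rdim P) (rdim C) s"
     "l * j = Idm (rdim A)" "q * s = Idm (rdim C)" "j * l + s * q = Idm (rdim P)"
     "j = x1 P * u + x2 P * v" using msesE[OF assms(1)] .
  obtain f e where f: "is_module C" "is_module C'" "hom C C' f" "hom C' C e"
    "f * e = Idm (rdim C')" "e * f = Idm (rdim C)" using isoE[OF assms(2)] .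
  have "f * q * (s * e) = Idm (rdim C')"
    by (simp add: mult.assoc assoc_rew[OF *(9)] homD[OF f(4)] f(5))
  moreover have "j * l + s * e * (f * q) = Idm (rdim P)"
    using *(10) by (simp add: mult.assoc assoc_rew[OF f(6)] homD[OF *(5)])
  ultimately show ?thesis
    unfolding minimal_exact_def using *(1,2,4,6,8,11) f(2) hom_comp[OF f(3) *(5)] rect_times[OF *(7) hom_rect[OF f(4)]]
    by (intro conjI exI[of _ j] exI[of _ "f * q"] exI[of _ l] exI[of _ "s * e"] exI[of _ u] exI[of _ v])
qed

lemma minimal_exact_cover:
  assumes "minimal_exact A P C"
  obtains q where "projective_cover P q C" "is_syzygy A C"
proof -
  obtain j q l s u v where *: "higman_projective P" "is_module A" "is_module C" "hom A P j" "hom P C q"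
     "rect (rdim A) (rdim P) l" "rect (rdim P) (rdim C) s"
     "l * j = Idm (rdim A)" "q * s = Idm (rdim C)" "j * l + s * q = Idm (rdim P)"
     "j = x1 P * u + x2 P * v" using msesE[OF assms] .
  have P: "is_module P" by (rule higman_projective_module[OF *(1)])
  let ?q = "prj (rdim C) (rdim P) q" and ?j = "prj (rdim P) (rdim A) j"
  have ej: "emb ?j = j" "emb ?q = q"
    by (rule emb_prj[OF hom_rect[OF *(4)]], rule emb_prj[OF hom_rect[OF *(5)]])
  have ex: "mono_mat ?j \<and> epi_mat ?q \<and> image_of ?j = mat_kernel ?q"
    by (subst exact_mat_iff[of _ "rdim P" "rdim A" _ "rdim C"])
      (use *(6-10) in \<open>auto simp: ej\<close>)
  have cov: "projective_cover P ?q C"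
    unfolding projective_cover_def
  proof (intro conjI allI impI ballI)
    show "projective P" by (rule higman_projective_projective[OF *(1)])
    show "is_module C" "?q \<in> module_homs P C" "epi_mat ?q"
      using * ex prj_hom[OF P *(3,5)] by auto
    fix X f assume X: "is_module X" "f \<in> module_homs X P" "epi_mat (?q * f)"
    have c: "f \<in> carrier_mat (rdim P) (rdim X)" using module_homs_carrier[OF X(2)] .
    have f: "hom X P (emb f)" by (rule hom_emb[OF X(1) P X(2)])
    have "?q * f \<in> carrier_mat (rdim C) (rdim X)" using c by auto
    then obtain r where r: "rect (rdim X) (rdim C) r" "emb (?q * f) * r = Idm (rdim C)"
      using epi_mat_iff X(3) by blast
    then have qfr: "q * emb f * r = Idm (rdim C)" using c by (simp add: emb_mult ej)
    obtain D c s' where D: "is_module D" "hom P D c" "c * emb f = 0"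
      "\<exists>t. rect (rdim X) (rdim P) t \<and> s' * c = Idm (rdim P) - emb f * t"
      using hom_cokernel[OF X(1) P f] by metis
    \<comment> \<open>Nakayama: the cokernel \<open>D\<close> satisfies \<open>D = rad D\<close>, hence vanishes.\<close>
    define m where "m = l * (Idm (rdim P) - emb f * r * q)"
    have qk: "q * (Idm (rdim P) - emb f * r * q) = 0"
      by (simp add: right_diff_distrib mult.assoc[symmetric] qfr homD[OF *(5)])
    have "j * m + s * (q * (Idm (rdim P) - emb f * r * q)) = Idm (rdim P) - emb f * r * q"
      unfolding m_def mult.assoc[symmetric] distrib_right[symmetric] *(10)
      by (simp add: right_diff_distrib homD[OF f] mult.assoc)
    then have jm: "j * m = Idm (rdim P) - emb f * r * q" by (simp add: qk)
    have "c = c * (j * m)"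
      by (simp add: jm right_diff_distrib homD[OF D(2)] mult.assoc[symmetric] D(3))
    also have "\<dots> = x1 D * (c * (u * m)) + x2 D * (c * (v * m))"
      by (simp add: *(11) distrib_left distrib_right mult.assoc homD[OF D(2)])
    finally have cc: "c = x1 D * (c * (u * m)) + x2 D * (c * (v * m))" .
    \<comment> \<open>The equation \<open>cc\<close> puts the image of \<open>c\<close> into the
      radical of \<open>D\<close>. Substituting it into itself uses up the nilpotency: first
      \<xi>1\<xi>2 kills \<open>c\<close>, then \<xi>1 and \<xi>2 do, and then \<open>cc\<close>
      reads \<open>c = 0\<close>.\<close>
    have thc: "th D * c = 0" by (subst cc) (simp add: distrib_left mod_simps D(1) mult.assoc)
    have thc2: "x1 D * (x2 D * (c * z)) = 0" for z using thc by (metis mult.assoc mult_zero_left)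
    have x1c: "x1 D * (c * z) = 0" for z
    proof -
      have "x1 D * (c * z) = x1 D * ((x1 D * (c * (u * m)) + x2 D * (c * (v * m))) * z)" using cc by simp
      also have "\<dots> = 0" by (simp add: distrib_left distrib_right mult.assoc mod_simps D(1) thc2)
      finally show ?thesis .
    qed
    have x2c: "x2 D * (c * z) = 0" for z
    proof -
      have "x2 D * (c * z) = x2 D * ((x1 D * (c * (u * m)) + x2 D * (c * (v * m))) * z)" using cc by simp
      also have "\<dots> = 0" by (simp add: distrib_left distrib_right mult.assoc mod_simps D(1) thc2)
      finally show ?thesis .
    qed
    have "c = 0" using cc by (simp add: x1c x2c)
    then obtain t where "rect (rdim X) (rdim P) t" "Idm (rdim P) = emb f * t" using D(4) by auto
    then show "epi_mat f" using epi_mat_iff[OF c] by metis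
  qed
  have "is_syzygy A C"
    unfolding is_syzygy_def using *(2) cov prj_hom[OF *(2) P *(4)] ex by blast
  with cov show ?thesis using that by blast
qed

text \<open>An explicit minimal sequence shows that the choice in \<open>syzygy\<close> is made from
  a nonempty set; uniqueness of syzygies then identifies the chosen module.\<close>

lemma syzygy_iso: assumes "minimal_exact A P C" "C \<cong>\<^sub>K M" shows "syzygy M \<cong>\<^sub>K A"
proof -
  have M: "minimal_exact A P M" by (rule minimal_exact_iso[OF assms])
  obtain q where "is_syzygy A M" using minimal_exact_cover[OF M] .
  then have "is_syzygy (syzygy M) M"
    unfolding syzygy_def is_syzygy_def[symmetric] by (rule someI)
  then show ?thesis using is_syzygy_unique[OF _ \<open>is_syzygy A M\<close> iso_refl] M by (auto simp: minimal_exact_def)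
qed

lemma proj_cover_iso: assumes "minimal_exact A P C" "C \<cong>\<^sub>K M" shows "proj_cover M \<cong>\<^sub>K P"
proof -
  obtain q where q: "projective_cover P q M" using minimal_exact_cover[OF minimal_exact_iso[OF assms]] .
  then have "\<exists>q. projective_cover (proj_cover M) q M"
    unfolding proj_cover_def by (intro someI_ex[of "\<lambda>P. \<exists>q. projective_cover P q M"]) blast
  then obtain q' where q': "projective_cover (proj_cover M) q' M" by blast
  obtain h g where "hom (proj_cover M) P h" "hom P (proj_cover M) g" "h * g = Idm (rdim P)"
    "g * h = Idm (rdim (proj_cover M))"
    using projective_cover_unique[OF q' q iso_refl[OF projective_coverD(3)[OF q]]] .
  then show ?thesis using isoI projective_coverD(2)[OF q] projective_coverD(2)[OF q'] by blast
qed

subsection \<open>Duality between covers and hulls\<close>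

lemma module_homs_trp:
  assumes "is_module M" "is_module N"
  shows "f \<in> module_homs M N \<longleftrightarrow> transpose_mat f \<in> module_homs (trp N) (trp M)"
proof -
  have "f \<in> module_homs M N \<Longrightarrow> transpose_mat f \<in> module_homs (trp N) (trp M)"
    if "is_module M" "is_module N" for M N f
  proof -
    assume f: "f \<in> module_homs M N"
    have c: "f \<in> carrier_mat (rdim N) (rdim M)" using module_homs_carrier[OF f] .
    have "transpose_mat (act N g * f) = transpose_mat (f * act M g)" for g using f by (simp add: module_homs_def)
    then have "transpose_mat f * transpose_mat (act N g) = transpose_mat (act M g) * transpose_mat f" for g
      using transpose_mult[OF is_module_carrier[OF that(2), of g] c]
        transpose_mult[OF c is_module_carrier[OF that(1), of g]] by metis
    then show ?thesis using c by (simp add: module_homs_def trp_def)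
  qed
  from this[OF assms] this[OF module_trp[OF assms(2)] module_trp[OF assms(1)]] show ?thesis
    by (metis transpose_transpose trp_trp)
qed

lemma mono_transpose: "mono_mat (transpose_mat f) \<longleftrightarrow> epi_mat f"
proof -
  let ?m = "dim_row f" and ?n = "dim_col f"
  have "(\<exists>l. rect ?m ?n l \<and> l * tp (emb f) = Idm ?m) \<longleftrightarrow> (\<exists>r. rect ?n ?m r \<and> emb f * r = Idm ?m)"
    by (metis rect_tp tp_times tp_Idm tp_tp)
  then show ?thesis
    using mono_mat_iff[of "transpose_mat f" ?n ?m] epi_mat_iff[of f ?m ?n] by (simp add: emb_transpose)
qed

lemma epi_transpose: "epi_mat (transpose_mat f) \<longleftrightarrow> mono_mat f"
  using mono_transpose[of "transpose_mat f"] by simp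

lemma exact_transpose:
  assumes "j \<in> carrier_mat n k" "q \<in> carrier_mat m n"
    "mono_mat j" "epi_mat q" "image_of j = mat_kernel q"
  shows "image_of (transpose_mat q) = mat_kernel (transpose_mat j)"
proof -
  obtain l s where *: "rect k n l" "rect n m s" "l * emb j = Idm k" "emb q * s = Idm m"
      "emb j * l + s * emb q = Idm n"
    using exact_mat_iff[OF assms(1,2)] assms by metis
  have "tp s * tp (emb q) = Idm m" "tp (emb j) * tp l = Idm k" "tp (emb q) * tp s + tp l * tp (emb j) = Idm n"
    using arg_cong[OF *(4), of tp] arg_cong[OF *(3), of tp] arg_cong[OF *(5), of tp] by (simp_all add: add.commute)
  then have "\<exists>l s. rect m n l \<and> rect n k s \<and> l * emb (transpose_mat q) = Idm m \<and>
      emb (transpose_mat j) * s = Idm k \<and> emb (transpose_mat q) * l + s * emb (transpose_mat j) = Idm n"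
    using rect_tp[OF *(1)] rect_tp[OF *(2)] by (auto simp: emb_transpose)
  then show ?thesis using exact_mat_iff[of "transpose_mat q" n m "transpose_mat j" k] assms(1,2) by simp
qed

lemma projective_trp: assumes "injective I" shows "projective (trp I)"
  unfolding projective_def
proof (intro conjI allI impI ballI)
  have I: "is_module I" using assms by (simp add: injective_def)
  then show "is_module (trp I)" by simp
  fix M N q f assume M: "is_module M \<and> is_module N" and q: "q \<in> module_homs M N" "epi_mat q"
    and f: "f \<in> module_homs (trp I) N"
  have "transpose_mat q \<in> module_homs (trp N) (trp M)" using module_homs_trp M q by blast
  moreover have tf: "transpose_mat f \<in> module_homs (trp N) I" using module_homs_trp[of "trp I" N f] M f I by simp
  ultimately obtain h where h: "h \<in> module_homs (trp M) I" "h * transpose_mat q = transpose_mat f"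
    using assms M q mono_transpose[of q] unfolding injective_def by (metis module_trp)
  have c: "h \<in> carrier_mat (rdim I) (rdim M)" "q \<in> carrier_mat (rdim N) (rdim M)"
    using module_homs_carrier[OF h(1)] module_homs_carrier[OF q(1)] by simp_all
  have "transpose_mat h \<in> module_homs (trp I) M" using module_homs_trp[of "trp M" I h] M I h by simp
  moreover have "q * transpose_mat h = f"
    using arg_cong[OF h(2), of transpose_mat] transpose_mult[OF c(1), of "transpose_mat q"] c(2) by simp
  ultimately show "\<exists>h\<in>module_homs (trp I) M. q * h = f" by blast
qed

lemma injective_trp: assumes "projective P" shows "injective (trp P)"
  unfolding injective_def
proof (intro conjI allI impI ballI)
  have P: "is_module P" using assms by (simp add: projective_def)
  then show "is_module (trp P)" by simp
  fix M N j f assume M: "is_module M \<and> is_module N" and j: "j \<in> module_homs M N" "mono_mat j"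
    and f: "f \<in> module_homs M (trp P)"
  have "transpose_mat j \<in> module_homs (trp N) (trp M)" using module_homs_trp M j by blast
  moreover have tf: "transpose_mat f \<in> module_homs P (trp M)" using module_homs_trp[of M "trp P" f] M f P by simp
  ultimately obtain h where h: "h \<in> module_homs P (trp N)" "transpose_mat j * h = transpose_mat f"
    using assms M j epi_transpose[of j] unfolding projective_def by (metis module_trp)
  have c: "h \<in> carrier_mat (rdim N) (rdim P)" "j \<in> carrier_mat (rdim N) (rdim M)"
    using module_homs_carrier[OF h(1)] module_homs_carrier[OF j(1)] by simp_all
  have "transpose_mat h \<in> module_homs N (trp P)" using module_homs_trp[of P "trp N" h] M P h by simp
  moreover have "transpose_mat h * j = f"
    using arg_cong[OF h(2), of transpose_mat] transpose_mult[OF _ c(1), of "transpose_mat j" "rdim M"] c(2) by simp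
  ultimately show "\<exists>h\<in>module_homs N (trp P). h * j = f" by blast
qed

lemma projective_cover_trp:
  assumes "injective_hull I j M" shows "projective_cover (trp I) (transpose_mat j) (trp M)"
  unfolding projective_cover_def
proof (intro conjI allI impI ballI)
  have I: "is_module I" and M: "is_module M" and j: "j \<in> module_homs M I" "mono_mat j"
    using assms by (auto simp: injective_hull_def injective_def)
  show "projective (trp I)" using projective_trp assms by (simp add: injective_hull_def)
  show "is_module (trp M)" using M by simp
  show "transpose_mat j \<in> module_homs (trp I) (trp M)" using module_homs_trp[OF M I] j by simp
  show "epi_mat (transpose_mat j)" using epi_transpose j by simp
  fix X f assume X: "is_module X" "f \<in> module_homs X (trp I)" "epi_mat (transpose_mat j * f)"
  have c: "f \<in> carrier_mat (rdim I) (rdim X)" "j \<in> carrier_mat (rdim I) (rdim M)"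
    using module_homs_carrier[OF X(2)] module_homs_carrier[OF j(1)] by simp_all
  have tf: "transpose_mat f \<in> module_homs I (trp X)" using module_homs_trp[of X "trp I" f] X I by simp
  have "transpose_mat (transpose_mat f * j) = transpose_mat j * f"
    using transpose_mult[of "transpose_mat f" "rdim X" "rdim I" j] c by simp
  then have "mono_mat (transpose_mat f * j)" using X(3) epi_transpose by metis
  then have "mono_mat (transpose_mat f)" using assms X(1) tf unfolding injective_hull_def by (metis module_trp)
  then show "epi_mat f" using mono_transpose by simp
qed

lemma injective_hull_trp:
  assumes "projective_cover P q M" shows "injective_hull (trp P) (transpose_mat q) (trp M)"
  unfolding injective_hull_def
proof (intro conjI allI impI ballI)
  have P: "is_module P" and M: "is_module M" and q: "q \<in> module_homs P M" "epi_mat q"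
    using assms by (auto simp: projective_cover_def projective_def)
  show "injective (trp P)" using injective_trp assms by (simp add: projective_cover_def)
  show "is_module (trp M)" using M by simp
  show "transpose_mat q \<in> module_homs (trp M) (trp P)" using module_homs_trp[OF P M] q by simp
  show "mono_mat (transpose_mat q)" using mono_transpose q by simp
  fix X f assume X: "is_module X" "f \<in> module_homs (trp P) X" "mono_mat (f * transpose_mat q)"
  have c: "f \<in> carrier_mat (rdim X) (rdim P)" "q \<in> carrier_mat (rdim M) (rdim P)"
    using module_homs_carrier[OF X(2)] module_homs_carrier[OF q(1)] by simp_all
  have tf: "transpose_mat f \<in> module_homs (trp X) P" using module_homs_trp[of "trp P" X f] X P by simp
  have "transpose_mat (q * transpose_mat f) = f * transpose_mat q"
    using transpose_mult[of q "rdim M" "rdim P" "transpose_mat f"] c by simp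
  then have "epi_mat (q * transpose_mat f)" using X(3) mono_transpose by metis
  then have "epi_mat (transpose_mat f)" using assms X(1) tf unfolding projective_cover_def by (metis module_trp)
  then show "mono_mat f" using epi_transpose by simp
qed

lemma is_syzygy_trp: assumes "is_cosyzygy X M" shows "is_syzygy (trp X) (trp M)"
proof -
  obtain I j q where *: "is_module X" "injective_hull I j M" "q \<in> module_homs I X" "epi_mat q"
    "mat_kernel q = image_of j" using assms unfolding is_cosyzygy_def by blast
  have I: "is_module I" "is_module M" "j \<in> module_homs M I" "mono_mat j"
    using *(2) by (auto simp: injective_hull_def injective_def)
  have "image_of (transpose_mat q) = mat_kernel (transpose_mat j)"
    by (rule exact_transpose[OF module_homs_carrier[OF I(3)] module_homs_carrier[OF *(3)] I(4) *(4) *(5)[symmetric]])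
  moreover have "mono_mat (transpose_mat q)" using mono_transpose *(4) by simp
  moreover have "transpose_mat q \<in> module_homs (trp X) (trp I)" using module_homs_trp[OF I(1) *(1)] *(3) by simp
  ultimately show ?thesis unfolding is_syzygy_def using projective_cover_trp[OF *(2)] *(1) by (metis module_trp)
qed

lemma is_cosyzygy_trp: assumes "is_syzygy X M" shows "is_cosyzygy (trp X) (trp M)"
proof -
  obtain P q j where *: "is_module X" "projective_cover P q M" "j \<in> module_homs X P" "mono_mat j"
    "image_of j = mat_kernel q" using assms unfolding is_syzygy_def by blast
  have P: "is_module P" "is_module M" "q \<in> module_homs P M" "epi_mat q"
    using *(2) by (auto simp: projective_cover_def projective_def)
  have "image_of (transpose_mat q) = mat_kernel (transpose_mat j)"
    by (rule exact_transpose[OF module_homs_carrier[OF *(3)] module_homs_carrier[OF P(3)] *(4) P(4) *(5)])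
  moreover have "epi_mat (transpose_mat j)" using epi_transpose *(4) by simp
  moreover have "transpose_mat j \<in> module_homs (trp P) (trp X)" using module_homs_trp[OF *(1) P(1)] *(3) by simp
  ultimately show ?thesis unfolding is_cosyzygy_def using injective_hull_trp[OF *(2)] *(1) by (metis module_trp)
qed

text \<open>Cosyzygies are transposed syzygies of the transposed module, so a minimal projective
  sequence suffices and no injective hull has to be constructed.\<close>

lemma cosyzygy_iso: assumes "minimal_exact A P C" "C \<cong>\<^sub>K trp M" shows "cosyzygy M \<cong>\<^sub>K trp A"
proof -
  obtain q where s: "is_syzygy A (trp M)" using minimal_exact_cover[OF minimal_exact_iso[OF assms]] .
  then have "is_cosyzygy (trp A) M" using is_cosyzygy_trp by fastforce
  then have "is_cosyzygy (cosyzygy M) M"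
    unfolding cosyzygy_def is_cosyzygy_def[symmetric] by (rule someI)
  then have "is_syzygy (trp (cosyzygy M)) (trp M)" by (rule is_syzygy_trp)
  then have "trp (cosyzygy M) \<cong>\<^sub>K A" using is_syzygy_unique[OF _ s iso_refl] assms(2) iso_module by blast
  then show ?thesis using iso_trp by fastforce
qed

subsection \<open>Kronecker modules\<close>

declare add_bit_eq_xor [simp del]

lemma bit_add_one_one [simp]: "r + 1 + 1 = (r :: bit)" by (simp add: add.assoc)

text \<open>\<open>M\<close> has top \<open>\<complex>\<^sup>a\<close> of parity \<open>t\<close> and socle part \<open>\<complex>\<^sup>b\<close> of the opposite parity, and
  \<open>\<xi>\<^sub>1, \<xi>\<^sub>2\<close> act by the pencil \<open>X, Y : \<complex>\<^sup>a \<rightarrow> \<complex>\<^sup>b\<close>.\<close>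

definition KR_data :: "rep \<Rightarrow> bit \<Rightarrow> nat \<Rightarrow> nat \<Rightarrow> fmat \<Rightarrow> fmat \<Rightarrow> fmat \<Rightarrow> fmat \<Rightarrow> fmat \<Rightarrow> fmat \<Rightarrow> bool" where
  "KR_data M t a b X Y iT pT iS pS \<longleftrightarrow> is_module M \<and>
     rect (rdim M) a iT \<and> rect a (rdim M) pT \<and> rect (rdim M) b iS \<and> rect b (rdim M) pS \<and>
     rect b a X \<and> rect b a Y \<and>
     pT * iT = Idm a \<and> pS * iS = Idm b \<and> pT * iS = 0 \<and> pS * iT = 0 \<and>
     iT * pT + iS * pS = Idm (rdim M) \<and>
     kk M = sgn_bit t *\<^sub>C (iT * pT - iS * pS) \<and> x1 M = iS * X * pT \<and> x2 M = iS * Y * pT"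

definition kronecker :: "rep \<Rightarrow> bit \<Rightarrow> nat \<Rightarrow> nat \<Rightarrow> fmat \<Rightarrow> fmat \<Rightarrow> bool" where
  "kronecker M t a b X Y \<longleftrightarrow> (\<exists>iT pT iS pS. KR_data M t a b X Y iT pT iS pS)"

lemma krE:
  assumes "kronecker M t a b X Y" obtains iT pT iS pS where "KR_data M t a b X Y iT pT iS pS"
  using assms unfolding kronecker_def by blast

lemma krI: "KR_data M t a b X Y iT pT iS pS \<Longrightarrow> kronecker M t a b X Y"
  unfolding kronecker_def by blast

lemma KR_dataD:
  assumes "KR_data M t a b X Y iT pT iS pS"
  shows "is_module M" "rect (rdim M) a iT" "rect a (rdim M) pT" "rect (rdim M) b iS" "rect b (rdim M) pS"
     "rect b a X" "rect b a Y"
     "pT * iT = Idm a" "pS * iS = Idm b" "pT * iS = 0" "pS * iT = 0"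
     "iT * pT + iS * pS = Idm (rdim M)"
     "kk M = sgn_bit t *\<^sub>C (iT * pT - iS * pS)" "x1 M = iS * X * pT" "x2 M = iS * Y * pT"
  using assms unfolding KR_data_def by blast+

lemma KR_simps:
  assumes "KR_data M t a b X Y iT pT iS pS"
  shows "kk M * iT = sgn_bit t *\<^sub>C iT" "kk M * iS = - sgn_bit t *\<^sub>C iS"
    "pT * kk M = sgn_bit t *\<^sub>C pT" "pS * kk M = - sgn_bit t *\<^sub>C pS"
    "x1 M * iT = iS * X" "x1 M * iS = 0" "x2 M * iT = iS * Y" "x2 M * iS = 0"
    "pT * x1 M = 0" "pS * x1 M = X * pT" "pT * x2 M = 0" "pS * x2 M = Y * pT"
  using KR_dataD(8-11)[OF assms] KR_dataD(2-7)[OF assms, THEN rectD(1)] KR_dataD(2-7)[OF assms, THEN rectD(2)]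
  by (simp_all add: KR_dataD(13-15)[OF assms] left_diff_distrib right_diff_distrib
      mult.assoc KR_dataD(8-11)[OF assms, THEN assoc_rew] KR_dataD(2-7)[OF assms, THEN rectD(3)]
      KR_dataD(2-7)[OF assms, THEN rectD(4)])

lemma KR_simps2:
  assumes "KR_data M t a b X Y iT pT iS pS"
  shows "kk M * (iT * z) = sgn_bit t *\<^sub>C (iT * z)" "kk M * (iS * z) = - sgn_bit t *\<^sub>C (iS * z)"
    "pT * (kk M * z) = sgn_bit t *\<^sub>C (pT * z)" "pS * (kk M * z) = - sgn_bit t *\<^sub>C (pS * z)"
    "x1 M * (iT * z) = iS * (X * z)" "x1 M * (iS * z) = 0" "x2 M * (iT * z) = iS * (Y * z)" "x2 M * (iS * z) = 0"
    "pT * (x1 M * z) = 0" "pS * (x1 M * z) = X * (pT * z)" "pT * (x2 M * z) = 0" "pS * (x2 M * z) = Y * (pT * z)"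
  using KR_simps[OF assms, THEN assoc_rew] by (simp_all add: mult.assoc)

lemmas KR_rules = KR_simps KR_simps2 KR_dataD(8-11) KR_dataD(8-11)[THEN assoc_rew]
  KR_dataD(2-7)[THEN rectD(1)] KR_dataD(2-7)[THEN rectD(2)]
  KR_dataD(2-7)[THEN rectD(3)] KR_dataD(2-7)[THEN rectD(4)]

lemma kronecker_module: "kronecker M t a b X Y \<Longrightarrow> is_module M"
  by (auto simp: kronecker_def KR_data_def)

lemma kronecker_rects: "kronecker M t a b X Y \<Longrightarrow> rect b a X" "kronecker M t a b X Y \<Longrightarrow> rect b a Y"
  by (auto simp: kronecker_def KR_data_def)

lemma kronecker_tr:
  assumes "kronecker M t a b X Y"
  shows "rdim M = a + b" "tr (kk M) = sgn_bit t * (of_nat a - of_nat b)"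
proof -
  obtain iT pT iS pS where d: "KR_data M t a b X Y iT pT iS pS" using krE[OF assms] .
  have t: "tr (iT * pT) = of_nat a" "tr (iS * pS) = of_nat b"
    by (simp_all add: tr_commute[of iT] tr_commute[of iS] KR_dataD(8,9)[OF d] tr_Idm)
  show "tr (kk M) = sgn_bit t * (of_nat a - of_nat b)"
    by (simp add: KR_dataD(13)[OF d] tr_scaleC tr_minus t)
  have "(of_nat (rdim M) :: complex) = of_nat (a + b)"
    using arg_cong[OF KR_dataD(12)[OF d], of tr] by (simp add: tr_plus t tr_Idm)
  then show "rdim M = a + b" using of_nat_eq_iff by blast
qed

lemma kronecker_th: "kronecker M t a b X Y \<Longrightarrow> th M = 0"
  by (elim krE) (simp add: KR_dataD(15) KR_rules mult.assoc)

lemma kronecker_parity: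
  assumes "kronecker M t a b X Y"
  shows "x1 M * kk M = sgn_bit t *\<^sub>C x1 M" "x2 M * kk M = sgn_bit t *\<^sub>C x2 M"
  using assms by (elim krE; simp add: KR_dataD(14,15) KR_rules mult.assoc)+

lemma KR_data_mk:
  fixes t :: bit
  assumes r: "rect n a iT" "rect a n pT" "rect n b iS" "rect b n pS" "rect b a X" "rect b a Y"
    and p: "pT * iT = Idm a" "pS * iS = Idm b" "pT * iS = 0" "pS * iT = 0"
    and sum: "iT * pT + iS * pS = Idm n"
  shows "KR_data (mk n (sgn_bit t *\<^sub>C (iT * pT - iS * pS)) (iS * X * pT) (iS * Y * pT)) t a b X Y iT pT iS pS"
proof -
  let ?K = "sgn_bit t *\<^sub>C (iT * pT - iS * pS)" and ?X = "iS * X * pT" and ?Y = "iS * Y * pT"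
  note rr = r[THEN rectD(1)] r[THEN rectD(2)] r[THEN rectD(3)] r[THEN rectD(4)] p p[THEN assoc_rew]
    left_diff_distrib right_diff_distrib distrib_left distrib_right mult.assoc
  have rK: "rect n n ?K" "rect n n ?X" "rect n n ?Y"
    by (intro rect_scaleC rect_minus rect_times[OF r(1,2)] rect_times[OF r(3,4)]
        rect_times[OF rect_times[OF r(3,5)] r(2)] rect_times[OF rect_times[OF r(3,6)] r(2)])+
  have mod: "is_module (mk n ?K ?X ?Y)"
  proof (rule module_mk[OF rK])
    show "?K * ?K = Idm n"
      unfolding sum[symmetric] by (simp add: rr scaleC_diff scaleC_add)
  qed (simp_all add: rr scaleC_diff scaleC_add)
  show ?thesis
    unfolding KR_data_def rdim_mk ac_mk[OF rK] using mod r p sum by simp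
qed

definition Kr :: "bit \<Rightarrow> nat \<Rightarrow> nat \<Rightarrow> fmat \<Rightarrow> fmat \<Rightarrow> rep" where
  "Kr t a b X Y = mk (a + b) (sgn_bit t *\<^sub>C (Idm a * Idm a - Sh a b * tp (Sh a b)))
     (Sh a b * X * Idm a) (Sh a b * Y * Idm a)"

lemma kronecker_Kr: assumes "rect b a X" "rect b a Y" shows "kronecker (Kr t a b X Y) t a b X Y"
proof -
  have "KR_data (Kr t a b X Y) t a b X Y (Idm a) (Idm a) (Sh a b) (tp (Sh a b))"
    unfolding Kr_def
    by (rule KR_data_mk) (use assms Sh_tpSh[of a b] in \<open>auto simp: tpSh_Sh intro!: rect_Idm rect_Sh rect_tp\<close>)
  then show ?thesis by (rule krI)
qed

text \<open>Strict equivalence of matrix pencils. One-sided inverses suffice because \<alpha> and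
  \<beta> are square.\<close>

definition pencil_iso :: "nat \<Rightarrow> nat \<Rightarrow> fmat \<Rightarrow> fmat \<Rightarrow> fmat \<Rightarrow> fmat \<Rightarrow> bool" where
  "pencil_iso a b X Y X' Y' \<longleftrightarrow> (\<exists>\<alpha> \<alpha>' \<beta> \<beta>'. rect a a \<alpha> \<and> rect a a \<alpha>' \<and> rect b b \<beta> \<and> rect b b \<beta>' \<and>
     \<alpha>' * \<alpha> = Idm a \<and> \<beta>' * \<beta> = Idm b \<and> \<beta> * X = X' * \<alpha> \<and> \<beta> * Y = Y' * \<alpha>)"

lemma pencil_iso_refl: "rect b a X \<Longrightarrow> rect b a Y \<Longrightarrow> pencil_iso a b X Y X Y"
  unfolding pencil_iso_def by (intro exI[of _ "Idm a"] exI[of _ "Idm b"]) (simp add: rectD)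

text \<open>A common scalar is absorbed by the base change of the target. This removes the signs
  that come from the antipode and from K acting on V(r).\<close>

lemma pencil_iso_scale:
  assumes "rect b a X" "rect b a Y" "c \<noteq> 0" shows "pencil_iso a b X Y (c *\<^sub>C X) (c *\<^sub>C Y)"
  unfolding pencil_iso_def
  by (rule exI[of _ "Idm a"], rule exI[of _ "Idm a"], rule exI[of _ "c *\<^sub>C Idm b"], rule exI[of _ "(1/c) *\<^sub>C Idm b"])
    (use assms in \<open>simp add: rectD rect_scaleC\<close>)

lemma pencil_iso_trans:
  assumes "pencil_iso a b X Y X' Y'" "pencil_iso a b X' Y' X'' Y''" shows "pencil_iso a b X Y X'' Y''"
proof -
  obtain \<alpha> \<alpha>' \<beta> \<beta>' where 1: "rect a a \<alpha>" "rect a a \<alpha>'" "rect b b \<beta>" "rect b b \<beta>'"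
    "\<alpha>' * \<alpha> = Idm a" "\<beta>' * \<beta> = Idm b" "\<beta> * X = X' * \<alpha>" "\<beta> * Y = Y' * \<alpha>"
    using assms(1) unfolding pencil_iso_def by (elim exE conjE) (rule that)
  obtain \<gamma> \<gamma>' \<delta> \<delta>' where 2: "rect a a \<gamma>" "rect a a \<gamma>'" "rect b b \<delta>" "rect b b \<delta>'"
    "\<gamma>' * \<gamma> = Idm a" "\<delta>' * \<delta> = Idm b" "\<delta> * X' = X'' * \<gamma>" "\<delta> * Y' = Y'' * \<gamma>"
    using assms(2) unfolding pencil_iso_def by (elim exE conjE) (rule that)
  have "\<delta> * \<beta> * X = X'' * (\<gamma> * \<alpha>)" "\<delta> * \<beta> * Y = Y'' * (\<gamma> * \<alpha>)"
    by (simp_all add: mult.assoc 1(7,8) 2(7,8)[THEN assoc_rew])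
  moreover have "\<alpha>' * \<gamma>' * (\<gamma> * \<alpha>) = Idm a" "\<beta>' * \<delta>' * (\<delta> * \<beta>) = Idm b"
    by (simp_all add: mult.assoc 1(5,6) 2(5,6)[THEN assoc_rew] rectD[OF 1(1)] rectD[OF 1(3)])
  moreover have "rect a a (\<gamma> * \<alpha>)" "rect a a (\<alpha>' * \<gamma>')" "rect b b (\<delta> * \<beta>)" "rect b b (\<beta>' * \<delta>')"
    using 1(1-4) 2(1-4) rect_times by blast+
  ultimately show ?thesis unfolding pencil_iso_def by blast
qed

lemma kronecker_iso:
  assumes "kronecker M t a b X Y" "kronecker N t a b X' Y'" "pencil_iso a b X Y X' Y'" shows "M \<cong>\<^sub>K N"
proof -
  obtain iT pT iS pS where d: "KR_data M t a b X Y iT pT iS pS" using krE[OF assms(1)] .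
  obtain iT' pT' iS' pS' where d': "KR_data N t a b X' Y' iT' pT' iS' pS'" using krE[OF assms(2)] .
  obtain \<alpha> \<alpha>' \<beta> \<beta>' where 1: "rect a a \<alpha>" "rect a a \<alpha>'" "rect b b \<beta>" "rect b b \<beta>'"
    "\<alpha>' * \<alpha> = Idm a" "\<beta>' * \<beta> = Idm b" "\<beta> * X = X' * \<alpha>" "\<beta> * Y = Y' * \<alpha>"
    using assms(3) unfolding pencil_iso_def by (elim exE conjE) (rule that)
  note r = KR_rules[OF d] KR_rules[OF d'] 1(5-8) 1(5-8)[THEN assoc_rew] mult.assoc distrib_left distrib_right
    rectD[OF 1(1)] rectD[OF 1(2)] rectD[OF 1(3)] rectD[OF 1(4)]
  define f where "f = iT' * \<alpha> * pT + iS' * \<beta> * pS"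
  define h where "h = iT * \<alpha>' * pT' + iS * \<beta>' * pS'"
  note D = KR_dataD[OF d] and D' = KR_dataD[OF d']
  have f: "hom M N f"
  proof (rule homI)
    show "rect (rdim N) (rdim M) f" unfolding f_def
      by (intro rect_plus rect_times[OF rect_times[OF D'(2) 1(1)] D(3)] rect_times[OF rect_times[OF D'(4) 1(3)] D(5)])
  qed (simp_all add: f_def r scaleC_add)
  have h: "rect (rdim M) (rdim N) h" unfolding h_def
    by (intro rect_plus rect_times[OF rect_times[OF D(2) 1(2)] D'(3)] rect_times[OF rect_times[OF D(4) 1(4)] D'(5)])
  have "h * f = Idm (rdim M)" using D(12) by (simp add: h_def f_def r)
  then show ?thesis
    by (rule isoI_left_inverse[OF D(1) D'(1) f h]) (simp add: kronecker_tr(1)[OF assms(1)] kronecker_tr(1)[OF assms(2)])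
qed

lemma kronecker_iso_refl: "kronecker M t a b X Y \<Longrightarrow> kronecker N t a b X Y \<Longrightarrow> M \<cong>\<^sub>K N"
  by (rule kronecker_iso) (auto intro: pencil_iso_refl kronecker_rects)

lemma kronecker_trp: assumes "kronecker M t a b X Y" shows "kronecker (trp M) (t + 1) b a (tp X) (tp Y)"
proof -
  obtain iT pT iS pS where d: "KR_data M t a b X Y iT pT iS pS" using krE[OF assms] .
  note D = KR_dataD[OF d]
  have "KR_data (trp M) (t + 1) b a (tp X) (tp Y) (tp pS) (tp iS) (tp pT) (tp iT)"
    unfolding KR_data_def
  proof (intro conjI)
    show "tp pS * tp iS + tp pT * tp iT = Idm (rdim (trp M))"
      using arg_cong[OF D(12), of tp] by (simp add: add.commute)
    show "kk (trp M) = sgn_bit (t + 1) *\<^sub>C (tp pS * tp iS - tp pT * tp iT)"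
      by (simp add: D(13) scaleC_diff)
    show "tp iS * tp pS = Idm b" "tp iT * tp pT = Idm a" "tp iS * tp pT = 0" "tp iT * tp pS = 0"
      using arg_cong[OF D(9), of tp] arg_cong[OF D(8), of tp] arg_cong[OF D(10), of tp] arg_cong[OF D(11), of tp]
      by simp_all
    show "x1 (trp M) = tp pT * tp X * tp iS" "x2 (trp M) = tp pT * tp Y * tp iS"
      by (simp_all add: D(14,15) mult.assoc)
  qed (use D(1-7) in \<open>simp_all add: rect_tp\<close>)
  then show ?thesis by (rule krI)
qed

subsection \<open>Syzygies of Kronecker modules\<close>

text \<open>The six equations express that \<open>0 \<rightarrow> \<complex>\<^sup>z \<rightarrow> \<complex>\<^sup>a \<oplus> \<complex>\<^sup>a \<rightarrow> \<complex>\<^sup>b \<rightarrow> 0\<close>, with maps \<open>(A, B)\<close> and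
  \<open>(X | Y)\<close>, is split exact.\<close>

definition exact_pair :: "nat \<Rightarrow> nat \<Rightarrow> nat \<Rightarrow> fmat \<Rightarrow> fmat \<Rightarrow> fmat \<Rightarrow> fmat \<Rightarrow> bool" where
  "exact_pair a b z X Y A B \<longleftrightarrow> rect a z A \<and> rect a z B \<and> (\<exists>l1 l2 s1 s2.
     rect z a l1 \<and> rect z a l2 \<and> rect a b s1 \<and> rect a b s2 \<and>
     l1 * A + l2 * B = Idm z \<and> X * s1 + Y * s2 = Idm b \<and>
     A * l1 + s1 * X = Idm a \<and> A * l2 + s1 * Y = 0 \<and> B * l1 + s2 * X = 0 \<and> B * l2 + s2 * Y = Idm a)"

text \<open>The kernel of the cover consists of the elements \<xi>1 A z + \<xi>2 B z and of all of
  the degree two part. On such an element \<xi>1 gives \<xi>1\<xi>2 B z and \<xi>2 gives -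
  \<xi>1\<xi>2 A z, whence the pencil \<open>(B, - A)\<close> and the shifted parity.\<close>

lemma kronecker_minimal_exact:
  assumes "kronecker M t a b X Y" "kronecker N (t + 1) z a B (- A)" "exact_pair a b z X Y A B"
  shows "minimal_exact N (free_rep t a) M"
proof -
  obtain iT pT iS pS where d: "KR_data M t a b X Y iT pT iS pS" using krE[OF assms(1)] .
  obtain iT' pT' iS' pS' where d': "KR_data N (t + 1) z a B (- A) iT' pT' iS' pS'" using krE[OF assms(2)] .
  obtain i0 i1 i2 i3 p0 p1 p2 p3 where e: "free_rep_data (free_rep t a) t a i0 i1 i2 i3 p0 p1 p2 p3"
    using free_rep_data_free_rep by blast
  note D = KR_dataD[OF d] and D' = KR_dataD[OF d'] and E = free_rep_dataD[OF e]
  obtain l1 l2 s1 s2 where x: "rect a z A" "rect a z B" "rect z a l1" "rect z a l2" "rect a b s1" "rect a b s2"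
     "l1 * A + l2 * B = Idm z" "X * s1 + Y * s2 = Idm b"
     "A * l1 + s1 * X = Idm a" "A * l2 + s1 * Y = 0" "B * l1 + s2 * X = 0" "B * l2 + s2 * Y = Idm a"
    using assms(3) unfolding exact_pair_def by (elim exE conjE) (rule that)
  note r = KR_rules[OF d] KR_rules[OF d'] free_rep_rules[OF e] mult.assoc distrib_left distrib_right
    left_diff_distrib right_diff_distrib
    x(1-6)[THEN rectD(1)] x(1-6)[THEN rectD(2)] x(1-6)[THEN rectD(3)] x(1-6)[THEN rectD(4)]
  define j where "j = i1 * A * pT' + i2 * B * pT' + i3 * pS'"
  define q where "q = iT * p0 + iS * X * p1 + iS * Y * p2"
  define l where "l = iT' * l1 * p1 + iT' * l2 * p2 + iS' * p3"
  define s where "s = i0 * pT + i1 * s1 * pS + i2 * s2 * pS"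
  have j: "hom N (free_rep t a) j"
  proof (rule homI)
    show "rect (rdim (free_rep t a)) (rdim N) j" unfolding j_def
      by (intro rect_plus rect_times[OF rect_times[OF E(3) x(1)] D'(3)] rect_times[OF rect_times[OF E(4) x(2)] D'(3)]
          rect_times[OF E(5) D'(5)])
  qed (simp_all add: j_def r scaleC_add)
  have q: "hom (free_rep t a) M q"
  proof (rule homI)
    show "rect (rdim M) (rdim (free_rep t a)) q" unfolding q_def
      by (intro rect_plus rect_times[OF rect_times[OF D(4,6)] E(7)] rect_times[OF rect_times[OF D(4,7)] E(8)]
          rect_times[OF D(2) E(6)])
  qed (simp_all add: q_def r scaleC_add)
  have l: "rect (rdim N) (rdim (free_rep t a)) l" unfolding l_def
    by (intro rect_plus rect_times[OF rect_times[OF D'(2) x(3)] E(7)] rect_times[OF rect_times[OF D'(2) x(4)] E(8)]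
          rect_times[OF D'(4) E(9)])
  have s: "rect (rdim (free_rep t a)) (rdim M) s" unfolding s_def
    by (intro rect_plus rect_times[OF rect_times[OF E(3) x(5)] D(5)] rect_times[OF rect_times[OF E(4) x(6)] D(5)]
          rect_times[OF E(2) D(3)])
  have lj: "l * j = Idm (rdim N)"
  proof -
    have "l * j = iT' * (l1 * A + l2 * B) * pT' + iS' * pS'" by (simp add: l_def j_def r)
    then show ?thesis using D'(12) by (simp add: x(7) r)
  qed
  have qs: "q * s = Idm (rdim M)"
  proof -
    have "q * s = iT * pT + iS * (X * s1 + Y * s2) * pS" by (simp add: q_def s_def r)
    then show ?thesis using D(12) by (simp add: x(8) r)
  qed
  have jl: "j * l + s * q = Idm (rdim (free_rep t a))"
  proof -
    have "j * l + s * q = i0 * p0 + i1 * (A * l1 + s1 * X) * p1 + i1 * (A * l2 + s1 * Y) * p2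
        + i2 * (B * l1 + s2 * X) * p1 + i2 * (B * l2 + s2 * Y) * p2 + i3 * p3"
      by (simp add: j_def l_def q_def s_def r algebra_simps)
    also have "\<dots> = i0 * p0 + i1 * p1 + i2 * p2 + i3 * p3" by (simp add: x(9-12) r)
    finally show ?thesis by (simp only: E(26))
  qed
  have "j = x1 (free_rep t a) * (i0 * A * pT' + i2 * pS') + x2 (free_rep t a) * (i0 * B * pT')"
    by (simp add: j_def r algebra_simps)
  then show ?thesis
    unfolding minimal_exact_def using higman_projective_free_rep kronecker_module[OF assms(2)] kronecker_module[OF assms(1)] j q l s lj qs jl
    by (intro conjI exI) assumption+
qed

section \<open>Superdiagonal matrices and the syzygies of the simple modules\<close>

definition Up :: "nat \<Rightarrow> fmat" where "Up k = (\<Sum>i<k. Eu i (Suc i))"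

lemma ent_Up: "ent (Up k) i j = (if i < k \<and> j = Suc i then 1 else 0)"
proof -
  have "ent (Up k) i j = (\<Sum>l<k. if l = i then (if j = Suc i then 1 else 0) else 0)"
    unfolding Up_def ent_sum by (intro sum.cong) (auto simp: ent_Eu)
  then show ?thesis by simp
qed

lemma ent_Up_times [simp]: "ent (Up k * f) i j = (if i < k then ent f (Suc i) j else 0)"
proof -
  have "ent (Up k * f) i j = (\<Sum>l<Suc k. ent (Up k) i l * ent f l j)"
    by (rule ent_times_left) (auto simp: ent_Up)
  also have "\<dots> = (\<Sum>l<Suc k. if l = Suc i then (if i < k then ent f (Suc i) j else 0) else 0)"
    by (intro sum.cong) (auto simp: ent_Up)
  finally show ?thesis by simp
qed

lemma ent_times_Up [simp]: "ent (f * Up k) i j = (if 0 < j \<and> j \<le> k then ent f i (j - 1) else 0)"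
proof -
  have "ent (f * Up k) i j = (\<Sum>l<k. ent f i l * ent (Up k) l j)"
    by (rule ent_times_right) (auto simp: ent_Up)
  also have "\<dots> = (\<Sum>l<k. if l = j - 1 then (if 0 < j then ent f i (j - 1) else 0) else 0)"
    by (intro sum.cong) (auto simp: ent_Up)
  finally show ?thesis by (simp, linarith)
qed

lemma ent_times_tpUp [simp]: "ent (f * tp (Up k)) i j = (if j < k then ent f i (Suc j) else 0)"
  using ent_Up_times[of k "tp f" j i] by (metis ent_tp tp_times tp_tp)

lemma rect_Up: "k \<le> m \<Longrightarrow> k < n \<Longrightarrow> rect m n (Up k)" by (rule rect_entI) (auto simp: ent_Up)

text \<open>Kronecker's singular block of size \<open>k\<close> by \<open>k + 1\<close>, with
  \<open>Up k\<close> its superdiagonal; the transposed block gives \<open>Wn\<close>. These model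
  the k-th syzygy and cosyzygy of V(r), and \<open>parity k\<close> enters because every step flips
  the parity. The nilpotent Jordan block of size \<open>n\<close> is
  \<open>Up (n - 1)\<close>.\<close>

definition Wp :: "nat \<Rightarrow> bit \<Rightarrow> rep" where "Wp k r = Kr (r + parity k) (k + 1) k (Idm k) (Up k)"
definition Wn :: "nat \<Rightarrow> bit \<Rightarrow> rep" where "Wn k r = Kr (r + parity k + 1) k (k + 1) (Idm k) (tp (Up k))"

lemma parity_simps [simp]: "parity 0 = 0" "parity (Suc k) = parity k + 1" "parity 1 = 1"
  by (simp_all add: parity_def)
lemma parity_add: "parity (m + n) = parity m + parity n" by (simp add: parity_def)

lemma kronecker_Wp: "kronecker (Wp k r) (r + parity k) (k + 1) k (Idm k) (Up k)"
  unfolding Wp_def by (rule kronecker_Kr) (auto intro: rect_Idm rect_Up)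

lemma kronecker_Wn: "kronecker (Wn k r) (r + parity k + 1) k (k + 1) (Idm k) (tp (Up k))"
  unfolding Wn_def by (rule kronecker_Kr) (auto intro: rect_Idm rect_tp[OF rect_Up])

lemma minimal_exact_Wp: "minimal_exact (Wp (Suc k) r) (free_rep (r + parity k) (k + 1)) (Wp k r)"
proof (rule kronecker_minimal_exact[OF kronecker_Wp])
  have e: "r + parity (Suc k) = r + parity k + 1" by (simp add: add.assoc)
  show "kronecker (Wp (Suc k) r) (r + parity k + 1) (Suc k + 1) (k + 1) (Idm (Suc k)) (- (- Up (Suc k)))"
    using kronecker_Wp[of "Suc k" r] unfolding e unfolding minus_minus Suc_eq_plus1 .
  show "exact_pair (k + 1) k (Suc k + 1) (Idm k) (Up k) (- Up (Suc k)) (Idm (Suc k))"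
    unfolding exact_pair_def
  proof (intro conjI)
    \<comment> \<open>The block \<open>Idm (Suc k)\<close> misses only the last of the
      \<open>k + 2\<close> coordinates. That coordinate is seen by row \<open>k\<close> of
      \<open>Up (Suc k)\<close>, so \<open>- Eu (Suc k) k\<close> recovers it.\<close>
    show "\<exists>l1 l2 s1 s2. rect (Suc k + 1) (k + 1) l1 \<and> rect (Suc k + 1) (k + 1) l2 \<and> rect (k + 1) k s1 \<and>
        rect (k + 1) k s2 \<and> l1 * (- Up (Suc k)) + l2 * Idm (Suc k) = Idm (Suc k + 1) \<and>
        Idm k * s1 + Up k * s2 = Idm k \<and> (- Up (Suc k)) * l1 + s1 * Idm k = Idm (k + 1) \<and>
        (- Up (Suc k)) * l2 + s1 * Up k = 0 \<and> Idm (Suc k) * l1 + s2 * Idm k = 0 \<and>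
        Idm (Suc k) * l2 + s2 * Up k = Idm (k + 1)"
      by (rule exI[of _ "- Eu (Suc k) k"], rule exI[of _ "Idm (Suc k)"], rule exI[of _ "Idm k"], rule exI[of _ 0])
        (auto intro!: fmat_eqI rect_uminus rect_Idm simp: ent_Up ent_Idm ent_Eu split: if_splits)
  qed (auto intro!: rect_uminus rect_Up rect_Idm)
qed

lemma minimal_exact_Wn: "minimal_exact (Wn k r) (free_rep (r + parity k) (k + 1)) (Wn (Suc k) r)"
proof -
  have e: "r + parity (Suc k) + 1 = r + parity k" by (simp add: add.assoc)
  have c: "kronecker (Wn (Suc k) r) (r + parity k) (k + 1) (Suc k + 1) (Idm (Suc k)) (tp (Up (Suc k)))"
    using kronecker_Wn[of "Suc k" r] unfolding e unfolding Suc_eq_plus1 .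
  show ?thesis
  proof (rule kronecker_minimal_exact[OF c])
    show "kronecker (Wn k r) (r + parity k + 1) k (k + 1) (Idm k) (- (- tp (Up k)))" using kronecker_Wn[of k r] by simp
    show "exact_pair (k + 1) (Suc k + 1) k (Idm (Suc k)) (tp (Up (Suc k))) (- tp (Up k)) (Idm k)"
      unfolding exact_pair_def
    proof (intro conjI)
      show "\<exists>l1 l2 s1 s2. rect k (k + 1) l1 \<and> rect k (k + 1) l2 \<and> rect (k + 1) (Suc k + 1) s1 \<and>
          rect (k + 1) (Suc k + 1) s2 \<and> l1 * (- tp (Up k)) + l2 * Idm k = Idm k \<and>
          Idm (Suc k) * s1 + tp (Up (Suc k)) * s2 = Idm (Suc k + 1) \<and>
          (- tp (Up k)) * l1 + s1 * Idm (Suc k) = Idm (k + 1) \<and>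
          (- tp (Up k)) * l2 + s1 * tp (Up (Suc k)) = 0 \<and> Idm k * l1 + s2 * Idm (Suc k) = 0 \<and>
          Idm k * l2 + s2 * tp (Up (Suc k)) = Idm (k + 1)"
        by (rule exI[of _ 0], rule exI[of _ "Idm k"], rule exI[of _ "Idm (Suc k)"], rule exI[of _ "Eu k (Suc k)"])
          (auto intro!: fmat_eqI rect_Idm simp: ent_Up ent_Idm ent_Eu split: if_splits)
    qed (auto intro!: rect_uminus rect_Idm rect_tp[OF rect_Up])
  qed
qed

subsection \<open>The listed modules\<close>

lemma ac_V_mod: "kk (V_mod r) = sgn_bit r *\<^sub>C Idm 1" "x1 (V_mod r) = 0" "x2 (V_mod r) = 0"
  by (simp_all add: ac_def V_mod_def emb_smult emb_one emb_zero)

lemma rdim_V_mod [simp]: "rdim (V_mod r) = 1" by (simp add: V_mod_def)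

lemma module_V_mod [simp]: "is_module (V_mod r)"
proof -
  have "act (V_mod r) g \<in> carrier_mat 1 1" for g by (cases g) (auto simp: V_mod_def)
  then show ?thesis unfolding module_iff ac_V_mod rdim_V_mod by simp
qed

lemma kronecker_V_mod: "kronecker (V_mod r) r 1 0 0 0"
proof -
  have "KR_data (V_mod r) r 1 0 0 0 (Idm 1) (Idm 1) 0 0" by (simp add: KR_data_def ac_V_mod)
  then show ?thesis unfolding kronecker_def by blast
qed

text \<open>The same module regarded as pure socle instead of pure top, whence the opposite parity:
  V(r) begins the family \<open>Wp\<close> in one reading and the family \<open>Wn\<close> in the
  other.\<close>

lemma kronecker_V_mod': "kronecker (V_mod r) (r + 1) 0 1 0 0"
proof -
  have "KR_data (V_mod r) (r + 1) 0 1 0 0 0 0 (Idm 1) (Idm 1)" by (simp add: KR_data_def ac_V_mod)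
  then show ?thesis unfolding kronecker_def by blast
qed

lemma Up_zero [simp]: "Up 0 = 0" by (simp add: Up_def)

lemma V_mod_Wp: "V_mod r \<cong>\<^sub>K Wp 0 r"
  using kronecker_iso_refl[OF kronecker_V_mod] kronecker_Wp[of 0 r] by simp
lemma V_mod_Wn: "V_mod r \<cong>\<^sub>K Wn 0 r"
  using kronecker_iso_refl[OF kronecker_V_mod'] kronecker_Wn[of 0 r] by simp

lemma P_mod_Pc: "P_mod r \<cong>\<^sub>K Pc r"
  unfolding P_mod_def Pc_def using proj_cover_iso[OF minimal_exact_Wp[of 0 r] iso_sym[OF V_mod_Wp]] by simp

lemma Omega_Wp: "Omega (int s) (V_mod r) \<cong>\<^sub>K Wp s r"
proof -
  have "(syzygy ^^ s) (V_mod r) \<cong>\<^sub>K Wp s r"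
    by (induction s) (simp_all add: V_mod_Wp syzygy_iso[OF minimal_exact_Wp] iso_sym)
  then show ?thesis by (simp add: Omega_def)
qed

lemma trp_Wn: "Wp k r \<cong>\<^sub>K trp (Wn k r)"
  by (rule kronecker_iso_refl[OF kronecker_Wp]) (use kronecker_trp[OF kronecker_Wn[of k r]] in \<open>simp add: add.assoc\<close>)

lemma Omega_Wn: "Omega (- int s) (V_mod r) \<cong>\<^sub>K Wn s r"
proof -
  have "(cosyzygy ^^ s) (V_mod r) \<cong>\<^sub>K Wn s r"
  proof (induction s)
    case (Suc s)
    have "Wp s r \<cong>\<^sub>K trp ((cosyzygy ^^ s) (V_mod r))" using iso_trans[OF trp_Wn iso_trp[OF iso_sym[OF Suc]]] .
    then have "cosyzygy ((cosyzygy ^^ s) (V_mod r)) \<cong>\<^sub>K trp (Wp (Suc s) r)" by (rule cosyzygy_iso[OF minimal_exact_Wp])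
    also have "\<dots> \<cong>\<^sub>K Wn (Suc s) r" using iso_trp[OF trp_Wn[of "Suc s" r]] by simp
    finally show ?case by simp
  qed (simp add: V_mod_Wn)
  then show ?thesis by (cases "s = 0") (simp_all add: Omega_def)
qed

text \<open>Coefficients for which \<xi>1 = a + b N and \<xi>2 = c + d N with N the nilpotent Jordan
  block. The point \<eta> has homogeneous coordinates (a : c), so the finite and the infinite case
  can be treated alike.\<close>

definition pencil_coeffs :: "cp1 \<Rightarrow> complex \<times> complex \<times> complex \<times> complex" where
  "pencil_coeffs \<eta> = (case \<eta> of Fin c \<Rightarrow> (1, 0, c, 1) | Infty \<Rightarrow> (0, 1, 1, 0))"

definition MX :: "nat \<Rightarrow> cp1 \<Rightarrow> fmat" where
  "MX n \<eta> = (case pencil_coeffs \<eta> of (a, b, c, d) \<Rightarrow> a *\<^sub>C Idm n + b *\<^sub>C Up (n - 1))"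
definition MY :: "nat \<Rightarrow> cp1 \<Rightarrow> fmat" where
  "MY n \<eta> = (case pencil_coeffs \<eta> of (a, b, c, d) \<Rightarrow> c *\<^sub>C Idm n + d *\<^sub>C Up (n - 1))"

lemma rect_MX: "n > 0 \<Longrightarrow> rect n n (MX n \<eta>)" and rect_MY: "n > 0 \<Longrightarrow> rect n n (MY n \<eta>)"
  by (auto simp: MX_def MY_def split: prod.splits intro!: rect_plus rect_scaleC rect_Up)

lemma emb_e_to_f: "emb (e_to_f n) = Sh n n * Idm n"
  by (auto intro!: fmat_eqI simp: ent_emb e_to_f_def ent_Sh)

lemma emb_e_to_prev_f: "emb (e_to_prev_f n) = Sh n n * Up (n - 1) * Idm n"
  by (auto intro!: fmat_eqI simp: ent_emb e_to_prev_f_def ent_Sh ent_Up)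

lemma dims_e_to [simp]: "dim_row (e_to_f n) = 2 * n" "dim_col (e_to_f n) = 2 * n"
  "dim_row (e_to_prev_f n) = 2 * n" "dim_col (e_to_prev_f n) = 2 * n"
  by (simp_all add: e_to_f_def e_to_prev_f_def)

lemma kronecker_M_mod: assumes "n > 0" shows "kronecker (M_mod n r \<eta>) (r + 1) n n (MX n \<eta>) (MY n \<eta>)"
proof -
  let ?S = "Sh n n"
  have K: "kk (M_mod n r \<eta>) = sgn_bit (r + 1) *\<^sub>C (Idm n * Idm n - ?S * tp ?S)"
    by (auto intro!: fmat_eqI simp: ac_def M_mod_def ent_emb ent_Idm ent_Sh)
  have X: "x1 (M_mod n r \<eta>) = ?S * MX n \<eta> * Idm n"
    by (cases \<eta>) (simp_all add: ac_def M_mod_def MX_def pencil_coeffs_def emb_e_to_f emb_e_to_prev_f mult.assoc)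
  have Y: "x2 (M_mod n r \<eta>) = ?S * MY n \<eta> * Idm n"
    by (cases \<eta>) (simp_all add: ac_def M_mod_def MY_def pencil_coeffs_def emb_e_to_f emb_e_to_prev_f mult.assoc
        emb_add emb_smult distrib_left distrib_right)
  have "KR_data (mk (n + n) (sgn_bit (r + 1) *\<^sub>C (Idm n * Idm n - ?S * tp ?S)) (?S * MX n \<eta> * Idm n)
      (?S * MY n \<eta> * Idm n)) (r + 1) n n (MX n \<eta>) (MY n \<eta>) (Idm n) (Idm n) ?S (tp ?S)"
    by (rule KR_data_mk)
      (use assms Sh_tpSh[of n n] in \<open>auto simp: tpSh_Sh rect_MX rect_MY intro!: rect_Idm rect_Sh rect_tp\<close>)
  then have k: "KR_data (Kr (r + 1) n n (MX n \<eta>) (MY n \<eta>)) (r + 1) n n (MX n \<eta>) (MY n \<eta>) (Idm n) (Idm n) ?S (tp ?S)"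
    by (simp only: Kr_def)
  note D = KR_dataD[OF k]
  have rd: "rdim (M_mod n r \<eta>) = n + n" by (simp add: M_mod_def)
  have rdK: "rdim (Kr (r + 1) n n (MX n \<eta>) (MY n \<eta>)) = n + n" by (simp add: Kr_def)
  have c: "act (M_mod n r \<eta>) g \<in> carrier_mat (rdim (M_mod n r \<eta>)) (rdim (M_mod n r \<eta>))" for g
    by (cases g; cases \<eta>) (auto simp: M_mod_def)
  have "is_module (M_mod n r \<eta>)"
    using D(1) c unfolding module_iff D(13-15) rdK by (simp only: K X Y rd) blast
  then have "KR_data (M_mod n r \<eta>) (r + 1) n n (MX n \<eta>) (MY n \<eta>) (Idm n) (Idm n) ?S (tp ?S)"
    using D(2-12) unfolding KR_data_def rdK rd K X Y by simp
  then show ?thesis by (rule krI)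
qed

text \<open>As \<open>MX n \<eta>\<close> and \<open>MY n \<eta>\<close> commute, the pair
  \<open>(- MY n \<eta>, MX n \<eta>)\<close> spans the kernel of the cover in degree one and the
  syzygy pencil is the original one. Only the parity changes. One of the two matrices is the
  identity, which supplies the splitting.\<close>

lemma minimal_exact_M_mod: assumes "n > 0" shows "minimal_exact (M_mod n (r + 1) \<eta>) (free_rep (r + 1) n) (M_mod n r \<eta>)"
proof (rule kronecker_minimal_exact[OF kronecker_M_mod[OF assms]])
  show "kronecker (M_mod n (r + 1) \<eta>) (r + 1 + 1) n n (MX n \<eta>) (- (- MY n \<eta>))"
    using kronecker_M_mod[OF assms, of "r + 1" \<eta>] by simp
  note r = rect_Up[of "n - 1" n n] rectD[OF rect_Up[of "n - 1" n n]]
  show "exact_pair n n n (MX n \<eta>) (MY n \<eta>) (- MY n \<eta>) (MX n \<eta>)"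
    unfolding exact_pair_def
  proof (intro conjI)
    show "\<exists>l1 l2 s1 s2. rect n n l1 \<and> rect n n l2 \<and> rect n n s1 \<and> rect n n s2 \<and>
        l1 * (- MY n \<eta>) + l2 * MX n \<eta> = Idm n \<and> MX n \<eta> * s1 + MY n \<eta> * s2 = Idm n \<and>
        (- MY n \<eta>) * l1 + s1 * MX n \<eta> = Idm n \<and> (- MY n \<eta>) * l2 + s1 * MY n \<eta> = 0 \<and>
        MX n \<eta> * l1 + s2 * MX n \<eta> = 0 \<and> MX n \<eta> * l2 + s2 * MY n \<eta> = Idm n"
    proof (cases \<eta>)
      case (Fin c)
      show ?thesis
        by (rule exI[of _ 0], rule exI[of _ "Idm n"], rule exI[of _ "Idm n"], rule exI[of _ 0])
          (use Fin assms in \<open>simp add: MX_def MY_def pencil_coeffs_def r distrib_left distrib_right left_diff_distrib\<close>)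
    next
      case Infty
      show ?thesis
        by (rule exI[of _ "- Idm n"], rule exI[of _ 0], rule exI[of _ 0], rule exI[of _ "Idm n"])
          (use Infty assms in \<open>simp add: MX_def MY_def pencil_coeffs_def r rect_uminus\<close>)
    qed
  qed (use assms in \<open>auto intro: rect_uminus rect_MX rect_MY\<close>)
qed

subsection \<open>Duals\<close>

lemma rdim_dual [simp]: "rdim (dual M) = rdim M" by (simp add: dual_def)

lemma ac_dual:
  assumes "is_module M"
  shows "kk (dual M) = tp (kk M)" "x1 (dual M) = - tp (kk M * x1 M)" "x2 (dual M) = - tp (kk M * x2 M)"
proof -
  have d: "dim_row (act M g) = rdim M" "dim_col (act M g) = rdim M" for g
    using is_module_carrier[OF assms, of g] by auto
  show "kk (dual M) = tp (kk M)" "x1 (dual M) = - tp (kk M * x1 M)" "x2 (dual M) = - tp (kk M * x2 M)"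
    by (simp_all add: ac_def dual_simps[OF assms] emb_transpose emb_uminus emb_mult d)
qed

lemma module_dual: assumes "is_module M" shows "is_module (dual M)"
  unfolding module_iff
proof (intro conjI allI)
  have c: "act M g \<in> carrier_mat (rdim M) (rdim M)" for g by (rule is_module_carrier[OF assms])
  show "act (dual M) g \<in> carrier_mat (rdim (dual M)) (rdim (dual M))" for g
    using dual_simps[OF assms] c mult_carrier_mat[OF c c] by (cases g) auto
  have t: "tp (kk M) * tp (kk M) = Idm (rdim M)" using mod_rels(1)[OF assms] by (simp flip: tp_times)
  show "kk (dual M) * kk (dual M) = Idm (rdim (dual M))" by (simp add: ac_dual assms t)
  show "x1 (dual M) * x1 (dual M) = 0" "x2 (dual M) * x2 (dual M) = 0"
    "kk (dual M) * x1 (dual M) = - (x1 (dual M) * kk (dual M))"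
    "kk (dual M) * x2 (dual M) = - (x2 (dual M) * kk (dual M))"
    "x1 (dual M) * x2 (dual M) = - (x2 (dual M) * x1 (dual M))"
    by (simp_all add: ac_dual assms mod_simps mult.assoc flip: tp_times tp_uminus)
qed

lemma hom_dual:
  assumes "is_module M" "is_module N" "hom M N f" shows "hom (dual N) (dual M) (tp f)"
proof (rule homI)
  show "rect (rdim (dual M)) (rdim (dual N)) (tp f)" using rect_tp[OF hom_rect[OF assms(3)]] by simp
qed (simp_all add: ac_dual assms homD[OF assms(3)] mult.assoc flip: tp_times)

lemma dual_cong: assumes "M \<cong>\<^sub>K N" shows "dual M \<cong>\<^sub>K dual N"
proof -
  obtain f h where *: "is_module M" "is_module N" "hom M N f" "hom N M h"
    "f * h = Idm (rdim N)" "h * f = Idm (rdim M)" using isoE[OF assms] .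
  show ?thesis
    by (rule isoI[OF module_dual[OF *(1)] module_dual[OF *(2)] hom_dual[OF *(2,1,4)] hom_dual[OF *(1,2,3)]])
      (simp_all add: * flip: tp_times)
qed

text \<open>The images of \<xi>1 and \<xi>2 lie in the socle, where K acts by
  \<open>- sgn_bit t\<close>. The antipode therefore contributes only the global factor
  \<open>sgn_bit t\<close>.\<close>

lemma kronecker_dual:
  assumes "kronecker M t a b X Y"
  shows "kronecker (dual M) (t + 1) b a (sgn_bit t *\<^sub>C tp X) (sgn_bit t *\<^sub>C tp Y)"
proof -
  obtain iT pT iS pS where d: "KR_data M t a b X Y iT pT iS pS" using krE[OF assms] .
  note D = KR_dataD[OF d]
  have "KR_data (dual M) (t + 1) b a (sgn_bit t *\<^sub>C tp X) (sgn_bit t *\<^sub>C tp Y) (tp pS) (tp iS) (tp pT) (tp iT)"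
    unfolding KR_data_def
  proof (intro conjI)
    show "is_module (dual M)" by (rule module_dual[OF D(1)])
    show "tp pS * tp iS + tp pT * tp iT = Idm (rdim (dual M))"
      using arg_cong[OF D(12), of tp] by (simp add: add.commute)
    show "kk (dual M) = sgn_bit (t + 1) *\<^sub>C (tp pS * tp iS - tp pT * tp iT)"
      by (simp add: D(13) scaleC_diff ac_dual[OF D(1)])
    show "tp iS * tp pS = Idm b" "tp iT * tp pT = Idm a" "tp iS * tp pT = 0" "tp iT * tp pS = 0"
      using arg_cong[OF D(9), of tp] arg_cong[OF D(8), of tp] arg_cong[OF D(10), of tp] arg_cong[OF D(11), of tp]
      by simp_all
    have "kk M * x1 M = - sgn_bit t *\<^sub>C (iS * X * pT)" "kk M * x2 M = - sgn_bit t *\<^sub>C (iS * Y * pT)"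
      by (simp_all add: D(14,15) KR_rules[OF d] mult.assoc)
    then show "x1 (dual M) = tp pT * (sgn_bit t *\<^sub>C tp X) * tp iS" "x2 (dual M) = tp pT * (sgn_bit t *\<^sub>C tp Y) * tp iS"
      by (simp_all add: ac_dual[OF D(1)] mult.assoc del: tp_times) (simp_all add: mult.assoc)
  qed (use D(2-7) in \<open>simp_all add: rect_tp rect_scaleC\<close>)
  then show ?thesis by (rule krI)
qed

lemma dual_kronecker_iso:
  assumes "kronecker M t a b X Y" "kronecker N (t + 1) b a (tp X) (tp Y)" shows "dual M \<cong>\<^sub>K N"
  by (rule iso_sym, rule kronecker_iso[OF assms(2) kronecker_dual[OF assms(1)]], rule pencil_iso_scale)
    (use kronecker_rects[OF assms(2)] in auto)

lemma dual_Wp: "dual (Wp s r) \<cong>\<^sub>K Wn s r"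
  using dual_kronecker_iso[OF kronecker_Wp] kronecker_Wn[of s r] by simp

lemma dual_V_mod: "dual (V_mod r) \<cong>\<^sub>K V_mod r"
  using dual_kronecker_iso[OF kronecker_V_mod] kronecker_V_mod'[of r] by simp

lemma dual_M_mod: assumes "n > 0" shows "dual (M_mod n r \<eta>) \<cong>\<^sub>K M_mod n (r + 1) \<eta>"
proof -
  have k: "kronecker (M_mod n (r + 1) \<eta>) (r + 1 + 1) n n (MX n \<eta>) (MY n \<eta>)" using kronecker_M_mod[OF assms] .
  note k' = kronecker_dual[OF kronecker_M_mod[OF assms, of r \<eta>]]
  \<comment> \<open>Reversing the basis turns the transposed Jordan block back.\<close>
  define R where "R = (\<Sum>i<n. Eu i (n - 1 - i))"
  have R: "ent R i j = (if i < n \<and> j = n - 1 - i then 1 else 0)" for i j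
  proof -
    have "ent R i j = (\<Sum>k<n. if k = i then (if j = n - 1 - i then 1 else 0) else 0)"
      unfolding R_def ent_sum by (intro sum.cong) (auto simp: ent_Eu)
    then show ?thesis by simp
  qed
  have rR: "rect n n R" by (rule rect_entI) (use assms in \<open>auto simp: R\<close>)
  have Rt: "ent (R * f) i j = (if i < n then ent f (n - 1 - i) j else 0)" for f i j
  proof -
    have "ent (R * f) i j = (\<Sum>k<n. ent R i k * ent f k j)"
      by (rule ent_times_left) (use assms in \<open>auto simp: R\<close>)
    also have "\<dots> = (\<Sum>k<n. if k = n - 1 - i then (if i < n then ent f (n - 1 - i) j else 0) else 0)"
      by (intro sum.cong) (auto simp: R)
    finally show ?thesis using assms by simp
  qed
  have RR: "R * R = Idm n"
  proof (rule fmat_eqI)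
    fix i j show "ent (R * R) i j = ent (Idm n) i j" unfolding Rt R ent_Idm using assms by auto
  qed
  have RU: "R * tp (Up (n - 1)) = Up (n - 1) * R"
  proof (rule fmat_eqI)
    fix i j show "ent (R * tp (Up (n - 1))) i j = ent (Up (n - 1) * R) i j"
      unfolding Rt ent_Up_times ent_tp ent_Up R using assms by auto
  qed
  have "R * tp (MX n \<eta>) = MX n \<eta> * R" "R * tp (MY n \<eta>) = MY n \<eta> * R"
    by (simp_all add: MX_def MY_def RU rectD[OF rR] distrib_left distrib_right split: prod.splits)
  then have "pencil_iso n n (tp (MX n \<eta>)) (tp (MY n \<eta>)) (MX n \<eta>) (MY n \<eta>)"
    unfolding pencil_iso_def using rR RR by blast
  moreover have "pencil_iso n n (sgn_bit (r + 1) *\<^sub>C tp (MX n \<eta>)) (sgn_bit (r + 1) *\<^sub>C tp (MY n \<eta>)) (tp (MX n \<eta>)) (tp (MY n \<eta>))"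
    using pencil_iso_scale[of n n "sgn_bit (r + 1) *\<^sub>C tp (MX n \<eta>)" "sgn_bit (r + 1) *\<^sub>C tp (MY n \<eta>)" "sgn_bit (r + 1)"]
      assms by (simp add: rect_scaleC rect_uminus rect_tp rect_MX rect_MY)
  ultimately show ?thesis using kronecker_iso[OF k' k] pencil_iso_trans by blast
qed

lemma dual_Pc: "dual (Pc r) \<cong>\<^sub>K Pc r"
proof (rule Pc_char)
  show m: "is_module (dual (Pc r))" by (rule module_dual) simp
  have "th (dual (Pc r)) = tp (kk (Pc r) * x2 (Pc r) * (kk (Pc r) * x1 (Pc r)))"
    by (simp add: ac_dual flip: tp_times)
  also have "kk (Pc r) * x2 (Pc r) * (kk (Pc r) * x1 (Pc r)) = th (Pc r)"
    by (simp add: mod_simps mult.assoc del: rdim_Pc)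
  finally have t: "th (dual (Pc r)) = tp (th (Pc r))" .
  then show "th (dual (Pc r)) \<noteq> 0" using th_Pc by (metis tp_tp tp_zero)
  have "kk (dual (Pc r)) * th (dual (Pc r)) = tp (th (Pc r) * kk (Pc r))"
    by (simp only: t ac_dual(1)[OF module_Pc] tp_times[symmetric])
  also have "\<dots> = sgn_bit r *\<^sub>C th (dual (Pc r))" by (simp only: kk_th[OF module_Pc, symmetric] kk_th_Pc t tp_scaleC)
  finally show "kk (dual (Pc r)) * th (dual (Pc r)) = sgn_bit r *\<^sub>C th (dual (Pc r))" .
qed simp

subsection \<open>Kronecker products and tensor products\<close>

text \<open>The format of the second factor is passed explicitly, because an \<open>fmat\<close>
  does not determine its own size and the index arithmetic depends on it.\<close>

definition kp :: "nat \<Rightarrow> nat \<Rightarrow> fmat \<Rightarrow> fmat \<Rightarrow> fmat" where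
  "kp b c F G = Fmat (\<lambda>i j. ent F (i div b) (j div c) * ent G (i mod b) (j mod c))"

lemma ent_kp: "ent (kp b c F G) i j = ent F (i div b) (j div c) * ent G (i mod b) (j mod c)"
proof -
  obtain n where n: "\<forall>i j. n \<le> i \<or> n \<le> j \<longrightarrow> ent F i j = 0 \<and> ent G i j = 0"
    using ent_bound2 by blast
  have "ent F (i div b) (j div c) * ent G (i mod b) (j mod c) = 0"
    if "n * (b + c + 1) \<le> i \<or> n * (b + c + 1) \<le> j" for i j
  proof -
    have big: "n \<le> k div d \<or> n \<le> k mod d" if "n * (b + c + 1) \<le> k" "d = b \<or> d = c" for k d
    proof (cases "d = 0")
      case True
      then show ?thesis using that(1) by (simp add: algebra_simps)
    next
      case False
      have "n * d \<le> n * (b + c + 1)" using that(2) by (intro mult_le_mono2) auto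
      then have "n * d \<le> k" using that(1) by (rule le_trans)
      then show ?thesis using False by (simp add: less_eq_div_iff_mult_less_eq)
    qed
    show ?thesis using that n big[of i b] big[of j c] by auto
  qed
  then have "(\<lambda>i j. ent F (i div b) (j div c) * ent G (i mod b) (j mod c))
      \<in> {f. \<exists>n. \<forall>i j. n \<le> i \<or> n \<le> j \<longrightarrow> f i j = 0}" by blast
  then show ?thesis by (simp add: kp_def Fmat_inverse)
qed

text \<open>The summation index is split as \<open>p * c + q\<close> with \<open>q < c\<close>. Only
  the second factors need a format: it bounds \<open>q\<close>, while the range of \<open>p\<close>
  is limited by the finite support of \<open>F\<close>.\<close>

lemma kp_mult:
  assumes G: "rect b c G" and G': "rect c d G'"
  shows "kp b c F G * kp c d F' G' = kp b d (F * F') (G * G')"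
proof (rule fmat_eqI)
  fix i j
  obtain n where n: "\<forall>i j. n \<le> i \<or> n \<le> j \<longrightarrow> ent F i j = 0 \<and> ent F' i j = 0"
    using ent_bound2 by blast
  have z: "ent (kp b c F G) i k = 0" if "n * c \<le> k" for k
  proof (cases "c = 0")
    case True
    then show ?thesis using rect_entD[OF G] by (simp add: ent_kp)
  next
    case False
    then show ?thesis using that n by (simp add: ent_kp less_eq_div_iff_mult_less_eq)
  qed
  let ?f = "\<lambda>k. ent (kp b c F G) i k * ent (kp c d F' G') k j"
  have "ent (kp b c F G * kp c d F' G') i j = (\<Sum>k<n * c. ?f k)"
    using z by (rule ent_times_left)
  also have "\<dots> = (\<Sum>p<n. sum ?f {p * c..<p * c + c})" by (rule sum.nat_group[symmetric])
  also have "\<dots> = (\<Sum>p<n. \<Sum>q<c. ?f (p * c + q))"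
  proof (rule sum.cong[OF refl])
    fix p
    show "sum ?f {p * c..<p * c + c} = (\<Sum>q<c. ?f (p * c + q))"
      using sum.shift_bounds_nat_ivl[of ?f 0 "p * c" c] by (simp add: lessThan_atLeast0 add.commute)
  qed
  also have "\<dots> = (\<Sum>p<n. \<Sum>q<c. (ent F (i div b) p * ent F' p (j div d)) * (ent G (i mod b) q * ent G' q (j mod d)))"
    by (intro sum.cong refl) (simp add: ent_kp)
  also have "\<dots> = (\<Sum>p<n. ent F (i div b) p * ent F' p (j div d)) * (\<Sum>q<c. ent G (i mod b) q * ent G' q (j mod d))"
    by (simp add: sum_product)
  also have "\<dots> = ent (kp b d (F * F') (G * G')) i j"
    unfolding ent_kp
    by (subst ent_times_left[of n F], use n in simp, subst ent_times_left[of c G], use rect_entD[OF G] in simp) simp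
  finally show "ent (kp b c F G * kp c d F' G') i j = ent (kp b d (F * F') (G * G')) i j" .
qed

lemma kp_linear:
  "kp b c (F + F') G = kp b c F G + kp b c F' G" "kp b c F (G + G') = kp b c F G + kp b c F G'"
  "kp b c (F - F') G = kp b c F G - kp b c F' G" "kp b c F (G - G') = kp b c F G - kp b c F G'"
  "kp b c (- F) G = - kp b c F G" "kp b c F (- G) = - kp b c F G"
  "kp b c (x *\<^sub>C F) G = x *\<^sub>C kp b c F G" "kp b c F (x *\<^sub>C G) = x *\<^sub>C kp b c F G"
  "kp b c 0 G = 0" "kp b c F 0 = 0"
  by (auto intro!: fmat_eqI simp: ent_kp algebra_simps)

lemma kp_Idm: "kp b b (Idm a) (Idm b) = Idm (a * b)"
proof (rule fmat_eqI)
  fix i j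
  show "ent (kp b b (Idm a) (Idm b)) i j = ent (Idm (a * b)) i j"
  proof (cases "b = 0")
    case True
    then show ?thesis by (simp add: ent_kp ent_Idm)
  next
    case False
    have "i = j \<longleftrightarrow> i div b = j div b \<and> i mod b = j mod b" by (metis div_mult_mod_eq)
    moreover have "i < a * b \<longleftrightarrow> i div b < a" using False by (simp add: div_less_iff_less_mult)
    ultimately show ?thesis using False by (auto simp: ent_kp ent_Idm)
  qed
qed

lemma rect_kp: assumes "rect a a' F" "rect b b' G" shows "rect (a * b) (a' * b') (kp b b' F G)"
proof (rule rect_entI)
  fix i j assume "a * b \<le> i \<or> a' * b' \<le> j"
  moreover have "a \<le> i div b \<or> b = 0" if "a * b \<le> i" using that by (cases "b = 0") (auto simp: less_eq_div_iff_mult_less_eq)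
  moreover have "a' \<le> j div b' \<or> b' = 0" if "a' * b' \<le> j" using that by (cases "b' = 0") (auto simp: less_eq_div_iff_mult_less_eq)
  ultimately show "ent (kp b b' F G) i j = 0"
    using rect_entD[OF assms(1)] rect_entD[OF assms(2)] by (auto simp: ent_kp)
qed

lemma kp_one_left: assumes "rect n m G" shows "kp n m (Idm 1) G = G"
proof (rule fmat_eqI)
  fix i j
  show "ent (kp n m (Idm 1) G) i j = ent G i j"
  proof (cases "i < n \<and> j < m")
    case True
    then show ?thesis by (simp add: ent_kp ent_Idm)
  next
    case False
    then have "ent G i j = 0" using rect_entD[OF assms] by (auto simp: not_less)
    moreover have "ent (kp n m (Idm 1) G) i j = 0"
    proof (cases "n = 0 \<or> m = 0")
      case True
      then show ?thesis using rect_entD[OF assms] by (auto simp: ent_kp)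
    next
      case nz: False
      then have "i div n \<ge> 1 \<or> j div m \<ge> 1" using False by (auto simp: less_eq_div_iff_mult_less_eq not_less)
      then show ?thesis by (auto simp: ent_kp ent_Idm)
    qed
    ultimately show ?thesis by simp
  qed
qed

lemma kp_one_right: "kp 1 1 F (Idm 1) = F"
  by (auto intro!: fmat_eqI simp: ent_kp ent_Idm)

lemma emb_kron: "emb (kron A B) = kp (dim_row B) (dim_col B) (emb A) (emb B)"
proof (rule fmat_eqI)
  fix i j
  show "ent (emb (kron A B)) i j = ent (kp (dim_row B) (dim_col B) (emb A) (emb B)) i j"
  proof (cases "dim_row B = 0 \<or> dim_col B = 0")
    case True
    then show ?thesis by (auto simp: ent_emb ent_kp kron_def)
  next
    case False
    then show ?thesis by (auto simp: ent_emb ent_kp kron_def div_less_iff_less_mult)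
  qed
qed

lemma rdim_tensor [simp]: "rdim (M \<otimes>\<^sub>K N) = rdim M * rdim N" by (simp add: tensor_def)

lemma ac_tensor:
  assumes "is_module M" "is_module N"
  shows "kk (M \<otimes>\<^sub>K N) = kp (rdim N) (rdim N) (kk M) (kk N)"
    "x1 (M \<otimes>\<^sub>K N) = kp (rdim N) (rdim N) (kk M) (x1 N) + kp (rdim N) (rdim N) (x1 M) (Idm (rdim N))"
    "x2 (M \<otimes>\<^sub>K N) = kp (rdim N) (rdim N) (kk M) (x2 N) + kp (rdim N) (rdim N) (x2 M) (Idm (rdim N))"
proof -
  have d: "dim_row (act M g) = rdim M" "dim_col (act M g) = rdim M"
    "dim_row (act N g) = rdim N" "dim_col (act N g) = rdim N" for g
    using is_module_carrier[OF assms(1), of g] is_module_carrier[OF assms(2), of g] by auto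
  have k: "dim_row (kron A B) = dim_row A * dim_row B" "dim_col (kron A B) = dim_col A * dim_col B" for A B
    by (simp_all add: kron_def)
  show "kk (M \<otimes>\<^sub>K N) = kp (rdim N) (rdim N) (kk M) (kk N)"
    "x1 (M \<otimes>\<^sub>K N) = kp (rdim N) (rdim N) (kk M) (x1 N) + kp (rdim N) (rdim N) (x1 M) (Idm (rdim N))"
    "x2 (M \<otimes>\<^sub>K N) = kp (rdim N) (rdim N) (kk M) (x2 N) + kp (rdim N) (rdim N) (x2 M) (Idm (rdim N))"
    by (simp_all add: ac_def tensor_simps[OF assms] emb_add emb_kron emb_one d k)
qed

lemma tensor_rules:
  assumes "is_module N"
  shows "rect (rdim N) (rdim N) (ac N g)" "rect (rdim N) (rdim N) (ac N g * ac N h)"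
    "rect (rdim N) (rdim N) (Idm (rdim N))"
  using rect_ac[OF assms] by (auto intro: rect_times)

lemma module_tensor: assumes "is_module M" "is_module N" shows "is_module (M \<otimes>\<^sub>K N)"
  unfolding module_iff
proof (intro conjI allI)
  have c: "act M g \<in> carrier_mat (rdim M) (rdim M)" "act N g \<in> carrier_mat (rdim N) (rdim N)" for g
    using assms by (auto intro: is_module_carrier)
  have k: "dim_row (kron A B) = dim_row A * dim_row B" "dim_col (kron A B) = dim_col A * dim_col B" for A B
    by (simp_all add: kron_def)
  show "act (M \<otimes>\<^sub>K N) g \<in> carrier_mat (rdim (M \<otimes>\<^sub>K N)) (rdim (M \<otimes>\<^sub>K N))" for g
    using c[THEN carrier_matD(1)] c[THEN carrier_matD(2)]
    by (cases g) (auto simp: tensor_simps[OF assms] k intro!: carrier_matI)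
  note r = ac_tensor[OF assms] kp_mult[OF tensor_rules(1)[OF assms(2)] tensor_rules(1)[OF assms(2)]]
    kp_mult[OF tensor_rules(1)[OF assms(2)] tensor_rules(3)[OF assms(2)]]
    kp_mult[OF tensor_rules(3)[OF assms(2)] tensor_rules(1)[OF assms(2)]]
    kp_mult[OF tensor_rules(3)[OF assms(2)] tensor_rules(3)[OF assms(2)]]
    mod_simps[OF assms(1)] mod_simps[OF assms(2)] kp_linear distrib_left distrib_right
  show "kk (M \<otimes>\<^sub>K N) * kk (M \<otimes>\<^sub>K N) = Idm (rdim (M \<otimes>\<^sub>K N))" by (simp add: r kp_Idm)
  show "x1 (M \<otimes>\<^sub>K N) * x1 (M \<otimes>\<^sub>K N) = 0" "x2 (M \<otimes>\<^sub>K N) * x2 (M \<otimes>\<^sub>K N) = 0"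
    "kk (M \<otimes>\<^sub>K N) * x1 (M \<otimes>\<^sub>K N) = - (x1 (M \<otimes>\<^sub>K N) * kk (M \<otimes>\<^sub>K N))"
    "kk (M \<otimes>\<^sub>K N) * x2 (M \<otimes>\<^sub>K N) = - (x2 (M \<otimes>\<^sub>K N) * kk (M \<otimes>\<^sub>K N))"
    "x1 (M \<otimes>\<^sub>K N) * x2 (M \<otimes>\<^sub>K N) = - (x2 (M \<otimes>\<^sub>K N) * x1 (M \<otimes>\<^sub>K N))"
    by (simp_all add: r)
qed

lemma hom_tensor:
  assumes "is_module A" "is_module B" "is_module C" "is_module D" "hom A B f" "hom C D g"
  shows "hom (A \<otimes>\<^sub>K C) (B \<otimes>\<^sub>K D) (kp (rdim D) (rdim C) f g)"
proof -
  note rg = hom_rect[OF assms(6)]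
  note r = ac_tensor[OF assms(1,3)] ac_tensor[OF assms(2,4)] kp_mult[OF tensor_rules(1)[OF assms(4)] rg]
    kp_mult[OF rg tensor_rules(1)[OF assms(3)]] kp_mult[OF tensor_rules(3)[OF assms(4)] rg]
    kp_mult[OF rg tensor_rules(3)[OF assms(3)]] homD[OF assms(5)] homD[OF assms(6)] distrib_left distrib_right
  show ?thesis
    by (rule homI) (use rect_kp[OF hom_rect[OF assms(5)] rg] in \<open>simp_all add: r\<close>)
qed

lemma tensor_cong:
  assumes "A \<cong>\<^sub>K B" "C \<cong>\<^sub>K D" shows "A \<otimes>\<^sub>K C \<cong>\<^sub>K B \<otimes>\<^sub>K D"
proof -
  obtain f h where f: "is_module A" "is_module B" "hom A B f" "hom B A h"
    "f * h = Idm (rdim B)" "h * f = Idm (rdim A)" using isoE[OF assms(1)] .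
  obtain f' h' where f': "is_module C" "is_module D" "hom C D f'" "hom D C h'"
    "f' * h' = Idm (rdim D)" "h' * f' = Idm (rdim C)" using isoE[OF assms(2)] .
  show ?thesis
    by (rule isoI[OF module_tensor[OF f(1) f'(1)] module_tensor[OF f(2) f'(2)]
          hom_tensor[OF f(1,2) f'(1,2) f(3) f'(3)] hom_tensor[OF f(2,1) f'(2,1) f(4) f'(4)]])
      (simp_all add: kp_mult[OF hom_rect[OF f'(3)] hom_rect[OF f'(4)]]
        kp_mult[OF hom_rect[OF f'(4)] hom_rect[OF f'(3)]] f f' kp_Idm)
qed

text \<open>Of the coproduct only the part \<xi> tensor 1 contributes to the supercommutator with
  \<open>w\<close> tensor 1, because the part K tensor \<xi> commutes with it, \<open>w\<close>
  being even.\<close>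

lemma even_tensor_left:
  assumes "is_module A" "is_module B" "is_module X" "even_map A B w"
  defines "n \<equiv> rdim X"
  shows "even_map (A \<otimes>\<^sub>K X) (B \<otimes>\<^sub>K X) (kp n n w (Idm n))"
    "higman_trace (A \<otimes>\<^sub>K X) (B \<otimes>\<^sub>K X) (kp n n w (Idm n)) = kp n n (higman_trace A B w) (Idm n)"
proof -
  note R1 = rect_ac[OF assms(3), folded n_def] and R2 = tensor_rules(2)[OF assms(3), folded n_def]
    and R3 = rect_Idm_same[of n]
  note r = ac_tensor[OF assms(1,3), folded n_def] ac_tensor[OF assms(2,3), folded n_def]
    kp_mult[OF R1 R1] kp_mult[OF R1 R2] kp_mult[OF R1 R3] kp_mult[OF R2 R1] kp_mult[OF R2 R2] kp_mult[OF R2 R3]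
    kp_mult[OF R3 R1] kp_mult[OF R3 R2] kp_mult[OF R3 R3]
    mod_simps[OF assms(1)] mod_simps[OF assms(2)] mod_simps[OF assms(3), folded n_def]
    kp_linear distrib_left distrib_right even_mapD(2,3)[OF assms(4)] left_diff_distrib right_diff_distrib
    rectD[OF even_mapD(1)[OF assms(4)]]
  show "even_map (A \<otimes>\<^sub>K X) (B \<otimes>\<^sub>K X) (kp n n w (Idm n))"
    using rect_kp[OF even_mapD(1)[OF assms(4)] R3] by (simp add: even_map_def r n_def[symmetric])
  show "higman_trace (A \<otimes>\<^sub>K X) (B \<otimes>\<^sub>K X) (kp n n w (Idm n)) = kp n n (higman_trace A B w) (Idm n)"
    by (simp add: higman_trace_def r mult.assoc)
qed

text \<open>Now the part K tensor \<xi> contributes, and the two factors K multiply to 1. The part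
  \<xi> tensor 1 commutes with 1 tensor \<open>w\<close>, and in the second step it drops out
  because \<xi> and K anticommute.\<close>

lemma even_tensor_right:
  assumes "is_module A" "is_module B" "is_module X" "even_map A B w"
  defines "n \<equiv> rdim X" and "a \<equiv> rdim A" and "b \<equiv> rdim B"
  shows "even_map (X \<otimes>\<^sub>K A) (X \<otimes>\<^sub>K B) (kp b a (Idm n) w)"
    "higman_trace (X \<otimes>\<^sub>K A) (X \<otimes>\<^sub>K B) (kp b a (Idm n) w) = kp b a (Idm n) (higman_trace A B w)"
proof -
  note w = even_mapD(1)[OF assms(4), folded a_def b_def]
  note A1 = rect_ac[OF assms(1), folded a_def] and A3 = rect_Idm_same[of a]
    and B1 = rect_ac[OF assms(2), folded b_def] and B3 = rect_Idm_same[of b]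
  note R1 = rect_times[OF B1 w] and R2 = rect_times[OF w A1]
  note R4 = rect_times[OF R1 A1] and R5 = rect_times[OF B1 R1] and R6 = rect_times[OF R2 A1]
  have R7: "rect b a (ac B g * (w * ac A h))" for g h using R4 by (simp add: mult.assoc)
  note r = ac_tensor[OF assms(3,1), folded a_def] ac_tensor[OF assms(3,2), folded b_def]
    kp_mult[OF B1 B1] kp_mult[OF B1 B3] kp_mult[OF B3 B1] kp_mult[OF B3 B3] kp_mult[OF B1 w] kp_mult[OF B3 w]
    kp_mult[OF A1 A1] kp_mult[OF A1 A3] kp_mult[OF A3 A1] kp_mult[OF A3 A3] kp_mult[OF w A1] kp_mult[OF w A3]
    kp_mult[OF tensor_rules(2)[OF assms(2), folded b_def] w] kp_mult[OF w tensor_rules(2)[OF assms(1), folded a_def]]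
    kp_mult[OF R1 A1] kp_mult[OF R1 A3] kp_mult[OF B1 R1] kp_mult[OF B3 R1]
    kp_mult[OF R2 A1] kp_mult[OF R2 A3] kp_mult[OF B1 R2] kp_mult[OF B3 R2]
    mod_simps[OF assms(3), folded n_def] mod_simps[OF assms(1), folded a_def] mod_simps[OF assms(2), folded b_def]
    kp_linear distrib_left distrib_right even_mapD(2,3)[OF assms(4)] left_diff_distrib right_diff_distrib
    rectD[OF w]
  show "even_map (X \<otimes>\<^sub>K A) (X \<otimes>\<^sub>K B) (kp b a (Idm n) w)"
    using rect_kp[OF rect_Idm_same[of n] w] by (simp add: even_map_def r n_def[symmetric] a_def[symmetric] b_def[symmetric])
  show "higman_trace (X \<otimes>\<^sub>K A) (X \<otimes>\<^sub>K B) (kp b a (Idm n) w) = kp b a (Idm n) (higman_trace A B w)"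
    by (simp add: higman_trace_def r mult.assoc)
qed

lemma higman_projective_tensor_left: assumes "higman_projective P" "is_module X" shows "higman_projective (P \<otimes>\<^sub>K X)"
proof -
  obtain w where w: "is_module P" "even_map P P w" "higman_trace P P w = Idm (rdim P)"
    using assms(1) by (auto simp: higman_projective_def)
  show ?thesis unfolding higman_projective_def
    using module_tensor[OF w(1) assms(2)] even_tensor_left[OF w(1,1) assms(2) w(2)] by (auto simp: w(3) kp_Idm)
qed

lemma higman_projective_tensor_right: assumes "higman_projective P" "is_module X" shows "higman_projective (X \<otimes>\<^sub>K P)"
proof -
  obtain w where w: "is_module P" "even_map P P w" "higman_trace P P w = Idm (rdim P)"
    using assms(1) by (auto simp: higman_projective_def)
  show ?thesis unfolding higman_projective_def
    using module_tensor[OF assms(2) w(1)] even_tensor_right[OF w(1,1) assms(2) w(2)] by (auto simp: w(3) kp_Idm)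
qed

lemma short_exact_tensor_left:
  assumes "short_exact A B C" "is_module X" shows "short_exact (A \<otimes>\<^sub>K X) (B \<otimes>\<^sub>K X) (C \<otimes>\<^sub>K X)"
proof -
  obtain j q l s where *: "is_module A" "is_module B" "is_module C" "hom A B j" "hom B C q"
     "rect (rdim A) (rdim B) l" "rect (rdim B) (rdim C) s"
     "l * j = Idm (rdim A)" "q * s = Idm (rdim C)" "j * l + s * q = Idm (rdim B)"
     "q * j = 0" "l * s = 0" using sesE[OF assms(1)] .
  let ?n = "rdim X"
  note R = rect_Idm_same[of ?n]
  have "kp ?n ?n j (Idm ?n) * kp ?n ?n l (Idm ?n) + kp ?n ?n s (Idm ?n) * kp ?n ?n q (Idm ?n) =
      Idm (rdim (B \<otimes>\<^sub>K X))"
    by (simp add: kp_mult[OF R R] kp_linear(1)[symmetric] *(10) kp_Idm)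
  then show ?thesis
    by (intro sesI[OF module_tensor[OF *(1) assms(2)] module_tensor[OF *(2) assms(2)] module_tensor[OF *(3) assms(2)]
          hom_tensor[OF *(1,2) assms(2,2) *(4) hom_Idm[OF assms(2)]]
          hom_tensor[OF *(2,3) assms(2,2) *(5) hom_Idm[OF assms(2)]],
          of "kp ?n ?n l (Idm ?n)" "kp ?n ?n s (Idm ?n)"])
      (use rect_kp[OF *(6) R] rect_kp[OF *(7) R] in \<open>simp_all add: kp_mult[OF R R] * kp_Idm\<close>)
qed

lemma short_exact_tensor_right:
  assumes "short_exact A B C" "is_module X" shows "short_exact (X \<otimes>\<^sub>K A) (X \<otimes>\<^sub>K B) (X \<otimes>\<^sub>K C)"
proof -
  obtain j q l s where *: "is_module A" "is_module B" "is_module C" "hom A B j" "hom B C q"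
     "rect (rdim A) (rdim B) l" "rect (rdim B) (rdim C) s"
     "l * j = Idm (rdim A)" "q * s = Idm (rdim C)" "j * l + s * q = Idm (rdim B)"
     "q * j = 0" "l * s = 0" using sesE[OF assms(1)] .
  let ?n = "rdim X" and ?a = "rdim A" and ?b = "rdim B" and ?c = "rdim C"
  note R = rect_Idm_same[of ?n] and rj = hom_rect[OF *(4)] and rq = hom_rect[OF *(5)]
  have "kp ?b ?a (Idm ?n) j * kp ?a ?b (Idm ?n) l + kp ?b ?c (Idm ?n) s * kp ?c ?b (Idm ?n) q =
      Idm (rdim (X \<otimes>\<^sub>K B))"
    by (simp add: kp_mult[OF rj *(6)] kp_mult[OF *(7) rq] kp_linear(2)[symmetric] *(10) kp_Idm)
  then show ?thesis
    by (intro sesI[OF module_tensor[OF assms(2) *(1)] module_tensor[OF assms(2) *(2)] module_tensor[OF assms(2) *(3)]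
          hom_tensor[OF assms(2,2) *(1,2) hom_Idm[OF assms(2)] *(4)]
          hom_tensor[OF assms(2,2) *(2,3) hom_Idm[OF assms(2)] *(5)],
          of "kp ?a ?b (Idm ?n) l" "kp ?b ?c (Idm ?n) s"])
      (use rect_kp[OF R *(6)] rect_kp[OF R *(7)] in
        \<open>simp_all add: kp_mult[OF *(6) rj] kp_mult[OF rq *(7)] * kp_Idm\<close>)
qed

section \<open>Tensor products with simple modules and the parity of the free part\<close>

lemma kronecker_V_tensor:
  assumes "kronecker N t a b X Y"
  shows "kronecker (V_mod r \<otimes>\<^sub>K N) (r + t) a b (sgn_bit r *\<^sub>C X) (sgn_bit r *\<^sub>C Y)"
proof -
  obtain iT pT iS pS where d: "KR_data N t a b X Y iT pT iS pS" using krE[OF assms] .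
  note D = KR_dataD[OF d]
  note r = ac_tensor[OF module_V_mod D(1)] ac_V_mod kp_linear kp_one_left[OF rect_ac[OF D(1)]]
  have "KR_data (V_mod r \<otimes>\<^sub>K N) (r + t) a b (sgn_bit r *\<^sub>C X) (sgn_bit r *\<^sub>C Y) iT pT iS pS"
    unfolding KR_data_def
    by (intro conjI) (use D(2-12) module_tensor[OF module_V_mod D(1)] in
        \<open>simp_all add: r rect_scaleC sgn_bit_add\<close>, simp_all add: D(13-15))
  then show ?thesis by (rule krI)
qed

lemma kronecker_tensor_V:
  assumes "kronecker N t a b X Y" shows "kronecker (N \<otimes>\<^sub>K V_mod r) (t + r) a b X Y"
proof -
  obtain iT pT iS pS where d: "KR_data N t a b X Y iT pT iS pS" using krE[OF assms] .
  note D = KR_dataD[OF d]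
  note r = ac_tensor[OF D(1) module_V_mod] ac_V_mod kp_linear kp_one_right
  have "KR_data (N \<otimes>\<^sub>K V_mod r) (t + r) a b X Y iT pT iS pS"
    unfolding KR_data_def
    by (intro conjI) (use D(2-12) module_tensor[OF D(1) module_V_mod] in
        \<open>simp_all add: r sgn_bit_add\<close>, simp_all add: D(13-15) mult.commute)
  then show ?thesis by (rule krI)
qed

lemma V_tensor_iso:
  assumes "kronecker M t a b X Y" "kronecker N (r + t) a b X Y" shows "V_mod r \<otimes>\<^sub>K M \<cong>\<^sub>K N"
  by (rule iso_sym, rule kronecker_iso[OF assms(2) kronecker_V_tensor[OF assms(1)]], rule pencil_iso_scale)
    (use kronecker_rects[OF assms(1)] in auto)

lemma V_tensor_Pc: "V_mod r \<otimes>\<^sub>K Pc r' \<cong>\<^sub>K Pc (r + r')"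
proof (rule Pc_char)
  note r = ac_tensor[OF module_V_mod module_Pc] ac_V_mod kp_linear kp_one_left[OF rect_ac[OF module_Pc, unfolded rdim_Pc]]
  have t: "th (V_mod r \<otimes>\<^sub>K Pc r') = th (Pc r')" by (simp add: r)
  then show "th (V_mod r \<otimes>\<^sub>K Pc r') \<noteq> 0" using th_Pc by simp
  show "kk (V_mod r \<otimes>\<^sub>K Pc r') * th (V_mod r \<otimes>\<^sub>K Pc r') = sgn_bit (r + r') *\<^sub>C th (V_mod r \<otimes>\<^sub>K Pc r')"
    unfolding t by (simp add: r(1-5) r kk_th_Pc sgn_bit_add)
qed (simp_all add: module_tensor)

lemma Pc_tensor_V: "Pc r \<otimes>\<^sub>K V_mod r' \<cong>\<^sub>K Pc (r + r')"
proof (rule Pc_char)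
  note r = ac_tensor[OF module_Pc module_V_mod] ac_V_mod kp_linear kp_one_right
  have t: "th (Pc r \<otimes>\<^sub>K V_mod r') = th (Pc r)" by (simp add: r)
  then show "th (Pc r \<otimes>\<^sub>K V_mod r') \<noteq> 0" using th_Pc by simp
  show "kk (Pc r \<otimes>\<^sub>K V_mod r') * th (Pc r \<otimes>\<^sub>K V_mod r') = sgn_bit (r + r') *\<^sub>C th (Pc r \<otimes>\<^sub>K V_mod r')"
    unfolding t by (simp add: r kk_th_Pc sgn_bit_add mult.commute)
qed (simp_all add: module_tensor)

text \<open>As \<xi>1\<xi>2 vanishes on both factors, only mixed terms survive. They map top tensor
  top to socle tensor socle, where K acts by the product of \<open>- sgn_bit t\<close> and
  \<open>- sgn_bit u\<close>.\<close>

lemma kronecker_tensor_th: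
  assumes "kronecker M t a b X Y" "kronecker N u c d Z W"
  shows "th (M \<otimes>\<^sub>K N) = kp (rdim N) (rdim N) (kk M * x2 M) (x1 N) + kp (rdim N) (rdim N) (x1 M * kk M) (x2 N)"
    "kk (M \<otimes>\<^sub>K N) * th (M \<otimes>\<^sub>K N) = sgn_bit (t + u) *\<^sub>C th (M \<otimes>\<^sub>K N)"
proof -
  note m = kronecker_module[OF assms(1)] kronecker_module[OF assms(2)]
  note T = tensor_rules[OF m(2)]
  note r = ac_tensor[OF m] kp_mult[OF T(1) T(1)] kp_mult[OF T(1) T(3)] kp_mult[OF T(3) T(1)] kp_mult[OF T(3) T(3)]
    mod_simps[OF m(1)] mod_simps[OF m(2)] kp_linear distrib_left distrib_right kronecker_th[OF assms(1)] kronecker_th[OF assms(2)]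
    kronecker_parity[OF assms(1)] kronecker_parity[OF assms(2)]
  show t: "th (M \<otimes>\<^sub>K N) = kp (rdim N) (rdim N) (kk M * x2 M) (x1 N) + kp (rdim N) (rdim N) (x1 M * kk M) (x2 N)"
    by (simp add: r)
  show "kk (M \<otimes>\<^sub>K N) * th (M \<otimes>\<^sub>K N) = sgn_bit (t + u) *\<^sub>C th (M \<otimes>\<^sub>K N)"
    unfolding t by (simp add: r sgn_bit_add scaleC_add scaleC_diff mult.commute right_diff_distrib)
qed

subsection \<open>Free factors\<close>

lemma short_exact_tr: assumes "short_exact A B C" shows "tr (ac B g) = tr (ac A g) + tr (ac C g)"
proof -
  obtain j q l s where *: "is_module A" "is_module B" "is_module C" "hom A B j" "hom B C q"
     "rect (rdim A) (rdim B) l" "rect (rdim B) (rdim C) s"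
     "l * j = Idm (rdim A)" "q * s = Idm (rdim C)" "j * l + s * q = Idm (rdim B)"
     "q * j = 0" "l * s = 0" using sesE[OF assms(1)] .
  have "ac B g = ac B g * (j * l + s * q)" by (simp add: *(10) mod_simps *(2))
  also have "\<dots> = j * (ac A g * l) + ac B g * (s * q)"
    by (simp add: distrib_left homD(6)[OF *(4)])
  finally have "tr (ac B g) = tr (j * (ac A g * l)) + tr (ac B g * (s * q))" by (metis tr_plus)
  also have "tr (j * (ac A g * l)) = tr (ac A g)"
    by (subst tr_commute) (simp add: mult.assoc *(8) mod_simps *(1))
  also have "tr (ac B g * (s * q)) = tr (q * (ac B g * s))"
    by (simp add: tr_commute[of q] mult.assoc)
  also have "q * (ac B g * s) = ac C g" by (simp add: homD(6)[OF *(5), symmetric] *(9) mod_simps *(3))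
  finally show ?thesis .
qed

text \<open>Some vector among \<xi>1\<xi>2 v, \<xi>1 v, \<xi>2 v and v, taken in this order, is the
  first nonzero one; it is killed by both \<xi>1 and \<xi>2. A nonzero K-eigenpart of it spans a
  copy of V(r).\<close>

lemma simple_submodule:
  assumes X: "is_module X" "rdim X > 0"
  obtains r C where "is_module C" "short_exact (V_mod r) X C"
proof -
  define n where "n = rdim X"
  have u: "rect n 1 (Eu 0 0)" using X by (simp add: n_def)
  have u0: "Eu 0 0 \<noteq> 0" by (metis ent_Eu ent_zero zero_neq_one)
  note rx = rect_ac[OF X(1), folded n_def]
  obtain w where w: "rect n 1 w" "w \<noteq> 0" "x1 X * w = 0" "x2 X * w = 0"
  proof (cases "th X * Eu 0 0 = 0")
    case False
    show ?thesis
      by (rule that[OF rect_times[OF rect_times[OF rx rx] u] False])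
        (simp_all add: mod_simps X mult.assoc)
  next
    case th0: True
    then have t: "x1 X * (x2 X * Eu 0 0) = 0" by (simp add: mult.assoc)
    show ?thesis
    proof (cases "x1 X * Eu 0 0 = 0")
      case False
      show ?thesis
        by (rule that[OF rect_times[OF rx u] False]) (simp_all add: mod_simps X mult.assoc t)
    next
      case x10: True
      show ?thesis
      proof (cases "x2 X * Eu 0 0 = 0")
        case False
        show ?thesis
          by (rule that[OF rect_times[OF rx u] False]) (simp_all add: mod_simps X mult.assoc t)
      next
        case True
        then show ?thesis using that[OF u u0 x10] by blast
      qed
    qed
  qed
  define v where "v r = w + sgn_bit r *\<^sub>C (kk X * w)" for r
  have "v 0 + v 1 = w + w" by (simp add: v_def)
  moreover have "w + w \<noteq> 0" using w(2) scaleC_half[of w] by auto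
  ultimately have "v 0 \<noteq> 0 \<or> v 1 \<noteq> 0" by auto
  then obtain r where r: "v r \<noteq> 0" by blast
  have rv: "rect n 1 (v r)" unfolding v_def by (intro rect_plus rect_scaleC w rect_times[OF rx w(1)])
  have xk: "x1 X * (kk X * w) = 0" "x2 X * (kk X * w) = 0"
    using mod_rels(10)[OF X(1), of w] mod_rels(11)[OF X(1), of w] w by simp_all
  have hv: "hom (V_mod r) X (v r)"
    by (rule homI) (use rv w xk in \<open>simp_all add: n_def[symmetric] v_def ac_V_mod distrib_left distrib_right
      mod_simps X rectD[OF w(1)] rectD[OF rect_times[OF rx w(1)]] scaleC_add add.commute mult.assoc\<close>)
  obtain a where a: "ent (v r) a 0 \<noteq> 0"
  proof (rule ccontr)
    assume "\<not> thesis"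
    then have "ent (v r) a 0 = 0" for a using that by blast
    moreover have "ent (v r) a (Suc j) = 0" for a j using rect_entD[OF rv, of a "Suc j"] by simp
    ultimately have "v r = 0" by (metis ent_zero fmat_eqI not0_implies_Suc)
    with r show False by simp
  qed
  have an: "a < n" using a rect_entD[OF rv, of a 0] by (metis not_less)
  define l where "l = (1 / ent (v r) a 0) *\<^sub>C Eu 0 a"
  have l: "rect 1 n l" using an by (simp add: l_def rect_scaleC)
  have lv: "l * v r = Idm 1"
  proof -
    have "rect 1 1 (l * v r)" by (rule rect_times[OF l rv])
    moreover have "ent (l * v r) 0 0 = 1" using a by (simp add: l_def)
    ultimately show ?thesis using rect_one by fastforce
  qed
  obtain C c s where C: "is_module C" "hom X C c" "rect n (rdim C) s" "c * s = Idm (rdim C)"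
    "c * v r = 0" "\<exists>t. rect 1 n t \<and> s * c = Idm n - v r * t"
    using hom_cokernel[OF module_V_mod X(1) hv] unfolding n_def rdim_V_mod by metis
  obtain t where t: "rect 1 n t" "s * c = Idm n - v r * t" using C(6) by blast
  have "v r * t * v r = v r"
  proof -
    have "(s * c) * v r = v r - v r * t * v r" by (simp add: t(2) left_diff_distrib rectD[OF rv])
    then show ?thesis by (simp add: mult.assoc C(5))
  qed
  then have "(l * v r) * (t * v r) = l * v r" by (metis mult.assoc)
  then have tv: "t * v r = Idm 1" by (simp only: lv) (simp add: rectD[OF t(1)])
  have "short_exact (V_mod r) X C"
    by (rule sesI[OF module_V_mod X(1) C(1) hv C(2)]) (use t C tv in \<open>auto simp: n_def\<close>)
  then show ?thesis using that C(1) by blast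
qed

text \<open>Peeling off simple submodules of \<open>X\<close> gives sequences that split, since
  their left term stays projective after tensoring. Dimension and trace of K are additive, and
  together they determine the two multiplicities.\<close>

lemma Pc_tensor:
  assumes "is_module X"
  obtains rs where "Pc r \<otimes>\<^sub>K X \<cong>\<^sub>K free_sum rs" "count_list rs 0 + count_list rs 1 = rdim X"
    "of_nat (count_list rs 0) - of_nat (count_list rs 1) = sgn_bit r * tr (kk X)"
proof -
  have "\<exists>rs. Pc r \<otimes>\<^sub>K X \<cong>\<^sub>K free_sum rs \<and> count_list rs 0 + count_list rs 1 = rdim X \<and>
    of_nat (count_list rs 0) - of_nat (count_list rs 1) = sgn_bit r * tr (kk X)"
    using assms
  proof (induction "rdim X" arbitrary: X rule: less_induct)
    case less
    show ?case
    proof (cases "rdim X = 0")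
      case True
      have k: "kk X = 0" using rectD(1)[OF rect_ac[OF less.prems], of GK] True by simp
      have z: "rdim (Pc r \<otimes>\<^sub>K X) = 0" using True by simp
      have "Pc r \<otimes>\<^sub>K X \<cong>\<^sub>K free_sum []"
        by (rule isoI[OF module_tensor[OF module_Pc less.prems] module_free_sum hom_zero hom_zero]) (simp_all add: True)
      then show ?thesis using True by (intro exI[of _ "[]"]) (simp add: k)
    next
      case False
      then have pos: "rdim X > 0" by simp
      obtain p C where C: "is_module C" "short_exact (V_mod p) X C" using simple_submodule[OF less.prems pos] .
      have "rdim C < rdim X" using short_exact_rdim[OF C(2)] by simp
      then obtain rs where rs: "Pc r \<otimes>\<^sub>K C \<cong>\<^sub>K free_sum rs" "count_list rs 0 + count_list rs 1 = rdim C"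
        "of_nat (count_list rs 0) - of_nat (count_list rs 1) = sgn_bit r * tr (kk C)"
        using less.hyps C(1) by metis
      have "biprod (Pc r \<otimes>\<^sub>K X) (Pc r \<otimes>\<^sub>K V_mod p) (Pc r \<otimes>\<^sub>K C)"
        by (rule short_exact_split_left[OF short_exact_tensor_right[OF C(2) module_Pc] higman_projective_tensor_left[OF higman_projective_Pc module_V_mod]])
      then have "Pc r \<otimes>\<^sub>K X \<cong>\<^sub>K (Pc r \<otimes>\<^sub>K V_mod p) \<oplus>\<^sub>K (Pc r \<otimes>\<^sub>K C)"
        using iso_dsum_iff module_tensor less.prems C(1) module_Pc module_V_mod by blast
      also have "\<dots> \<cong>\<^sub>K free_sum ((r + p) # rs)" unfolding free_sum_simps by (rule dsum_cong[OF Pc_tensor_V rs(1)])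
      finally have iso: "Pc r \<otimes>\<^sub>K X \<cong>\<^sub>K free_sum ((r + p) # rs)" .
      have tr: "tr (kk X) = sgn_bit p + tr (kk C)" using short_exact_tr[OF C(2), of GK] by (simp add: ac_V_mod tr_scaleC tr_Idm)
      have cnt: "count_list ((r + p) # rs) 0 + count_list ((r + p) # rs) 1 = rdim X"
        using short_exact_rdim[OF C(2)] rs(2) by (cases "r + p") auto
      have "of_nat (count_list ((r + p) # rs) 0) - of_nat (count_list ((r + p) # rs) 1) =
          sgn_bit (r + p) + (of_nat (count_list rs 0) - of_nat (count_list rs 1) :: complex)"
        by (cases "r + p") auto
      also have "\<dots> = sgn_bit r * tr (kk X)" by (simp add: rs(3) tr sgn_bit_add algebra_simps)
      finally show ?thesis using iso cnt by blast
    qed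
  qed
  then show ?thesis using that by blast
qed

lemma Pc_tensor_odd:
  assumes "is_module X" "rdim X = 2 * s + 1" "tr (kk X) = sgn_bit t"
  shows "Pc r \<otimes>\<^sub>K X \<cong>\<^sub>K s \<odot>\<^sub>K Pc (r + t + 1) \<oplus>\<^sub>K (s + 1) \<odot>\<^sub>K Pc (r + t)"
proof -
  obtain rs where rs: "Pc r \<otimes>\<^sub>K X \<cong>\<^sub>K free_sum rs" "count_list rs 0 + count_list rs 1 = rdim X"
    "of_nat (count_list rs 0) - of_nat (count_list rs 1) = sgn_bit r * tr (kk X)"
    using Pc_tensor[OF assms(1)] .
  have d: "of_nat (count_list rs 0) - of_nat (count_list rs 1) = sgn_bit (r + t)"
    using rs(3) assms(3) by (simp add: sgn_bit_add)
  have iso: "Pc r \<otimes>\<^sub>K X \<cong>\<^sub>K (count_list rs 0 \<odot>\<^sub>K Pc 0) \<oplus>\<^sub>K (count_list rs 1 \<odot>\<^sub>K Pc 1)"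
    using iso_trans[OF rs(1) free_sum_norm] .
  show ?thesis
  proof (cases "r + t")
    case zero
    then have "(of_nat (count_list rs 0) :: complex) = of_nat (count_list rs 1 + 1)" using d by (simp add: algebra_simps)
    then have "count_list rs 0 = count_list rs 1 + 1" using of_nat_eq_iff by blast
    then have "count_list rs 0 = s + 1" "count_list rs 1 = s" using rs(2) assms(2) by simp_all
    then show ?thesis using iso_trans[OF iso dsum_comm] zero by (simp add: module_copies)
  next
    case one
    then have "(of_nat (count_list rs 1) :: complex) = of_nat (count_list rs 0 + 1)" using d by (simp add: algebra_simps)
    then have "count_list rs 1 = count_list rs 0 + 1" using of_nat_eq_iff by blast
    then have "count_list rs 1 = s + 1" "count_list rs 0 = s" using rs(2) assms(2) by simp_all
    then show ?thesis using iso one by simp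
  qed
qed

lemma Pc_tensor_even:
  assumes "is_module X" "rdim X = 2 * n" "tr (kk X) = 0"
  shows "Pc r \<otimes>\<^sub>K X \<cong>\<^sub>K n \<odot>\<^sub>K Pc 0 \<oplus>\<^sub>K n \<odot>\<^sub>K Pc 1"
proof -
  obtain rs where rs: "Pc r \<otimes>\<^sub>K X \<cong>\<^sub>K free_sum rs" "count_list rs 0 + count_list rs 1 = rdim X"
    "of_nat (count_list rs 0) - of_nat (count_list rs 1) = sgn_bit r * tr (kk X)"
    using Pc_tensor[OF assms(1)] .
  have "(of_nat (count_list rs 0) :: complex) = of_nat (count_list rs 1)" using rs(3) assms(3) by simp
  then have "count_list rs 0 = count_list rs 1" using of_nat_eq_iff by blast
  then have "count_list rs 0 = n" "count_list rs 1 = n" using rs(2) assms(2) by simp_all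
  then show ?thesis using iso_trans[OF rs(1) free_sum_norm] by simp
qed

lemma tr_kk_Pc: "tr (kk (Pc r)) = 0"
proof -
  obtain i0 i1 i2 i3 p0 p1 p2 p3 where d: "free_rep_data (Pc r) r 1 i0 i1 i2 i3 p0 p1 p2 p3" using Pc_dataE .
  show ?thesis
    by (simp add: free_rep_dataD(27)[OF d] tr_scaleC tr_plus tr_minus tr_commute[of i0] tr_commute[of i1]
        tr_commute[of i2] tr_commute[of i3] free_rep_dataD(10,15,20,25)[OF d])
qed

subsection \<open>Tensor products of syzygies\<close>

text \<open>Minimality is dropped on purpose: tensoring keeps the middle term projective, but it
  need not remain a projective cover.\<close>

definition syz_rel :: "rep \<Rightarrow> rep \<Rightarrow> bool" where
  "syz_rel A C \<longleftrightarrow> (\<exists>A' P C'. higman_projective P \<and> short_exact A' P C' \<and> A' \<cong>\<^sub>K A \<and> C' \<cong>\<^sub>K C)"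

lemma syz_rel_minimal_exact: "minimal_exact A P C \<Longrightarrow> syz_rel A C"
  unfolding syz_rel_def using minimal_exact_short_exact iso_refl by (metis minimal_exact_def)

lemma syz_rel_cong: "syz_rel A C \<Longrightarrow> A \<cong>\<^sub>K A' \<Longrightarrow> C \<cong>\<^sub>K C' \<Longrightarrow> syz_rel A' C'"
  unfolding syz_rel_def using iso_trans by blast

lemma stably_iso_syz_rel:
  assumes "syz_rel A C" "syz_rel A' C'" shows "stably_iso A A' \<longleftrightarrow> stably_iso C C'"
proof -
  obtain B P D where 1: "higman_projective P" "short_exact B P D" "B \<cong>\<^sub>K A" "D \<cong>\<^sub>K C" using assms(1) unfolding syz_rel_def by blast
  obtain B' P' D' where 2: "higman_projective P'" "short_exact B' P' D'" "B' \<cong>\<^sub>K A'" "D' \<cong>\<^sub>K C'" using assms(2) unfolding syz_rel_def by blast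
  have "stably_iso A A' \<longleftrightarrow> stably_iso B B'" using 1(3) 2(3) stably_iso_iso stably_iso_trans stably_iso_sym by meson
  moreover have "stably_iso C C' \<longleftrightarrow> stably_iso D D'" using 1(4) 2(4) stably_iso_iso stably_iso_trans stably_iso_sym by meson
  moreover have "stably_iso B B' \<longleftrightarrow> stably_iso D D'" using stably_iso_syzygy[OF 1(2) 2(2) 1(1) 2(1)] stably_iso_cosyzygy[OF 1(2) 2(2) 1(1) 2(1)] by blast
  ultimately show ?thesis by blast
qed

lemma syz_rel_tensor_left: "syz_rel A C \<Longrightarrow> is_module X \<Longrightarrow> syz_rel (A \<otimes>\<^sub>K X) (C \<otimes>\<^sub>K X)"
  unfolding syz_rel_def using short_exact_tensor_left higman_projective_tensor_left tensor_cong iso_refl by metis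

lemma syz_rel_tensor_right: "syz_rel A C \<Longrightarrow> is_module X \<Longrightarrow> syz_rel (X \<otimes>\<^sub>K A) (X \<otimes>\<^sub>K C)"
  unfolding syz_rel_def using short_exact_tensor_right higman_projective_tensor_right tensor_cong iso_refl by metis

text \<open>Taking syzygies is invertible on stable classes, so agreement at index 0 propagates in
  both directions. This reduces all the products below to tensoring with a simple module.\<close>

lemma stably_iso_family:
  fixes k :: int
  assumes "\<And>k. syz_rel (F (k + 1)) (F k)" "\<And>k. syz_rel (G (k + 1)) (G k)" "stably_iso (F 0) (G 0)"
  shows "stably_iso (F k) (G k)"
proof (induction k rule: int_induct[where k = 0])
  case base
  show ?case by (rule assms(3))
next
  case (step1 i)
  then show ?case using stably_iso_syz_rel[OF assms(1,2)] by blast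
next
  case (step2 i)
  then show ?case using stably_iso_syz_rel[OF assms(1)[of "i - 1"] assms(2)[of "i - 1"]] by simp
qed

definition W :: "int \<Rightarrow> bit \<Rightarrow> rep" where
  "W k r = (if k \<ge> 0 then Wp (nat k) r else Wn (nat (- k)) r)"

lemma W_nat: "W (int s) r = Wp s r" by (simp add: W_def)
lemma W_neg: "W (- int s) r \<cong>\<^sub>K Wn s r"
proof (cases "s = 0")
  case True
  then show ?thesis using iso_trans[OF iso_sym[OF V_mod_Wp] V_mod_Wn] by (simp add: W_def)
qed (use iso_refl[OF kronecker_module[OF kronecker_Wn]] in \<open>simp add: W_def\<close>)

lemma W_cases:
  fixes k :: int
  obtains s where "k = int s" | s where "k = - int (Suc s)"
  by (cases k) (auto simp del: of_nat_Suc)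

lemma kronecker_W:
  obtains t a b X Y where "kronecker (W k r) t a b X Y" "a + b = 2 * nat \<bar>k\<bar> + 1"
proof (cases k rule: W_cases)
  case (1 s)
  then have "W k r = Wp s r" by (simp add: W_nat)
  then show ?thesis using that[of "r + parity s"] kronecker_Wp[of s r] 1 by auto
next
  case (2 s)
  then have "W k r = Wn (Suc s) r" by (simp add: W_def nat_add_distrib)
  then show ?thesis using that[of "r + parity (Suc s) + 1"] kronecker_Wn[of "Suc s" r] 2 by auto
qed

lemma module_W: "is_module (W k r)" and th_W: "th (W k r) = 0" and rdim_W: "rdim (W k r) = 2 * nat \<bar>k\<bar> + 1"
  using kronecker_W kronecker_module kronecker_th kronecker_tr(1) by metis+

lemma syz_rel_W: "syz_rel (W (k + 1) r) (W k r)"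
proof (cases k rule: W_cases)
  case (1 s)
  then have "W (k + 1) r = Wp (Suc s) r" by (simp add: W_def nat_add_distrib)
  then show ?thesis using 1 syz_rel_minimal_exact[OF minimal_exact_Wp] by (simp add: W_nat)
next
  case (2 s)
  have "syz_rel (W (- int s) r) (W (- int (Suc s)) r)"
    by (rule syz_rel_cong[OF syz_rel_minimal_exact[OF minimal_exact_Wn] iso_sym[OF W_neg] iso_sym[OF W_neg]])
  then show ?thesis using 2 by simp
qed

lemma W_zero: "W 0 r \<cong>\<^sub>K V_mod r" using iso_sym[OF V_mod_Wp] by (simp add: W_def)

lemma Omega_W: "Omega k (V_mod r) \<cong>\<^sub>K W k r"
proof (cases k rule: W_cases)
  case (1 s)
  then show ?thesis using Omega_Wp by (simp add: W_nat)
next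
  case (2 s)
  then show ?thesis using iso_trans[OF Omega_Wn iso_sym[OF W_neg], of "Suc s"] by simp
qed

lemma V_tensor_Wp: "V_mod r \<otimes>\<^sub>K Wp s r' \<cong>\<^sub>K Wp s (r + r')"
  by (rule V_tensor_iso[OF kronecker_Wp]) (use kronecker_Wp[of s "r + r'"] in \<open>simp add: add.assoc\<close>)
lemma V_tensor_Wn: "V_mod r \<otimes>\<^sub>K Wn s r' \<cong>\<^sub>K Wn s (r + r')"
  by (rule V_tensor_iso[OF kronecker_Wn]) (use kronecker_Wn[of s "r + r'"] in \<open>simp add: add.assoc\<close>)

lemma V_tensor_W: "V_mod r \<otimes>\<^sub>K W k r' \<cong>\<^sub>K W k (r + r')"
  by (auto simp: W_def V_tensor_Wp V_tensor_Wn)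

lemma V_tensor_M_mod: "n > 0 \<Longrightarrow> V_mod r \<otimes>\<^sub>K M_mod n r' \<eta> \<cong>\<^sub>K M_mod n (r + r') \<eta>"
  by (rule V_tensor_iso[OF kronecker_M_mod]) (use kronecker_M_mod[of n "r + r'" \<eta>] in \<open>simp_all add: add.assoc\<close>)

lemma V_tensor_V: "V_mod r \<otimes>\<^sub>K V_mod r' \<cong>\<^sub>K V_mod (r + r')"
  using V_tensor_iso[OF kronecker_V_mod kronecker_V_mod] .

lemma M_mod_tensor_V: assumes "n > 0" shows "M_mod n r \<eta> \<otimes>\<^sub>K V_mod r' \<cong>\<^sub>K M_mod n (r + r') \<eta>"
proof (rule kronecker_iso_refl[OF kronecker_tensor_V[OF kronecker_M_mod[OF assms]]])
  show "kronecker (M_mod n (r + r') \<eta>) (r + 1 + r') n n (MX n \<eta>) (MY n \<eta>)"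
    using kronecker_M_mod[OF assms, of "r + r'" \<eta>] by (simp add: ac_simps)
qed

lemma module_M_mod: "n > 0 \<Longrightarrow> is_module (M_mod n r \<eta>)" by (rule kronecker_module[OF kronecker_M_mod])
lemma rdim_M_mod [simp]: "rdim (M_mod n r \<eta>) = 2 * n" by (simp add: M_mod_def)

lemma syz_rel_M_mod: "n > 0 \<Longrightarrow> syz_rel (M_mod n (r + 1) \<eta>) (M_mod n r \<eta>)"
  by (rule syz_rel_minimal_exact[OF minimal_exact_M_mod])

text \<open>On the left a syzygy step raises \<open>k\<close>; on the right it flips the parity of
  M_n, which is its own syzygy up to parity. The conversion \<open>of_int\<close> into
  \<open>bit\<close> gives the parity for negative \<open>k\<close> as well.\<close>

lemma stably_iso_W_M_mod:
  assumes "n > 0" shows "stably_iso (W k r \<otimes>\<^sub>K M_mod n r' \<eta>) (M_mod n (r + r' + of_int k) \<eta>)"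
proof (rule stably_iso_family)
  fix k show "syz_rel (W (k + 1) r \<otimes>\<^sub>K M_mod n r' \<eta>) (W k r \<otimes>\<^sub>K M_mod n r' \<eta>)"
    by (rule syz_rel_tensor_left[OF syz_rel_W module_M_mod[OF assms]])
  show "syz_rel (M_mod n (r + r' + of_int (k + 1)) \<eta>) (M_mod n (r + r' + of_int k) \<eta>)"
    using syz_rel_M_mod[OF assms, of "r + r' + of_int k" \<eta>] by (simp add: add.assoc)
next
  have "W 0 r \<otimes>\<^sub>K M_mod n r' \<eta> \<cong>\<^sub>K V_mod r \<otimes>\<^sub>K M_mod n r' \<eta>"
    by (intro tensor_cong W_zero iso_refl module_M_mod assms)
  also have "\<dots> \<cong>\<^sub>K M_mod n (r + r') \<eta>" by (rule V_tensor_M_mod[OF assms])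
  finally show "stably_iso (W 0 r \<otimes>\<^sub>K M_mod n r' \<eta>) (M_mod n (r + r' + of_int 0) \<eta>)" by (simp add: stably_iso_iso)
qed

lemma stably_iso_M_mod_W:
  assumes "n > 0" shows "stably_iso (M_mod n r \<eta> \<otimes>\<^sub>K W k r') (M_mod n (r + r' + of_int k) \<eta>)"
proof (rule stably_iso_family)
  fix k show "syz_rel (M_mod n r \<eta> \<otimes>\<^sub>K W (k + 1) r') (M_mod n r \<eta> \<otimes>\<^sub>K W k r')"
    by (rule syz_rel_tensor_right[OF syz_rel_W module_M_mod[OF assms]])
  show "syz_rel (M_mod n (r + r' + of_int (k + 1)) \<eta>) (M_mod n (r + r' + of_int k) \<eta>)"
    using syz_rel_M_mod[OF assms, of "r + r' + of_int k" \<eta>] by (simp add: add.assoc)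
next
  have "M_mod n r \<eta> \<otimes>\<^sub>K W 0 r' \<cong>\<^sub>K M_mod n r \<eta> \<otimes>\<^sub>K V_mod r'"
    by (intro tensor_cong W_zero iso_refl module_M_mod assms)
  also have "\<dots> \<cong>\<^sub>K M_mod n (r + r') \<eta>" by (rule M_mod_tensor_V[OF assms])
  finally show "stably_iso (M_mod n r \<eta> \<otimes>\<^sub>K W 0 r') (M_mod n (r + r' + of_int 0) \<eta>)" by (simp add: stably_iso_iso)
qed

lemma stably_iso_W_W: "stably_iso (W k r \<otimes>\<^sub>K W l r') (W (k + l) (r + r'))"
proof (rule stably_iso_family[where F = "\<lambda>k. W k r \<otimes>\<^sub>K W l r'" and G = "\<lambda>k. W (k + l) (r + r')"])
  fix k show "syz_rel (W (k + 1) r \<otimes>\<^sub>K W l r') (W k r \<otimes>\<^sub>K W l r')"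
    by (rule syz_rel_tensor_left[OF syz_rel_W module_W])
  show "syz_rel (W (k + 1 + l) (r + r')) (W (k + l) (r + r'))"
    using syz_rel_W[of "k + l"] by (simp add: ac_simps)
next
  have "W 0 r \<otimes>\<^sub>K W l r' \<cong>\<^sub>K V_mod r \<otimes>\<^sub>K W l r'" by (intro tensor_cong W_zero iso_refl module_W)
  also have "\<dots> \<cong>\<^sub>K W l (r + r')" by (rule V_tensor_W)
  finally show "stably_iso (W 0 r \<otimes>\<^sub>K W l r') (W (0 + l) (r + r'))" by (simp add: stably_iso_iso)
qed

lemma copies_Pc_P_mod: "m \<odot>\<^sub>K Pc \<rho> \<cong>\<^sub>K m \<odot>\<^sub>K P_mod \<rho>"
  by (rule copies_cong[OF iso_sym[OF P_mod_Pc]])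

lemma tensor_formula:
  assumes "M \<cong>\<^sub>K A" "N \<cong>\<^sub>K B" "kronecker A t a b X Y" "kronecker B u c d Z V" "stably_iso (A \<otimes>\<^sub>K B) L" "th L = 0" "L \<cong>\<^sub>K L'"
    "rdim A * rdim B = rdim L + 4 * m" "\<rho> = t + u"
  shows "M \<otimes>\<^sub>K N \<cong>\<^sub>K L' \<oplus>\<^sub>K m \<odot>\<^sub>K P_mod \<rho>"
proof -
  have "M \<otimes>\<^sub>K N \<cong>\<^sub>K A \<otimes>\<^sub>K B" by (rule tensor_cong[OF assms(1,2)])
  also have "\<dots> \<cong>\<^sub>K L \<oplus>\<^sub>K m \<odot>\<^sub>K Pc \<rho>"
    by (rule stable_decomposition[OF assms(5,6)]) (use kronecker_tensor_th(2)[OF assms(3,4)] assms(8,9) in simp_all)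
  also have "\<dots> \<cong>\<^sub>K L' \<oplus>\<^sub>K m \<odot>\<^sub>K P_mod \<rho>" by (rule dsum_cong[OF assms(7) copies_Pc_P_mod])
  finally show ?thesis .
qed

lemma rdim_Wp [simp]: "rdim (Wp s r) = 2 * s + 1" using kronecker_tr(1)[OF kronecker_Wp] by simp
lemma rdim_Wn [simp]: "rdim (Wn s r) = 2 * s + 1" using kronecker_tr(1)[OF kronecker_Wn] by simp

text \<open>The parity of the projectives is the sum of the parities of the two tops:
  \<open>r' + 1\<close> for M_n, and \<open>r + parity s\<close> for \<open>Wp\<close> but
  \<open>r + parity s + 1\<close> for \<open>Wn\<close>. Hence the different parities for syzygies
  and cosyzygies.\<close>

lemma Omega_tensor_M_mod:
  assumes "n > 0"
  shows "Omega (int s) (V_mod r) \<otimes>\<^sub>K M_mod n r' \<eta>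
          \<cong>\<^sub>K M_mod n (r + r' + parity s) \<eta> \<oplus>\<^sub>K (s * n) \<odot>\<^sub>K P_mod (r + r' + parity (s + 1))"
    "Omega (- int s) (V_mod r) \<otimes>\<^sub>K M_mod n r' \<eta>
          \<cong>\<^sub>K M_mod n (r + r' + parity s) \<eta> \<oplus>\<^sub>K (s * n) \<odot>\<^sub>K P_mod (r + r' + parity s)"
proof -
  note m = module_M_mod[OF assms] and k = kronecker_M_mod[OF assms]
  show "Omega (int s) (V_mod r) \<otimes>\<^sub>K M_mod n r' \<eta>
          \<cong>\<^sub>K M_mod n (r + r' + parity s) \<eta> \<oplus>\<^sub>K (s * n) \<odot>\<^sub>K P_mod (r + r' + parity (s + 1))"
    by (rule tensor_formula[OF Omega_Wp iso_refl[OF m] kronecker_Wp k _ kronecker_th[OF k] iso_refl[OF m]])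
      (use stably_iso_W_M_mod[OF assms, of "int s" r r' \<eta>] in \<open>simp_all add: W_nat parity_def algebra_simps\<close>)
  have "stably_iso (Wn s r \<otimes>\<^sub>K M_mod n r' \<eta>) (W (- int s) r \<otimes>\<^sub>K M_mod n r' \<eta>)"
    by (rule stably_iso_iso[OF tensor_cong[OF iso_sym[OF W_neg] iso_refl[OF m]]])
  also have "stably_iso \<dots> (M_mod n (r + r' + parity s) \<eta>)"
    using stably_iso_W_M_mod[OF assms, of "- int s" r r' \<eta>] by (simp add: parity_def)
  finally have stably_iso: "stably_iso (Wn s r \<otimes>\<^sub>K M_mod n r' \<eta>) (M_mod n (r + r' + parity s) \<eta>)" .
  have "r + r' + parity s = (r + parity s + 1) + (r' + 1)"
  proof -
    have "(r + parity s + 1) + (r' + 1) = (r + r' + parity s) + 1 + 1" by (simp only: ac_simps)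
    then show ?thesis by simp
  qed
  then show "Omega (- int s) (V_mod r) \<otimes>\<^sub>K M_mod n r' \<eta>
          \<cong>\<^sub>K M_mod n (r + r' + parity s) \<eta> \<oplus>\<^sub>K (s * n) \<odot>\<^sub>K P_mod (r + r' + parity s)"
    by (intro tensor_formula[OF Omega_Wn iso_refl[OF m] kronecker_Wn k stably_iso kronecker_th[OF k] iso_refl[OF m]])
      (simp_all add: algebra_simps)
qed

lemma Omega_tensor_Omega:
  "Omega (int s) (V_mod r) \<otimes>\<^sub>K Omega (int n) (V_mod r')
    \<cong>\<^sub>K Omega (int s + int n) (V_mod (r + r')) \<oplus>\<^sub>K (s * n) \<odot>\<^sub>K P_mod (r + r' + parity (s + n))"
  by (rule tensor_formula[OF Omega_Wp Omega_Wp kronecker_Wp kronecker_Wp _ th_W iso_sym[OF Omega_W]])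
    (use stably_iso_W_W[of "int s" r "int n" r'] in \<open>simp_all add: W_nat rdim_W parity_add nat_add_distrib algebra_simps\<close>)

lemma Omega_tensor_Omega_neg:
  assumes "(2 * s + 1) * (2 * n + 1) = 2 * nat \<bar>int s - int n\<bar> + 1 + 4 * m"
  shows "Omega (int s) (V_mod r) \<otimes>\<^sub>K Omega (- int n) (V_mod r')
    \<cong>\<^sub>K Omega (int s - int n) (V_mod (r + r')) \<oplus>\<^sub>K m \<odot>\<^sub>K P_mod (r + r' + parity (s + n + 1))"
proof -
  have "stably_iso (Wp s r \<otimes>\<^sub>K Wn n r') (W (int s) r \<otimes>\<^sub>K W (- int n) r')"
    unfolding W_nat by (rule stably_iso_iso[OF tensor_cong[OF iso_refl[OF kronecker_module[OF kronecker_Wp]] iso_sym[OF W_neg]]])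
  also have "stably_iso \<dots> (W (int s - int n) (r + r'))" using stably_iso_W_W[of "int s" r "- int n" r'] by simp
  finally have stably_iso: "stably_iso (Wp s r \<otimes>\<^sub>K Wn n r') (W (int s - int n) (r + r'))" .
  show ?thesis
    by (rule tensor_formula[OF Omega_Wp Omega_Wn kronecker_Wp kronecker_Wn stably_iso th_W iso_sym[OF Omega_W]])
      (use assms in \<open>simp_all add: rdim_W parity_add ac_simps\<close>)
qed

lemma P_mod_tensor:
  "P_mod r \<otimes>\<^sub>K P_mod r' \<cong>\<^sub>K 2 \<odot>\<^sub>K P_mod 0 \<oplus>\<^sub>K 2 \<odot>\<^sub>K P_mod 1"
  "P_mod r \<otimes>\<^sub>K Omega (int s) (V_mod r')
    \<cong>\<^sub>K s \<odot>\<^sub>K P_mod (r + r' + parity (s + 1)) \<oplus>\<^sub>K (s + 1) \<odot>\<^sub>K P_mod (r + r' + parity s)"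
  "P_mod r \<otimes>\<^sub>K Omega (- int s) (V_mod r')
    \<cong>\<^sub>K s \<odot>\<^sub>K P_mod (r + r' + parity (s + 1)) \<oplus>\<^sub>K (s + 1) \<odot>\<^sub>K P_mod (r + r' + parity s)"
  "n > 0 \<Longrightarrow> P_mod r \<otimes>\<^sub>K M_mod n r' \<eta> \<cong>\<^sub>K n \<odot>\<^sub>K P_mod 0 \<oplus>\<^sub>K n \<odot>\<^sub>K P_mod 1"
proof -
  note c = dsum_cong[OF copies_Pc_P_mod copies_Pc_P_mod]
  show "P_mod r \<otimes>\<^sub>K P_mod r' \<cong>\<^sub>K 2 \<odot>\<^sub>K P_mod 0 \<oplus>\<^sub>K 2 \<odot>\<^sub>K P_mod 1"
    by (rule iso_trans[OF iso_trans[OF tensor_cong[OF P_mod_Pc P_mod_Pc] Pc_tensor_even] c])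
      (simp_all add: tr_kk_Pc)
  have odd: "P_mod r \<otimes>\<^sub>K X
    \<cong>\<^sub>K s \<odot>\<^sub>K P_mod (r + r' + parity (s + 1)) \<oplus>\<^sub>K (s + 1) \<odot>\<^sub>K P_mod (r + r' + parity s)"
    if "X \<cong>\<^sub>K A" "is_module A" "rdim A = 2 * s + 1" "tr (kk A) = sgn_bit (r' + parity s)" for X A
  proof -
    have e: "r + (r' + parity s) = r + r' + parity s" "r + r' + parity s + 1 = r + r' + parity (s + 1)"
      by (simp_all add: parity_add ac_simps)
    show ?thesis
      using iso_trans[OF iso_trans[OF tensor_cong[OF P_mod_Pc that(1)] Pc_tensor_odd[OF that(2-4), of r]] c]
      unfolding e(1) unfolding e(2) .
  qed
  show "P_mod r \<otimes>\<^sub>K Omega (int s) (V_mod r')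
    \<cong>\<^sub>K s \<odot>\<^sub>K P_mod (r + r' + parity (s + 1)) \<oplus>\<^sub>K (s + 1) \<odot>\<^sub>K P_mod (r + r' + parity s)"
    by (rule odd[OF Omega_Wp kronecker_module[OF kronecker_Wp]]) (simp_all add: kronecker_tr(2)[OF kronecker_Wp])
  show "P_mod r \<otimes>\<^sub>K Omega (- int s) (V_mod r')
    \<cong>\<^sub>K s \<odot>\<^sub>K P_mod (r + r' + parity (s + 1)) \<oplus>\<^sub>K (s + 1) \<odot>\<^sub>K P_mod (r + r' + parity s)"
    by (rule odd[OF Omega_Wn kronecker_module[OF kronecker_Wn]]) (simp_all add: kronecker_tr(2)[OF kronecker_Wn])
  assume n: "n > 0"
  show "P_mod r \<otimes>\<^sub>K M_mod n r' \<eta> \<cong>\<^sub>K n \<odot>\<^sub>K P_mod 0 \<oplus>\<^sub>K n \<odot>\<^sub>K P_mod 1"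
    by (rule iso_trans[OF iso_trans[OF tensor_cong[OF P_mod_Pc iso_refl[OF module_M_mod[OF n]]] Pc_tensor_even[OF module_M_mod[OF n]]] c])
      (simp_all add: kronecker_tr(2)[OF kronecker_M_mod[OF n]])
qed

subsection \<open>Tensor products of the modules \<open>M\<^sub>n(r, \<eta>)\<close>\<close>

text \<open>The vectors e_i and f_i with i at most s span the submodule. This filtration by copies
  of M_1 reduces the product for distinct points to dimension four.\<close>

lemma short_exact_M_mod:
  assumes "s > 0" shows "short_exact (M_mod s r \<eta>) (M_mod (Suc s) r \<eta>) (M_mod 1 r \<eta>)"
proof -
  obtain iT pT iS pS where d1: "KR_data (M_mod s r \<eta>) (r + 1) s s (MX s \<eta>) (MY s \<eta>) iT pT iS pS"
    using krE[OF kronecker_M_mod[OF assms]] .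
  obtain iT' pT' iS' pS' where d2: "KR_data (M_mod (Suc s) r \<eta>) (r + 1) (Suc s) (Suc s) (MX (Suc s) \<eta>) (MY (Suc s) \<eta>) iT' pT' iS' pS'"
    using krE[OF kronecker_M_mod] by blast
  have one: "0 < (1 :: nat)" by simp
  obtain iT2 pT2 iS2 pS2 where d3: "KR_data (M_mod 1 r \<eta>) (r + 1) 1 1 (MX 1 \<eta>) (MY 1 \<eta>) iT2 pT2 iS2 pS2"
    using krE[OF kronecker_M_mod[OF one]] .
  note D1 = KR_dataD[OF d1] and D2 = KR_dataD[OF d2] and D3 = KR_dataD[OF d3]
  have i: "rect (Suc s) s (Idm s)" "rect s (Suc s) (Idm s)" "rect 1 (Suc s) (Eu 0 s)" "rect (Suc s) 1 (Eu s 0)"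
    by (auto intro: rect_Idm)
  have U: "Up s * Idm s = Idm s * Up (s - 1)" "Eu 0 s * Up s = 0" using assms
    by (cases s; auto intro!: fmat_eqI simp: ent_Up ent_Idm ent_Eu)+
  have X: "MX (Suc s) \<eta> * Idm s = Idm s * MX s \<eta>" "MY (Suc s) \<eta> * Idm s = Idm s * MY s \<eta>"
    "Eu 0 s * MX (Suc s) \<eta> = MX 1 \<eta> * Eu 0 s" "Eu 0 s * MY (Suc s) \<eta> = MY 1 \<eta> * Eu 0 s"
    by (simp_all add: MX_def MY_def distrib_left distrib_right U split: prod.splits)
  have XP: "MX (Suc s) \<eta> * pT = MX s \<eta> * pT" "MY (Suc s) \<eta> * pT = MY s \<eta> * pT"
    using arg_cong[OF X(1), of "\<lambda>f. f * pT"] arg_cong[OF X(2), of "\<lambda>f. f * pT"]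
    by (simp_all add: mult.assoc KR_rules[OF d1])
  note X2 = X[THEN assoc_rew, unfolded mult.assoc] XP XP[THEN assoc_rew, unfolded mult.assoc]
  have E: "Idm s + Eu s s = Idm (Suc s)" by (simp add: Idm_Suc)
  note r = KR_rules[OF d1] KR_rules[OF d2] KR_rules[OF d3] mult.assoc distrib_left distrib_right X X2
    i[THEN rectD(1)] i[THEN rectD(2)] i[THEN rectD(3)] i[THEN rectD(4)] Eu_times_Eu assoc_rew[OF Eu_times_Eu]
  have le: "s \<le> Suc s" by simp
  note np = rectD[OF rect_mono[OF D1(3) le order_refl]] rectD[OF rect_mono[OF D1(5) le order_refl]]
  define j where "j = iT' * Idm s * pT + iS' * Idm s * pS"
  define q where "q = iT2 * Eu 0 s * pT' + iS2 * Eu 0 s * pS'"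
  define l where "l = iT * Idm s * pT' + iS * Idm s * pS'"
  define v where "v = iT' * Eu s 0 * pT2 + iS' * Eu s 0 * pS2"
  have j: "hom (M_mod s r \<eta>) (M_mod (Suc s) r \<eta>) j"
    by (rule homI, unfold j_def, intro rect_plus rect_times[OF rect_times[OF D2(2) i(1)] D1(3)]
        rect_times[OF rect_times[OF D2(4) i(1)] D1(5)]) (simp_all add: r scaleC_add del: rectD)
  have q: "hom (M_mod (Suc s) r \<eta>) (M_mod 1 r \<eta>) q"
    by (rule homI, unfold q_def, intro rect_plus rect_times[OF rect_times[OF D3(2) i(3)] D2(3)]
        rect_times[OF rect_times[OF D3(4) i(3)] D2(5)]) (simp_all add: r scaleC_add)
  have l: "rect (rdim (M_mod s r \<eta>)) (rdim (M_mod (Suc s) r \<eta>)) l" unfolding l_def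
    by (intro rect_plus rect_times[OF rect_times[OF D1(2) i(2)] D2(3)] rect_times[OF rect_times[OF D1(4) i(2)] D2(5)])
  have v: "rect (rdim (M_mod (Suc s) r \<eta>)) (rdim (M_mod 1 r \<eta>)) v" unfolding v_def
    by (intro rect_plus rect_times[OF rect_times[OF D2(2) i(4)] D3(3)] rect_times[OF rect_times[OF D2(4) i(4)] D3(5)])
  have lj: "l * j = Idm (rdim (M_mod s r \<eta>))" using D1(12) by (simp add: l_def j_def r np)
  have E0: "Eu 0 0 = Idm 1" by (auto intro!: fmat_eqI simp: ent_Eu ent_Idm)
  have qv: "q * v = Idm (rdim (M_mod 1 r \<eta>))"
    using D3(12) by (simp add: q_def v_def r E0)
  have "j * l + v * q = iT' * (Idm s + Eu s s) * pT' + iS' * (Idm s + Eu s s) * pS'"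
    by (simp add: j_def l_def q_def v_def r algebra_simps)
  also have "\<dots> = Idm (rdim (M_mod (Suc s) r \<eta>))" unfolding E using D2(12) by (simp add: r)
  finally show ?thesis by (intro sesI[OF D1(1) D2(1) D3(1) j q l v lj qv])
qed

text \<open>Top tensor top is one-dimensional, and up to sign \<xi>1\<xi>2 maps it by the
  determinant \<open>a * c' - c * a'\<close>, which is nonzero exactly when the two points of the
  projective line differ. A four-dimensional module on which \<xi>1\<xi>2 is nonzero is some
  \<open>Pc\<close>.\<close>

lemma M_one_tensor:
  assumes "\<eta> \<noteq> \<eta>'" shows "higman_projective (M_mod 1 r \<eta> \<otimes>\<^sub>K M_mod 1 r' \<eta>')"
proof -
  have pos: "(0 :: nat) < 1" by simp
  obtain a b c d where pencil_coeffs: "pencil_coeffs \<eta> = (a, b, c, d)" by (metis prod_cases4)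
  obtain a' b' c' d' where cf': "pencil_coeffs \<eta>' = (a', b', c', d')" by (metis prod_cases4)
  have det: "a * c' - c * a' \<noteq> 0" using assms pencil_coeffs cf' by (cases \<eta>; cases \<eta>') (auto simp: pencil_coeffs_def)
  note k = kronecker_M_mod[OF pos, of r \<eta>] and k' = kronecker_M_mod[OF pos, of r' \<eta>']
  obtain iT pT iS pS where d: "KR_data (M_mod 1 r \<eta>) (r + 1) 1 1 (MX 1 \<eta>) (MY 1 \<eta>) iT pT iS pS"
    using krE[OF k] .
  obtain iT' pT' iS' pS' where d': "KR_data (M_mod 1 r' \<eta>') (r' + 1) 1 1 (MX 1 \<eta>') (MY 1 \<eta>') iT' pT' iS' pS'"
    using krE[OF k'] .
  have M: "MX 1 \<eta> = a *\<^sub>C Idm 1" "MY 1 \<eta> = c *\<^sub>C Idm 1" "MX 1 \<eta>' = a' *\<^sub>C Idm 1" "MY 1 \<eta>' = c' *\<^sub>C Idm 1"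
    by (simp_all add: MX_def MY_def pencil_coeffs cf')
  let ?M = "M_mod 1 r \<eta>" and ?N = "M_mod 1 r' \<eta>'"
  note D = KR_dataD[OF d] and D' = KR_dataD[OF d']
  have x: "x1 ?M = a *\<^sub>C (iS * pT)" "x2 ?M = c *\<^sub>C (iS * pT)" "x1 ?N = a' *\<^sub>C (iS' * pT')" "x2 ?N = c' *\<^sub>C (iS' * pT')"
    by (simp_all add: D(14,15) D'(14,15) M KR_rules[OF d] KR_rules[OF d'] mult.assoc)
  have th: "th (?M \<otimes>\<^sub>K ?N) = (- sgn_bit r * (a * c' - c * a')) *\<^sub>C kp 2 2 (iS * pT) (iS' * pT')"
    unfolding kronecker_tensor_th(1)[OF k k'] x
    by (simp add: kp_linear KR_rules[OF d] mult.assoc)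
      (auto intro!: fmat_eqI simp: algebra_simps)
  have "kp 1 2 pS pS' * kp 2 2 (iS * pT) (iS' * pT') * kp 2 1 iT iT' = Idm 1"
  proof -
    have "rect 1 2 pS'" "rect 2 2 (iS' * pT')" "rect 2 1 iT'" "rect 1 2 (pS' * (iS' * pT'))"
      using D'(2-5) by (auto intro: rect_times)
    then show ?thesis using kp_Idm[of 1 1]
      by (simp add: kp_mult KR_rules[OF d] KR_rules[OF d'] mult.assoc)
  qed
  then have "kp 2 2 (iS * pT) (iS' * pT') \<noteq> 0" using Idm_inj[of 1 0] by auto
  then have "th (?M \<otimes>\<^sub>K ?N) \<noteq> 0" unfolding th using det scaleC_cancel by (metis mult_eq_0_iff neg_equal_0_iff_equal sgn_bit_simps(5))
  then have "?M \<otimes>\<^sub>K ?N \<cong>\<^sub>K Pc (r + 1 + (r' + 1))"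
    by (intro Pc_char kronecker_tensor_th(2)[OF k k'] module_tensor D(1) D'(1)) simp_all
  then show ?thesis using higman_projective_iso[OF iso_sym higman_projective_Pc] by blast
qed

text \<open>Extensions of projectives are projective, so the case of two factors M_1 propagates
  along the filtrations of both factors; dimension and parity then determine the module.\<close>

lemma M_mod_tensor_distinct:
  assumes "\<eta> \<noteq> \<eta>'" "s > 0" "n > 0"
  shows "M_mod s r \<eta> \<otimes>\<^sub>K M_mod n r' \<eta>' \<cong>\<^sub>K (s * n) \<odot>\<^sub>K P_mod (r + r')"
proof -
  have 1: "higman_projective (M_mod 1 r \<eta> \<otimes>\<^sub>K M_mod (Suc n) r' \<eta>')" for n
  proof (induction n)
    case 0
    show ?case using M_one_tensor[OF assms(1)] by (simp add: One_nat_def)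
  next
    case (Suc n)
    show ?case
      by (rule short_exact_higman_projective[OF short_exact_tensor_right[OF short_exact_M_mod module_M_mod] Suc M_one_tensor[OF assms(1)]]) simp_all
  qed
  have "higman_projective (M_mod (Suc s) r \<eta> \<otimes>\<^sub>K M_mod (Suc n) r' \<eta>')" for s n
  proof (induction s)
    case 0
    show ?case using 1 by (simp add: One_nat_def)
  next
    case (Suc s)
    show ?case by (rule short_exact_higman_projective[OF short_exact_tensor_left[OF short_exact_M_mod module_M_mod] Suc 1]) simp_all
  qed
  then have hp: "higman_projective (M_mod s r \<eta> \<otimes>\<^sub>K M_mod n r' \<eta>')" using assms(2,3) by (metis Suc_pred)
  have e: "r + 1 + (r' + 1) = r + r'"
  proof -
    have "r + 1 + (r' + 1) = r + r' + 1 + 1" by (simp only: ac_simps)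
    then show ?thesis by simp
  qed
  have "M_mod s r \<eta> \<otimes>\<^sub>K M_mod n r' \<eta>' \<cong>\<^sub>K (s * n) \<odot>\<^sub>K Pc (r + r')"
    by (rule higman_projective_decomposition[OF hp kronecker_tensor_th(2)[OF kronecker_M_mod[OF assms(2), of r \<eta>]
      kronecker_M_mod[OF assms(3), of r' \<eta>'], unfolded e]]) simp
  then show ?thesis using iso_trans copies_Pc_P_mod by blast
qed

definition QX :: "nat \<Rightarrow> cp1 \<Rightarrow> fmat" where
  "QX k \<eta> = (case pencil_coeffs \<eta> of (a, b, c, d) \<Rightarrow> a *\<^sub>C Idm k + b *\<^sub>C Up k)"
definition QY :: "nat \<Rightarrow> cp1 \<Rightarrow> fmat" where
  "QY k \<eta> = (case pencil_coeffs \<eta> of (a, b, c, d) \<Rightarrow> c *\<^sub>C Idm k + d *\<^sub>C Up k)"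

text \<open>\<open>Q k r \<eta>\<close> is \<open>\<Omega>\<^sup>k V(r)\<close> in the coordinates in which it is a quotient of
  \<open>M\<^bsub>k+1\<^esub>(r', \<eta>)\<close>.\<close>

definition Q :: "nat \<Rightarrow> bit \<Rightarrow> cp1 \<Rightarrow> rep" where
  "Q k r \<eta> = Kr (r + parity k) (k + 1) k (QX k \<eta>) (QY k \<eta>)"

lemma rect_QX: "rect k (k + 1) (QX k \<eta>)" and rect_QY: "rect k (k + 1) (QY k \<eta>)"
  by (auto simp: QX_def QY_def split: prod.splits intro!: rect_plus rect_scaleC rect_Up rect_Idm)

lemma kronecker_Q: "kronecker (Q k r \<eta>) (r + parity k) (k + 1) k (QX k \<eta>) (QY k \<eta>)"
  unfolding Q_def by (rule kronecker_Kr[OF rect_QX rect_QY])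

lemma minimal_exact_Q: "minimal_exact (Q (Suc k) r \<eta>) (free_rep (r + parity k) (k + 1)) (Q k r \<eta>)"
proof (rule kronecker_minimal_exact[OF kronecker_Q])
  have e: "r + parity (Suc k) = r + parity k + 1" by (simp add: add.assoc)
  show "kronecker (Q (Suc k) r \<eta>) (r + parity k + 1) (Suc k + 1) (k + 1) (QX (Suc k) \<eta>) (- (- QY (Suc k) \<eta>))"
    using kronecker_Q[of "Suc k" r \<eta>] unfolding e unfolding minus_minus Suc_eq_plus1 .
  show "exact_pair (k + 1) k (Suc k + 1) (QX k \<eta>) (QY k \<eta>) (- QY (Suc k) \<eta>) (QX (Suc k) \<eta>)"
    unfolding exact_pair_def
  proof (intro conjI)
    show "rect (k + 1) (Suc k + 1) (- QY (Suc k) \<eta>)" "rect (k + 1) (Suc k + 1) (QX (Suc k) \<eta>)"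
      using rect_uminus[OF rect_QY[of "Suc k" \<eta>]] rect_QX[of "Suc k" \<eta>] unfolding Suc_eq_plus1 .
    show "\<exists>l1 l2 s1 s2. rect (Suc k + 1) (k + 1) l1 \<and> rect (Suc k + 1) (k + 1) l2 \<and> rect (k + 1) k s1 \<and>
        rect (k + 1) k s2 \<and> l1 * (- QY (Suc k) \<eta>) + l2 * QX (Suc k) \<eta> = Idm (Suc k + 1) \<and>
        QX k \<eta> * s1 + QY k \<eta> * s2 = Idm k \<and> (- QY (Suc k) \<eta>) * l1 + s1 * QX k \<eta> = Idm (k + 1) \<and>
        (- QY (Suc k) \<eta>) * l2 + s1 * QY k \<eta> = 0 \<and> QX (Suc k) \<eta> * l1 + s2 * QX k \<eta> = 0 \<and>
        QX (Suc k) \<eta> * l2 + s2 * QY k \<eta> = Idm (k + 1)"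
    proof (cases \<eta>)
      case (Fin c)
      have q: "QX k \<eta> = Idm k" "QY k \<eta> = c *\<^sub>C Idm k + Up k" for k
        by (simp_all add: QX_def QY_def Fin pencil_coeffs_def)
      \<comment> \<open>As for \<open>Wp\<close>, with the extra term
        \<open>- c *\<^sub>C Eu (Suc k) k\<close> compensating the summand
        \<open>c *\<^sub>C Idm k\<close> of \<open>QY\<close>.\<close>
      show ?thesis unfolding q
        by (rule exI[of _ "- Eu (Suc k) k"], rule exI[of _ "Idm (Suc k) - c *\<^sub>C Eu (Suc k) k"], rule exI[of _ "Idm k"], rule exI[of _ 0])
          (auto intro!: fmat_eqI rect_uminus rect_Idm rect_minus rect_scaleC
            simp: ent_Up ent_Idm ent_Eu distrib_left distrib_right left_diff_distrib right_diff_distrib split: if_splits)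
    next
      case Infty
      have q: "QX k \<eta> = Up k" "QY k \<eta> = Idm k" for k
        by (simp_all add: QX_def QY_def Infty pencil_coeffs_def)
      show ?thesis unfolding q
        by (rule exI[of _ "- Idm (Suc k)"], rule exI[of _ "Eu (Suc k) k"], rule exI[of _ 0], rule exI[of _ "Idm k"])
          (auto intro!: fmat_eqI rect_uminus rect_Idm simp: ent_Up ent_Idm ent_Eu split: if_splits)
    qed
  qed
qed

text \<open>No base change is computed: both families start at V(r) and consist of successive
  syzygies, hence are stably isomorphic, and for modules killed by \<xi>1\<xi>2 this
  suffices.\<close>

lemma Q_iso: "Q k r \<eta> \<cong>\<^sub>K Wp k r"
proof (rule stably_iso_imp_iso[OF _ kronecker_th[OF kronecker_Q] kronecker_th[OF kronecker_Wp]])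
  show "stably_iso (Q k r \<eta>) (Wp k r)"
  proof (induction k)
    case 0
    have "QX 0 \<eta> = 0" "QY 0 \<eta> = 0" by (simp_all add: QX_def QY_def split: prod.splits)
    then show ?case using kronecker_iso_refl[OF kronecker_Q[of 0 r \<eta>]] kronecker_Wp[of 0 r] stably_iso_iso by simp
  next
    case (Suc k)
    show ?case by (rule stably_iso_syzygy[OF minimal_exact_short_exact[OF minimal_exact_Q] minimal_exact_short_exact[OF minimal_exact_Wp] higman_projective_free_rep higman_projective_free_rep Suc])
  qed
qed

text \<open>The m-th power of the nilpotent Jordan block of size \<open>s\<close>, written down
  directly; it is zero as soon as \<open>s \<le> m\<close>.\<close>

definition Us :: "nat \<Rightarrow> nat \<Rightarrow> fmat" where "Us s m = tp (Sh m (s - m))"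

lemma ent_Us: "ent (Us s m) i j = (if i < s - m \<and> j = m + i then 1 else 0)"
  by (simp add: Us_def ent_Sh)

lemma rect_Us: "rect s s (Us s m)" by (rule rect_entI) (auto simp: ent_Us)

lemma Us_rules: "Us s 0 = Idm s" "s \<le> m \<Longrightarrow> Us s m = 0"
  "Us s m * Up (s - 1) = Us s (Suc m)" "Up (s - 1) * Us s m = Us s (Suc m)"
  by (auto intro!: fmat_eqI simp: ent_Us ent_Idm split: if_splits)

text \<open>The inclusion \<open>x \<mapsto> x \<otimes> f\<^sub>n\<close> of \<open>M\<^sub>s(r, \<eta>)\<close> into \<open>M\<^sub>s(r, \<eta>) \<otimes> M\<^sub>n(r', \<eta>)\<close> has a
  retraction when \<open>s \<le> n\<close>: with \<open>\<nu>\<close> the nilpotent endomorphism of \<open>M\<^sub>s\<close> that lowers indices, it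
  sends \<open>x \<otimes> f\<^bsub>n-m\<^esub>\<close> to \<open>\<nu>\<^sup>m x\<close> and \<open>f\<^sub>i \<otimes> e\<^bsub>n-m\<^esub>\<close> to \<open>\<plusminus> \<nu>\<^sup>m e\<^sub>i\<close>. The condition \<open>s \<le> n\<close> makes
  the last term \<open>\<nu>\<^sup>n\<close> of a telescoping sum vanish.\<close>

lemma M_mod_retraction:
  assumes d: "KR_data A (r + 1) s s (MX s \<eta>) (MY s \<eta>) iT pT iS pS"
    and d': "KR_data B (r' + 1) n n (MX n \<eta>) (MY n \<eta>) iT' pT' iS' pS'"
    and s: "0 < s" "s \<le> n"
  obtains \<rho> where "hom (A \<otimes>\<^sub>K B) (A \<otimes>\<^sub>K V_mod r') \<rho>"
    "\<rho> * kp (rdim B) 1 (Idm (rdim A)) (iS' * Eu (n - 1) 0) = Idm (rdim A)"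
proof -
  define N where "N = rdim B"
  define \<sigma> where "\<sigma> = sgn_bit r"
  note D = KR_dataD[OF d] and D' = KR_dataD[OF d', folded N_def]
  define fs where "fs m = Eu 0 m * pS'" for m
  define es where "es m = Eu 0 m * pT'" for m
  define v where "v m = iT * Us s m * pT + iS * Us s m * pS" for m
  define e where "e m = iT * Us s m * pS" for m
  define T where "T m = kp 1 N (v m) (fs (n - 1 - m)) + \<sigma> *\<^sub>C kp 1 N (e m) (es (n - 1 - m))" for m
  define \<rho> where "\<rho> = (\<Sum>m<n. T m)"
  note U = rectD[OF rect_Us[of s]]
  note r = KR_rules[OF d] mult.assoc distrib_left distrib_right U
  have rfs: "rect 1 N (fs m)" and res: "rect 1 N (es m)" if "m < n" for m
    unfolding fs_def es_def using that by (auto intro!: rect_times[of 1 n] D'(3,5))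
  have rv: "rect (rdim A) (rdim A) (v m)" for m unfolding v_def
    by (intro rect_plus rect_times[OF rect_times[OF D(2) rect_Us] D(3)] rect_times[OF rect_times[OF D(4) rect_Us] D(5)])
  have re: "rect (rdim A) (rdim A) (e m)" for m unfolding e_def
    by (intro rect_times[OF rect_times[OF D(2) rect_Us] D(5)])
  \<comment> \<open>A single \<open>T m\<close> fails to be equivariant by a difference of
    consecutive terms, in which only the nilpotent coefficient \<open>d\<close> of the pencil
    appears. The parameters \<open>g\<close> and \<open>d\<close> let one computation serve both
    \<xi>1 and \<xi>2.\<close>
  have step: "T m * (kp N N (kk A) \<xi>' + kp N N \<xi> (Idm N)) - kp 1 1 \<xi> (Idm 1) * T m =
      d *\<^sub>C (kp 1 N (v m * kk A) (es (n - m)) - kp 1 N (v (Suc m) * kk A) (es (n - Suc m)))"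
    if m: "m < n" and xi: "\<xi> = iS * (g *\<^sub>C Idm s + d *\<^sub>C Up (s - 1)) * pT"
      "\<xi>' = iS' * (g *\<^sub>C Idm n + d *\<^sub>C Up (n - 1)) * pT'" for m \<xi> \<xi>' g d
  proof -
    define j where "j = n - 1 - m"
    have j: "j < n" "n - m = Suc j" "n - Suc m = j" using m by (auto simp: j_def)
    have EU: "Eu 0 j * Up (n - 1) * pT' = es (Suc j)"
    proof (cases "j < n - 1")
      case True
      then have "Eu 0 j * Up (n - 1) = Eu 0 (Suc j)" by (auto intro!: fmat_eqI simp: ent_Up ent_Eu)
      then show ?thesis by (simp add: es_def)
    next
      case False
      then have "Suc j = n" using j by simp
      moreover have "Eu 0 n * pT' = 0" using rectD(1)[OF D'(3)]
        by (metis Eu_times_Idm less_irrefl mult.assoc mult_zero_left)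
      moreover have "Eu 0 j * Up (n - 1) = 0" using False by (auto intro!: fmat_eqI simp: ent_Up ent_Eu)
      ultimately show ?thesis by (simp add: es_def)
    qed
    have rxi: "rect N N \<xi>'" unfolding xi using s
      by (intro rect_times[OF rect_times[OF D'(4)] D'(3)] rect_plus rect_scaleC rect_Up) simp_all
    have rU: "rect n n (Up (n - 1))" using s by (intro rect_Up) simp_all
    have fx: "fs j * \<xi>' = g *\<^sub>C es j + d *\<^sub>C es (Suc j)"
      using j(1) EU by (simp add: fs_def xi es_def KR_rules[OF d'] rectD[OF rU] mult.assoc distrib_left distrib_right)
    have ex: "es j * \<xi>' = 0" by (simp add: es_def xi KR_rules[OF d'] mult.assoc)
    have vx: "v m * \<xi> = \<xi> * v m"
      by (simp add: v_def xi r Us_rules assoc_rew[OF Us_rules(3)] assoc_rew[OF Us_rules(4)])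
    have vk: "v k * kk A = \<sigma> *\<^sub>C (iS * Us s k * pS - iT * Us s k * pT)" for k
      by (simp add: v_def r \<sigma>_def scaleC_diff)
    have sc: "sgn_bit r * (c * sgn_bit r) = c" for c by (simp add: mult.left_commute[of _ c])
    have exi: "e m * \<xi> = \<xi> * e m - \<sigma> *\<^sub>C (g *\<^sub>C (v m * kk A) + d *\<^sub>C (v (Suc m) * kk A))"
      unfolding vk
      by (simp add: e_def xi r Us_rules assoc_rew[OF Us_rules(3)] assoc_rew[OF Us_rules(4)] \<sigma>_def
          scaleC_diff scaleC_add right_diff_distrib sc algebra_simps)
    have \<sigma>\<sigma>: "\<sigma> * \<sigma> = 1" "\<sigma> * (\<sigma> * c) = c" for c by (simp_all add: \<sigma>_def)
    note k = kp_mult[OF rfs[OF j(1)] rxi] kp_mult[OF res[OF j(1)] rxi]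
      kp_mult[OF rfs[OF j(1)] rect_Idm_same] kp_mult[OF res[OF j(1)] rect_Idm_same]
      kp_mult[OF rect_Idm_same rfs[OF j(1)]] kp_mult[OF rect_Idm_same res[OF j(1)]]
      rectD[OF rfs[OF j(1)]] rectD[OF res[OF j(1)]]
    show ?thesis
      unfolding T_def j_def[symmetric] j(2,3)
      by (simp add: distrib_left distrib_right k fx ex vx exi kp_linear scaleC_add scaleC_diff \<sigma>\<sigma> algebra_simps)
  qed
  have tele: "\<rho> * (kp N N (kk A) \<xi>' + kp N N \<xi> (Idm N)) = kp 1 1 \<xi> (Idm 1) * \<rho>"
    if xi: "\<xi> = iS * (g *\<^sub>C Idm s + d *\<^sub>C Up (s - 1)) * pT"
      "\<xi>' = iS' * (g *\<^sub>C Idm n + d *\<^sub>C Up (n - 1)) * pT'" for \<xi> \<xi>' g d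
  proof -
    define G where "G m = d *\<^sub>C kp 1 N (v m * kk A) (es (n - m))" for m
    have "\<rho> * (kp N N (kk A) \<xi>' + kp N N \<xi> (Idm N)) - kp 1 1 \<xi> (Idm 1) * \<rho> =
        (\<Sum>m<n. T m * (kp N N (kk A) \<xi>' + kp N N \<xi> (Idm N)) - kp 1 1 \<xi> (Idm 1) * T m)"
      by (simp add: \<rho>_def sum_subtractf sum_distrib_left sum_distrib_right)
    also have "\<dots> = (\<Sum>m<n. G m - G (Suc m))"
      by (rule sum.cong[OF refl]) (simp add: step[OF _ xi] G_def scaleC_diff)
    also have "\<dots> = G 0 - G n" by (rule sum_lessThan_telescope')
    \<comment> \<open>The two ends vanish for different reasons: \<open>es n\<close> is a coordinate
      past the last one, whereas \<open>v n\<close> is a power of \<nu> that is zero by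
      \<open>s \<le> n\<close>.\<close>
    also have "G 0 = 0"
    proof -
      have "es n = 0" using rectD(1)[OF D'(3)] unfolding es_def
        by (metis Eu_times_Idm less_irrefl mult.assoc mult_zero_left)
      then show ?thesis by (simp add: G_def kp_linear)
    qed
    also have "G n = 0" using s(2) by (simp add: G_def v_def Us_rules(2) kp_linear)
    finally show ?thesis by simp
  qed
  have hom: "hom (A \<otimes>\<^sub>K B) (A \<otimes>\<^sub>K V_mod r') \<rho>"
  proof (rule homI)
    note ac = ac_tensor[OF D(1) D'(1), folded N_def] ac_tensor[OF D(1) module_V_mod] ac_V_mod kp_linear
    show "rect (rdim (A \<otimes>\<^sub>K V_mod r')) (rdim (A \<otimes>\<^sub>K B)) \<rho>"
    proof -
      have "rect (rdim A * 1) (rdim A * N) (T m)" if "m < n" for m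
        unfolding T_def using that by (intro rect_plus rect_scaleC rect_kp rv re rfs res) auto
      then show ?thesis unfolding \<rho>_def by (intro rect_sum) (simp add: N_def)
    qed
    obtain a b c q where pencil_coeffs: "pencil_coeffs \<eta> = (a, b, c, q)" by (metis prod_cases4)
    show "x1 (A \<otimes>\<^sub>K V_mod r') * \<rho> = \<rho> * x1 (A \<otimes>\<^sub>K B)"
      unfolding ac using tele[of "x1 A" a b "x1 B"] D(14) D'(14) by (simp add: MX_def pencil_coeffs)
    show "x2 (A \<otimes>\<^sub>K V_mod r') * \<rho> = \<rho> * x2 (A \<otimes>\<^sub>K B)"
      unfolding ac using tele[of "x2 A" c q "x2 B"] D(15) D'(15) by (simp add: MY_def pencil_coeffs)
    have "kp 1 1 (kk A) (sgn_bit r' *\<^sub>C Idm 1) * T m = T m * kp N N (kk A) (kk B)" if m: "m < n" for m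
    proof -
      define j where "j = n - 1 - m"
      have j: "j < n" using m by (auto simp: j_def)
      have K: "fs j * kk B = sgn_bit r' *\<^sub>C fs j" "es j * kk B = - sgn_bit r' *\<^sub>C es j"
        by (simp_all add: fs_def es_def KR_rules[OF d'] mult.assoc)
      have vk: "v m * kk A = kk A * v m" "e m * kk A = - (kk A * e m)"
        by (simp_all add: v_def e_def r)
      note rB = rect_ac[OF D'(1), of GK, folded N_def]
      note k = kp_mult[OF rfs[OF j] rB] kp_mult[OF res[OF j] rB]
        kp_mult[OF rect_Idm_same rfs[OF j]] kp_mult[OF rect_Idm_same res[OF j]]
        rectD[OF rfs[OF j]] rectD[OF res[OF j]]
      show ?thesis
        unfolding T_def j_def[symmetric]
        by (simp add: distrib_left distrib_right k K vk kp_linear)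
    qed
    then show "kk (A \<otimes>\<^sub>K V_mod r') * \<rho> = \<rho> * kk (A \<otimes>\<^sub>K B)"
      unfolding ac(1,4,7) \<rho>_def sum_distrib_left sum_distrib_right by (intro sum.cong) auto
  qed
  have "T m * kp N 1 (Idm (rdim A)) (iS' * Eu (n - 1) 0) = (if m = 0 then Idm (rdim A) else 0)" if m: "m < n" for m
  proof -
    define j where "j = n - 1 - m"
    have j: "j < n" using m by (auto simp: j_def)
    have ri: "rect N 1 (iS' * Eu (n - 1) 0)" using s by (intro rect_times[OF D'(4)]) simp
    have f: "fs j * (iS' * Eu (n - 1) 0) = (if m = 0 then Idm 1 else 0)"
      using m by (auto intro!: fmat_eqI simp: fs_def KR_rules[OF d'] mult.assoc j_def Eu_times_Eu ent_Eu ent_Idm)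
    have e: "es j * (iS' * Eu (n - 1) 0) = 0" by (simp add: es_def KR_rules[OF d'] mult.assoc)
    have v0: "v 0 = Idm (rdim A)" using D(12) by (simp add: v_def Us_rules(1) r)
    show ?thesis
      unfolding T_def j_def[symmetric]
      by (simp add: distrib_right kp_mult[OF rfs[OF j] ri] kp_mult[OF res[OF j] ri] f e kp_linear
          rectD[OF rv] v0 kp_one_right)
  qed
  then have "\<rho> * kp N 1 (Idm (rdim A)) (iS' * Eu (n - 1) 0) = (\<Sum>m<n. if m = 0 then Idm (rdim A) else 0)"
    unfolding \<rho>_def sum_distrib_right by (intro sum.cong) auto
  also have "\<dots> = Idm (rdim A)" using s by simp
  finally show ?thesis using that[OF hom] by (simp add: N_def)
qed

lemma M_mod_tensor_same:
  assumes s: "0 < s" "s \<le> n"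
  shows "M_mod s r \<eta> \<otimes>\<^sub>K M_mod n r' \<eta>
    \<cong>\<^sub>K (s * (n - 1)) \<odot>\<^sub>K P_mod (r + r') \<oplus>\<^sub>K M_mod s 0 \<eta> \<oplus>\<^sub>K M_mod s 1 \<eta>"
proof -
  have n: "n > 0" using s by simp
  define k where "k = n - 1"
  have nk: "n = k + 1" using n by (simp add: k_def)
  \<comment> \<open>Chosen so that the top of \<open>Q k p \<eta>\<close>, of parity
    \<open>p + parity k\<close>, has the parity \<open>r' + 1\<close> of the top of M_n, with which
    it is identified.\<close>
  define p where "p = r' + 1 + parity k"
  let ?A = "M_mod s r \<eta>" and ?B = "M_mod n r' \<eta>" and ?V = "V_mod r'" and ?Q = "Q k p \<eta>"
  have pk: "p + parity k = r' + 1" by (simp add: p_def add.assoc)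
  obtain iT pT iS pS where d1: "KR_data ?A (r + 1) s s (MX s \<eta>) (MY s \<eta>) iT pT iS pS"
    using krE[OF kronecker_M_mod[OF s(1)]] .
  obtain iT' pT' iS' pS' where d2: "KR_data ?B (r' + 1) n n (MX n \<eta>) (MY n \<eta>) iT' pT' iS' pS'"
    using krE[OF kronecker_M_mod[OF n]] .
  obtain iT2 pT2 iS2 pS2 where d3: "KR_data ?Q (r' + 1) n k (QX k \<eta>) (QY k \<eta>) iT2 pT2 iS2 pS2"
    using krE[OF kronecker_Q[of k p \<eta>, unfolded pk nk[symmetric]]] .
  note D1 = KR_dataD[OF d1] and D2 = KR_dataD[OF d2] and D3 = KR_dataD[OF d3]
  have i: "rect n k (Idm k)" "rect k n (Idm k)" "rect 1 n (Eu 0 k)" "rect n 1 (Eu k 0)"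
    using nk by (auto intro: rect_Idm)
  have X: "Idm k * MX n \<eta> = QX k \<eta>" "Idm k * MY n \<eta> = QY k \<eta>" using nk
    by (auto intro!: fmat_eqI simp: MX_def MY_def QX_def QY_def distrib_left ent_Up ent_Idm split: prod.splits)
  have E: "Idm k + Eu k k = Idm n" by (simp add: nk Idm_Suc flip: Suc_eq_plus1)
  have E0: "Eu 0 0 = Idm 1" by (auto intro!: fmat_eqI simp: ent_Eu ent_Idm)
  note r = KR_rules[OF d2] KR_rules[OF d3] mult.assoc distrib_left distrib_right X[symmetric]
    i[THEN rectD(1)] i[THEN rectD(2)] i[THEN rectD(3)] i[THEN rectD(4)] Eu_times_Eu assoc_rew[OF Eu_times_Eu] ac_V_mod
  have kn: "k \<le> n" using nk by simp
  note np = rectD[OF rect_mono[OF D3(5) kn order_refl]]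
  define j where "j = iS' * Eu k 0"
  define q where "q = iT2 * pT' + iS2 * Idm k * pS'"
  define l where "l = Eu 0 k * pS'"
  define v where "v = iT' * pT2 + iS' * Idm k * pS2"
  have j: "hom ?V ?B j"
    by (rule homI, unfold j_def, use rect_times[OF D2(4) i(4)] in simp) (simp_all add: r)
  have q: "hom ?B ?Q q"
    by (rule homI, unfold q_def, intro rect_plus rect_times[OF D3(2) D2(3)] rect_times[OF rect_times[OF D3(4) i(2)] D2(5)])
      (simp_all add: r scaleC_add)
  have v: "rect (rdim ?B) (rdim ?Q) v" unfolding v_def
    by (intro rect_plus rect_times[OF D2(2) D3(3)] rect_times[OF rect_times[OF D2(4) i(1)] D3(5)])
  have l: "rect 1 (rdim ?B) l" unfolding l_def by (rule rect_times[OF i(3) D2(5)])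
  have qv: "q * v = Idm (rdim ?Q)" using D3(12) by (simp add: q_def v_def r np)
  have "iS2 * Eu k 0 = 0"
    using rectD(2)[OF D3(4)] by (metis Idm_times_Eu less_irrefl mult.assoc mult_zero_right)
  then have qj: "q * j = 0" by (simp add: q_def j_def r)
  have "j * l + v * q = iT' * pT' + iS' * (Idm k + Eu k k) * pS'"
    by (simp add: j_def l_def q_def v_def r algebra_simps)
  also have "\<dots> = Idm (rdim ?B)" unfolding E using D2(12) by (simp add: r)
  finally have jl: "j * l + v * q = Idm (rdim ?B)" .
  obtain \<rho> where \<rho>: "hom (?A \<otimes>\<^sub>K ?B) (?A \<otimes>\<^sub>K ?V) \<rho>"
    "\<rho> * kp (rdim ?B) 1 (Idm (rdim ?A)) j = Idm (rdim ?A)"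
    using M_mod_retraction[OF d1 d2 s] unfolding j_def k_def by metis
  let ?a = "rdim ?A" and ?b = "rdim ?B" and ?c = "rdim ?Q"
  note hj = hom_tensor[OF D1(1,1) module_V_mod D2(1) hom_Idm[OF D1(1)] j]
    and hq = hom_tensor[OF D1(1,1) D2(1) D3(1) hom_Idm[OF D1(1)] q]
  have bp: "biprod (?A \<otimes>\<^sub>K ?B) (?A \<otimes>\<^sub>K ?V) (?A \<otimes>\<^sub>K ?Q)"
  proof (rule short_exact_split_retraction[OF module_tensor[OF D1(1) module_V_mod] module_tensor[OF D1(1) D2(1)]
        module_tensor[OF D1(1) D3(1)] hj hq])
    show "rect (rdim (?A \<otimes>\<^sub>K ?B)) (rdim (?A \<otimes>\<^sub>K ?Q)) (kp ?b ?c (Idm ?a) v)"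
      unfolding rdim_tensor by (rule rect_kp[OF rect_Idm_same v])
    show "kp ?c ?b (Idm ?a) q * kp ?b ?c (Idm ?a) v = Idm (rdim (?A \<otimes>\<^sub>K ?Q))"
      unfolding kp_mult[OF hom_rect[OF q] v] qv by (simp add: kp_Idm)
    show "kp ?b (rdim ?V) (Idm ?a) j * kp 1 ?b (Idm ?a) l + kp ?b ?c (Idm ?a) v * kp ?c ?b (Idm ?a) q
        = Idm (rdim (?A \<otimes>\<^sub>K ?B))"
      unfolding kp_mult[OF v hom_rect[OF q]] rdim_V_mod kp_mult[OF hom_rect[OF j, unfolded rdim_V_mod] l]
        kp_linear(2)[symmetric] jl by (simp add: kp_Idm)
    show "kp ?c ?b (Idm ?a) q * kp ?b (rdim ?V) (Idm ?a) j = 0"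
      unfolding kp_mult[OF hom_rect[OF q] hom_rect[OF j]] qj by (simp add: kp_linear)
    show "\<rho> * kp ?b (rdim ?V) (Idm ?a) j = Idm (rdim (?A \<otimes>\<^sub>K ?V))" using \<rho>(2) by simp
  qed (rule \<rho>(1))
  have m: "is_module (M_mod s x \<eta>)" for x by (rule module_M_mod[OF s(1)])
  have pkr: "r + p + parity k = r + r' + 1" using pk by (simp add: add.assoc)
  have "?A \<otimes>\<^sub>K ?Q \<cong>\<^sub>K M_mod s (r + r' + 1) \<eta> \<oplus>\<^sub>K (s * k) \<odot>\<^sub>K P_mod (r + r')"
  proof (rule tensor_formula[OF iso_refl[OF m] Q_iso kronecker_M_mod[OF s(1)] kronecker_Wp _ kronecker_th[OF kronecker_M_mod[OF s(1)]] iso_refl[OF m]])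
    show "stably_iso (?A \<otimes>\<^sub>K Wp k p) (M_mod s (r + r' + 1) \<eta>)"
      using stably_iso_M_mod_W[OF s(1), of r \<eta> "int k" p] by (simp add: W_nat pkr flip: parity_def)
    show "r + r' = r + 1 + (p + parity k)" unfolding pk
    proof -
      have "r + 1 + (r' + 1) = r + r' + 1 + 1" by (simp only: ac_simps)
      then show "r + r' = r + 1 + (r' + 1)" by simp
    qed
  qed (simp add: algebra_simps)
  moreover have "?A \<otimes>\<^sub>K ?V \<cong>\<^sub>K M_mod s (r + r') \<eta>" by (rule M_mod_tensor_V[OF s(1)])
  moreover have "?A \<otimes>\<^sub>K ?B \<cong>\<^sub>K (?A \<otimes>\<^sub>K ?V) \<oplus>\<^sub>K (?A \<otimes>\<^sub>K ?Q)"
    using iso_dsum_iff[OF module_tensor[OF D1(1) D2(1)] module_tensor[OF D1(1) module_V_mod]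
        module_tensor[OF D1(1) D3(1)]] bp by blast
  ultimately have 1: "?A \<otimes>\<^sub>K ?B \<cong>\<^sub>K
      M_mod s (r + r') \<eta> \<oplus>\<^sub>K (M_mod s (r + r' + 1) \<eta> \<oplus>\<^sub>K (s * k) \<odot>\<^sub>K P_mod (r + r'))"
    using iso_trans dsum_cong by blast
  let ?P = "(s * k) \<odot>\<^sub>K P_mod (r + r')"
  have P: "is_module ?P" by (rule module_copies[OF iso_module(1)[OF P_mod_Pc]])
  note 1
  also have "M_mod s (r + r') \<eta> \<oplus>\<^sub>K (M_mod s (r + r' + 1) \<eta> \<oplus>\<^sub>K ?P) \<cong>\<^sub>K
      (M_mod s (r + r') \<eta> \<oplus>\<^sub>K M_mod s (r + r' + 1) \<eta>) \<oplus>\<^sub>K ?P" by (rule dsum_assoc[OF m m P])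
  also have "\<dots> \<cong>\<^sub>K ?P \<oplus>\<^sub>K (M_mod s (r + r') \<eta> \<oplus>\<^sub>K M_mod s (r + r' + 1) \<eta>)"
    by (rule dsum_comm[OF module_dsum(1)[OF m m] P])
  also have "\<dots> \<cong>\<^sub>K ?P \<oplus>\<^sub>K (M_mod s 0 \<eta> \<oplus>\<^sub>K M_mod s 1 \<eta>)"
  proof (rule dsum_cong[OF iso_refl[OF P]])
    show "M_mod s (r + r') \<eta> \<oplus>\<^sub>K M_mod s (r + r' + 1) \<eta> \<cong>\<^sub>K M_mod s 0 \<eta> \<oplus>\<^sub>K M_mod s 1 \<eta>"
      using iso_refl[OF module_dsum(1)[OF m m]] dsum_comm[OF m m] by (cases "r + r'") simp_all
  qed
  finally show ?thesis by (simp only: k_def)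
qed

subsection \<open>Indecomposability of the listed modules\<close>

lemma indecomposable_iso: assumes "M \<cong>\<^sub>K N" "indecomposable M" shows "indecomposable N"
  using assms unfolding indecomposable_def
  by (metis iso_module iso_rdim iso_trans)

definition indec_pencil :: "nat \<Rightarrow> nat \<Rightarrow> fmat \<Rightarrow> fmat \<Rightarrow> bool" where
  "indec_pencil a b X Y \<longleftrightarrow> a + b \<noteq> 0 \<and> (\<forall>e f. rect a a e \<longrightarrow> rect b b f \<longrightarrow> e * e = e \<longrightarrow> f * f = f \<longrightarrow>
     f * X = X * e \<longrightarrow> f * Y = Y * e \<longrightarrow> e = 0 \<and> f = 0 \<or> e = Idm a \<and> f = Idm b)"

lemma pindI:
  assumes "a + b \<noteq> 0"
    and "\<And>e f. rect a a e \<Longrightarrow> rect b b f \<Longrightarrow> e * e = e \<Longrightarrow> f * f = f \<Longrightarrow> f * X = X * e \<Longrightarrow> f * Y = Y * e \<Longrightarrow>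
      e = 0 \<and> f = 0 \<or> e = Idm a \<and> f = Idm b"
  shows "indec_pencil a b X Y"
  using assms unfolding indec_pencil_def by blast

lemma pindD:
  assumes "indec_pencil a b X Y" "rect a a e" "rect b b f" "e * e = e" "f * f = f" "f * X = X * e" "f * Y = Y * e"
  shows "e = 0 \<and> f = 0 \<or> e = Idm a \<and> f = Idm b"
  using assms unfolding indec_pencil_def by blast

text \<open>An endomorphism commutes with K, which takes opposite signs on top and socle, so its
  mixed blocks vanish. Idempotent endomorphisms are thus pairs of idempotents intertwining
  \<open>X\<close> and \<open>Y\<close>.\<close>

lemma kronecker_indecomposable: assumes "kronecker M t a b X Y" shows "indecomposable M \<longleftrightarrow> indec_pencil a b X Y"
proof
  obtain iT pT iS pS where d: "KR_data M t a b X Y iT pT iS pS" using krE[OF assms] .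
  note D = KR_dataD[OF d]
  have ab: "rdim M = a + b" using kronecker_tr[OF assms] by simp
  note r = KR_rules[OF d] mult.assoc distrib_left distrib_right
  show "indec_pencil a b X Y" if ind: "indecomposable M"
  proof (rule pindI)
    show "a + b \<noteq> 0" using ind ab by (simp add: indecomposable_def)
    fix e f assume ef: "rect a a e" "rect b b f" "e * e = e" "f * f = f" "f * X = X * e" "f * Y = Y * e"
    define E where "E = iT * e * pT + iS * f * pS"
    note r = r ef(3-6) ef(3-6)[THEN assoc_rew] rectD[OF ef(1)] rectD[OF ef(2)]
    have "hom M M E"
    proof (rule homI)
      show "rect (rdim M) (rdim M) E" unfolding E_def
        by (intro rect_plus rect_times[OF rect_times[OF D(2) ef(1)] D(3)] rect_times[OF rect_times[OF D(4) ef(2)] D(5)])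
    qed (simp_all add: E_def D(13-15) r left_diff_distrib right_diff_distrib scaleC_diff)
    moreover have "E * E = E" by (simp add: E_def r)
    ultimately have "E = 0 \<or> E = Idm (rdim M)" using ind indecomposable_idem_iff by blast
    moreover have "pT * E * iT = e" "pS * E * iS = f" by (simp_all add: E_def r)
    moreover have "pT * Idm (rdim M) * iT = Idm a" "pS * Idm (rdim M) * iS = Idm b"
      using D(8,9) rectD[OF D(2)] rectD[OF D(4)] by (simp_all add: mult.assoc)
    ultimately show "e = 0 \<and> f = 0 \<or> e = Idm a \<and> f = Idm b" by auto
  qed
  show "indecomposable M" if p: "indec_pencil a b X Y"
    unfolding indecomposable_idem_iff
  proof (intro conjI allI impI)
    show "is_module M" by (rule D(1))
    show "rdim M \<noteq> 0" using p ab by (simp add: indec_pencil_def)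
    fix E assume E: "hom M M E" "E * E = E"
    note h = homD[OF E(1)]
    have s: "sgn_bit t \<noteq> 0" by simp
    have "pT * (kk M * E) * iS = pT * (E * kk M) * iS" by (simp add: h)
    then have "sgn_bit t *\<^sub>C (pT * E * iS) = - (sgn_bit t *\<^sub>C (pT * E * iS))"
      by (simp add: mult.assoc KR_rules[OF d] del: h)
    then have z1: "pT * (E * iS) = 0" using scaleC_neg_self s by (metis mult.assoc)
    have "pS * (kk M * E) * iT = pS * (E * kk M) * iT" by (simp add: h)
    then have "sgn_bit t *\<^sub>C (pS * E * iT) = - (sgn_bit t *\<^sub>C (pS * E * iT))"
      by (simp add: mult.assoc KR_rules[OF d] del: h)
    then have z2: "pS * (E * iT) = 0" using scaleC_neg_self s by (metis mult.assoc)
    have one: "E * z = E * (iT * (pT * z)) + E * (iS * (pS * z))" for z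
    proof -
      have "E * (Idm (rdim M) * z) = E * ((iT * pT + iS * pS) * z)" by (simp only: D(12))
      then show ?thesis by (simp add: h mult.assoc distrib_left distrib_right)
    qed
    have one': "E = (iT * pT + iS * pS) * (E * (iT * pT + iS * pS))" by (simp add: D(12) h)
    define e f where "e = pT * (E * iT)" and "f = pS * (E * iS)"
    have dec: "E = iT * (e * pT) + iS * (f * pS)"
      using one' by (simp add: distrib_left distrib_right mult.assoc e_def f_def assoc_rew[OF z1[folded mult.assoc]]
          assoc_rew[OF z2[folded mult.assoc]] flip: mult.assoc)
        (simp add: mult.assoc z1 z2 assoc_rew[OF z1[folded mult.assoc]] assoc_rew[OF z2[folded mult.assoc]])
    have re: "rect a a e" and rf: "rect b b f"
      unfolding e_def f_def using D(2-5) hom_rect[OF E(1)] by (auto intro!: rect_times)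
    note r = r rectD[OF re] rectD[OF rf]
    have "pT * (E * E) * iT = e * e" "pS * (E * E) * iS = f * f" by (subst (1 2) dec; simp add: r)+
    then have idem: "e * e = e" "f * f = f" by (simp_all add: E(2) e_def f_def mult.assoc)
    have "pS * (x1 M * E) * iT = pS * (E * x1 M) * iT" "pS * (x2 M * E) * iT = pS * (E * x2 M) * iT"
      by (simp_all add: h)
    then have "f * X = X * e" "f * Y = Y * e" by (subst (asm) (1 2) dec; simp add: r D(14,15))+
    then have "e = 0 \<and> f = 0 \<or> e = Idm a \<and> f = Idm b" using pindD[OF p re rf idem] by blast
    then show "E = 0 \<or> E = Idm (rdim M)" using dec D(12) by (auto simp: rectD[OF D(3)] rectD[OF D(5)])
  qed
qed

text \<open>The identity block makes \<open>f\<close> a corner of \<open>e\<close>, and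
  compatibility with \<open>Up k\<close> makes \<open>e\<close> constant along diagonals. Below the
  main diagonal these constants are read in the first column, above it in the last column, and both
  are zero there. So \<open>e\<close> is a scalar.\<close>

lemma indec_pencil_Wp: "indec_pencil (k + 1) k (Idm k) (Up k)"
proof (rule pindI)
  fix e f assume *: "rect (k + 1) (k + 1) e" "rect k k f" "e * e = e" "f * f = f"
    "f * Idm k = Idm k * e" "f * Up k = Up k * e"
  have f: "f = Idm k * e" using *(5) by (simp add: rectD[OF *(2)])
  have fe: "ent f i j = (if i < k then ent e i j else 0)" for i j by (simp add: f ent_Idm_times)
  have up: "(if 0 < j \<and> j \<le> k then ent f i (j - 1) else 0) = (if i < k then ent e (Suc i) j else 0)" for i j
    using arg_cong[OF *(6), of "\<lambda>g. ent g i j"] by simp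
  have sh: "ent e (Suc i) (Suc j) = ent e i j" if "i < k" "j < k" for i j
    using up[of "Suc j" i] that by (simp add: fe)
  have c0: "ent e (Suc i) 0 = 0" if "i < k" for i using up[of 0 i] that by simp
  have ck: "ent e i k = 0" if "i < k" for i
    using fe[of i k] rect_entD[OF *(2), of i k] that by simp
  have low: "ent e (i + d) i = (if d = 0 then ent e 0 0 else 0)" if "i + d \<le> k" for i d
    using that
  proof (induction i)
    case 0 then show ?case using c0[of "d - 1"] by (cases d) auto
  next
    case (Suc i) then show ?case using sh[of "i + d" i] by simp
  qed
  have high: "ent e (k - d - m) (k - m) = 0" if "0 < d" "d + m \<le> k" for d m
    using that
  proof (induction m)
    case 0 then show ?case using ck[of "k - d"] by simp
  next
    case (Suc m)
    then have "Suc (k - d - Suc m) = k - d - m" "Suc (k - Suc m) = k - m" by auto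
    then show ?case using sh[of "k - d - Suc m" "k - Suc m"] Suc by simp
  qed
  have e: "e = ent e 0 0 *\<^sub>C Idm (k + 1)"
  proof (rule fmat_eqI)
    fix i j show "ent e i j = ent (ent e 0 0 *\<^sub>C Idm (k + 1)) i j"
    proof (cases "i \<le> k \<and> j \<le> k")
      case True
      show ?thesis
      proof (cases "i \<ge> j")
        case True then show ?thesis using low[of j "i - j"] \<open>i \<le> k \<and> j \<le> k\<close> by (auto simp: ent_Idm)
      next
        case False then show ?thesis using high[of "j - i" "k - j"] \<open>i \<le> k \<and> j \<le> k\<close> by (auto simp: ent_Idm)
      qed
    next
      case False then show ?thesis using rect_entD[OF *(1), of i j] by (auto simp: ent_Idm)
    qed
  qed
  define c where "c = ent e 0 0"
  have ec: "e = c *\<^sub>C Idm (k + 1)" using e by (simp add: c_def)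
  have "ent (e * e) 0 0 = ent e 0 0" by (simp add: *(3))
  then have "c * c = c" by (simp add: ec ent_Idm)
  then have "c = 0 \<or> c = 1" by simp
  moreover have "Idm k * Idm (k + 1) = Idm k" by (auto intro!: fmat_eqI simp: ent_Idm_times ent_Idm)
  ultimately show "e = 0 \<and> f = 0 \<or> e = Idm (k + 1) \<and> f = Idm k" using f ec by auto
qed simp

lemma indec_pencil_tp: assumes "indec_pencil a b X Y" shows "indec_pencil b a (tp X) (tp Y)"
proof (rule pindI)
  show "b + a \<noteq> 0" using assms by (auto simp: indec_pencil_def)
  fix e f assume *: "rect b b e" "rect a a f" "e * e = e" "f * f = f" "f * tp X = tp X * e" "f * tp Y = tp Y * e"
  have "tp f = 0 \<and> tp e = 0 \<or> tp f = Idm a \<and> tp e = Idm b"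
  proof (rule pindD[OF assms])
    show "tp f * tp f = tp f" "tp e * tp e = tp e" "tp e * X = X * tp f" "tp e * Y = Y * tp f"
      using *(3-6)[THEN arg_cong[of _ _ tp]] by simp_all
  qed (use * rect_tp in auto)
  then show "e = 0 \<and> f = 0 \<or> e = Idm b \<and> f = Idm a" by (metis tp_tp tp_Idm tp_zero)
qed

text \<open>Matrices commuting with the nilpotent Jordan block are upper triangular with constant
  diagonals. An idempotent of this shape with zero diagonal vanishes one superdiagonal after the
  other; the diagonal entry being 0 or 1, this applies to \<open>e\<close> or to
  \<open>Idm n - e\<close>.\<close>

lemma idempotent_commute_Up:
  assumes r: "rect n n e" and idem: "e * e = e" and n: "n > 0" and comm: "e * Up (n - 1) = Up (n - 1) * e"
  shows "e = 0 \<or> e = Idm n"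
proof -
  have key: "e = 0" if r: "rect n n e" and idem: "e * e = e" and comm: "e * Up (n - 1) = Up (n - 1) * e"
    and z: "ent e 0 0 = 0" for e
  proof -
    have up: "(if 0 < j \<and> j \<le> n - 1 then ent e i (j - 1) else 0) = (if i < n - 1 then ent e (Suc i) j else 0)" for i j
      using arg_cong[OF comm, of "\<lambda>g. ent g i j"] by simp
    have toep: "ent e (i + d) i = (if d = 0 then 0 else 0)" if "i + d < n" for i d
      using that
    proof (induction i)
      case 0 then show ?case using up[of 0 "d - 1"] z by (cases d) (auto split: if_splits simp: Suc_diff_1)
    next
      case (Suc i) then show ?case using up[of "Suc i" "i + d"] by (simp add: diff_Suc_1 less_diff_conv Suc_le_eq)
    qed
    have low: "ent e i j = 0" if "j \<le> i" for i j
      using toep[of j "i - j"] rect_entD[OF r, of i j] that by (cases "i < n") auto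
    have "\<forall>i. ent e i (i + d) = 0" for d
    proof (induction d rule: less_induct)
      case (less d)
      show ?case
      proof
        fix i
        have "ent e i (i + d) = ent (e * e) i (i + d)" by (simp add: idem)
        also have "\<dots> = (\<Sum>l<n. ent e i l * ent e l (i + d))"
          by (rule ent_times_left) (auto intro: rect_entD[OF r])
        also have "\<dots> = 0"
        proof (intro sum.neutral ballI)
          fix l show "ent e i l * ent e l (i + d) = 0"
          proof (cases "l \<le> i \<or> l \<ge> i + d")
            case True then show ?thesis using low by auto
          next
            case False
            then have "l - i < d" by auto
            from less.IH[OF this] have "ent e i (i + (l - i)) = 0" by blast
            then show ?thesis using False by simp
          qed
        qed
        finally show "ent e i (i + d) = 0" .
      qed
    qed
    then have "ent e i j = 0" for i j using low[of j i] by (metis le_Suc_ex nat_le_linear)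
    then show ?thesis by (intro fmat_eqI) simp
  qed
  have "ent e 0 0 = ent (e * e) 0 0" by (simp add: idem)
  also have "\<dots> = (\<Sum>l<n. ent e 0 l * ent e l 0)"
    by (rule ent_times_left) (auto intro: rect_entD[OF r])
  also have "\<dots> = (\<Sum>l<n. if l = 0 then ent e 0 0 * ent e 0 0 else 0)"
  proof (intro sum.cong refl)
    fix l assume "l \<in> {..<n}"
    then show "ent e 0 l * ent e l 0 = (if l = 0 then ent e 0 0 * ent e 0 0 else 0)"
      using arg_cong[OF comm, of "\<lambda>g. ent g (l - 1) 0"] by (cases l) (auto split: if_splits)
  qed
  finally have "ent e 0 0 = 0 \<or> ent e 0 0 = 1" using n by simp
  then show ?thesis
  proof
    assume "ent e 0 0 = 0" then show ?thesis using key r idem comm by blast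
  next
    assume 1: "ent e 0 0 = 1"
    have "Idm n - e = 0"
    proof (rule key)
      show "(Idm n - e) * Up (n - 1) = Up (n - 1) * (Idm n - e)"
        using comm n by (simp add: left_diff_distrib right_diff_distrib rectD[OF rect_Up[of "n - 1" n n]])
    qed (use r idem n 1 in \<open>auto simp: left_diff_distrib right_diff_distrib rectD[OF r] ent_Idm intro!: rect_minus\<close>)
    then show ?thesis by simp
  qed
qed

lemma indec_pencil_Idm:
  assumes "n > 0" "\<And>e. rect n n e \<Longrightarrow> e * e = e \<Longrightarrow> e * N = N * e \<Longrightarrow> e = 0 \<or> e = Idm n"
  shows "indec_pencil n n (Idm n) N" "indec_pencil n n N (Idm n)"
proof -
  have "e = 0 \<and> f = 0 \<or> e = Idm n \<and> f = Idm n"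
    if "rect n n e" "rect n n f" "e * e = e" "f * Idm n = Idm n * e" "f * N = N * e" for e f
  proof -
    have "f = e" using that(4) by (simp add: rectD[OF that(1)] rectD[OF that(2)])
    then show ?thesis using assms(2)[OF that(1,3)] that(5) by simp
  qed
  then show "indec_pencil n n (Idm n) N" "indec_pencil n n N (Idm n)" using assms(1) by (auto intro!: pindI)
qed

lemma indec_pencil_M: assumes "n > 0" shows "indec_pencil n n (MX n \<eta>) (MY n \<eta>)"
proof -
  have U: "rect n n (Up (n - 1))" using assms by (intro rect_Up) simp_all
  show ?thesis
  proof (cases \<eta>)
    case (Fin c)
    have "indec_pencil n n (Idm n) (c *\<^sub>C Idm n + Up (n - 1))"
      by (rule indec_pencil_Idm(1)[OF assms])
        (rule idempotent_commute_Up[OF _ _ assms], auto simp: distrib_left distrib_right rectD)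
    then show ?thesis by (simp add: MX_def MY_def pencil_coeffs_def Fin)
  next
    case Infty
    have "indec_pencil n n (Up (n - 1)) (Idm n)"
      by (rule indec_pencil_Idm(2)[OF assms]) (rule idempotent_commute_Up[OF _ _ assms])
    then show ?thesis by (simp add: MX_def MY_def pencil_coeffs_def Infty)
  qed
qed

lemma indecomposable_M_mod: "n > 0 \<Longrightarrow> indecomposable (M_mod n r \<eta>)"
  using kronecker_indecomposable[OF kronecker_M_mod] indec_pencil_M by blast
lemma indecomposable_Wp: "indecomposable (Wp k r)"
  using kronecker_indecomposable[OF kronecker_Wp] indec_pencil_Wp by blast
lemma indecomposable_Wn: "indecomposable (Wn k r)"
  using kronecker_indecomposable[OF kronecker_Wn] indec_pencil_tp[OF indec_pencil_Wp, of k] by simp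

lemma th_iso: assumes "M \<cong>\<^sub>K N" "th M = 0" shows "th N = 0"
proof -
  obtain f h where f: "is_module M" "is_module N" "hom M N f" "hom N M h"
    "f * h = Idm (rdim N)" "h * f = Idm (rdim M)" using isoE[OF assms(1)] .
  have "th N = f * (th M * h)" using f(5) by (simp add: mult.assoc homD[OF f(4)] mod_simps[OF f(2)] flip: f(5))
      (simp add: mult.assoc homD[OF f(4)] assoc_rew[OF f(5)] mod_simps[OF f(2)])
  then show ?thesis by (simp add: assms)
qed

text \<open>One of the two summands has nonzero \<xi>1\<xi>2, hence contains some \<open>Pc\<close>
  as a summand and already has dimension at least four.\<close>

lemma indecomposable_Pc: "indecomposable (Pc r)"
  unfolding indecomposable_def
proof (intro conjI allI impI)
  fix A B assume *: "is_module A \<and> is_module B \<and> Pc r \<cong>\<^sub>K A \<oplus>\<^sub>K B"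
  have big: "rdim C \<ge> 4" if "is_module C" "th C \<noteq> 0" for C
    using th_nonzero_split[OF that] biprodE rdim_Pc by (metis le_add1)
  have "th (A \<oplus>\<^sub>K B) \<noteq> 0" using * th_iso[OF iso_sym] th_Pc by blast
  moreover have "th (A \<oplus>\<^sub>K B) = 0" if "th A = 0" "th B = 0"
  proof -
    have A: "is_module A" and B: "is_module B" using * by auto
    have s: "ac A g * (Sh (rdim A) (rdim B) * z) = 0" for g z
      by (metis Idm_Sh assoc_rew le_refl mod_simps(2)[OF A] mult.assoc mult_zero_left mult_zero_right)
    have s': "tp (Sh (rdim A) (rdim B)) * ac A g = 0" for g
      by (metis tpSh_Idm le_refl mod_simps(1)[OF A] mult.assoc mult_zero_left)
    show ?thesis
      using that by (simp add: ac_dsum[OF A B] distrib_left distrib_right mult.assoc s s'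
          assoc_rew[OF tpSh_Sh] mod_simps[OF B])
        (simp add: assoc_rew[OF \<open>th B = 0\<close>])
  qed
  ultimately consider "rdim A \<ge> 4" | "rdim B \<ge> 4" using big * by blast
  moreover have "rdim A + rdim B = 4" using iso_rdim[of "Pc r" "A \<oplus>\<^sub>K B"] * by simp
  ultimately show "rdim A = 0 \<or> rdim B = 0" by cases auto
qed simp_all

subsection \<open>Classification of indecomposable modules\<close>

lemma th_nonzero_Pc: assumes "indecomposable M" "th M \<noteq> 0" obtains r where "M \<cong>\<^sub>K Pc r"
proof -
  have M: "is_module M" using assms(1) by (simp add: indecomposable_def)
  obtain r N where N: "is_module N" "biprod M (Pc r) N" using th_nonzero_split[OF M assms(2)] .
  have iso: "M \<cong>\<^sub>K Pc r \<oplus>\<^sub>K N" using iso_dsum_iff[OF M module_Pc N(1)] N(2) by blast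
  then have "rdim (Pc r) = 0 \<or> rdim N = 0"
    using assms(1)[unfolded indecomposable_def, THEN conjunct2, THEN conjunct2, rule_format, of "Pc r" N] module_Pc N(1)
    by simp
  then have "rdim N = 0" by simp
  then show thesis by (rule that[OF iso_trans[OF iso dsum_zero(1)[OF module_Pc N(1)]]])
qed

text \<open>A projection onto the common kernel of \<xi>1 and \<xi>2, obtained from a generalized
  inverse of the stacked matrix \<open>G\<close> and averaged over K. As \<xi>1\<xi>2 is zero, it
  fixes the images of \<xi>1 and \<xi>2.\<close>

lemma socle_projection:
  assumes M: "is_module M" and th: "th M = 0"
  obtains \<sigma> where "rect (rdim M) (rdim M) \<sigma>" "kk M * \<sigma> = \<sigma> * kk M" "x1 M * \<sigma> = 0" "x2 M * \<sigma> = 0"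
    "\<sigma> * x1 M = x1 M" "\<sigma> * x2 M = x2 M" "\<sigma> * \<sigma> = \<sigma>"
proof -
  define n where "n = rdim M"
  note m = mod_simps[OF M, folded n_def]
  define G where "G = x1 M + Sh n n * x2 M"
  have "rect (n + n) n (x1 M)" using rect_mono[OF rect_ac[OF M], of "n + n" n] by (simp add: n_def)
  moreover have "rect (n + n) n (Sh n n * x2 M)"
    using rect_ac[OF M] by (intro rect_times[of _ n] rect_Sh) (simp_all add: n_def)
  ultimately have rG: "rect (n + n) n G" unfolding G_def by (rule rect_plus)
  obtain s where s: "rect n (n + n) s" "G * s * G = G" using generalized_inverse[OF rG] .
  have "Idm n * (Sh n n * z) = 0" for z by (simp flip: mult.assoc)
  then have g1: "Idm n * G = x1 M" by (simp add: G_def distrib_left m)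
  have "tp (Sh n n) * x1 M = tp (Sh n n) * Idm n * x1 M" by (simp only: mult.assoc m)
  then have "tp (Sh n n) * x1 M = 0" by simp
  then have g2: "tp (Sh n n) * G = x2 M" by (simp add: G_def distrib_left assoc_rew[OF tpSh_Sh] m)
  define \<sigma>0 where "\<sigma>0 = Idm n - s * G"
  have G0: "G * \<sigma>0 = 0" using s(2) by (simp add: \<sigma>0_def right_diff_distrib rectD[OF rG] mult.assoc)
  have x0: "x1 M * \<sigma>0 = 0" "x2 M * \<sigma>0 = 0" using G0 by (simp_all add: mult.assoc flip: g1 g2)
  have fix0: "\<sigma>0 * z = z" if "x1 M * z = 0" "x2 M * z = 0" "Idm n * z = z" for z
    using that by (simp add: \<sigma>0_def G_def left_diff_distrib distrib_right mult.assoc)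
  have r0: "rect n n \<sigma>0" unfolding \<sigma>0_def by (intro rect_minus rect_times[OF s(1) rG]) simp
  define \<sigma> where "\<sigma> = (1/2) *\<^sub>C (\<sigma>0 + kk M * \<sigma>0 * kk M)"
  have rK: "rect n n (kk M)" using rect_ac[OF M] by (simp add: n_def)
  have r: "rect n n \<sigma>" unfolding \<sigma>_def
    by (intro rect_scaleC rect_plus r0 rect_times[OF rect_times[OF rK r0] rK])
  have K: "kk M * \<sigma> = \<sigma> * kk M"
    by (simp add: \<sigma>_def distrib_left distrib_right mult.assoc m rectD[OF r0] add.commute)
  have xk: "x1 M * (kk M * z) = - (kk M * (x1 M * z))" "x2 M * (kk M * z) = - (kk M * (x2 M * z))" for z
    by (simp_all add: m)
  have x: "x1 M * \<sigma> = 0" "x2 M * \<sigma> = 0"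
    by (simp_all add: \<sigma>_def distrib_left mult.assoc xk x0 assoc_rew[OF x0(1)] assoc_rew[OF x0(2)])
  have fixp: "\<sigma> * z = z" if z: "x1 M * z = 0" "x2 M * z = 0" "Idm n * z = z" for z
  proof -
    have "\<sigma>0 * (kk M * z) = kk M * z" by (rule fix0) (simp_all add: xk z m(1-4))
    then have "\<sigma> * z = (1/2) *\<^sub>C (z + kk M * (kk M * z))"
      by (simp add: \<sigma>_def distrib_right mult.assoc fix0[OF z])
    also have "kk M * (kk M * z) = z" using z(3) m(11) by simp
    finally show ?thesis by (simp add: scaleC_half)
  qed
  have th': "x2 M * x1 M = 0" using th m by simp
  have "\<sigma> * x1 M = x1 M" "\<sigma> * x2 M = x2 M" using th th' by (auto intro!: fixp simp: m)
  moreover have "\<sigma> * \<sigma> = \<sigma>" using x r by (intro fixp) (auto simp: rectD)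
  ultimately show thesis using that[of \<sigma>] r K x by (simp add: n_def)
qed

text \<open>The idempotent below is an endomorphism separating the two parities of \<open>\<xi>\<^sub>i\<close>.\<close>

lemma th_zero_kronecker:
  assumes ind: "indecomposable M" and th: "th M = 0"
  obtains t a b X Y where "kronecker M t a b X Y"
proof -
  have M: "is_module M" using ind by (simp add: indecomposable_def)
  define n where "n = rdim M"
  note m = mod_simps[OF M, folded n_def]
  obtain \<sigma> where r: "rect n n \<sigma>" and K: "kk M * \<sigma> = \<sigma> * kk M" and x: "x1 M * \<sigma> = 0" "x2 M * \<sigma> = 0"
    "\<sigma> * x1 M = x1 M" "\<sigma> * x2 M = x2 M" and idem: "\<sigma> * \<sigma> = \<sigma>"
    using socle_projection[OF M th] unfolding n_def .
  note q = m K x idem x[THEN assoc_rew] idem[THEN assoc_rew] K[THEN assoc_rew] mult.assoc rectD[OF r]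
    distrib_left distrib_right left_diff_distrib right_diff_distrib
  \<comment> \<open>On a complement of the socle \<open>e\<close> acts as (1 + K)/2 and on the socle
    as (1 - K)/2. It thus selects even top and odd socle, a choice respected by the parity-reversing
    maps \<xi>1 and \<xi>2. For an indecomposable module \<open>e\<close> is trivial, and then K is
    one sign on the top and the opposite one on the socle.\<close>
  define e where "e = (1/2) *\<^sub>C (Idm n + kk M) - \<sigma> * kk M"
  have rK: "rect n n (kk M)" using rect_ac[OF M] by (simp add: n_def)
  have "hom M M e"
  proof (rule homI)
    show "rect (rdim M) (rdim M) e" unfolding n_def[symmetric] e_def
      by (intro rect_minus rect_scaleC rect_plus rect_times[OF r rK] rK) simp
    show "kk M * e = e * kk M" by (simp add: e_def q)
    have sx: "\<sigma> * (x1 M * kk M) = x1 M * kk M" "\<sigma> * (x2 M * kk M) = x2 M * kk M"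
      using x(3,4) by (metis mult.assoc)+
    have xs: "x1 M * (\<sigma> * kk M) = 0" "x2 M * (\<sigma> * kk M) = 0"
      using x(1,2) by (metis mult.assoc mult_zero_left)+
    have "x1 M * e = (1/2) *\<^sub>C x1 M + (1/2) *\<^sub>C (x1 M * kk M)" "x2 M * e = (1/2) *\<^sub>C x2 M + (1/2) *\<^sub>C (x2 M * kk M)"
      unfolding e_def right_diff_distrib xs by (auto simp: distrib_left m(1-4) scaleC_add)
    moreover have "e * x1 M = (1/2) *\<^sub>C x1 M + (1/2) *\<^sub>C (x1 M * kk M)" "e * x2 M = (1/2) *\<^sub>C x2 M + (1/2) *\<^sub>C (x2 M * kk M)"
      unfolding e_def left_diff_distrib mult.assoc m(8,9) mult_minus_right sx
      by (auto intro!: fmat_eqI simp: distrib_right m field_simps)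
    ultimately show "x1 M * e = e * x1 M" "x2 M * e = e * x2 M" by simp_all
  qed
  moreover have "e * e = e"
  proof -
    define H Q where "H = (1/2) *\<^sub>C (Idm n + kk M)" and "Q = \<sigma> * kk M"
    have "H * H = H" by (auto intro!: fmat_eqI simp: H_def distrib_left distrib_right m field_simps)
    moreover have "H * Q = (1/2) *\<^sub>C (Q + \<sigma>)" "Q * H = (1/2) *\<^sub>C (Q + \<sigma>)" "Q * Q = \<sigma>"
      by (simp_all add: H_def Q_def q add.commute)
    ultimately have "e * e = H - (1/2) *\<^sub>C (Q + \<sigma>) - (1/2) *\<^sub>C (Q + \<sigma>) + \<sigma>"
      unfolding e_def H_def[symmetric] Q_def[symmetric] left_diff_distrib right_diff_distrib by simp
    also have "\<dots> = e" unfolding e_def H_def[symmetric] Q_def[symmetric]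
      by (auto intro!: fmat_eqI simp: field_simps)
    finally show ?thesis .
  qed
  ultimately have "e = 0 \<or> e = Idm n" using ind unfolding indecomposable_idem_iff n_def by blast
  moreover have eK: "e * kk M = (1/2) *\<^sub>C (kk M + Idm n) - \<sigma>" by (simp add: e_def q scaleC_add)
  ultimately have "kk M = 2 *\<^sub>C \<sigma> - Idm n \<or> kk M = Idm n - 2 *\<^sub>C \<sigma>"
  proof (elim disjE)
    assume "e = 0"
    then have z: "(1/2) *\<^sub>C (kk M + Idm n) - \<sigma> = 0" using eK by simp
    have "kk M = 2 *\<^sub>C \<sigma> - Idm n"
    proof (rule fmat_eqI)
      fix i j show "ent (kk M) i j = ent (2 *\<^sub>C \<sigma> - Idm n) i j"
        using arg_cong[OF z, of "\<lambda>f. ent f i j"] by (simp add: field_simps)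
    qed
    then show ?thesis by blast
  next
    assume "e = Idm n"
    then have z: "(1/2) *\<^sub>C (kk M + Idm n) - \<sigma> = kk M" using eK by (simp add: m)
    have "kk M = Idm n - 2 *\<^sub>C \<sigma>"
    proof (rule fmat_eqI)
      fix i j show "ent (kk M) i j = ent (Idm n - 2 *\<^sub>C \<sigma>) i j"
        using arg_cong[OF z, of "\<lambda>f. ent f i j"] by (simp add: field_simps)
    qed
    then show ?thesis by blast
  qed
  then obtain t where t: "kk M = sgn_bit t *\<^sub>C (Idm n - \<sigma> - \<sigma>)"
  proof (elim disjE)
    assume "kk M = 2 *\<^sub>C \<sigma> - Idm n"
    then have "kk M = sgn_bit 1 *\<^sub>C (Idm n - \<sigma> - \<sigma>)" by (auto intro!: fmat_eqI)
    then show thesis by (rule that)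
  next
    assume "kk M = Idm n - 2 *\<^sub>C \<sigma>"
    then have "kk M = sgn_bit 0 *\<^sub>C (Idm n - \<sigma> - \<sigma>)" by (auto intro!: fmat_eqI)
    then show thesis by (rule that)
  qed
  obtain b iS pS where S: "rect n b iS" "rect b n pS" "\<sigma> = iS * pS" "pS * iS = Idm b"
    using idempotent_split[OF r idem] .
  have "rect n n (Idm n - \<sigma>)" "(Idm n - \<sigma>) * (Idm n - \<sigma>) = Idm n - \<sigma>"
    using r by (auto intro: rect_minus simp: left_diff_distrib right_diff_distrib idem rectD)
  then obtain a iT pT where T: "rect n a iT" "rect a n pT" "Idm n - \<sigma> = iT * pT" "pT * iT = Idm a"
    by (rule idempotent_split)
  have "pT * iS = (pT * iT) * (pT * iS) * (pS * iS)"
    by (simp add: S(4) T(4) mult.assoc rectD[OF T(2)] rectD[OF S(1)])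
  also have "\<dots> = pT * ((Idm n - \<sigma>) * \<sigma>) * iS" by (simp only: T(3) mult.assoc) (simp only: S(3) mult.assoc)
  finally have TS: "pT * iS = 0" by (simp add: left_diff_distrib idem rectD[OF r])
  have "pS * iT = (pS * iS) * (pS * iT) * (pT * iT)"
    by (simp add: S(4) T(4) mult.assoc rectD[OF S(2)] rectD[OF T(1)])
  also have "\<dots> = pS * (\<sigma> * (Idm n - \<sigma>)) * iT" by (simp only: T(3) mult.assoc) (simp only: S(3) mult.assoc)
  finally have ST: "pS * iT = 0" by (simp add: right_diff_distrib idem rectD[OF r])
  have X: "\<xi> = iS * (pS * \<xi> * iT) * pT" if "\<xi> * \<sigma> = 0" "\<sigma> * \<xi> = \<xi>" "\<xi> * Idm n = \<xi>" for \<xi>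
  proof -
    have "iS * (pS * \<xi> * iT) * pT = (\<sigma> * \<xi>) * (Idm n - \<sigma>)" by (simp only: T(3) mult.assoc) (simp only: S(3) mult.assoc)
    then show ?thesis by (simp add: right_diff_distrib that)
  qed
  have "KR_data M t a b (pS * x1 M * iT) (pS * x2 M * iT) iT pT iS pS"
    unfolding KR_data_def n_def[symmetric]
  proof (intro conjI)
    show "kk M = sgn_bit t *\<^sub>C (iT * pT - iS * pS)" using t by (simp add: S(3)[symmetric] T(3)[symmetric])
    show "x1 M = iS * (pS * x1 M * iT) * pT" "x2 M = iS * (pS * x2 M * iT) * pT"
      by (rule X; simp add: x m)+
    show "iT * pT + iS * pS = Idm n" by (simp add: S(3)[symmetric] T(3)[symmetric])
    have rx: "rect n n (ac M g)" for g using rect_ac[OF M] by (simp add: n_def)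
    show "rect b a (pS * x1 M * iT)" "rect b a (pS * x2 M * iT)"
      by (rule rect_times[OF rect_times[OF S(2) rx] T(1)])+
  qed (use M S T TS ST in auto)
  then show thesis by (rule that[OF krI])
qed

text \<open>A vector killed by both matrices of the pencil spans a direct summand, cut out by the
  idempotent pair \<open>(u * s, 0)\<close>. Indecomposability makes it the whole module.\<close>

lemma kronecker_common_kernel:
  assumes kronecker: "kronecker M t a b X Y" and ind: "indecomposable M"
    and u: "rect a 1 u" "u \<noteq> 0" "X * u = 0" "Y * u = 0"
  shows "M \<cong>\<^sub>K Wp 0 t"
proof -
  have p: "indec_pencil a b X Y" using kronecker_indecomposable[OF kronecker] ind by simp
  obtain s where s: "rect 1 a s" "u * s * u = u" using generalized_inverse[OF u(1)] .
  define c where "c = ent (s * u) 0 0"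
  have c: "s * u = c *\<^sub>C Idm 1" using rect_one[OF rect_times[OF s(1) u(1)]] by (simp add: c_def)
  have "u = c *\<^sub>C u" using s(2) by (simp add: mult.assoc c rectD[OF u(1)])
  have "(1 - c) *\<^sub>C u = u - c *\<^sub>C u" by (simp add: scaleC_diff_left)
  also have "\<dots> = 0" unfolding right_minus_eq by fact
  finally have "(1 - c) *\<^sub>C u = 0" .
  then have "c = 1" using scaleC_cancel u(2) by fastforce
  then have su: "s * u = Idm 1" using c by simp
  have "u * s = 0 \<and> (0 :: fmat) = 0 \<or> u * s = Idm a \<and> 0 = Idm b"
  proof (rule pindD[OF p])
    show "rect a a (u * s)" by (rule rect_times[OF u(1) s(1)])
    show "u * s * (u * s) = u * s" using s(2) by (simp flip: mult.assoc)
    show "0 * X = X * (u * s)" "0 * Y = Y * (u * s)" by (simp_all add: u flip: mult.assoc)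
  qed simp_all
  moreover have "u * s \<noteq> 0" using s(2) u(2) by auto
  ultimately have *: "u * s = Idm a" "Idm b = Idm 0" by auto
  have "b = 0" using Idm_inj[OF *(2)] .
  have "a = 1" using left_inverse_dim(1)[OF u(1) s(1) su] left_inverse_dim(1)[OF s(1) u(1) *(1)] by simp
  have "X = 0" "Y = 0" using kronecker_rects[OF kronecker] \<open>b = 0\<close> by (auto intro!: fmat_eqI rect_entD)
  then have "kronecker M t 1 0 0 0" using kronecker \<open>a = 1\<close> \<open>b = 0\<close> by simp
  then show ?thesis using iso_trans[OF kronecker_iso_refl[OF _ kronecker_V_mod] V_mod_Wp] by blast
qed

text \<open>The coefficients of a nonzero polynomial vector of degree less than \<open>L\<close> in
  the kernel of \<open>X + t Y\<close>, listed by powers of \<open>t\<close>.\<close>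

definition kernel_chain :: "fmat \<Rightarrow> fmat \<Rightarrow> nat \<Rightarrow> nat \<Rightarrow> (nat \<Rightarrow> fmat) \<Rightarrow> bool" where
  "kernel_chain X Y a L v \<longleftrightarrow> (\<forall>i. rect a 1 (v i)) \<and> (\<forall>i\<ge>L. v i = 0) \<and> (\<exists>i. v i \<noteq> 0) \<and>
     X * v 0 = 0 \<and> (\<forall>i. X * v (Suc i) + Y * v i = 0)"

text \<open>A polynomial vector \<open>\<Sum> v\<^sub>i t\<^sup>i\<close> killed by \<open>X + tY\<close> becomes shorter when passing to the
  cosyzygy of the module.\<close>

lemma kernel_chain_Wp:
  assumes "kronecker M t a b X Y" "indecomposable M" "kernel_chain X Y a L v"
  shows "\<exists>k r. M \<cong>\<^sub>K Wp k r"
  using assms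
proof (induction L arbitrary: M t a b X Y v)
  case 0
  then show ?case by (auto simp: kernel_chain_def)
next
  case (Suc L)
  note kronecker = Suc.prems(1) and ind = Suc.prems(2)
  note v = Suc.prems(3)[unfolded kernel_chain_def]
  show ?case
  proof (cases "\<exists>u. rect a 1 u \<and> u \<noteq> 0 \<and> X * u = 0 \<and> Y * u = 0")
    case True
    then show ?thesis using kronecker_common_kernel[OF kronecker ind] by blast
  next
    case nocommon: False
    have p: "indec_pencil a b X Y" using kronecker_indecomposable[OF kronecker] ind by simp
    have rX: "rect b a X" and rY: "rect b a Y" using kronecker_rects[OF kronecker] by auto
    \<comment> \<open>The matrix \<open>G\<close> stacks \<open>- Y\<close> above \<open>X\<close>.
      Its cokernel pencil \<open>(U, V)\<close> defines a module \<open>N\<close> with syzygy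
      \<open>M\<close>; the absence of a common kernel vector is exactly the injectivity of
      \<open>G\<close>.\<close>
    define G where "G = Sh b b * X - Y"
    have rG: "rect (b + b) a G" unfolding G_def
      by (intro rect_minus rect_times[OF rect_Sh rX] rect_mono[OF rY]) simp_all
    obtain s where s: "rect a (b + b) s" "G * s * G = G" using generalized_inverse[OF rG] .
    have ib: "Idm b * (Sh b b * z) = 0" for z by (simp flip: mult.assoc)
    have g1: "Idm b * G = - Y" by (simp add: G_def right_diff_distrib ib rectD[OF rY])
    have "tp (Sh b b) * Y = tp (Sh b b) * Idm b * Y" by (simp only: mult.assoc rectD[OF rY])
    then have "tp (Sh b b) * Y = 0" by simp
    then have g2: "tp (Sh b b) * G = X" by (simp add: G_def right_diff_distrib assoc_rew[OF tpSh_Sh] rectD[OF rX])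
    have inj: "z = 0" if "rect a a z" "G * z = 0" for z
    proof -
      have "X * z = tp (Sh b b) * (G * z)" "- (Y * z) = Idm b * (G * z)"
        by (simp_all only: g1 g2 mult_minus_left flip: mult.assoc)
      then have xz: "X * z = 0" "Y * z = 0" using that(2) by simp_all
      have "z * Eu j 0 = 0" for j
      proof (cases "j < a")
        case True
        have "rect a 1 (z * Eu j 0)" using True by (intro rect_times[OF that(1)]) simp
        moreover have "X * (z * Eu j 0) = 0" "Y * (z * Eu j 0) = 0" using xz by (simp_all flip: mult.assoc)
        ultimately show ?thesis using nocommon by blast
      next
        case False
        have "z * Eu j 0 = z * Idm a * Eu j 0" by (simp only: rectD[OF that(1)])
        also have "\<dots> = z * (Idm a * Eu j 0)" by (rule mult.assoc)
        finally show ?thesis using False by simp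
      qed
      then have "ent (z * Eu j 0 * Eu 0 j) i j = 0" for i j by simp
      then show ?thesis by (intro fmat_eqI) (simp add: ent_times_Eu)
    qed
    have sG: "s * G = Idm a"
    proof -
      have "Idm a - s * G = 0"
      proof (rule inj)
        show "rect a a (Idm a - s * G)" by (intro rect_minus rect_times[OF s(1) rG]) simp
        show "G * (Idm a - s * G) = 0" using s(2) by (simp add: right_diff_distrib rectD[OF rG] mult.assoc)
      qed
      then show ?thesis by simp
    qed
    define q where "q = Idm (b + b) - G * s"
    have rq: "rect (b + b) (b + b) q" unfolding q_def by (intro rect_minus rect_times[OF rG s(1)]) simp
    have "q * q = q"
      by (simp add: q_def left_diff_distrib right_diff_distrib mult.assoc rectD[OF rG] rectD[OF s(1)] assoc_rew[OF sG])
    then obtain c i w where c: "rect (b + b) c i" "rect c (b + b) w" "q = i * w" "w * i = Idm c"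
      using idempotent_split[OF rq] by blast
    have wG: "w * G = 0"
    proof -
      have "w * q = w" by (simp add: c(3) assoc_rew[OF c(4)] rectD[OF c(2)])
      moreover have "q * G = 0" by (simp add: q_def left_diff_distrib mult.assoc sG rectD[OF rG])
      ultimately show ?thesis by (metis mult.assoc mult_zero_right)
    qed
    define U V where "U = w * Idm b" and "V = w * Sh b b"
    define s1 s2 where "s1 = Idm b * i" and "s2 = tp (Sh b b) * i"
    define l1 l2 where "l1 = s * Idm b" and "l2 = s * Sh b b"
    have rU: "rect c b U" and rV: "rect c b V" and rs: "rect b c s1" "rect b c s2" and rl: "rect a b l1" "rect a b l2"
      unfolding U_def V_def s1_def s2_def l1_def l2_def
      by (rule rect_times[OF c(2)] rect_times[OF s(1)] rect_times[OF _ c(1)]; auto intro: rect_Idm rect_Sh rect_tp)+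
    define A where "A = - Y"
    have gA: "Idm b * G = A" using g1 by (simp add: A_def)
    have rA: "rect b a A" unfolding A_def by (rule rect_uminus[OF rY])
    have spl: "f * (Idm b * g) + f * (Sh b b * (tp (Sh b b) * g)) = f * g" if "rect m (b + b) f" for f g m
      using arg_cong[OF Sh_tpSh[of b b], of "\<lambda>z. f * z * g"]
      by (simp only: distrib_left distrib_right mult.assoc rectD[OF that])
    have ib2: "Idm b * (Idm b * z) = Idm b * z" for z by (simp flip: mult.assoc)
    have ker: "U * A + V * X = 0"
      using spl[OF c(2), of G] wG by (simp only: U_def V_def gA[symmetric] g2[symmetric] mult.assoc ib2)
    have one: "U * s1 + V * s2 = Idm c"
      using spl[OF c(2), of i] c(4) by (simp only: U_def V_def s1_def s2_def mult.assoc ib2)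
    have lin: "l1 * A + l2 * X = Idm a"
      using spl[OF s(1), of G] sG by (simp only: l1_def l2_def gA[symmetric] g2[symmetric] mult.assoc ib2)
    have ls: "A * l1 + s1 * U = Idm b" "A * l2 + s1 * V = 0" "X * l1 + s2 * U = 0" "X * l2 + s2 * V = Idm b"
    proof -
      have gs: "G * s + i * w = Idm (b + b)" using c(3)[symmetric] by (simp add: q_def)
      have *: "P * G * (s * R) + P * i * (w * R) = P * Idm (b + b) * R" for P R
        using arg_cong[OF gs, of "\<lambda>z. P * z * R"] by (simp only: distrib_left distrib_right mult.assoc)
      have "Idm b * Idm (b + b) * Idm b = Idm b" "tp (Sh b b) * Idm (b + b) * Sh b b = Idm b"
        "Idm b * Idm (b + b) * Sh b b = 0" "tp (Sh b b) * Idm (b + b) * Idm b = 0"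
        by (auto intro!: fmat_eqI simp: ent_Idm ent_Sh)
      then show "A * l1 + s1 * U = Idm b" "A * l2 + s1 * V = 0" "X * l1 + s2 * U = 0" "X * l2 + s2 * V = Idm b"
        unfolding U_def V_def s1_def s2_def l1_def l2_def gA[symmetric] g2[symmetric] * by simp_all
    qed
    have ex: "exact_pair b c a U V A X"
      unfolding exact_pair_def using rA rX rs rl lin one ls by blast
    define N where "N = Kr (t + 1) b c U V"
    have krN: "kronecker N (t + 1) b c U V" unfolding N_def by (rule kronecker_Kr[OF rU rV])
    have "kronecker M (t + 1 + 1) a b X (- A)" using kronecker by (simp add: add.assoc A_def)
    from kronecker_minimal_exact[OF krN this ex] have ms: "minimal_exact M (free_rep (t + 1) b) N" .
    have "indec_pencil b c U V"
    proof (rule pindI)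
      have "b \<noteq> 0"
      proof
        assume "b = 0"
        then have "X = 0" "Y = 0" using rX rY by (auto intro!: fmat_eqI rect_entD)
        then show False using nocommon v by auto
      qed
      then show "b + c \<noteq> 0" by simp
      fix e f assume ef: "rect b b e" "rect c c f" "e * e = e" "f * f = f" "f * U = U * e" "f * V = V * e"
      \<comment> \<open>The columns \<open>e * A\<close>, \<open>e * X\<close> lie in the kernel of
        \<open>(U | V)\<close>, so by exactness they come from a unique \<open>g\<close>. In this
        way idempotent pairs of the new pencil lift to the old one, and indecomposability passes
        from \<open>M\<close> to \<open>N\<close>.\<close>
      define g where "g = l1 * e * A + l2 * e * X"
      have "U * (e * A) + V * (e * X) = f * (U * A + V * X)"
        by (simp only: distrib_left ef(5,6) flip: mult.assoc)
      then have k0: "U * (e * A) + V * (e * X) = 0" unfolding ker by simp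
      have lift: "Z * g = e * Z" if "Z * l1 = F1 - S * U" "Z * l2 = F2 - S * V" "F1 * (e * A) + F2 * (e * X) = e * Z"
        for Z S F1 F2
      proof -
        have "Z * g = (Z * l1) * (e * A) + (Z * l2) * (e * X)"
          unfolding g_def distrib_left by (simp only: mult.assoc)
        also have "\<dots> = F1 * (e * A) + F2 * (e * X) - S * (U * (e * A) + V * (e * X))"
          unfolding that(1,2) by (simp add: algebra_simps)
        finally show ?thesis unfolding k0 that(3) by simp
      qed
      have eA: "A * g = e * A"
        by (rule lift[of _ "Idm b" s1 0])
          (use ls(1,2) in \<open>simp_all add: eq_diff_eq eq_neg_iff_add_eq_0 rectD[OF ef(1)]\<close>)
      have eX: "X * g = e * X"
        by (rule lift[of _ 0 s2 "Idm b"])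
          (use ls(3,4) in \<open>simp_all add: eq_diff_eq eq_neg_iff_add_eq_0 rectD[OF ef(1)]\<close>)
      have "g * g = l1 * (e * (A * g)) + l2 * (e * (X * g))"
        by (subst (1) g_def) (simp only: distrib_right mult.assoc)
      also have "\<dots> = g" unfolding eA eX by (simp only: assoc_rew[OF ef(3)] g_def mult.assoc)
      finally have gg: "g * g = g" .
      have rg: "rect a a g" unfolding g_def
        by (intro rect_plus rect_times[OF rect_times[OF rl(1) ef(1)] rA] rect_times[OF rect_times[OF rl(2) ef(1)] rX])
      have "e * Y = Y * g" using eA by (simp add: A_def)
      then have "g = 0 \<and> e = 0 \<or> g = Idm a \<and> e = Idm b"
        using pindD[OF p rg ef(1) gg ef(3)] eX by simp
      moreover have "f = U * e * s1 + V * e * s2"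
      proof -
        have "f = f * (U * s1 + V * s2)" unfolding one by (simp add: rectD[OF ef(2)])
        also have "\<dots> = U * e * s1 + V * e * s2" by (simp only: distrib_left ef(5,6) flip: mult.assoc)
        finally show ?thesis .
      qed
      ultimately show "e = 0 \<and> f = 0 \<or> e = Idm b \<and> f = Idm c" using one by (auto simp: rectD[OF rU] rectD[OF rV])
    qed
    then have indN: "indecomposable N" using kronecker_indecomposable[OF krN] by simp
    \<comment> \<open>The new chain \<open>X * v (Suc i) = - (Y * v i)\<close> is one step shorter.
      It cannot vanish altogether, since a nonzero \<open>v i\<close> would then lie in the common
      kernel.\<close>
    have "kernel_chain U V b L (\<lambda>i. X * v (Suc i))"
      unfolding kernel_chain_def
    proof (intro conjI allI impI)
      have vc: "X * v (Suc j) = - (Y * v j)" for j using v by (simp add: eq_neg_iff_add_eq_0)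
      have uv: "U * (Y * z) = V * (X * z)" for z

      proof -
        have "V * X = U * Y" using ker by (simp add: A_def)
        then show ?thesis by (metis mult.assoc)
      qed
      fix j
      show "rect b 1 (X * v (Suc j))" using v by (intro rect_times[OF rX]) simp
      show "X * v (Suc j) = 0" if "L \<le> j" using v that by simp
      show "U * (X * v (Suc 0)) = 0" unfolding vc using v by (simp add: uv)
      show "U * (X * v (Suc (Suc j))) + V * (X * v (Suc j)) = 0" unfolding vc[of "Suc j"] by (simp add: uv)
      show "\<exists>i. X * v (Suc i) \<noteq> 0"
      proof (rule ccontr)
        assume "\<nexists>i. X * v (Suc i) \<noteq> 0"
        then have z: "X * v (Suc i) = 0" for i by blast
        have "X * v i = 0" for i using v z by (cases i) simp_all
        moreover have "Y * v i = 0" for i using vc[of i] z by simp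
        moreover obtain i where "v i \<noteq> 0" "rect a 1 (v i)" using v by auto
        ultimately show False using nocommon by metis
      qed
    qed
    from Suc.IH[OF krN indN this] obtain k r where "N \<cong>\<^sub>K Wp k r" by (elim exE) (rule that)
    then have "syzygy N \<cong>\<^sub>K Wp (Suc k) r" by (rule syzygy_iso[OF minimal_exact_Wp iso_sym])
    moreover have "syzygy N \<cong>\<^sub>K M" by (rule syzygy_iso[OF ms iso_refl[OF kronecker_module[OF krN]]])
    ultimately have "M \<cong>\<^sub>K Wp (Suc k) r" by (rule iso_trans[OF iso_sym, rotated])
    then show ?thesis by blast
  qed
qed

text \<open>Padding \<open>X + t Y\<close> with zero rows to a square matrix over the polynomial
  ring, singularity at every \<open>t\<close> forces the determinant to be the zero polynomial. Over
  an integral domain this already gives a nonzero kernel vector with entries in the ring, and its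
  coefficients form the chain.\<close>

lemma kernel_chain_exists:
  assumes X: "rect b a X" and Y: "rect b a Y" and ba: "b \<le> a"
    and sing: "\<And>t Z. rect a a Z \<Longrightarrow> Z * (X + t *\<^sub>C Y) \<noteq> Idm a"
  obtains L v where "kernel_chain X Y a L v"
proof -
  define A where "A = mat a a (\<lambda>(i, j). [:ent X i j, ent Y i j:])"
  have cA: "A \<in> carrier_mat a a" by (simp add: A_def)
  have "poly (det A) t = 0" for t
  proof -
    define B where "B = prj a a (X + t *\<^sub>C Y)"
    have cB: "B \<in> carrier_mat a a" by (simp add: B_def)
    have "rect a a (X + t *\<^sub>C Y)" using X Y ba by (intro rect_plus rect_scaleC) (auto intro: rect_mono)
    then have eB: "emb B = X + t *\<^sub>C Y" unfolding B_def by (rule emb_prj)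
    have "poly (det A) t = det B"
      by (rule poly_det_cong[OF cB cA]) (simp add: A_def B_def prj_def)
    moreover have "det B = 0"
    proof (rule ccontr)
      assume nz: "det B \<noteq> 0"
      have c: "adj_mat B \<in> carrier_mat a a" by (rule adj_mat(1)[OF cB])
      have "emb (adj_mat B * B) = det B *\<^sub>C Idm a" by (simp add: adj_mat(3)[OF cB] emb_smult emb_one)
      then have "emb (adj_mat B) * (X + t *\<^sub>C Y) = det B *\<^sub>C Idm a" using c cB by (simp add: emb_mult eB)
      then have "((1 / det B) *\<^sub>C emb (adj_mat B)) * (X + t *\<^sub>C Y) = Idm a" using nz by (simp only: scaleC_mult_left) simp
      then show False using sing[OF rect_scaleC[OF rect_emb[OF c]]] by blast
    qed
    ultimately show ?thesis by simp
  qed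
  then have "det A = 0" using poly_all_0_iff_0 by blast
  then obtain w where w: "w \<in> carrier_vec a" "w \<noteq> 0\<^sub>v a" "A *\<^sub>v w = 0\<^sub>v a"
    using det_0_iff_vec_prod_zero[OF cA] by blast
  define v where "v k = (\<Sum>j<a. coeff (w $ j) k *\<^sub>C Eu j 0)" for k
  define L where "L = (\<Sum>j<a. Suc (degree (w $ j)))"
  have ev: "ent (v k) j l = (if j < a \<and> l = 0 then coeff (w $ j) k else 0)" for k j l
  proof -
    have "ent (v k) j l = (\<Sum>i<a. if i = j then (if l = 0 then coeff (w $ j) k else 0) else 0)"
      unfolding v_def ent_sum by (intro sum.cong) (auto simp: ent_Eu)
    then show ?thesis by simp
  qed
  have rv: "rect a 1 (v k)" for k by (rule rect_entI) (auto simp: ev)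
  have ent_mult: "ent (Z * v k) i l = (\<Sum>j<a. ent Z i j * ent (v k) j l)" for Z k i l
    by (rule ent_times_right) (simp add: ev)
  have row: "(\<Sum>j<a. [:ent X i j, ent Y i j:] * w $ j) = 0" for i
  proof (cases "i < a")
    case True
    have "(A *\<^sub>v w) $ i = (\<Sum>j<a. [:ent X i j, ent Y i j:] * w $ j)"
      using True w(1) cA by (auto simp: scalar_prod_def A_def lessThan_atLeast0 intro!: sum.cong)
    then show ?thesis using True w(3) by simp
  next
    case False
    then show ?thesis using rect_entD[OF X] rect_entD[OF Y] ba by simp
  qed
  have c: "(\<Sum>j<a. coeff ([:ent X i j, ent Y i j:] * w $ j) k) = 0" for i k
    using arg_cong[OF row[of i], of "\<lambda>p. coeff p k"] by (simp add: coeff_sum)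
  have "kernel_chain X Y a L v"
    unfolding kernel_chain_def
  proof (intro conjI allI impI)
    fix k
    show "rect a 1 (v k)" by (rule rv)
    show "X * v 0 = 0"
    proof (rule fmat_eqI)
      fix i l show "ent (X * v 0) i l = ent 0 i l"
        using c[of i 0] by (cases "l = 0") (simp_all add: ent_mult ev)
    qed
    show "X * v (Suc k) + Y * v k = 0"
    proof (rule fmat_eqI)
      fix i l show "ent (X * v (Suc k) + Y * v k) i l = ent 0 i l"
        using c[of i "Suc k"] by (cases "l = 0") (simp_all add: ent_mult ev sum.distrib)
    qed
    show "v k = 0" if "L \<le> k"
    proof (rule fmat_eqI)
      fix j l
      have "degree (w $ j) < k" if "j < a"
      proof -
        have "Suc (degree (w $ j)) \<le> L" unfolding L_def using that by (intro member_le_sum) auto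
        then show ?thesis using \<open>L \<le> k\<close> by simp
      qed
      then show "ent (v k) j l = ent 0 j l" by (auto simp: ev coeff_eq_0)
    qed
    obtain j where j: "j < a" "w $ j \<noteq> 0" using w(1,2) by (metis eq_vecI index_zero_vec carrier_vecD)
    then have "ent (v (degree (w $ j))) j 0 \<noteq> 0" by (simp add: ev)
    then show "\<exists>i. v i \<noteq> 0" by (metis ent_zero)
  qed
  then show thesis by (rule that)
qed

text \<open>The projection onto the first Jordan block commutes with the Jordan matrix. By
  hypothesis it is trivial after conjugation, so there is only this block.\<close>

lemma jordan_block_form:
  assumes N: "rect n n N" and n: "n > 0"
    and ind: "\<And>e. rect n n e \<Longrightarrow> e * e = e \<Longrightarrow> e * N = N * e \<Longrightarrow> e = 0 \<or> e = Idm n"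
  obtains c P Q where "rect n n P" "rect n n Q" "P * Q = Idm n" "Q * P = Idm n"
    "N = P * (c *\<^sub>C Idm n + Up (n - 1)) * Q"
proof -
  define A where "A = prj n n N"
  have cA: "A \<in> carrier_mat n n" by (simp add: A_def)
  obtain as where "char_poly A = (\<Prod>a\<leftarrow>as. [:- a, 1:])" using char_poly_factorized[OF cA] by blast
  then obtain n_as where jnf: "jordan_nf A n_as" using jordan_nf_exists[OF cA] by blast
  obtain n' P Q where s: "{A, jordan_matrix n_as, P, Q} \<subseteq> carrier_mat n' n'" "P * Q = 1\<^sub>m n'" "Q * P = 1\<^sub>m n'"
    "A = P * jordan_matrix n_as * Q" using similar_matD jnf unfolding jordan_nf_def by blast
  have n': "n' = n" using s(1) cA by auto
  have nz: "0 \<notin> fst ` set n_as" using jnf by (simp add: jordan_nf_def)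
  have sz: "sum_list (map fst n_as) = n"
    using s(1) n' jordan_matrix_dim(1)[of n_as] unfolding carrier_mat_def by auto
  define J where "J = emb (jordan_matrix n_as)"
  have cP: "P \<in> carrier_mat n n" and cQ: "Q \<in> carrier_mat n n" and cJ: "jordan_matrix n_as \<in> carrier_mat n n"
    using s(1) n' by auto
  have rP: "rect n n (emb P)" and rQ: "rect n n (emb Q)" and rJ: "rect n n J"
    unfolding J_def by (rule rect_emb, fact)+
  have PQ: "emb P * emb Q = Idm n" "emb Q * emb P = Idm n"
    using s(2,3)[THEN arg_cong[of _ _ emb]] cP cQ n' by (simp_all add: emb_mult emb_one)
  have "emb A = emb P * J * emb Q" using cP cQ cJ sz unfolding s(4) J_def by (simp add: emb_mult mult.assoc)
  then have NJ: "N = emb P * J * emb Q" using emb_prj[OF N] by (simp add: A_def)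
  obtain m c rest where n_as: "n_as = (m, c) # rest" using sz n by (cases n_as) auto
  have m: "m > 0" "m \<le> n" using nz sz n_as by (auto simp: not_less)
  have eJ: "ent J i j = (if i < m \<and> j < m then (if i = j then c else if Suc i = j then 1 else 0) else 0)"
    if "i < m \<or> j < m" for i j
    using that by (auto simp: J_def ent_emb n_as jordan_matrix_Cons)
  define e where "e = emb P * Idm m * emb Q"
  have im: "Idm m * Idm m = Idm m" "Idm n * Idm m = Idm m" using m by (auto intro!: fmat_eqI simp: ent_Idm)
  have re: "rect n n (Idm m)" using m by (intro rect_Idm) auto
  note r = mult.assoc PQ(2) PQ(2)[THEN assoc_rew] rectD[OF rP] rectD[OF rQ] rectD[OF rJ] rectD[OF re] im im[THEN assoc_rew]
  have "e = 0 \<or> e = Idm n"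
  proof (rule ind)
    show "rect n n e" unfolding e_def by (intro rect_times[OF rect_times[OF rP re] rQ])
    show "e * e = e" by (simp add: e_def r)
    have "Idm m * J = J * Idm m" by (rule fmat_eqI) (auto simp: eJ)
    then have "emb P * (Idm m * J) * emb Q = emb P * (J * Idm m) * emb Q" by simp
    then show "e * N = N * e" by (simp add: e_def NJ r)
  qed
  moreover have "emb Q * e * emb P = Idm m" by (simp add: e_def r min_absorb1[OF m(2)])
  ultimately have "Idm m = Idm 0 \<or> Idm m = Idm n" using PQ(2) by (auto simp: rectD[OF rQ])
  then have "m = n" using m Idm_inj by blast
  have "J = c *\<^sub>C Idm n + Up (n - 1)"
  proof (rule fmat_eqI)
    fix i j show "ent J i j = ent (c *\<^sub>C Idm n + Up (n - 1)) i j"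
    proof (cases "i < n \<or> j < n")
      case True then show ?thesis using eJ[of i j] \<open>m = n\<close> by (auto simp: ent_Idm ent_Up)
    next
      case False then show ?thesis using rect_entD[OF rJ] by (auto simp: ent_Idm ent_Up)
    qed
  qed
  from NJ[unfolded this] show thesis by (rule that[OF rP rQ PQ])
qed

text \<open>The matrix is triangular with diagonal entry \<open>p\<close>, so back-substitution from
  the last row gives injectivity; a generalized inverse is then a left inverse.\<close>

lemma pencil_left_inverse:
  assumes "p \<noteq> 0" "n > 0"
  obtains V where "rect n n V" "V * (p *\<^sub>C Idm n + q *\<^sub>C Up (n - 1)) = Idm n"
proof -
  define F where "F = p *\<^sub>C Idm n + q *\<^sub>C Up (n - 1)"
  have rF: "rect n n F" unfolding F_def using assms(2) by (intro rect_plus rect_scaleC rect_Up) auto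
  obtain s where s: "rect n n s" "F * s * F = F" using generalized_inverse[OF rF] .
  have inj: "g = 0" if "rect n n g" "F * g = 0" for g
  proof (rule fmat_eqI)
    have "ent g (n - k) j = 0" if "k \<le> n" for k j using that
    proof (induction k)
      case 0 show ?case using rect_entD[OF \<open>rect n n g\<close>] by simp
    next
      case (Suc k)
      then have "Suc (n - Suc k) = n - k" by simp
      then have "p * ent g (n - Suc k) j = 0"
        using arg_cong[OF \<open>F * g = 0\<close>, of "\<lambda>f. ent f (n - Suc k) j"] Suc
        by (auto simp: F_def distrib_right split: if_splits)
      then show ?case using assms by simp
    qed
    from this[of "n - i" for i] show "ent g i j = ent 0 i j" for i j
      using rect_entD[OF \<open>rect n n g\<close>, of i j] by (cases "i \<le> n") (metis diff_diff_cancel diff_le_self ent_zero, simp)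
  qed
  have "Idm n - s * F = 0"
  proof (rule inj)
    show "rect n n (Idm n - s * F)" by (intro rect_minus rect_times[OF s(1) rF]) simp
    show "F * (Idm n - s * F) = 0" using s(2) by (simp add: right_diff_distrib rectD[OF rF] mult.assoc)
  qed
  then show thesis using that[OF s(1)] by (simp add: F_def)
qed

lemma pencil_iso_left_inverse:
  assumes "pencil_iso n n X Y X' Y'" "rect n n X" "rect n n V" "V * X' = Idm n"
  obtains Z where "rect n n Z" "Z * X = Idm n"
proof -
  obtain \<alpha> \<alpha>' \<beta> \<beta>' where 1: "rect n n \<alpha>" "rect n n \<alpha>'" "rect n n \<beta>" "rect n n \<beta>'"
    "\<alpha>' * \<alpha> = Idm n" "\<beta>' * \<beta> = Idm n" "\<beta> * X = X' * \<alpha>" "\<beta> * Y = Y' * \<alpha>"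
    using assms(1) unfolding pencil_iso_def by (elim exE conjE) (rule that)
  have "(\<alpha>' * V * \<beta>) * X = \<alpha>' * ((V * X') * \<alpha>)" by (simp only: 1(7) mult.assoc)
  then have "(\<alpha>' * V * \<beta>) * X = Idm n" by (simp add: assms(4) rectD[OF 1(1)] 1(5))
  then show thesis by (rule that[OF rect_times[OF rect_times[OF 1(2) assms(3)] 1(3)]])
qed

text \<open>Normal form relative to any invertible member \<open>Z\<close> of the pencil: dividing
  by \<open>Z\<close> leaves a single matrix, which is one Jordan block by indecomposability. The
  coefficients then carry the result back to \<open>X\<close> and \<open>Y\<close>.\<close>

lemma regular_pair:
  assumes p: "indec_pencil n n X Y" and r: "rect n n Z" "rect n n T" and Z: "rect n n Z'" "Z' * Z = Idm n"
    and XY: "X = a1 *\<^sub>C Z + a2 *\<^sub>C T" "Y = b1 *\<^sub>C Z + b2 *\<^sub>C T"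
  obtains c where "pencil_iso n n X Y ((a1 + a2 * c) *\<^sub>C Idm n + a2 *\<^sub>C Up (n - 1)) ((b1 + b2 * c) *\<^sub>C Idm n + b2 *\<^sub>C Up (n - 1))"
proof -
  have n: "n > 0" using p by (simp add: indec_pencil_def)
  have ZZ: "Z * Z' = Idm n" using left_inverse_dim(2)[OF r(1) Z] by simp
  note q = mult.assoc Z(2) ZZ assoc_rew[OF Z(2)] assoc_rew[OF ZZ] rectD[OF r(1)] rectD[OF r(2)] rectD[OF Z(1)]
    distrib_left distrib_right
  obtain c P Q where N: "rect n n P" "rect n n Q" "P * Q = Idm n" "Q * P = Idm n"
    "Z' * T = P * (c *\<^sub>C Idm n + Up (n - 1)) * Q"
  proof (rule jordan_block_form[of n "Z' * T"])
    show "rect n n (Z' * T)" by (rule rect_times[OF Z(1) r(2)])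
    fix e assume e: "rect n n e" "e * e = e" "e * (Z' * T) = Z' * T * e"
    have "Z * (e * (Z' * T)) = T * e" unfolding e(3) by (simp add: q)
    then have fW: "Z * (e * (Z' * T)) = T * e" by (simp add: mult.assoc)
    have "e = 0 \<and> Z * e * Z' = 0 \<or> e = Idm n \<and> Z * e * Z' = Idm n"
    proof (rule pindD[OF p e(1) _ e(2)])
      show "rect n n (Z * e * Z')" by (rule rect_times[OF rect_times[OF r(1) e(1)] Z(1)])
      show "Z * e * Z' * (Z * e * Z') = Z * e * Z'" by (simp add: q rectD[OF e(1)] assoc_rew[OF e(2)])
      show "Z * e * Z' * X = X * e" "Z * e * Z' * Y = Y * e"
        by (simp_all add: XY q rectD[OF e(1)] fW)
    qed
    then show "e = 0 \<or> e = Idm n" by blast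
  qed (use n in auto)
  let ?J = "c *\<^sub>C Idm n + Up (n - 1)"
  have rU: "rect n n (Up (n - 1))" using n by (intro rect_Up) auto
  have QZ: "Q * Z' * Z = Q" by (simp add: q rectD[OF N(2)])
  have "Q * (Z' * T) = ?J * Q" unfolding N(5)
    by (simp only: mult.assoc assoc_rew[OF N(4)]) (simp add: distrib_left distrib_right rectD[OF N(2)] rectD[OF rU])
  then have QW: "Q * Z' * T = ?J * Q" by (simp add: mult.assoc)
  have lin: "Q * Z' * (a *\<^sub>C Z + b *\<^sub>C T) = ((a + b * c) *\<^sub>C Idm n + b *\<^sub>C Up (n - 1)) * Q" for a b
  proof -
    have "Q * Z' * (a *\<^sub>C Z + b *\<^sub>C T) = a *\<^sub>C Q + b *\<^sub>C (?J * Q)"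
      unfolding distrib_left scaleC_mult_right QZ QW ..
    then show ?thesis by (simp add: distrib_right rectD[OF N(2)] scaleC_add scaleC_add_left)
  qed
  have "Z * P * (Q * Z') = Idm n" by (simp add: q assoc_rew[OF N(3)])
  then have "pencil_iso n n X Y ((a1 + a2 * c) *\<^sub>C Idm n + a2 *\<^sub>C Up (n - 1)) ((b1 + b2 * c) *\<^sub>C Idm n + b2 *\<^sub>C Up (n - 1))"
    unfolding pencil_iso_def XY
    by (intro exI[of _ Q] exI[of _ P] exI[of _ "Q * Z'"] exI[of _ "Z * P"] conjI lin N(1-3)
       rect_times[OF N(2) Z(1)] rect_times[OF r(1) N(1)])
  then show thesis by (rule that)
qed

text \<open>If \<open>X\<close> is invertible, the normal form relative to \<open>X\<close> gives a
  finite \<eta>. Otherwise the normal form relative to \<open>X + d Y\<close> shows that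
  \<open>Y\<close> is invertible, and relative to \<open>Y\<close> the matrix \<open>X\<close> has
  eigenvalue zero, which is the point at infinity.\<close>

lemma regular_M_mod:
  assumes kronecker: "kronecker M t n n X Y" and ind: "indecomposable M"
    and Z: "rect n n Z" "Z * (X + d *\<^sub>C Y) = Idm n"
  obtains r \<eta> where "n > 0" "M \<cong>\<^sub>K M_mod n r \<eta>"
proof -
  have p: "indec_pencil n n X Y" using kronecker_indecomposable[OF kronecker] ind by simp
  have n: "n > 0" using p by (simp add: indec_pencil_def)
  have rX: "rect n n X" and rY: "rect n n Y" using kronecker_rects[OF kronecker] by auto
  note result = that
  have conc: thesis if "pencil_iso n n X Y (MX n \<eta>) (MY n \<eta>)" for \<eta>
  proof (rule result[OF n])
    have "kronecker (M_mod n (t + 1) \<eta>) t n n (MX n \<eta>) (MY n \<eta>)" using kronecker_M_mod[OF n, of "t + 1" \<eta>] by (simp add: add.assoc)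
    then show "M \<cong>\<^sub>K M_mod n (t + 1) \<eta>" by (rule kronecker_iso[OF kronecker _ that])
  qed
  show thesis
  proof (cases "\<exists>V. rect n n V \<and> V * X = Idm n")
    case True
    then obtain V where V: "rect n n V" "V * X = Idm n" by blast
    obtain c where "pencil_iso n n X Y ((1 + 0 * c) *\<^sub>C Idm n + 0 *\<^sub>C Up (n - 1)) ((0 + 1 * c) *\<^sub>C Idm n + 1 *\<^sub>C Up (n - 1))"
      by (rule regular_pair[OF p rX rY V, of 1 0 0 1]) simp_all
    then have "pencil_iso n n X Y (MX n (Fin c)) (MY n (Fin c))" by (simp add: MX_def MY_def pencil_coeffs_def)
    then show thesis by (rule conc)
  next
    case False
    have X0: "\<not> pencil_iso n n X Y (a *\<^sub>C Idm n + b *\<^sub>C Up (n - 1)) Y'" if nz: "a \<noteq> 0" for a b Y'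
    proof
      assume ps: "pencil_iso n n X Y (a *\<^sub>C Idm n + b *\<^sub>C Up (n - 1)) Y'"
      obtain V where V: "rect n n V" "V * (a *\<^sub>C Idm n + b *\<^sub>C Up (n - 1)) = Idm n"
        using pencil_left_inverse[OF nz n] .
      obtain Z where "rect n n Z" "Z * X = Idm n" using pencil_iso_left_inverse[OF ps rX V] .
      then show False using False by blast
    qed
    have rZ: "rect n n (X + d *\<^sub>C Y)" by (intro rect_plus rect_scaleC rX rY)
    have "X = 1 *\<^sub>C (X + d *\<^sub>C Y) + (- d) *\<^sub>C Y" "Y = 0 *\<^sub>C (X + d *\<^sub>C Y) + 1 *\<^sub>C Y"
      by (auto intro!: fmat_eqI)
    then obtain c where c: "pencil_iso n n X Y ((1 + (- d) * c) *\<^sub>C Idm n + (- d) *\<^sub>C Up (n - 1)) ((0 + 1 * c) *\<^sub>C Idm n + 1 *\<^sub>C Up (n - 1))"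
      by (rule regular_pair[OF p rZ rY Z])
    \<comment> \<open>Otherwise the normal form of \<open>X\<close> would be triangular with nonzero
      diagonal and \<open>X\<close> invertible. The equation in turn gives
      \<open>c \<noteq> 0\<close>, the diagonal entry of the normal form of
      \<open>Y\<close>.\<close>
    then have "1 + (- d) * c = 0" using X0 by blast
    then have c0: "0 + 1 * c \<noteq> 0" by auto
    have ps: "pencil_iso n n Y X ((0 + 1 * c) *\<^sub>C Idm n + 1 *\<^sub>C Up (n - 1)) ((1 + (- d) * c) *\<^sub>C Idm n + (- d) *\<^sub>C Up (n - 1))"
      using c unfolding pencil_iso_def by (elim exE conjE) (intro exI conjI; assumption)
    obtain V' where V': "rect n n V'" "V' * ((0 + 1 * c) *\<^sub>C Idm n + 1 *\<^sub>C Up (n - 1)) = Idm n"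
      using pencil_left_inverse[OF c0 n] .
    obtain V where V: "rect n n V" "V * Y = Idm n" using pencil_iso_left_inverse[OF ps rY V'] .
    obtain c' where c': "pencil_iso n n X Y ((0 + 1 * c') *\<^sub>C Idm n + 1 *\<^sub>C Up (n - 1)) ((1 + 0 * c') *\<^sub>C Idm n + 0 *\<^sub>C Up (n - 1))"
      by (rule regular_pair[OF p rY rX V, of 0 1 1 0]) simp_all
    then have "0 + 1 * c' = 0" using X0 by blast
    then have "pencil_iso n n X Y (MX n Infty) (MY n Infty)" using c' by (simp add: MX_def MY_def pencil_coeffs_def)
    then show thesis by (rule conc)
  qed
qed

lemma th_zero_classification:
  assumes ind: "indecomposable M" and th: "th M = 0"
  shows "(\<exists>k r. M \<cong>\<^sub>K Wp k r) \<or> (\<exists>k r. M \<cong>\<^sub>K Wn k r) \<or> (\<exists>n r \<eta>. n > 0 \<and> M \<cong>\<^sub>K M_mod n r \<eta>)"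
proof -
  obtain t a b X Y where kronecker: "kronecker M t a b X Y" using th_zero_kronecker[OF ind th] .
  have rX: "rect b a X" and rY: "rect b a Y" using kronecker_rects[OF kronecker] by auto
  show ?thesis
  proof (cases "b \<le> a")
    case True
    show ?thesis
    proof (cases "\<exists>d Z. rect a a Z \<and> Z * (X + d *\<^sub>C Y) = Idm a")
      case True
      then obtain d Z where Z: "rect a a Z" "Z * (X + d *\<^sub>C Y) = Idm a" by blast
      have rp: "rect b a (X + d *\<^sub>C Y)" by (intro rect_plus rect_scaleC rX rY)
      have "(Z * Idm b) * (X + d *\<^sub>C Y) = Idm a" using Z(2) by (simp only: mult.assoc rectD[OF rp])
      moreover have "rect a b (Z * Idm b)" using \<open>b \<le> a\<close> by (intro rect_times[OF Z(1)] rect_Idm) auto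
      ultimately have "a \<le> b" using left_inverse_dim(1)[OF rp] by blast
      then have "a = b" using \<open>b \<le> a\<close> by simp
      then have "kronecker M t a a X Y" using kronecker by simp
      then obtain r \<eta> where "a > 0" "M \<cong>\<^sub>K M_mod a r \<eta>" using regular_M_mod[OF _ ind Z] by metis
      then show ?thesis by (intro disjI2 exI conjI)
    next
      case False
      then have "Z * (X + d *\<^sub>C Y) \<noteq> Idm a" if "rect a a Z" for d Z using that by blast
      then obtain L v where "kernel_chain X Y a L v" by (rule kernel_chain_exists[OF rX rY True])
      from kernel_chain_Wp[OF kronecker ind this] show ?thesis by (rule disjI1)
    qed
  next
    case False
    have kr': "kronecker (trp M) (t + 1) b a (tp X) (tp Y)" by (rule kronecker_trp[OF kronecker])
    have ind': "indecomposable (trp M)"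
      using kronecker_indecomposable[OF kr'] kronecker_indecomposable[OF kronecker] ind indec_pencil_tp by blast
    have rX': "rect a b (tp X)" and rY': "rect a b (tp Y)" using kronecker_rects[OF kr'] by auto
    obtain L v where "kernel_chain (tp X) (tp Y) b L v"
    proof (rule kernel_chain_exists[OF rX' rY'])
      show "a \<le> b" using False by simp
      fix d Z assume Z: "rect b b Z"
      have rp: "rect a b (tp X + d *\<^sub>C tp Y)" by (intro rect_plus rect_scaleC rX' rY')
      show "Z * (tp X + d *\<^sub>C tp Y) \<noteq> Idm b"
      proof
        assume "Z * (tp X + d *\<^sub>C tp Y) = Idm b"
        then have "(Z * Idm a) * (tp X + d *\<^sub>C tp Y) = Idm b" by (simp only: mult.assoc rectD[OF rp])
        moreover have "rect b a (Z * Idm a)" using False by (intro rect_times[OF Z] rect_Idm) auto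
        ultimately show False using left_inverse_dim(1)[OF rp] False by blast
      qed
    qed
    from kernel_chain_Wp[OF kr' ind' this] obtain k r where "trp M \<cong>\<^sub>K Wp k r" by (elim exE) (rule that)
    from iso_trp[OF iso_trans[OF this trp_Wn]] have "M \<cong>\<^sub>K Wn k r" by simp
    then show ?thesis by (intro disjI2 disjI1 exI)
  qed
qed

subsection \<open>The listed modules are pairwise non-isomorphic\<close>

text \<open>The top parity is the sign in \<open>x1 M * kk M\<close> or \<open>x2 M * kk M\<close>,
  an isomorphism invariant as long as one of \<xi>1 and \<xi>2 acts nontrivially. For V(r) it is
  ambiguous, the module being top or socle at will.\<close>

lemma kronecker_iso_parity:
  assumes iso: "M \<cong>\<^sub>K N" and M: "kronecker M t a b X Y" and N: "kronecker N t' c d X' Y'" and nz: "X \<noteq> 0 \<or> Y \<noteq> 0"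
  shows "t = t'"
proof -
  obtain f h where f: "is_module M" "is_module N" "hom M N f" "hom N M h"
    "f * h = Idm (rdim N)" "h * f = Idm (rdim M)" using isoE[OF iso] .
  obtain iT pT iS pS where d: "KR_data M t a b X Y iT pT iS pS" using krE[OF M] .
  have *: "t = t'" if "ac M g * kk M = sgn_bit t *\<^sub>C ac M g" "ac N g * kk N = sgn_bit t' *\<^sub>C ac N g" "ac M g \<noteq> 0" for g
  proof -
    have "h * (ac N g * kk N) * f = ac M g * kk M"
      by (simp add: mult.assoc homD[OF f(3)] homD[OF f(4)] f(6) assoc_rew[OF f(6)] mod_simps[OF f(1)])
    moreover have "h * (ac N g * kk N) * f = sgn_bit t' *\<^sub>C ac M g"
      unfolding that(2) by (simp add: mult.assoc homD[OF f(3)] assoc_rew[OF f(6)] mod_simps[OF f(1)])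
    ultimately have "(sgn_bit t - sgn_bit t') *\<^sub>C ac M g = 0" using that(1) by (simp add: scaleC_diff_left)
    then show ?thesis using that(3) scaleC_cancel by (metis right_minus_eq sgn_bit_inj)
  qed
  have "X = pS * x1 M * iT" "Y = pS * x2 M * iT"
    by (simp_all add: KR_dataD(14,15)[OF d] KR_rules[OF d] mult.assoc)
  then have "x1 M \<noteq> 0 \<or> x2 M \<noteq> 0" using nz by auto
  then show ?thesis using * kronecker_parity[OF M] kronecker_parity[OF N] by blast
qed

lemma kronecker_iso_pencil_iso:
  assumes iso: "M \<cong>\<^sub>K N" and M: "kronecker M t a b X Y" and N: "kronecker N t a b X' Y'"
  shows "pencil_iso a b X Y X' Y'"
proof -
  obtain f h where f: "is_module M" "is_module N" "hom M N f" "hom N M h"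
    "f * h = Idm (rdim N)" "h * f = Idm (rdim M)" using isoE[OF iso] .
  obtain iT pT iS pS where d: "KR_data M t a b X Y iT pT iS pS" using krE[OF M] .
  obtain iT' pT' iS' pS' where d': "KR_data N t a b X' Y' iT' pT' iS' pS'" using krE[OF N] .
  note D = KR_dataD[OF d] and D' = KR_dataD[OF d']
  have cross: "pS' * (f * iT) = 0" "pT' * (f * iS) = 0"
  proof -
    have "pS' * (kk N * f) * iT = pS' * (f * kk M) * iT" "pT' * (kk N * f) * iS = pT' * (f * kk M) * iS"
      by (simp_all add: homD[OF f(3)])
    then have "sgn_bit t *\<^sub>C (pS' * (f * iT)) = - (sgn_bit t *\<^sub>C (pS' * (f * iT)))"
      "sgn_bit t *\<^sub>C (pT' * (f * iS)) = - (sgn_bit t *\<^sub>C (pT' * (f * iS)))"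
      by (simp_all add: mult.assoc KR_rules[OF d] KR_rules[OF d'])
    then show "pS' * (f * iT) = 0" "pT' * (f * iS) = 0" using scaleC_neg_self by auto
  qed
  have un: "f * z = iT' * (pT' * (f * z)) + iS' * (pS' * (f * z))" for z
    using arg_cong[OF D'(12), of "\<lambda>g. g * (f * z)"] by (simp add: distrib_right mult.assoc homD[OF f(3)])
  have "pT * h * iT' * (pT' * f * iT) = pT * (h * (f * iT))"
    by (subst un) (simp add: cross mult.assoc)
  moreover have "pS * h * iS' * (pS' * f * iS) = pS * (h * (f * iS))"
    by (subst un) (simp add: cross mult.assoc)
  ultimately have inv: "pT * h * iT' * (pT' * f * iT) = Idm a" "pS * h * iS' * (pS' * f * iS) = Idm b"
    using D(8,9) by (simp_all add: assoc_rew[OF f(6)] rectD[OF D(2)] rectD[OF D(4)])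
  have comm: "pS' * f * iS * Z = Z' * (pT' * f * iT)" if "ac N g * f = f * ac M g" "ac M g = iS * Z * pT" "ac N g = iS' * Z' * pT'" "rect b a Z" "rect b a Z'" for g Z Z'
  proof -
    have "pS' * (f * ac M g) * iT = pS' * f * iS * Z"
      unfolding that(2) by (simp add: KR_rules[OF d] rectD[OF that(4)] mult.assoc)
    moreover have "pS' * (ac N g * f) * iT = Z' * (pT' * f * iT)"
      unfolding that(3) by (simp add: KR_rules[OF d'] rectD[OF that(5)] mult.assoc)
    ultimately show ?thesis using that(1) by simp
  qed
  show ?thesis
    unfolding pencil_iso_def
    by (intro exI[of _ "pT' * f * iT"] exI[of _ "pT * h * iT'"] exI[of _ "pS' * f * iS"] exI[of _ "pS * h * iS'"] conjI inv
      comm[OF homD(5)[OF f(3)] D(14) D'(14) D(6) D'(6)] comm[OF homD(5)[OF f(3)] D(15) D'(15) D(7) D'(7)]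
      rect_times[OF rect_times[OF D'(3) hom_rect[OF f(3)]] D(2)] rect_times[OF rect_times[OF D(3) hom_rect[OF f(4)]] D'(2)]
      rect_times[OF rect_times[OF D'(5) hom_rect[OF f(3)]] D(4)] rect_times[OF rect_times[OF D(5) hom_rect[OF f(4)]] D'(4)])
qed

text \<open>For two finite points \<alpha> and \<beta> coincide and the matrices are conjugate, so
  the trace \<open>n * c\<close> distinguishes them. Against infinity the first matrix decides: it
  is the identity in one case and singular in the other.\<close>

lemma pencil_iso_M:
  assumes n: "n > 0" and p: "pencil_iso n n (MX n \<eta>) (MY n \<eta>) (MX n \<eta>') (MY n \<eta>')"
  shows "\<eta> = \<eta>'"
proof -
  obtain \<alpha> \<alpha>' \<beta> \<beta>' where 1: "rect n n \<alpha>" "rect n n \<alpha>'" "rect n n \<beta>" "rect n n \<beta>'"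
    "\<alpha>' * \<alpha> = Idm n" "\<beta>' * \<beta> = Idm n" "\<beta> * MX n \<eta> = MX n \<eta>' * \<alpha>" "\<beta> * MY n \<eta> = MY n \<eta>' * \<alpha>"
    using p unfolding pencil_iso_def by (elim exE conjE) (rule that)
  have rt: "\<alpha> * \<alpha>' = Idm n" "\<beta> * \<beta>' = Idm n"
    using left_inverse_dim(2)[OF 1(1,2,5)] left_inverse_dim(2)[OF 1(3,4,6)] by simp_all
  define U where "U = Up (n - 1)"
  have U: "rect n n U" unfolding U_def using n by (intro rect_Up) auto
  have trU: "tr U = 0" unfolding U_def by (subst tr_eq[of 0]) (simp_all add: ent_Up)
  note q = rectD[OF 1(1)] rectD[OF 1(3)] rectD[OF U] mult.assoc
  show ?thesis
  proof (cases \<eta>; cases \<eta>')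
    fix c c' assume e: "\<eta> = Fin c" "\<eta>' = Fin c'"
    have "\<beta> = \<alpha>" using 1(7) by (simp add: e MX_def pencil_coeffs_def q)
    then have "\<alpha> * (c *\<^sub>C Idm n + U) = (c' *\<^sub>C Idm n + U) * \<alpha>" using 1(8) by (simp add: e MY_def pencil_coeffs_def U_def)
    then have "\<alpha>' * (\<alpha> * (c *\<^sub>C Idm n + U)) = \<alpha>' * ((c' *\<^sub>C Idm n + U) * \<alpha>)" by simp
    moreover have "\<alpha>' * (\<alpha> * (c *\<^sub>C Idm n + U)) = c *\<^sub>C Idm n + U"
      by (simp add: distrib_left q assoc_rew[OF 1(5)] 1(5))
    moreover have "tr (\<alpha>' * ((c' *\<^sub>C Idm n + U) * \<alpha>)) = tr (c' *\<^sub>C Idm n + U)"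
      by (subst tr_commute) (simp add: mult.assoc rt distrib_right q)
    ultimately have "tr (c *\<^sub>C Idm n + U) = tr (c' *\<^sub>C Idm n + U)" by simp
    then show ?thesis using n by (simp add: e tr_plus tr_scaleC trU tr_Idm)
  next
    fix c assume e: "\<eta> = Fin c" "\<eta>' = Infty"
    have "\<beta> = U * \<alpha>" using 1(7) by (simp add: e MX_def pencil_coeffs_def q U_def)
    then have "U * (\<alpha> * \<beta>') = Idm n" using rt(2) by (simp add: mult.assoc)
    from arg_cong[OF this, of "\<lambda>f. ent f (n - 1) (n - 1)"] show ?thesis using n by (simp add: U_def ent_Idm)
  next
    fix c assume e: "\<eta> = Infty" "\<eta>' = Fin c"
    have "\<beta> * U = \<alpha>" using 1(7) by (simp add: e MX_def pencil_coeffs_def q U_def)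
    then have "\<alpha>' * \<beta> * U = Idm n" using 1(5) by (simp add: mult.assoc)
    from arg_cong[OF this, of "\<lambda>f. ent f 0 0"] show ?thesis using n by (simp add: U_def ent_Idm)
  qed simp_all
qed

lemma M_mod_inj:
  assumes "n > 0" "M_mod n r \<eta> \<cong>\<^sub>K M_mod n' r' \<eta>'" shows "n = n'" "r = r'" "\<eta> = \<eta>'"
proof -
  show n: "n = n'" using iso_rdim[OF assms(2)] by simp
  note k = kronecker_M_mod[OF assms(1)]
  have "MX n \<eta> \<noteq> 0 \<or> MY n \<eta> \<noteq> 0"
  proof -
    have "ent (Idm n) 0 0 \<noteq> 0" using assms(1) by (simp add: ent_Idm)
    then have "Idm n \<noteq> 0" by auto
    moreover have "ent (Up (n - 1)) 0 0 = 0" by (simp add: ent_Up)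
    ultimately show ?thesis by (cases \<eta>) (auto simp: MX_def MY_def pencil_coeffs_def)
  qed
  then have "r + 1 = r' + 1" using kronecker_iso_parity[OF assms(2)[folded n] k k] by simp
  then show r: "r = r'" by simp
  show "\<eta> = \<eta>'" using pencil_iso_M[OF assms(1)] kronecker_iso_pencil_iso[OF assms(2)[folded n r] k k] by blast
qed

lemma tr_kk_Wp: "tr (kk (Wp s r)) = sgn_bit (r + parity s)" using kronecker_tr(2)[OF kronecker_Wp] by simp
lemma tr_kk_Wn: "tr (kk (Wn s r)) = sgn_bit (r + parity s)" using kronecker_tr(2)[OF kronecker_Wn] by simp

lemma Wp_inj: assumes "Wp s r \<cong>\<^sub>K Wp s' r'" shows "s = s'" "r = r'"
  using iso_rdim[OF assms] tr_ac_iso[OF assms, of GK] by (simp_all add: tr_kk_Wp)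
lemma Wn_inj: assumes "Wn s r \<cong>\<^sub>K Wn s' r'" shows "s = s'" "r = r'"
  using iso_rdim[OF assms] tr_ac_iso[OF assms, of GK] by (simp_all add: tr_kk_Wn)

text \<open>Dimension and trace of K force equal indices, and then the parities of the tops differ.
  This is contradictory unless \<xi>1 and \<xi>2 act as zero, that is, \<open>s = 0\<close>.\<close>

lemma Wp_Wn: assumes "Wp s r \<cong>\<^sub>K Wn s' r'" shows "s = 0" "s' = 0"
proof -
  have e: "s = s'" "r = r'"
    using iso_rdim[OF assms] tr_ac_iso[OF assms, of GK] by (simp_all add: tr_kk_Wp tr_kk_Wn)
  show "s = 0"
  proof (rule ccontr)
    assume "s \<noteq> 0"
    then have "ent (Idm s) 0 0 \<noteq> 0" by (simp add: ent_Idm)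
    then have "Idm s \<noteq> 0" by auto
    then have "r + parity s = r' + parity s' + 1" using kronecker_iso_parity[OF assms kronecker_Wp kronecker_Wn] by simp
    then show False by (simp add: e)
  qed
  then show "s' = 0" using e by simp
qed

lemma Pc_inj: assumes "Pc r \<cong>\<^sub>K Pc r'" shows "r = r'"
proof -
  obtain f h where f: "is_module (Pc r)" "is_module (Pc r')" "hom (Pc r) (Pc r') f" "hom (Pc r') (Pc r) h"
    "f * h = Idm (rdim (Pc r'))" "h * f = Idm (rdim (Pc r))" using isoE[OF assms] .
  have "h * (kk (Pc r') * th (Pc r')) * f = kk (Pc r) * th (Pc r)"
    by (simp add: mult.assoc homD[OF f(3)] homD[OF f(4)] f(6) assoc_rew[OF f(6)] mod_simps[OF f(1)] del: rdim_Pc)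
  moreover have "h * th (Pc r') * f = th (Pc r)"
    by (simp add: mult.assoc homD[OF f(3)] homD[OF f(4)] f(6) assoc_rew[OF f(6)] mod_simps[OF f(1)] del: rdim_Pc)
  then have "h * (kk (Pc r') * th (Pc r')) * f = sgn_bit r' *\<^sub>C th (Pc r)" unfolding kk_th_Pc by simp
  ultimately have "(sgn_bit r - sgn_bit r') *\<^sub>C th (Pc r) = 0" by (simp add: kk_th_Pc scaleC_diff_left)
  then show ?thesis using th_Pc scaleC_cancel by (metis right_minus_eq sgn_bit_inj)
qed

text \<open>Explicit models in place of the chosen representatives. V(r) appears as
  \<open>Wp 0 r\<close>, so that it shares all case distinctions with the syzygies.\<close>

fun concrete :: "label \<Rightarrow> rep" where
  "concrete (LV r) = Wp 0 r"
| "concrete (LP r) = Pc r"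
| "concrete (LSyz s r) = Wp s r"
| "concrete (LCosyz s r) = Wn s r"
| "concrete (LMod n r \<eta>) = M_mod n r \<eta>"

lemma listed_concrete: assumes "l \<in> labels" shows "listed l \<cong>\<^sub>K concrete l"
  using assms by (auto simp: labels_def V_mod_Wp P_mod_Pc Omega_Wp Omega_Wn intro!: iso_refl module_M_mod)

lemma indecomposable_concrete: assumes "l \<in> labels" shows "indecomposable (concrete l)"
  using assms by (auto simp: labels_def indecomposable_Wp indecomposable_Wn indecomposable_Pc indecomposable_M_mod)

lemma th_concrete: assumes "l \<in> labels" shows "th (concrete l) = 0 \<longleftrightarrow> l \<notin> range LP"
  using assms by (auto simp: labels_def kronecker_th[OF kronecker_Wp] kronecker_th[OF kronecker_Wn] kronecker_th[OF kronecker_M_mod] th_Pc)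

lemma rdim_odd: "Wp s r \<cong>\<^sub>K M_mod n r' \<eta> \<Longrightarrow> False" "Wn s r \<cong>\<^sub>K M_mod n r' \<eta> \<Longrightarrow> False"
  by (drule iso_rdim, simp, presburger)+

text \<open>The invariants are \<xi>1\<xi>2 for the projectives, the parity of the dimension for the
  modules M_n, and the dimension, the trace of K and the top parity for syzygies against
  cosyzygies.\<close>

lemma concrete_inj:
  assumes l: "l \<in> labels" "l' \<in> labels" and iso: "concrete l \<cong>\<^sub>K concrete l'" shows "l = l'"
proof (cases "l \<in> range LP")
  case True
  then have "l' \<in> range LP" using th_concrete l th_iso[OF iso_sym[OF iso]] by blast
  then show ?thesis using True iso Pc_inj by auto
next
  case False
  then have "l' \<notin> range LP" using th_concrete l th_iso[OF iso] by blast
  with False l have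
    "(\<exists>s r. concrete l = Wp s r \<and> l = (if s = 0 then LV r else LSyz s r)) \<or> (\<exists>s r. s > 0 \<and> l = LCosyz s r) \<or> (\<exists>n r \<eta>. n > 0 \<and> l = LMod n r \<eta>)"
    "(\<exists>s r. concrete l' = Wp s r \<and> l' = (if s = 0 then LV r else LSyz s r)) \<or> (\<exists>s r. s > 0 \<and> l' = LCosyz s r) \<or> (\<exists>n r \<eta>. n > 0 \<and> l' = LMod n r \<eta>)"
    by (auto simp: labels_def)
  then show ?thesis
  proof (elim disjE exE conjE)
    fix s r s' r'
    assume c: "concrete l = Wp s r" "concrete l' = Wp s' r'" and e: "l = (if s = 0 then LV r else LSyz s r)" "l' = (if s' = 0 then LV r' else LSyz s' r')"
    have "Wp s r \<cong>\<^sub>K Wp s' r'" using iso unfolding c .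
    from Wp_inj[OF this] show ?thesis by (simp add: e)
  next
    fix s r s' r' assume "concrete l = Wp s r" "l' = LCosyz s' r'" "0 < s'"
    then show ?thesis using iso Wp_Wn(2)[of s r s' r'] by simp
  next
    fix s r s' r' assume "concrete l' = Wp s r" "l = LCosyz s' r'" "0 < s'"
    then show ?thesis using iso_sym[OF iso] Wp_Wn(2)[of s r s' r'] by simp
  next
    fix s r n r' \<eta> assume "concrete l = Wp s r" "l' = LMod n r' \<eta>"
    then show ?thesis using iso rdim_odd(1)[of s r n r' \<eta>] by simp
  next
    fix s r n r' \<eta> assume "concrete l' = Wp s r" "l = LMod n r' \<eta>"
    then show ?thesis using iso_sym[OF iso] rdim_odd(1)[of s r n r' \<eta>] by simp
  next
    fix s r n r' \<eta> assume "l = LCosyz s r" "l' = LMod n r' \<eta>"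
    then show ?thesis using iso rdim_odd(2)[of s r n r' \<eta>] by simp
  next
    fix s r n r' \<eta> assume "l' = LCosyz s r" "l = LMod n r' \<eta>"
    then show ?thesis using iso_sym[OF iso] rdim_odd(2)[of s r n r' \<eta>] by simp
  next
    fix s r s' r' assume e: "l = LCosyz s r" "l' = LCosyz s' r'"
    then have "Wn s r \<cong>\<^sub>K Wn s' r'" using iso by simp
    from Wn_inj[OF this] show ?thesis by (simp add: e)
  next
    fix n r \<eta> n' r' \<eta>' assume e: "l = LMod n r \<eta>" "l' = LMod n' r' \<eta>'" "0 < n"
    then have "M_mod n r \<eta> \<cong>\<^sub>K M_mod n' r' \<eta>'" using iso by simp
    from M_mod_inj[OF e(3) this] show ?thesis by (simp add: e)
  qed
qed

lemma indecomposable_classification: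
  assumes "indecomposable M" obtains l where "l \<in> labels" "M \<cong>\<^sub>K concrete l"
proof (cases "th M = 0")
  case True
  from th_zero_classification[OF assms True] show thesis
  proof (elim disjE exE conjE)
    fix k r assume "M \<cong>\<^sub>K Wp k r"
    then have "M \<cong>\<^sub>K concrete (if k = 0 then LV r else LSyz k r)" by (cases "k = 0") simp_all
    then show thesis by (rule that[rotated]) (simp add: labels_def)
  next
    fix k r assume M: "M \<cong>\<^sub>K Wn k r"
    have "M \<cong>\<^sub>K concrete (if k = 0 then LV r else LCosyz k r)"
    proof (cases "k = 0")
      case True
      then have "M \<cong>\<^sub>K Wn 0 r" using M by simp
      from iso_trans[OF this iso_trans[OF iso_sym[OF V_mod_Wn] V_mod_Wp]] True show ?thesis by simp
    qed (use M in simp)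
    then show thesis by (rule that[rotated]) (simp add: labels_def)
  next
    fix n r \<eta> assume "0 < n" "M \<cong>\<^sub>K M_mod n r \<eta>"
    then show thesis by (intro that[of "LMod n r \<eta>"]) (simp_all add: labels_def)
  qed
next
  case False
  obtain r where "M \<cong>\<^sub>K Pc r" using th_nonzero_Pc[OF assms False] .
  then show thesis by (intro that[of "LP r"]) (simp_all add: labels_def)
qed

text \<open>The origin of the multiplicities: for \<open>s \<ge> n\<close> the product of the odd
  dimensions exceeds \<open>2 (s - n) + 1\<close> by \<open>4 s n + 4 n\<close>, four times the
  number of projective summands. The second equation serves the case where the roles are
  exchanged.\<close>

lemma odd_dims:
  assumes "n \<le> s"
  shows "(2 * s + 1) * (2 * n + 1) = 2 * nat \<bar>int s - int n\<bar> + 1 + 4 * ((s + 1) * n)"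
    "(2 * n + 1) * (2 * s + 1) = 2 * nat \<bar>int n - int s\<bar> + 1 + 4 * ((s + 1) * n)"
proof -
  obtain d where d: "s = n + d" using le_Suc_ex[OF assms] by (elim exE) (rule that)
  have a: "nat \<bar>int (n + d) - int n\<bar> = d" "nat \<bar>int n - int (n + d)\<bar> = d" by simp_all
  show "(2 * s + 1) * (2 * n + 1) = 2 * nat \<bar>int s - int n\<bar> + 1 + 4 * ((s + 1) * n)"
    "(2 * n + 1) * (2 * s + 1) = 2 * nat \<bar>int n - int s\<bar> + 1 + 4 * ((s + 1) * n)"
    unfolding d a by (simp_all add: algebra_simps)
qed

theorem theorem5p1:
  shows
    "(\<forall>X. indecomposable X \<longleftrightarrow> (\<exists>l\<in>labels. X \<cong>\<^sub>K listed l))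
   \<and> (\<forall>l\<in>labels. \<forall>l'\<in>labels. listed l \<cong>\<^sub>K listed l' \<longrightarrow> l = l')
   \<and> (\<forall>r r'.
        dual (V_mod r) \<cong>\<^sub>K V_mod r \<and> dual (P_mod r) \<cong>\<^sub>K P_mod r
      \<and> V_mod r \<otimes>\<^sub>K V_mod r' \<cong>\<^sub>K V_mod (r + r')
      \<and> V_mod r \<otimes>\<^sub>K P_mod r' \<cong>\<^sub>K P_mod (r + r')
      \<and> P_mod r \<otimes>\<^sub>K P_mod r' \<cong>\<^sub>K 2 \<odot>\<^sub>K P_mod 0 \<oplus>\<^sub>K 2 \<odot>\<^sub>K P_mod 1)
   \<and> (\<forall>r r' \<eta> \<eta>'. \<forall>s>0. \<forall>n>0.
        dual (Omega (int s) (V_mod r)) \<cong>\<^sub>K Omega (- int s) (V_mod r)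
      \<and> dual (M_mod n r \<eta>) \<cong>\<^sub>K M_mod n (r + 1) \<eta>

      \<and> V_mod r \<otimes>\<^sub>K Omega (int s) (V_mod r') \<cong>\<^sub>K Omega (int s) (V_mod (r + r'))
      \<and> V_mod r \<otimes>\<^sub>K Omega (- int s) (V_mod r') \<cong>\<^sub>K Omega (- int s) (V_mod (r + r'))
      \<and> V_mod r \<otimes>\<^sub>K M_mod n r' \<eta> \<cong>\<^sub>K M_mod n (r + r') \<eta>

      \<and> P_mod r \<otimes>\<^sub>K Omega (int s) (V_mod r')
          \<cong>\<^sub>K s \<odot>\<^sub>K P_mod (r + r' + parity (s + 1)) \<oplus>\<^sub>K (s + 1) \<odot>\<^sub>K P_mod (r + r' + parity s)
      \<and> P_mod r \<otimes>\<^sub>K Omega (- int s) (V_mod r')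
          \<cong>\<^sub>K s \<odot>\<^sub>K P_mod (r + r' + parity (s + 1)) \<oplus>\<^sub>K (s + 1) \<odot>\<^sub>K P_mod (r + r' + parity s)
      \<and> P_mod r \<otimes>\<^sub>K M_mod n r' \<eta> \<cong>\<^sub>K n \<odot>\<^sub>K P_mod 0 \<oplus>\<^sub>K n \<odot>\<^sub>K P_mod 1

      \<and> Omega (int s) (V_mod r) \<otimes>\<^sub>K M_mod n r' \<eta>
          \<cong>\<^sub>K M_mod n (r + r' + parity s) \<eta> \<oplus>\<^sub>K (s * n) \<odot>\<^sub>K P_mod (r + r' + parity (s + 1))
      \<and> Omega (- int s) (V_mod r) \<otimes>\<^sub>K M_mod n r' \<eta>
          \<cong>\<^sub>K M_mod n (r + r' + parity s) \<eta> \<oplus>\<^sub>K (s * n) \<odot>\<^sub>K P_mod (r + r' + parity s)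

      \<and> Omega (int s) (V_mod r) \<otimes>\<^sub>K Omega (int n) (V_mod r')
          \<cong>\<^sub>K Omega (int s + int n) (V_mod (r + r')) \<oplus>\<^sub>K (s * n) \<odot>\<^sub>K P_mod (r + r' + parity (s + n))
      \<and> (s \<ge> n \<longrightarrow> Omega (int s) (V_mod r) \<otimes>\<^sub>K Omega (- int n) (V_mod r')
          \<cong>\<^sub>K Omega (int s - int n) (V_mod (r + r')) \<oplus>\<^sub>K ((s + 1) * n) \<odot>\<^sub>K P_mod (r + r' + parity (s + n + 1)))
      \<and> (\<not> s \<ge> n \<longrightarrow> Omega (int s) (V_mod r) \<otimes>\<^sub>K Omega (- int n) (V_mod r')
          \<cong>\<^sub>K Omega (int s - int n) (V_mod (r + r')) \<oplus>\<^sub>K ((n + 1) * s) \<odot>\<^sub>K P_mod (r + r' + parity (s + n + 1)))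

      \<and> (\<eta> \<noteq> \<eta>' \<longrightarrow> M_mod s r \<eta> \<otimes>\<^sub>K M_mod n r' \<eta>' \<cong>\<^sub>K (s * n) \<odot>\<^sub>K P_mod (r + r'))
      \<and> (s \<le> n \<longrightarrow> M_mod s r \<eta> \<otimes>\<^sub>K M_mod n r' \<eta>
          \<cong>\<^sub>K (s * (n - 1)) \<odot>\<^sub>K P_mod (r + r') \<oplus>\<^sub>K M_mod s 0 \<eta> \<oplus>\<^sub>K M_mod s 1 \<eta>))"
proof (intro conjI allI ballI impI)
  show "indecomposable X \<longleftrightarrow> (\<exists>l\<in>labels. X \<cong>\<^sub>K listed l)" for X
  proof
    assume "indecomposable X"
    then obtain l where "l \<in> labels" "X \<cong>\<^sub>K concrete l" by (rule indecomposable_classification)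
    then show "\<exists>l\<in>labels. X \<cong>\<^sub>K listed l" using iso_trans iso_sym listed_concrete by blast
  next
    assume "\<exists>l\<in>labels. X \<cong>\<^sub>K listed l"
    then obtain l where "l \<in> labels" "X \<cong>\<^sub>K listed l" by blast
    then show "indecomposable X"
      using indecomposable_iso[OF iso_sym[OF iso_trans[OF _ listed_concrete]] indecomposable_concrete] by blast
  qed
  show "l = l'" if "l \<in> labels" "l' \<in> labels" "listed l \<cong>\<^sub>K listed l'" for l l'
    using concrete_inj[OF that(1,2)] iso_trans[OF iso_trans[OF iso_sym[OF listed_concrete[OF that(1)]] that(3)] listed_concrete[OF that(2)]]
    by blast
next
  fix r r' :: bit
  show "dual (V_mod r) \<cong>\<^sub>K V_mod r" by (rule dual_V_mod)
  show "dual (P_mod r) \<cong>\<^sub>K P_mod r"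
    by (rule iso_trans[OF iso_trans[OF dual_cong[OF P_mod_Pc] dual_Pc] iso_sym[OF P_mod_Pc]])
  show "V_mod r \<otimes>\<^sub>K V_mod r' \<cong>\<^sub>K V_mod (r + r')" by (rule V_tensor_V)
  show "V_mod r \<otimes>\<^sub>K P_mod r' \<cong>\<^sub>K P_mod (r + r')"
    by (rule iso_trans[OF iso_trans[OF tensor_cong[OF iso_refl[OF kronecker_module[OF kronecker_V_mod]] P_mod_Pc] V_tensor_Pc] iso_sym[OF P_mod_Pc]])
  show "P_mod r \<otimes>\<^sub>K P_mod r' \<cong>\<^sub>K 2 \<odot>\<^sub>K P_mod 0 \<oplus>\<^sub>K 2 \<odot>\<^sub>K P_mod 1" by (rule P_mod_tensor(1))
next
  fix r r' :: bit and \<eta> \<eta>' :: cp1 and s n :: nat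
  assume s: "0 < s" and n: "0 < n"
  show "dual (Omega (int s) (V_mod r)) \<cong>\<^sub>K Omega (- int s) (V_mod r)"
    by (rule iso_trans[OF iso_trans[OF dual_cong[OF Omega_Wp] dual_Wp] iso_sym[OF Omega_Wn]])
  show "dual (M_mod n r \<eta>) \<cong>\<^sub>K M_mod n (r + 1) \<eta>" by (rule dual_M_mod[OF n])
  note V = iso_refl[OF kronecker_module[OF kronecker_V_mod]]
  show "V_mod r \<otimes>\<^sub>K Omega (int s) (V_mod r') \<cong>\<^sub>K Omega (int s) (V_mod (r + r'))"
    by (rule iso_trans[OF iso_trans[OF tensor_cong[OF V Omega_Wp] V_tensor_Wp] iso_sym[OF Omega_Wp]])
  show "V_mod r \<otimes>\<^sub>K Omega (- int s) (V_mod r') \<cong>\<^sub>K Omega (- int s) (V_mod (r + r'))"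
    by (rule iso_trans[OF iso_trans[OF tensor_cong[OF V Omega_Wn] V_tensor_Wn] iso_sym[OF Omega_Wn]])
  show "V_mod r \<otimes>\<^sub>K M_mod n r' \<eta> \<cong>\<^sub>K M_mod n (r + r') \<eta>" by (rule V_tensor_M_mod[OF n])
  show "P_mod r \<otimes>\<^sub>K Omega (int s) (V_mod r')
      \<cong>\<^sub>K s \<odot>\<^sub>K P_mod (r + r' + parity (s + 1)) \<oplus>\<^sub>K (s + 1) \<odot>\<^sub>K P_mod (r + r' + parity s)"
    by (rule P_mod_tensor(2))
  show "P_mod r \<otimes>\<^sub>K Omega (- int s) (V_mod r')
      \<cong>\<^sub>K s \<odot>\<^sub>K P_mod (r + r' + parity (s + 1)) \<oplus>\<^sub>K (s + 1) \<odot>\<^sub>K P_mod (r + r' + parity s)"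
    by (rule P_mod_tensor(3))
  show "P_mod r \<otimes>\<^sub>K M_mod n r' \<eta> \<cong>\<^sub>K n \<odot>\<^sub>K P_mod 0 \<oplus>\<^sub>K n \<odot>\<^sub>K P_mod 1" by (rule P_mod_tensor(4)[OF n])
  show "Omega (int s) (V_mod r) \<otimes>\<^sub>K M_mod n r' \<eta>
      \<cong>\<^sub>K M_mod n (r + r' + parity s) \<eta> \<oplus>\<^sub>K (s * n) \<odot>\<^sub>K P_mod (r + r' + parity (s + 1))"
    by (rule Omega_tensor_M_mod(1)[OF n])
  show "Omega (- int s) (V_mod r) \<otimes>\<^sub>K M_mod n r' \<eta>
      \<cong>\<^sub>K M_mod n (r + r' + parity s) \<eta> \<oplus>\<^sub>K (s * n) \<odot>\<^sub>K P_mod (r + r' + parity s)"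
    by (rule Omega_tensor_M_mod(2)[OF n])
  show "Omega (int s) (V_mod r) \<otimes>\<^sub>K Omega (int n) (V_mod r')
      \<cong>\<^sub>K Omega (int s + int n) (V_mod (r + r')) \<oplus>\<^sub>K (s * n) \<odot>\<^sub>K P_mod (r + r' + parity (s + n))"
    by (rule Omega_tensor_Omega)
  show "Omega (int s) (V_mod r) \<otimes>\<^sub>K Omega (- int n) (V_mod r')
      \<cong>\<^sub>K Omega (int s - int n) (V_mod (r + r')) \<oplus>\<^sub>K ((s + 1) * n) \<odot>\<^sub>K P_mod (r + r' + parity (s + n + 1))"
    if "n \<le> s"
    by (rule Omega_tensor_Omega_neg[OF odd_dims(1)[OF that]])
  show "Omega (int s) (V_mod r) \<otimes>\<^sub>K Omega (- int n) (V_mod r')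
      \<cong>\<^sub>K Omega (int s - int n) (V_mod (r + r')) \<oplus>\<^sub>K ((n + 1) * s) \<odot>\<^sub>K P_mod (r + r' + parity (s + n + 1))"
    if "\<not> n \<le> s"
    by (rule Omega_tensor_Omega_neg[OF odd_dims(2)]) (use that in linarith)
  show "M_mod s r \<eta> \<otimes>\<^sub>K M_mod n r' \<eta>' \<cong>\<^sub>K (s * n) \<odot>\<^sub>K P_mod (r + r')" if "\<eta> \<noteq> \<eta>'"
    by (rule M_mod_tensor_distinct[OF that s n])
  show "M_mod s r \<eta> \<otimes>\<^sub>K M_mod n r' \<eta>
      \<cong>\<^sub>K (s * (n - 1)) \<odot>\<^sub>K P_mod (r + r') \<oplus>\<^sub>K M_mod s 0 \<eta> \<oplus>\<^sub>K M_mod s 1 \<eta>" if "s \<le> n"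
    by (rule M_mod_tensor_same[OF s that])
qed

end
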